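(* Consider the optimal control problem $(OC)$ and its dual $(D_{OC})$ described in the context. Assume that (A) $A_t\mathcal S\subseteq\mathcal S$ and $B_t\mathcal C\subseteq\mathcal S$ for $t=1,\dots,T$; (B) for $t=0,\dots,T$, $EL_t$ is proper on $\mathcal S\times\mathcal C$, and there exists a feasible $(\bar X,\bar U)\in\mathcal X_a$ such that the sets $\mathcal K_t:=\operatorname{pos}(\operatorname{dom}EL_t-(\bar X_t,\bar U_t))$, $t=0,\dots,T$, are linear and strongly closed; (C) for every $t$: (a) $E_t\mathcal K_{t'}\subset\mathcal K_{t'}$ for all $t'\le t$; (b) for every $X_t\in\mathcal S$ there exists $U_t\in\mathcal C$ with $(X_t,U_t)\in\mathcal K_t$; (D) for every $t$: (1) $E_t\operatorname{dom}EL_{t'}\subset\operatorname{dom}EL_{t'}$ for all $t'\le t$; (2) for every $X_t\in\mathcal S$ there exists $U_t\in\mathcal C$ with $(X_t,U_t)\in\operatorname{dom}EL_t$. Then $(OC)$ is feasible for any $W\in\mathcal U_a$, $\inf(OC)=\sup(D_{OC})$ and the optimum in $(D_{OC})$ is attained. In particular, a feasible $(X,U)$ is optimal in $(OC)$ if and only if there exists a dual feasible $(p,y)\in\mathcal X_a^\perp\times\mathcal Y$ such that \[ p_t-(\Delta y_{t+1}+A_{t+1}^*y_{t+1},B_{t+1}^*y_{t+1})\in\partial L_t(X_t,U_t),\quad t=0,\dots,T, \] almost surely. If each $L_t$ is $\mathcal F_t$-measurable, this is equivalent to the existence of a $y\in\mathcal Y_a$ feasible in the reduced dual such that \[ -E_t(\Delta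 y_{t+1}+A_{t+1}^*y_{t+1},B_{t+1}^*y_{t+1})\in\partial L_t(X_t,U_t),\quad t=0,\dots,T, \] almost surely.
   Context: $(\Omega,\mathcal F,P)$ is a probability space with a filtration $(\mathcal F_t)_{t=0}^T$; $E_t$ is the conditional expectation given $\mathcal F_t$; $\Delta z_t=z_t-z_{t-1}$. A convex normal integrand is a function $L:\mathbb R^d\times\Omega\to\overline{\mathbb R}$ with $L(\cdot,\omega)$ closed convex for every $\omega$ and $\omega\mapsto\operatorname{epi}L(\cdot,\omega)$ measurable; $EL(x)=\int L(x(\omega),\omega)dP$, integrals being $+\infty$ unless the positive part is integrable; $L^*$ and $\partial L$ are the scenario-wise conjugate and subdifferential. $(OC)$: minimize $E[\sum_{t=0}^TL_t(X_t,U_t)]$ over $(X,U)\in\mathcal N$ subject to $\Delta X_t=A_tX_{t-1}+B_tU_{t-1}+W_t$ a.s., $t=1,\dots,T$. Here $\mathcal N$ is the space of all adapted processes $(X,U)=(X_t,U_t)_{t=0}^T$ with $X_t\in\mathbb R^N$, $U_t\in\mathbb R^M$; $A_t$, $B_t$ are $\mathcal F_t$-measurable random matrices, $W_t$ is an $\mathcal F_t$-measurable random vector, and $L_t$ are convex normal integrands on $\mathbb R^N\times\mathbb R^M$. Spaces: $\mathcal S,\mathcal S'\subset L^0(\mathbb R^N)$ and $\mathcal C,\mathcal C'\subset L^0(\mathbb R^M)$ are linear spaces, decomposable ($1_Bx+1_{\Omega\setminus B}x'$ is in the space for all $x$ in the space, $x'\in L^\infty$, $B\in\mathcal F$) and solid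 (if $\bar x$ is in the space and $|x^i|\le|\bar x^i|$ a.s. for all $i$, then $x$ is in the space); $\mathcal S,\mathcal S'$ and $\mathcal C,\mathcal C'$ are in separating duality under the bilinear forms $E[x\cdot v]$. $E_t\mathcal S\subseteq\mathcal S$ and $E_t\mathcal C\subseteq\mathcal C$ for all $t$. $\mathcal S$ and $\mathcal C$ have "strong" topologies, at least as strong as the Mackey topologies of these pairings, under which they are Fréchet with topological duals $\mathcal S^*=\mathcal S'\oplus(\mathcal S')^s$ and $\mathcal C^*=\mathcal C'\oplus(\mathcal C')^s$, where $(\mathcal S')^s$ and $(\mathcal C')^s$ are the sets of singular elements (functionals $\ell$ such that for every $x$ there is a decreasing sequence $(B^\nu)\subset\mathcal F$ with $P(B^\nu)\searrow0$ and $\ell(1_{\Omega\setminus B^\nu}x)=0$ for all $\nu$). Put $\mathcal X=(\mathcal S\times\mathcal C)^{T+1}$, $\mathcal V=(\mathcal S'\times\mathcal C')^{T+1}$, $\mathcal U=\mathcal S^T$, $\mathcal Y=(\mathcal S')^T$ (elements of $\mathcal U$, $\mathcal Y$ indexed by $t=1,\dots,T$); $W\in\mathcal U$. $\mathcal X_a=\mathcal X\cap\mathcal N$; $\mathcal U_a$ and $\mathcal Y_a$ are the adapted elements of $\mathcal U$ and $\mathcal Y$; $\mathcal X_a^\perp=\{p\in\mathcal V\mid E[x\cdot p]=0\ \forall x\in\mathcal X_a\}$. $\operatorname{dom}EL_t=\{(X_t,U_t)\in\mathcal S\times\mathcal C\mid EL_t(X_t,U_t)<\infty\}$, $\operatorname{pos}C=\bigcup_{\lambda>0}\lambda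 C$; "linear" means being a linear subspace. Dual problems (with the conventions $y_0:=0$, $y_{T+1}:=0$ and $A_{T+1}^*y_{T+1}:=0$, $B_{T+1}^*y_{T+1}:=0$): $(D_{OC})$: maximize \[ E\Big[\sum_{t=1}^TW_t\cdot y_t-\sum_{t=0}^TL_t^*\big(p_t-(\Delta y_{t+1}+A_{t+1}^*y_{t+1},B_{t+1}^*y_{t+1})\big)\Big] \] over $(p,y)\in\mathcal X_a^\perp\times\mathcal Y$. Reduced dual: maximize \[ E\Big[\sum_{t=1}^TW_t\cdot y_t-\sum_{t=0}^TL_t^*\big(-E_t(\Delta y_{t+1}+A_{t+1}^*y_{t+1},B_{t+1}^*y_{t+1})\big)\Big] \] over $y\in\mathcal Y_a$. In these maximization problems the expectation of $\xi$ is understood as $-E[-\xi]$. Dual feasible means objective value $>-\infty$; $(X,U)\in\mathcal N$ is feasible in $(OC)$ if it satisfies the system equations and the objective is finite. *)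

theory Defs
  imports "HOL-Probability.Probability" "HOL-Library.Function_Algebras"
begin

section \<open>Functions as a real vector space\<close>

text \<open>
  Elements of \<open>L\<^sup>0\<close> are represented by measurable functions; equality in \<open>L\<^sup>0\<close> is almost sure
  equality.  All the function spaces below are closed under almost sure equality because they
  are solid.  The pointwise vector space structure makes \<^const>\<open>subspace\<close> and \<^const>\<open>convex\<close>
  available for sets of random vectors, for sets of pairs of these, and for sets of functionals.
\<close>

instantiation "fun" :: (type, real_vector) real_vector
begin

definition scaleR_fun :: "real \<Rightarrow> ('a \<Rightarrow> 'b) \<Rightarrow> 'a \<Rightarrow> 'b" where
  "scaleR_fun c f = (\<lambda>x. c *\<^sub>R f x)"

instance
  by standard (auto simp: scaleR_fun_def fun_eq_iff scaleR_add_right scaleR_add_left)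

end

section \<open>Convex integrands\<close>

definition epi :: "('b \<Rightarrow> ereal) \<Rightarrow> ('b \<times> real) set" where
  "epi f = {(x, r). f x \<le> ereal r}"

text \<open>\<open>closed (epi f)\<close> is lower semicontinuity of \<open>f\<close>, and \<open>convex (epi f)\<close> is convexity of \<open>f\<close>.\<close>

definition convex_normal_integrand ::
    "'a measure \<Rightarrow> ('b::euclidean_space \<Rightarrow> 'a \<Rightarrow> ereal) \<Rightarrow> bool" where
  "convex_normal_integrand M L \<longleftrightarrow>
     (\<forall>\<omega>\<in>space M. closed (epi (\<lambda>x. L x \<omega>)) \<and> convex (epi (\<lambda>x. L x \<omega>))) \<and>
     (\<forall>G. open G \<longrightarrow> {\<omega>\<in>space M. epi (\<lambda>x. L x \<omega>) \<inter> G \<noteq> {}} \<in> sets M)"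

definition fenchel_conjugate :: "('b::euclidean_space \<Rightarrow> ereal) \<Rightarrow> 'b \<Rightarrow> ereal" where
  "fenchel_conjugate f v = (SUP x. ereal (x \<bullet> v) - f x)"

definition subdifferential :: "('b::euclidean_space \<Rightarrow> ereal) \<Rightarrow> 'b \<Rightarrow> 'b set" where
  "subdifferential f x = {v. \<forall>z. f x + ereal (v \<bullet> (z - x)) \<le> f z}"

text \<open>The expectation is \<open>\<infinity>\<close> unless the positive part is integrable.  Note that
  \<^term>\<open>e2ennreal r\<close> is the positive part of \<open>r\<close>.\<close>

definition ext_expectation :: "'a measure \<Rightarrow> ('a \<Rightarrow> ereal) \<Rightarrow> ereal" where
  "ext_expectation M f =
     (if (\<integral>\<^sup>+\<omega>. e2ennreal (f \<omega>) \<partial>M) = \<infinity> then \<infinity>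
      else enn2ereal (\<integral>\<^sup>+\<omega>. e2ennreal (f \<omega>) \<partial>M) - enn2ereal (\<integral>\<^sup>+\<omega>. e2ennreal (- f \<omega>) \<partial>M))"

definition integral_functional ::
    "'a measure \<Rightarrow> ('b \<Rightarrow> 'a \<Rightarrow> ereal) \<Rightarrow> ('a \<Rightarrow> 'b) \<Rightarrow> ereal" where
  "integral_functional M L x = ext_expectation M (\<lambda>\<omega>. L (x \<omega>) \<omega>)"

definition dom_E ::
    "'a measure \<Rightarrow> ('a \<Rightarrow> 'b) set \<Rightarrow> ('a \<Rightarrow> 'c) set \<Rightarrow> ('b \<times> 'c \<Rightarrow> 'a \<Rightarrow> ereal) \<Rightarrow>
       (('a \<Rightarrow> 'b) \<times> ('a \<Rightarrow> 'c)) set" where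
  "dom_E M S C L = {(x, u) \<in> S \<times> C. integral_functional M L (\<lambda>\<omega>. (x \<omega>, u \<omega>)) < \<infinity>}"

definition proper_E_on ::
    "'a measure \<Rightarrow> ('a \<Rightarrow> 'b) set \<Rightarrow> ('a \<Rightarrow> 'c) set \<Rightarrow> ('b \<times> 'c \<Rightarrow> 'a \<Rightarrow> ereal) \<Rightarrow> bool" where
  "proper_E_on M S C L \<longleftrightarrow>
     (\<forall>(x, u) \<in> S \<times> C. integral_functional M L (\<lambda>\<omega>. (x \<omega>, u \<omega>)) > - \<infinity>) \<and>
     dom_E M S C L \<noteq> {}"

definition pos_hull :: "'v::real_vector set \<Rightarrow> 'v set" where
  "pos_hull K = (\<Union>c\<in>{0<..}. (\<lambda>z. c *\<^sub>R z) ` K)"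

section \<open>Conditional expectations\<close>

definition finite_filtration :: "'a measure \<Rightarrow> nat \<Rightarrow> (nat \<Rightarrow> 'a measure) \<Rightarrow> bool" where
  "finite_filtration M T F \<longleftrightarrow>
     (\<forall>t\<le>T. subalgebra M (F t)) \<and> (\<forall>s t. s \<le> t \<and> t \<le> T \<longrightarrow> subalgebra (F t) (F s))"

definition cond_exp ::
    "'a measure \<Rightarrow> 'a measure \<Rightarrow> ('a \<Rightarrow> 'b::euclidean_space) \<Rightarrow> 'a \<Rightarrow> 'b" where
  "cond_exp M G x = (\<lambda>\<omega>. \<Sum>b\<in>Basis. real_cond_exp M G (\<lambda>\<omega>. x \<omega> \<bullet> b) \<omega> *\<^sub>R b)"

section \<open>Spaces of random variables\<close>

definition Linf :: "'a measure \<Rightarrow> ('a \<Rightarrow> 'b::euclidean_space) set" where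
  "Linf M = {x \<in> borel_measurable M. \<exists>c. AE \<omega> in M. norm (x \<omega>) \<le> c}"

definition decomposable :: "'a measure \<Rightarrow> ('a \<Rightarrow> 'b::euclidean_space) set \<Rightarrow> bool" where
  "decomposable M V \<longleftrightarrow>
     (\<forall>x\<in>V. \<forall>x'\<in>Linf M. \<forall>B\<in>sets M.
        (\<lambda>\<omega>. indicator B \<omega> *\<^sub>R x \<omega> + indicator (space M - B) \<omega> *\<^sub>R x' \<omega>) \<in> V)"

definition solid :: "'a measure \<Rightarrow> ('a \<Rightarrow> real^'n) set \<Rightarrow> bool" where
  "solid M V \<longleftrightarrow>
     (\<forall>x'\<in>V. \<forall>x\<in>borel_measurable M. (AE \<omega> in M. \<forall>i. \<bar>x \<omega> $ i\<bar> \<le> \<bar>x' \<omega> $ i\<bar>) \<longrightarrow> x \<in> V)"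

definition solid_decomposable_space :: "'a measure \<Rightarrow> ('a \<Rightarrow> real^'n) set \<Rightarrow> bool" where
  "solid_decomposable_space M V \<longleftrightarrow>
     V \<subseteq> borel_measurable M \<and> subspace V \<and> decomposable M V \<and> solid M V"

definition separating_duality ::
    "'a measure \<Rightarrow> ('a \<Rightarrow> 'b::euclidean_space) set \<Rightarrow> ('a \<Rightarrow> 'b) set \<Rightarrow> bool" where
  "separating_duality M V V' \<longleftrightarrow>
     (\<forall>x\<in>V. \<forall>v\<in>V'. integrable M (\<lambda>\<omega>. x \<omega> \<bullet> v \<omega>)) \<and>
     (\<forall>x\<in>V. (\<forall>v\<in>V'. (\<integral>\<omega>. x \<omega> \<bullet> v \<omega> \<partial>M) = 0) \<longrightarrow> (AE \<omega> in M. x \<omega> = 0)) \<and>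
     (\<forall>v\<in>V'. (\<forall>x\<in>V. (\<integral>\<omega>. x \<omega> \<bullet> v \<omega> \<partial>M) = 0) \<longrightarrow> (AE \<omega> in M. v \<omega> = 0))"

text \<open>The weak topology \<open>\<sigma>(V', V)\<close> on \<open>V'\<close>.\<close>

definition weak_topology ::
    "'a measure \<Rightarrow> ('a \<Rightarrow> 'b::euclidean_space) set \<Rightarrow> ('a \<Rightarrow> 'b) set \<Rightarrow> ('a \<Rightarrow> 'b) topology" where
  "weak_topology M V V' =
     topology_generated_by {{v\<in>V'. (\<integral>\<omega>. x \<omega> \<bullet> v \<omega> \<partial>M) \<in> G} | x G. x \<in> V \<and> open G}"

text \<open>The Mackey topology \<open>\<tau>(V, V')\<close> on \<open>V\<close>: uniform convergence on the \<open>\<sigma>(V', V)\<close>-compact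
  convex sets.  These are stable under scaling, so radius 1 suffices.\<close>

definition mackey_topology ::
    "'a measure \<Rightarrow> ('a \<Rightarrow> 'b::euclidean_space) set \<Rightarrow> ('a \<Rightarrow> 'b) set \<Rightarrow> ('a \<Rightarrow> 'b) topology" where
  "mackey_topology M V V' =
     topology_generated_by
       {{z\<in>V. \<forall>v\<in>K. \<bar>\<integral>\<omega>. (z \<omega> - x \<omega>) \<bullet> v \<omega> \<partial>M\<bar> < 1} | x K.
          x \<in> V \<and> K \<subseteq> V' \<and> convex K \<and> compactin (weak_topology M V V') K}"

definition locally_convex_tvs :: "'v::real_vector set \<Rightarrow> 'v topology \<Rightarrow> bool" where
  "locally_convex_tvs V \<tau> \<longleftrightarrow>
     subspace V \<and> topspace \<tau> = V \<and>
     continuous_map (prod_topology \<tau> \<tau>) \<tau> (\<lambda>(x, y). x + y) \<and>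
     continuous_map (prod_topology euclideanreal \<tau>) \<tau> (\<lambda>(c, x). c *\<^sub>R x) \<and>
     (\<forall>G. openin \<tau> G \<and> 0 \<in> G \<longrightarrow> (\<exists>K. openin \<tau> K \<and> convex K \<and> 0 \<in> K \<and> K \<subseteq> G))"

text \<open>A locally convex topology induced by a complete translation invariant metric.  The metric
  is one on equivalence classes: it vanishes exactly on pairs of almost surely equal functions.\<close>

definition frechet_ae :: "'a measure \<Rightarrow> ('a \<Rightarrow> 'b::real_vector) set \<Rightarrow> ('a \<Rightarrow> 'b) topology \<Rightarrow> bool" where
  "frechet_ae M V \<tau> \<longleftrightarrow>
     locally_convex_tvs V \<tau> \<and>
     (\<exists>d::('a \<Rightarrow> 'b) \<Rightarrow> ('a \<Rightarrow> 'b) \<Rightarrow> real.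
        (\<forall>x\<in>V. \<forall>y\<in>V. 0 \<le> d x y \<and> d x y = d y x \<and>
                       (d x y = 0 \<longleftrightarrow> (AE \<omega> in M. x \<omega> = y \<omega>))) \<and>
        (\<forall>x\<in>V. \<forall>y\<in>V. \<forall>z\<in>V. d x z \<le> d x y + d y z \<and> d (x + z) (y + z) = d x y) \<and>
        (\<forall>G. openin \<tau> G \<longleftrightarrow> G \<subseteq> V \<and> (\<forall>x\<in>G. \<exists>e>0. \<forall>y\<in>V. d x y < e \<longrightarrow> y \<in> G)) \<and>
        (\<forall>s::nat \<Rightarrow> 'a \<Rightarrow> 'b. range s \<subseteq> V \<and> (\<forall>e>0. \<exists>k. \<forall>i\<ge>k. \<forall>j\<ge>k. d (s i) (s j) < e) \<longrightarrow>
            (\<exists>x\<in>V. (\<lambda>i. d (s i) x) \<longlonglongrightarrow> 0)))"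

text \<open>Functionals on \<open>V\<close> are extended by \<open>0\<close> outside \<open>V\<close>, so that equality on \<open>V\<close> is equality.\<close>

definition topological_dual :: "'v::real_vector set \<Rightarrow> 'v topology \<Rightarrow> ('v \<Rightarrow> real) set" where
  "topological_dual V \<tau> =
     {l. (\<forall>x\<in>V. \<forall>y\<in>V. l (x + y) = l x + l y) \<and> (\<forall>c. \<forall>x\<in>V. l (c *\<^sub>R x) = c * l x) \<and>
         continuous_map \<tau> euclideanreal l \<and> (\<forall>x. x \<notin> V \<longrightarrow> l x = 0)}"

definition pairing_functional ::
    "'a measure \<Rightarrow> ('a \<Rightarrow> 'b::euclidean_space) set \<Rightarrow> ('a \<Rightarrow> 'b) \<Rightarrow> ('a \<Rightarrow> 'b) \<Rightarrow> real" where
  "pairing_functional M V v = (\<lambda>x. if x \<in> V then \<integral>\<omega>. x \<omega> \<bullet> v \<omega> \<partial>M else 0)"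

definition singular_functionals ::
    "'a measure \<Rightarrow> ('a \<Rightarrow> 'b::euclidean_space) set \<Rightarrow> ('a \<Rightarrow> 'b) topology \<Rightarrow>
       (('a \<Rightarrow> 'b) \<Rightarrow> real) set" where
  "singular_functionals M V \<tau> =
     {l \<in> topological_dual V \<tau>. \<forall>x\<in>V. \<exists>B::nat \<Rightarrow> 'a set.
         range B \<subseteq> sets M \<and> decseq B \<and> (\<lambda>\<nu>. measure M (B \<nu>)) \<longlonglongrightarrow> 0 \<and>
         (\<forall>\<nu>. l (\<lambda>\<omega>. indicator (space M - B \<nu>) \<omega> *\<^sub>R x \<omega>) = 0)}"

definition is_direct_sum :: "'v::real_vector set \<Rightarrow> 'v set \<Rightarrow> 'v set \<Rightarrow> bool" where
  "is_direct_sum V V1 V2 \<longleftrightarrow>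
     subspace V1 \<and> subspace V2 \<and> V1 \<inter> V2 = {0} \<and> V = {a + b | a b. a \<in> V1 \<and> b \<in> V2}"

definition strong_topology ::
    "'a measure \<Rightarrow> ('a \<Rightarrow> 'b::euclidean_space) set \<Rightarrow> ('a \<Rightarrow> 'b) set \<Rightarrow> ('a \<Rightarrow> 'b) topology \<Rightarrow> bool"
  where
  "strong_topology M V V' \<tau> \<longleftrightarrow>
     frechet_ae M V \<tau> \<and>
     (\<forall>G. openin (mackey_topology M V V') G \<longrightarrow> openin \<tau> G) \<and>
     is_direct_sum (topological_dual V \<tau>)
       (pairing_functional M V ` V') (singular_functionals M V \<tau>)"

section \<open>The optimal control problem\<close>

text \<open>A process is a function on \<^typ>\<open>nat\<close> of which only the values on the relevant index set,
  \<open>{0..T}\<close> or \<open>{1..T}\<close>, are used.\<close>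

definition adapted_processes ::
    "nat \<Rightarrow> (nat \<Rightarrow> 'a measure) \<Rightarrow> ((nat \<Rightarrow> 'a \<Rightarrow> real^'n) \<times> (nat \<Rightarrow> 'a \<Rightarrow> real^'m)) set" where
  "adapted_processes T F =
     {(X, U). \<forall>t\<le>T. X t \<in> borel_measurable (F t) \<and> U t \<in> borel_measurable (F t)}"

definition adapted_strategies ::
    "nat \<Rightarrow> (nat \<Rightarrow> 'a measure) \<Rightarrow> ('a \<Rightarrow> real^'n) set \<Rightarrow> ('a \<Rightarrow> real^'m) set \<Rightarrow>
       ((nat \<Rightarrow> 'a \<Rightarrow> real^'n) \<times> (nat \<Rightarrow> 'a \<Rightarrow> real^'m)) set" where
  "adapted_strategies T F S C =
     {(X, U) \<in> adapted_processes T F. \<forall>t\<le>T. X t \<in> S \<and> U t \<in> C}"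

definition annihilator ::
    "'a measure \<Rightarrow> nat \<Rightarrow> (nat \<Rightarrow> 'a measure) \<Rightarrow> ('a \<Rightarrow> real^'n) set \<Rightarrow> ('a \<Rightarrow> real^'n) set \<Rightarrow>
       ('a \<Rightarrow> real^'m) set \<Rightarrow> ('a \<Rightarrow> real^'m) set \<Rightarrow> (nat \<Rightarrow> 'a \<Rightarrow> (real^'n) \<times> (real^'m)) set" where
  "annihilator M T F S S' C C' =
     {p. (\<forall>t\<le>T. (\<lambda>\<omega>. fst (p t \<omega>)) \<in> S' \<and> (\<lambda>\<omega>. snd (p t \<omega>)) \<in> C') \<and>
         (\<forall>(X, U) \<in> adapted_strategies T F S C.
            (\<integral>\<omega>. (\<Sum>t=0..T. (X t \<omega>, U t \<omega>) \<bullet> p t \<omega>) \<partial>M) = 0)}"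

definition sequences_in :: "nat \<Rightarrow> ('a \<Rightarrow> 'b) set \<Rightarrow> (nat \<Rightarrow> 'a \<Rightarrow> 'b) set" where
  "sequences_in T V = {y. \<forall>t\<in>{1..T}. y t \<in> V}"

definition adapted_sequences_in ::
    "nat \<Rightarrow> (nat \<Rightarrow> 'a measure) \<Rightarrow> ('a \<Rightarrow> 'b::euclidean_space) set \<Rightarrow> (nat \<Rightarrow> 'a \<Rightarrow> 'b) set" where
  "adapted_sequences_in T F V = {y \<in> sequences_in T V. \<forall>t\<in>{1..T}. y t \<in> borel_measurable (F t)}"

definition system_equations ::
    "'a measure \<Rightarrow> nat \<Rightarrow> (nat \<Rightarrow> 'a \<Rightarrow> real^'n^'n) \<Rightarrow> (nat \<Rightarrow> 'a \<Rightarrow> real^'m^'n) \<Rightarrow>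
       (nat \<Rightarrow> 'a \<Rightarrow> real^'n) \<Rightarrow> (nat \<Rightarrow> 'a \<Rightarrow> real^'n) \<Rightarrow> (nat \<Rightarrow> 'a \<Rightarrow> real^'m) \<Rightarrow> bool" where
  "system_equations M T A B W X U \<longleftrightarrow>
     (\<forall>t\<in>{1..T}. AE \<omega> in M.
        X t \<omega> - X (t - 1) \<omega> = A t \<omega> *v X (t - 1) \<omega> + B t \<omega> *v U (t - 1) \<omega> + W t \<omega>)"

definition oc_objective ::
    "'a measure \<Rightarrow> nat \<Rightarrow> (nat \<Rightarrow> (real^'n) \<times> (real^'m) \<Rightarrow> 'a \<Rightarrow> ereal) \<Rightarrow>
       (nat \<Rightarrow> 'a \<Rightarrow> real^'n) \<Rightarrow> (nat \<Rightarrow> 'a \<Rightarrow> real^'m) \<Rightarrow> ereal" where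
  "oc_objective M T L X U = ext_expectation M (\<lambda>\<omega>. \<Sum>t=0..T. L t (X t \<omega>, U t \<omega>) \<omega>)"

definition oc_constraints ::
    "'a measure \<Rightarrow> nat \<Rightarrow> (nat \<Rightarrow> 'a measure) \<Rightarrow> (nat \<Rightarrow> 'a \<Rightarrow> real^'n^'n) \<Rightarrow>
       (nat \<Rightarrow> 'a \<Rightarrow> real^'m^'n) \<Rightarrow> (nat \<Rightarrow> 'a \<Rightarrow> real^'n) \<Rightarrow>
       ((nat \<Rightarrow> 'a \<Rightarrow> real^'n) \<times> (nat \<Rightarrow> 'a \<Rightarrow> real^'m)) set" where
  "oc_constraints M T F A B W =
     {(X, U) \<in> adapted_processes T F. system_equations M T A B W X U}"

definition oc_feasible ::
    "'a measure \<Rightarrow> nat \<Rightarrow> (nat \<Rightarrow> 'a measure) \<Rightarrow> (nat \<Rightarrow> 'a \<Rightarrow> real^'n^'n) \<Rightarrow>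
       (nat \<Rightarrow> 'a \<Rightarrow> real^'m^'n) \<Rightarrow> (nat \<Rightarrow> 'a \<Rightarrow> real^'n) \<Rightarrow>
       (nat \<Rightarrow> (real^'n) \<times> (real^'m) \<Rightarrow> 'a \<Rightarrow> ereal) \<Rightarrow>
       (nat \<Rightarrow> 'a \<Rightarrow> real^'n) \<Rightarrow> (nat \<Rightarrow> 'a \<Rightarrow> real^'m) \<Rightarrow> bool" where
  "oc_feasible M T F A B W L X U \<longleftrightarrow>
     (X, U) \<in> oc_constraints M T F A B W \<and> \<bar>oc_objective M T L X U\<bar> \<noteq> \<infinity>"

definition oc_inf ::
    "'a measure \<Rightarrow> nat \<Rightarrow> (nat \<Rightarrow> 'a measure) \<Rightarrow> (nat \<Rightarrow> 'a \<Rightarrow> real^'n^'n) \<Rightarrow>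
       (nat \<Rightarrow> 'a \<Rightarrow> real^'m^'n) \<Rightarrow> (nat \<Rightarrow> 'a \<Rightarrow> real^'n) \<Rightarrow>
       (nat \<Rightarrow> (real^'n) \<times> (real^'m) \<Rightarrow> 'a \<Rightarrow> ereal) \<Rightarrow> ereal" where
  "oc_inf M T F A B W L = (INF (X, U) \<in> oc_constraints M T F A B W. oc_objective M T L X U)"

definition oc_optimal ::
    "'a measure \<Rightarrow> nat \<Rightarrow> (nat \<Rightarrow> 'a measure) \<Rightarrow> (nat \<Rightarrow> 'a \<Rightarrow> real^'n^'n) \<Rightarrow>
       (nat \<Rightarrow> 'a \<Rightarrow> real^'m^'n) \<Rightarrow> (nat \<Rightarrow> 'a \<Rightarrow> real^'n) \<Rightarrow>
       (nat \<Rightarrow> (real^'n) \<times> (real^'m) \<Rightarrow> 'a \<Rightarrow> ereal) \<Rightarrow>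
       (nat \<Rightarrow> 'a \<Rightarrow> real^'n) \<Rightarrow> (nat \<Rightarrow> 'a \<Rightarrow> real^'m) \<Rightarrow> bool" where
  "oc_optimal M T F A B W L X U \<longleftrightarrow>
     (X, U) \<in> oc_constraints M T F A B W \<and> oc_objective M T L X U = oc_inf M T F A B W L"

section \<open>The dual problems\<close>

definition zero_ext :: "nat \<Rightarrow> (nat \<Rightarrow> 'a \<Rightarrow> 'b::zero) \<Rightarrow> nat \<Rightarrow> 'a \<Rightarrow> 'b" where
  "zero_ext T y t = (if t \<in> {1..T} then y t else (\<lambda>\<omega>. 0))"

text \<open>\<open>(\<Delta>y\<^bsub>t+1\<^esub> + A\<^bsub>t+1\<^esub>\<^sup>* y\<^bsub>t+1\<^esub>, B\<^bsub>t+1\<^esub>\<^sup>* y\<^bsub>t+1\<^esub>)\<close> with \<open>y\<^sub>0 = 0\<close> and \<open>y\<^bsub>T+1\<^esub> = 0\<close>; at \<open>t = T\<close>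
  the matrices are applied to \<open>0\<close>.\<close>

definition adjoint_term ::
    "nat \<Rightarrow> (nat \<Rightarrow> 'a \<Rightarrow> real^'n^'n) \<Rightarrow> (nat \<Rightarrow> 'a \<Rightarrow> real^'m^'n) \<Rightarrow> (nat \<Rightarrow> 'a \<Rightarrow> real^'n) \<Rightarrow>
       nat \<Rightarrow> 'a \<Rightarrow> (real^'n) \<times> (real^'m)" where
  "adjoint_term T A B y t \<omega> =
     (zero_ext T y (t + 1) \<omega> - zero_ext T y t \<omega> + transpose (A (t + 1) \<omega>) *v zero_ext T y (t + 1) \<omega>,
      transpose (B (t + 1) \<omega>) *v zero_ext T y (t + 1) \<omega>)"

text \<open>The objective of both dual problems as a function of \<open>y\<close> and of the arguments \<open>v\<^sub>t\<close> of the
  conjugates.\<close>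

definition dual_value ::
    "'a measure \<Rightarrow> nat \<Rightarrow> (nat \<Rightarrow> 'a \<Rightarrow> real^'n) \<Rightarrow> (nat \<Rightarrow> (real^'n) \<times> (real^'m) \<Rightarrow> 'a \<Rightarrow> ereal) \<Rightarrow>
       (nat \<Rightarrow> 'a \<Rightarrow> (real^'n) \<times> (real^'m)) \<Rightarrow> (nat \<Rightarrow> 'a \<Rightarrow> real^'n) \<Rightarrow> ereal" where
  "dual_value M T W L v y =
     - ext_expectation M (\<lambda>\<omega>. - (ereal (\<Sum>t=1..T. W t \<omega> \<bullet> y t \<omega>)
                                - (\<Sum>t=0..T. fenchel_conjugate (\<lambda>z. L t z \<omega>) (v t \<omega>))))"

definition dual_objective ::
    "'a measure \<Rightarrow> nat \<Rightarrow> (nat \<Rightarrow> 'a \<Rightarrow> real^'n^'n) \<Rightarrow> (nat \<Rightarrow> 'a \<Rightarrow> real^'m^'n) \<Rightarrow>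
       (nat \<Rightarrow> 'a \<Rightarrow> real^'n) \<Rightarrow> (nat \<Rightarrow> (real^'n) \<times> (real^'m) \<Rightarrow> 'a \<Rightarrow> ereal) \<Rightarrow>
       (nat \<Rightarrow> 'a \<Rightarrow> (real^'n) \<times> (real^'m)) \<Rightarrow> (nat \<Rightarrow> 'a \<Rightarrow> real^'n) \<Rightarrow> ereal" where
  "dual_objective M T A B W L p y =
     dual_value M T W L (\<lambda>t \<omega>. p t \<omega> - adjoint_term T A B y t \<omega>) y"

definition reduced_dual_objective ::
    "'a measure \<Rightarrow> nat \<Rightarrow> (nat \<Rightarrow> 'a measure) \<Rightarrow> (nat \<Rightarrow> 'a \<Rightarrow> real^'n^'n) \<Rightarrow>
       (nat \<Rightarrow> 'a \<Rightarrow> real^'m^'n) \<Rightarrow> (nat \<Rightarrow> 'a \<Rightarrow> real^'n) \<Rightarrow>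
       (nat \<Rightarrow> (real^'n) \<times> (real^'m) \<Rightarrow> 'a \<Rightarrow> ereal) \<Rightarrow> (nat \<Rightarrow> 'a \<Rightarrow> real^'n) \<Rightarrow> ereal" where
  "reduced_dual_objective M T F A B W L y =
     dual_value M T W L (\<lambda>t \<omega>. - cond_exp M (F t) (adjoint_term T A B y t) \<omega>) y"

end

theory Submission imports Defs begin

text \<open>
  Let \<open>m\<close> be the optimal value.  The processes \<open>h\<close> with \<open>h\<^sub>t - E\<^sub>t h\<^sub>t \<in> K\<^sub>t\<close> form a Frechet space in which, by
  the Robinson--Ursescu theorem, the value function of the perturbed problem is bounded above near \<open>0\<close>.
  Hahn--Banach then gives a continuous functional that vanishes on the adapted solutions of the homogeneous
  system and separates the costs from \<open>m\<close>; it decomposes over time into marginal values of state and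
  control.  As the domains are stable under \<open>E\<^sub>t\<close>, the singular parts can be replaced by their compositions with
  \<open>E\<^sub>t\<close>.  Going backwards in time, these are representable by functions: the control part because homogeneous
  trajectories starting from an arbitrary control at time \<open>t\<close> only involve later states, and the state part
  because a singular functional that is bounded above on all of the space vanishes.  The dual
  variable \<open>y\<close> is obtained from the backward recursion for the marginal values of the states, and
  \<open>p\<close> is what remains.  The conjugates of the integral functionals are computed by selecting near
  maximizers, which can be done measurably with respect to \<open>F\<^sub>t\<close> when \<open>L\<^sub>t\<close> is \<open>F\<^sub>t\<close>-measurable.
\<close>

text \<open>The domains of the integrands may have empty interior, so perturbations in all of
  \<open>procs\<close> cannot be absorbed. The process space of the overview is tailored to what can
  be: it contains the homogeneous solutions and all differences of domain points from
  \<open>xb\<close>, and each of its elements becomes \<open>K\<close>-valued after adding a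
  homogeneous solution. Since \<open>K t\<close> is a linear positive hull, such an element can then
  be shrunk into the domains. The strong topologies are Frechet, but nothing relates them directly
  to moduli, conditional expectations or random matrices. Continuity of the embedding into L1, of
  these operators, and the existence of small majorants all come from one source: a closed convex
  relation with absorbing domain, to which the Robinson--Ursescu theorem is applied. A singular
  functional composed with a conditional expectation need not be singular: for a trivial
  sigma-algebra it can be a multiple of the mean. This is why the singular parts cannot be discarded
  in one stroke, and why the composed functional is decomposed again at each time.\<close>

section \<open>Complete translation invariant pseudo-metrics\<close>

text \<open>\<open>q x\<close> plays the role of the distance of \<open>x\<close> from
  \<open>0\<close> in a translation invariant metric. It may vanish at nonzero elements, since
  functions that agree almost surely are kept apart. Of the continuity of scalar multiplication only
  the limit along \<open>(1/2)^n\<close> is recorded; the convex neighbourhoods supply the rest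
  through \<open>q_shrink\<close>.\<close>

definition fspace :: "'v::real_vector set => ('v => real) => bool" where
 "fspace V q \<longleftrightarrow> subspace V & (ALL x:V. 0 <= q x & q (- x) = q x) &
  (ALL x:V. ALL y:V. q (x + y) <= q x + q y) &
  (ALL x:V. (%n. q ((1/2)^n *\<^sub>R x)) \<longlonglongrightarrow> 0) &
  (ALL e>0. EX N. convex N & N <= {x:V. q x < e} & (EX \<delta>>0. {x:V. q x < \<delta>} <= N)) &
  (ALL s::nat => 'v. range s <= V & (ALL e>0. EX k. ALL i>=k. ALL j>=k. q (s i - s j) < e) -->
    (EX x:V. (%i. q (s i - x)) \<longlonglongrightarrow> 0))"

definition seq_closed_in :: "'v::real_vector set => ('v => real) => 'v set => bool" where
 "seq_closed_in V q D \<longleftrightarrow>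
  (ALL s x. (ALL n::nat. s n : D) & x : V & (%n. q (s n - x)) \<longlonglongrightarrow> 0 --> x : D)"

text \<open>The weights add up to \<open>1 - (1/2)^n\<close>, and the missing mass sits at
  \<open>0\<close>. The induction splits off the first term and halves the rest, so that every step
  is a midpoint.\<close>

lemma convex_weighted_halves:
 fixes e :: "nat => 'v::real_vector"
 assumes "convex D" "0 : D" "!!n. e n : D"
 shows "(SUM k<n. (1/2)^(Suc k) *\<^sub>R e k) : D"
 using assms(3)
proof (induction n arbitrary: e)
 case 0
 thus ?case using assms by simp
next
 case (Suc n)
 have "(SUM k<n. (1/2)^(Suc k) *\<^sub>R e (Suc k)) : D"
  by (rule Suc.IH) (rule Suc.prems)
 hence "(1/2) *\<^sub>R e 0 + (1/2) *\<^sub>R (SUM k<n. (1/2)^(Suc k) *\<^sub>R e (Suc k)) : D"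
  by (intro convexD[OF assms(1)] Suc.prems) auto
 also have "(1/2) *\<^sub>R e 0 + (1/2) *\<^sub>R (SUM k<n. (1/2)^(Suc k) *\<^sub>R e (Suc k)) = (SUM k<Suc n. (1/2)^(Suc k) *\<^sub>R e k)"
  unfolding sum.lessThan_Suc_shift by (simp add: scaleR_sum_right)
 finally show ?case .
qed

context
 fixes V :: "'v::real_vector set" and q :: "'v => real"
 assumes fsp: "fspace V q"
begin

lemma fspace_subspace: "subspace V"
 using fsp by (simp add: fspace_def)

lemma fspace_add: "x : V ==> y : V ==> x + y : V"
 and fspace_diff: "x : V ==> y : V ==> x - y : V"
 and fspace_neg: "x : V ==> - x : V"
 and fspace_scale: "x : V ==> c *\<^sub>R x : V"
 and fspace_zero: "0 : V"
 using fspace_subspace by (simp_all add: subspace_add subspace_diff subspace_neg subspace_scale subspace_0)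

lemma q_nonneg: "x : V ==> 0 <= q x"
 and q_minus: "x : V ==> q (- x) = q x"
 and q_triangle: "x : V ==> y : V ==> q (x + y) <= q x + q y"
 and q_half_pow: "x : V ==> (%n. q ((1/2)^n *\<^sub>R x)) \<longlonglongrightarrow> 0"
 using fsp by (simp_all add: fspace_def)

lemma q_convex_nhd:
 assumes "e > 0"
 obtains N \<delta> where "convex N" "N <= {x:V. q x < e}" "\<delta> > 0" "{x:V. q x < \<delta>} <= N"
 using fsp assms unfolding fspace_def by meson

lemma q_complete:
 assumes "!!n::nat. s n : V" "!!e. e > 0 ==> EX k. ALL i>=k. ALL j>=k. q (s i - s j) < e"
 obtains x where "x : V" "(%i. q (s i - x)) \<longlonglongrightarrow> 0"
proof -
 have "range s <= V & (ALL e>0. EX k. ALL i>=k. ALL j>=k. q (s i - s j) < e)"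
  using assms by auto
 thus ?thesis using fsp that unfolding fspace_def by blast
qed

lemma q_zero: "q 0 = 0"
 using q_half_pow[OF fspace_zero] by (simp add: LIMSEQ_const_iff)

lemma q_diff_commute: "x : V ==> y : V ==> q (x - y) = q (y - x)"
 using q_minus[of "x - y"] by (simp add: fspace_diff)

lemma q_diff_triangle: "x : V ==> y : V ==> z : V ==> q (x - z) <= q (x - y) + q (y - z)"
 using q_triangle[of "x - y" "y - z"] by (simp add: fspace_diff)

lemma q_minus_triangle: "x : V ==> y : V ==> q (x - y) <= q x + q y"
 using q_triangle[of x "- y"] by (simp add: fspace_neg q_minus)

text \<open>Uniformity in the scalar comes from local convexity: a convex neighbourhood of
  \<open>0\<close> is star-shaped about it, which a ball of \<open>q\<close> need not be.\<close>

lemma q_shrink: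
 assumes "e > 0"
 obtains \<delta> where "\<delta> > 0" "!!x c. x : V ==> q x < \<delta> ==> 0 <= c ==> c <= 1 ==> q (c *\<^sub>R x) < e"
proof -
 obtain N \<delta> where N: "convex N" "N <= {x:V. q x < e}" "\<delta> > 0" "{x:V. q x < \<delta>} <= N"
  using q_convex_nhd[OF assms] .
 have "0 : N" using N fspace_zero q_zero by auto
 hence "c *\<^sub>R x : N" if "x : V" "q x < \<delta>" "0 <= c" "c <= 1" for x c
  using that N convexD_alt[OF N(1), of 0 x c] by auto
 thus ?thesis using that N by blast
qed

text \<open>Natural multiples follow from the triangle inequality; a real factor is a natural factor
  \<open>k\<close> followed by a contraction by \<open>\<bar>c\<bar> / k\<close>, which
  \<open>q_shrink\<close> controls.\<close>

lemma q_scale_tendsto: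
 assumes "(%n. q (s n)) \<longlonglongrightarrow> 0" "!!n::nat. s n : V"
 shows "(%n. q (c *\<^sub>R s n)) \<longlonglongrightarrow> 0"
proof -
 have nn: "(%n. q (real k *\<^sub>R s n)) \<longlonglongrightarrow> 0" for k
 proof (induction k)
  case 0
  thus ?case by (simp add: q_zero)
 next
  case (Suc k)
  have "(%n. q (real k *\<^sub>R s n) + q (s n)) \<longlonglongrightarrow> 0 + 0"
   using Suc assms by (intro tendsto_add)
  hence "(%n. q (real k *\<^sub>R s n) + q (s n)) \<longlonglongrightarrow> 0" by simp
  thus ?case
  proof (rule Lim_null_comparison[rotated], intro always_eventually allI)
   fix n
   show "norm (q (real (Suc k) *\<^sub>R s n)) <= q (real k *\<^sub>R s n) + q (s n)"
    using q_triangle[of "real k *\<^sub>R s n" "s n"] q_nonneg[of "real (Suc k) *\<^sub>R s n"]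
     fspace_scale[OF assms(2)[of n], of "real k"] fspace_scale[OF assms(2)[of n], of "real (Suc k)"]
     assms(2)[of n] by (simp add: algebra_simps)
  qed
 qed
 define k where "k = nat \<lceil>\<bar>c\<bar>\<rceil> + 1"
 have k: "\<bar>c\<bar> <= real k" "real k > 0" unfolding k_def by linarith+
 have "(%n. q (\<bar>c\<bar> *\<^sub>R s n)) \<longlonglongrightarrow> 0"
 proof (rule LIMSEQ_I)
  fix e :: real assume "e > 0"
  obtain \<delta> where d: "\<delta> > 0" "!!x c. x : V ==> q x < \<delta> ==> 0 <= c ==> c <= 1 ==> q (c *\<^sub>R x) < e"
   by (rule q_shrink[OF \<open>e > 0\<close>]) blast
  obtain n0 where n0: "!!n. n >= n0 ==> norm (q (real k *\<^sub>R s n) - 0) < \<delta>"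
   using LIMSEQ_D[OF nn d(1)] by blast
  show "EX n0. ALL n>=n0. norm (q (\<bar>c\<bar> *\<^sub>R s n) - 0) < e"
  proof (intro exI allI impI)
   fix n assume "n >= n0"
   hence "q (real k *\<^sub>R s n) < \<delta>" using n0[of n] by auto
   hence "q ((\<bar>c\<bar> / real k) *\<^sub>R (real k *\<^sub>R s n)) < e"
    using k by (intro d(2)) (auto simp: assms fspace_scale)
   thus "norm (q (\<bar>c\<bar> *\<^sub>R s n) - 0) < e"
    using k q_nonneg[of "\<bar>c\<bar> *\<^sub>R s n"] assms by (simp add: fspace_scale)
  qed
 qed
 moreover have "q (c *\<^sub>R s n) = q (\<bar>c\<bar> *\<^sub>R s n)" for n
  using q_minus[of "c *\<^sub>R s n"] by (cases "c >= 0") (auto simp: assms fspace_scale)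
 ultimately show ?thesis by simp
qed

lemma q_add_tendsto:
 assumes "(%n. q (s n)) \<longlonglongrightarrow> 0" "!!n::nat. s n : V" "(%n. q (u n)) \<longlonglongrightarrow> 0" "!!n::nat. u n : V"
 shows "(%n. q (s n + u n)) \<longlonglongrightarrow> 0"
proof (rule Lim_null_comparison)
 show "(%n. q (s n) + q (u n)) \<longlonglongrightarrow> 0" using tendsto_add[OF assms(1,3)] by simp
 show "\<forall>\<^sub>F n in sequentially. norm (q (s n + u n)) <= q (s n) + q (u n)"
  using q_triangle q_nonneg assms fspace_add by (intro always_eventually allI) simp
qed

lemma geometric_series_converges:
 assumes w: "!!k::nat. w k : V" "!!k. q (w k) <= c * (1/2)^k"
 obtains x where "x : V" "(%n. q ((SUM k<n. w k) - x)) \<longlonglongrightarrow> 0" "q x <= 2 * c"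
proof -
 have c: "c >= 0" using w(2)[of 0] q_nonneg[OF w(1)[of 0]] by simp
 have sV: "(SUM k<n. w k) : V" for n by (intro subspace_sum[OF fspace_subspace] w)
 have fin: "q ((SUM k<n+j. w k) - (SUM k<n. w k)) <= 2 * c * (1/2)^n" for n j
 proof -
  \<comment> \<open>The induction needs the subtracted tail; it is dropped afterwards.\<close>
  have *: "q ((SUM k<n+j. w k) - (SUM k<n. w k)) <= 2 * c * (1/2)^n - 2 * c * (1/2)^(n+j)"
  proof (induction j)
   case 0
   thus ?case by (simp add: q_zero)
  next
   case (Suc j)
   have "q ((SUM k<n+Suc j. w k) - (SUM k<n. w k)) <= q ((SUM k<n+j. w k) - (SUM k<n. w k)) + q (w (n+j))"
    using q_triangle[of "(SUM k<n+j. w k) - (SUM k<n. w k)" "w (n+j)"] w sV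
    by (simp add: fspace_diff algebra_simps)
   thus ?case using Suc w(2)[of "n+j"] by (simp add: algebra_simps)
  qed
  have "0 <= 2 * c * (1/2)^(n+j)" using c by simp
  thus ?thesis using * by linarith
 qed
 have lim0: "(%n. 2 * c * (1/2::real)^n) \<longlonglongrightarrow> 0"
  by (intro tendsto_mult_right_zero LIMSEQ_power_zero) simp
 obtain x where x: "x : V" "(%n. q ((SUM k<n. w k) - x)) \<longlonglongrightarrow> 0"
 proof (rule q_complete[OF sV])
  fix e :: real assume e: "e > 0"
  obtain n where n: "norm (2 * c * (1/2::real)^n - 0) < e/2"
   using LIMSEQ_D[OF lim0, of "e/2"] e by auto
  have "q ((SUM k<i. w k) - (SUM k<j. w k)) < e" if "i >= n" "j >= n" for i j
  proof -
   have "q ((SUM k<i. w k) - (SUM k<j. w k)) <= q ((SUM k<i. w k) - (SUM k<n. w k)) + q ((SUM k<n. w k) - (SUM k<j. w k))"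
    by (intro q_diff_triangle sV)
   also have "q ((SUM k<n. w k) - (SUM k<j. w k)) = q ((SUM k<j. w k) - (SUM k<n. w k))"
    by (intro q_diff_commute sV)
   finally show ?thesis using fin[of n "i - n"] fin[of n "j - n"] that n by auto
  qed
  thus "EX k. ALL i>=k. ALL j>=k. q ((SUM k<i. w k) - (SUM k<j. w k)) < e" by blast
 qed
 have "q x <= 2 * c + q ((SUM k<n. w k) - x)" for n
 proof -
  have "q x <= q (SUM k<n. w k) + q ((SUM k<n. w k) - x)"
   using q_minus_triangle[of "SUM k<n. w k" "(SUM k<n. w k) - x"] sV x by (simp add: fspace_diff)
  thus ?thesis using fin[of 0 n] by simp
 qed
 moreover have "(%n. 2 * c + q ((SUM k<n. w k) - x)) \<longlonglongrightarrow> 2 * c + 0"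
  using x by (intro tendsto_intros)
 ultimately have "q x <= 2 * c" by (intro LIMSEQ_le_const[where X="%n. 2 * c + q ((SUM k<n. w k) - x)"]) auto
 thus ?thesis using that x by blast
qed

lemma seq_closed_inI_approx:
 assumes "seq_closed_in V q D" "x : V" "!!r. r > 0 ==> EX y:D. q (y - x) < r" "D <= V"
 shows "x : D"
proof -
 have "EX y:D. q (y - x) < 1 / real (Suc n)" for n using assms(3) by simp
 then obtain s where s: "!!n. s n : D" "!!n. q (s n - x) < 1 / real (Suc n)" by metis
 have "(%n. q (s n - x)) \<longlonglongrightarrow> 0"
 proof (rule Lim_null_comparison)
  show "(%n. 1 / real (Suc n)) \<longlonglongrightarrow> 0" using LIMSEQ_inverse_real_of_nat by (simp add: inverse_eq_divide)
  show "\<forall>\<^sub>F n in sequentially. norm (q (s n - x)) <= 1 / real (Suc n)"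
   using s(2) q_nonneg[OF fspace_diff] s(1) assms(2,4)
   by (intro always_eventually allI) (metis abs_of_nonneg less_imp_le real_norm_def subsetD)
 qed
 thus ?thesis using assms s unfolding seq_closed_in_def by blast
qed

text \<open>If no \<open>D n\<close> contained a ball, one could pick balls one inside the other,
  the next one always missing \<open>D n\<close>; by completeness their centres converge to a point
  outside all the \<open>D n\<close>.\<close>

lemma fspace_Baire:
 assumes cl: "!!n::nat. seq_closed_in V q (D n)" "!!n. D n <= V" and cover: "V <= (UN n. D n)"
 shows "EX n. EX x:V. EX r>0. ALL y:V. q (y - x) < r --> y : D n"
proof (rule ccontr)
 assume neg: "~ (EX n. EX x:V. EX r>0. ALL y:V. q (y - x) < r --> y : D n)"
 have no: "EX y:V. q (y - x) < r & y ~: D n" if "x : V" "r > 0" for n x r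
  using neg that by blast
 \<comment> \<open>The factor 4 in the radii keeps all later centres within half of the current
   radius, so that the limit lies strictly inside every ball.\<close>
 have step: "EX y r'. y : V & 0 < r' & r' <= r/4 & q (y - x) < r/4 & (ALL z:V. q (z - y) < r' --> z ~: D n)"
  if x: "x : V" "r > 0" for n x r
 proof -
  obtain y where y: "y : V" "q (y - x) < r/4" "y ~: D n" using no[of x "r/4" n] x by auto
  then obtain e where e: "e > 0" "ALL z:D n. ~ q (z - y) < e"
   using seq_closed_inI_approx[OF cl(1) y(1) _ cl(2)] by blast
  show ?thesis
   using y e x by (intro exI[of _ y] exI[of _ "min e (r/4)"]) auto
 qed
 have "EX f. ALL n. (fst (f n) : V & snd (f n) > (0::real) & snd (f n) <= (1/4)^n) &
  (snd (f (Suc n)) <= snd (f n)/4 & q (fst (f (Suc n)) - fst (f n)) < snd (f n)/4 &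
    (ALL z:V. q (z - fst (f (Suc n))) < snd (f (Suc n)) --> z ~: D n))"
 proof (rule dependent_nat_choice)
  show "EX x. fst x : V & 0 < snd x & snd x <= (1 / 4 :: real) ^ 0"
   using fspace_zero by (intro exI[of _ "(0, 1)"]) simp
 next
  fix x and n :: nat assume x: "fst x : V & 0 < snd x & snd x <= (1 / 4 :: real) ^ n"
  then obtain y r' where yr: "y : V" "0 < r'" "r' <= snd x/4" "q (y - fst x) < snd x/4"
    "ALL z:V. q (z - y) < r' --> z ~: D n"
   using step[of "fst x" "snd x" n] by blast
  show "EX y. (fst y : V & 0 < snd y & snd y <= (1 / 4) ^ Suc n) & snd y <= snd x / 4 &
      q (fst y - fst x) < snd x / 4 & (ALL z:V. q (z - fst y) < snd y --> z ~: D n)"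
   using yr x by (intro exI[of _ "(y, r')"]) auto
 qed
 then obtain f where "ALL n. (fst (f n) : V & snd (f n) > (0::real) & snd (f n) <= (1/4)^n) &
  (snd (f (Suc n)) <= snd (f n)/4 & q (fst (f (Suc n)) - fst (f n)) < snd (f n)/4 &
    (ALL z:V. q (z - fst (f (Suc n))) < snd (f (Suc n)) --> z ~: D n))" by blast
 hence f: "!!n. fst (f n) : V" "!!n. snd (f n) > 0" "!!n. snd (f n) <= (1/4)^n"
   "!!n. snd (f (Suc n)) <= snd (f n)/4" "!!n. q (fst (f (Suc n)) - fst (f n)) < snd (f n)/4"
   "!!n z. z : V ==> q (z - fst (f (Suc n))) < snd (f (Suc n)) ==> z ~: D n" by auto
 \<comment> \<open>Subtracting half of the last radius makes the estimate telescope: the next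
   displacement is less than a quarter of that radius, and the radius itself drops at least by the
   factor 4.\<close>
 have dist: "q (fst (f (n + j)) - fst (f n)) <= snd (f n)/2 - snd (f (n+j))/2" for n j
 proof (induction j)
  case 0
  thus ?case by (simp add: q_zero)
 next
  case (Suc j)
  have "q (fst (f (n + Suc j)) - fst (f n)) <= q (fst (f (n + Suc j)) - fst (f (n + j))) + q (fst (f (n + j)) - fst (f n))"
   by (intro q_diff_triangle f(1))
  thus ?case using Suc f(2)[of "n+j"] f(4)[of "n+j"] f(5)[of "n+j"] by simp
 qed
 have "q (fst (f (n + j)) - fst (f n)) <= snd (f n)/2" for n j
  using dist[of n j] f(2)[of "n+j"] by linarith
 hence dist': "q (fst (f i) - fst (f n)) <= snd (f n)/2" if "i >= n" for i n
  using that by (metis le_add_diff_inverse)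
 obtain x where x: "x : V" "(%n. q (fst (f n) - x)) \<longlonglongrightarrow> 0"
 proof (rule q_complete[OF f(1)])
  fix e :: real assume "e > 0"
  then obtain n where n: "(1/4::real)^n < e" using real_arch_pow_inv[of e "1/4"] by auto
  have "q (fst (f i) - fst (f j)) < e" if "i >= n" "j >= n" for i j
  proof -
   have "q (fst (f i) - fst (f j)) <= q (fst (f i) - fst (f n)) + q (fst (f n) - fst (f j))"
    by (intro q_diff_triangle f(1))
   moreover have "q (fst (f n) - fst (f j)) = q (fst (f j) - fst (f n))"
    by (intro q_diff_commute f(1))
   ultimately show ?thesis
    using dist'[of n i] dist'[of n j] that f(2)[of n] f(3)[of n] n by linarith
  qed
  thus "EX k. ALL i>=k. ALL j>=k. q (fst (f i) - fst (f j)) < e" by blast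
 qed
 have near: "q (x - fst (f n)) < snd (f n)" for n
 proof -
  obtain k where k: "!!i. i >= k ==> norm (q (fst (f i) - x) - 0) < snd (f n)/4"
   using LIMSEQ_D[OF x(2), of "snd (f n)/4"] f(2)[of n] by auto
  let ?i = "max k n"
  have "q (x - fst (f n)) <= q (x - fst (f ?i)) + q (fst (f ?i) - fst (f n))"
   using q_diff_triangle x f(1) by blast
  thus ?thesis
   using k[of ?i] dist'[of n ?i] q_diff_commute[OF x(1) f(1)[of ?i]] f(2)[of n] by auto
 qed
 have "x ~: D n" for n using f(6)[OF x(1) near] .
 thus False using cover x by blast
qed

end

section \<open>Barrels and the Robinson--Ursescu theorem\<close>

definition q_closure :: "'v::real_vector set => ('v => real) => 'v set => 'v set" where
 "q_closure V q D = {x:V. ALL r>0. EX a:D. q (x - a) < r}"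

text \<open>Complete spaces are barrelled. Scaled closures of the symmetric set \<open>B\<close>
  cover \<open>V\<close>, so by Baire one of them contains a ball, and symmetry with midpoints moves
  that ball to \<open>0\<close>. Absorption is required for all large \<open>n\<close> so that
  \<open>x\<close> and \<open>- x\<close> have a power in common.\<close>

lemma absorbing_convex_closure_nhd:
 assumes fs: "fspace V q" and D: "convex D" "D <= V"
  and absorb: "!!x. x : V ==> EX n0. ALL n>=n0. (1/2)^n *\<^sub>R x : D"
 obtains \<rho> where "\<rho> > 0" "!!x. x : V ==> q x < \<rho> ==> x : q_closure V q D"
proof -
 note V = fspace_add[OF fs] fspace_diff[OF fs] fspace_neg[OF fs] fspace_scale[OF fs] fspace_zero[OF fs]
 define B where "B = D \<inter> uminus ` D"
 have Bsym: "- x : B" if "x : B" for x using that unfolding B_def by force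
 have Bcon: "convex B" unfolding B_def by (intro convex_Int convex_negations D)
 have BV: "B <= V" using D(2) unfolding B_def by auto
 define cB where "cB = q_closure V q B"
 have cB: "x : cB \<longleftrightarrow> x : V & (ALL r>0. EX a:B. q (x - a) < r)" for x unfolding cB_def q_closure_def by auto
 define E where "E n = {x:V. (1/2)^n *\<^sub>R x : cB}" for n
 have clE: "seq_closed_in V q (E n)" for n
  unfolding seq_closed_in_def
 proof (intro allI impI, elim conjE)
  fix s x assume s: "ALL i. s i : E n" and x: "x : V" and lim: "(%i. q (s i - x)) \<longlonglongrightarrow> 0"
  have sV: "s i : V" for i using s unfolding E_def by auto
  have lim': "(%i. q ((1/2)^n *\<^sub>R (s i - x))) \<longlonglongrightarrow> 0"
   by (intro q_scale_tendsto[OF fs] lim V sV x)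
  have "EX a:B. q ((1/2)^n *\<^sub>R x - a) < r" if r: "r > 0" for r
  proof -
   obtain i where i: "norm (q ((1/2)^n *\<^sub>R (s i - x)) - 0) < r/2"
    using LIMSEQ_D[OF lim', of "r/2"] r by auto
   have "(1/2)^n *\<^sub>R s i : cB" using s unfolding E_def by blast
   hence "EX a:B. q ((1/2)^n *\<^sub>R s i - a) < r/2" using r unfolding cB by (meson half_gt_zero)
   then obtain a where a: "a : B" "q ((1/2)^n *\<^sub>R s i - a) < r/2" by blast
   have aV: "a : V" using a BV by blast
   have "q ((1/2)^n *\<^sub>R x - a) <= q ((1/2)^n *\<^sub>R x - (1/2)^n *\<^sub>R s i) + q ((1/2)^n *\<^sub>R s i - a)"
    by (intro q_diff_triangle[OF fs] V x sV aV)
   also have "q ((1/2)^n *\<^sub>R x - (1/2)^n *\<^sub>R s i) = q ((1/2)^n *\<^sub>R (s i - x))"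
    by (subst q_diff_commute[OF fs]) (auto simp: V x sV algebra_simps)
   finally show ?thesis using i a by (intro bexI[of _ a]) auto
  qed
  thus "x : E n" unfolding E_def using x V(4)[OF x] by (simp add: cB)
 qed
 have EV: "E n <= V" for n unfolding E_def by blast
 have "V <= (UN n. E n)"
 proof
  fix x assume x: "x : V"
  obtain n1 where n1: "ALL n>=n1. (1/2)^n *\<^sub>R x : D" using absorb[OF x] by blast
  obtain n2 where n2: "ALL n>=n2. (1/2)^n *\<^sub>R (- x) : D" using absorb[OF V(3)[OF x]] by blast
  let ?n = "max n1 n2"
  have "(1/2)^?n *\<^sub>R x : B" unfolding B_def
  proof (intro IntI image_eqI[where x="(1/2)^?n *\<^sub>R (- x)"])
   show "(1/2)^?n *\<^sub>R x : D" using n1 by (metis max.cobounded1)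
   show "(1/2)^?n *\<^sub>R (-x) : D" using n2 by (metis max.cobounded2)
  qed simp
  hence "EX a:B. q ((1/2)^?n *\<^sub>R x - a) < r" if "r > 0" for r
   using that q_zero[OF fs] by (intro bexI[of _ "(1/2)^?n *\<^sub>R x"]) auto
  hence "(1/2)^?n *\<^sub>R x : cB" unfolding cB using V(4)[OF x] by blast
  thus "x : (UN n. E n)" unfolding E_def using x by blast
 qed
 from fspace_Baire[OF fs clE EV this]
 obtain n x r where nxr: "x : V" "r > 0" "!!y. y : V ==> q (y - x) < r ==> y : E n"
  by blast
 have mid: "(1/2) *\<^sub>R a + (1/2) *\<^sub>R b : cB" if ab: "a : cB" "b : cB" for a b
  unfolding cB
 proof (intro conjI allI impI)
  show "(1/2) *\<^sub>R a + (1/2) *\<^sub>R b : V" using ab unfolding cB by (intro V) auto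
  fix e :: real assume "e > 0"
  hence "e/2 > 0" by simp
  then obtain \<delta> where d: "\<delta> > 0" "!!x c. x : V ==> q x < \<delta> ==> 0 <= c ==> c <= 1 ==> q (c *\<^sub>R x) < e/2"
   by (rule q_shrink[OF fs]) blast
  obtain a' b' where ab': "a' : B" "q (a - a') < \<delta>" "b' : B" "q (b - b') < \<delta>"
   using ab d(1) unfolding cB by blast
  have V': "a : V" "b : V" "a' : V" "b' : V" using ab ab' BV unfolding cB by auto
  have "q ((1/2) *\<^sub>R (a - a') + (1/2) *\<^sub>R (b - b')) <= q ((1/2) *\<^sub>R (a - a')) + q ((1/2) *\<^sub>R (b - b'))"
   by (intro q_triangle[OF fs] V V')
  also have "\<dots> < e/2 + e/2" by (intro add_strict_mono d V V' ab') auto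
  finally show "EX y:B. q ((1/2) *\<^sub>R a + (1/2) *\<^sub>R b - y) < e"
   using convexD[OF Bcon ab'(1,3), of "1/2" "1/2"]
   by (intro bexI[of _ "(1/2) *\<^sub>R a' + (1/2) *\<^sub>R b'"]) (auto simp: algebra_simps)
 qed
 have csym: "- a : cB" if acB: "a : cB" for a
  unfolding cB
 proof (intro conjI allI impI)
  show "- a : V" using acB unfolding cB by (intro V) auto
  fix e :: real assume "e > 0"
  then obtain b where b: "b : B" "q (a - b) < e" using acB unfolding cB by blast
  have "q (- a - (- b)) = q (a - b)"
   using q_minus[OF fs, of "a - b"] acB b(1) BV V(2)[of a b] unfolding cB by auto
  thus "EX c:B. q (- a - c) < e" using b Bsym by (intro bexI[of _ "- b"]) auto
 qed
 \<comment> \<open>\<open>y\<close> is the midpoint of \<open>x + y\<close> and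
   \<open>- (x - y)\<close>, where \<open>x + y\<close> and \<open>x - y\<close> both lie in the
   ball around \<open>x\<close>.\<close>
 have small: "(1/2)^n *\<^sub>R y : cB" if y: "y : V" "q y < r" for y
 proof -
  have 1: "(1/2)^n *\<^sub>R (x + y) : cB" using nxr(3)[of "x + y"] y V(1)[OF nxr(1) y(1)] unfolding E_def by auto
  have "(1/2)^n *\<^sub>R (x - y) : cB"
   using nxr(3)[of "x - y"] y V(2)[OF nxr(1) y(1)] q_minus[OF fs, of y] unfolding E_def by auto
  from mid[OF 1 csym[OF this]] show ?thesis
   by (simp add: algebra_simps flip: scaleR_add_left)
 qed
 show ?thesis
 proof (rule that[of "r / 2^n"])
  show "r / 2^n > 0" using nxr by simp
  fix x assume x: "x : V" "q x < r / 2^n"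
  \<comment> \<open>Doubling \<open>n\<close> times multiplies \<open>q\<close> by at most
    \<open>2^n\<close>, which explains the radius \<open>r / 2^n\<close>.\<close>
  have "q (2^k *\<^sub>R x) <= 2^k * q x" for k
  proof (induction k)
   case (Suc k)
   have "q (2^k *\<^sub>R x + 2^k *\<^sub>R x) <= q (2^k *\<^sub>R x) + q (2^k *\<^sub>R x)" by (intro q_triangle[OF fs] V x)
   thus ?case using Suc by (simp flip: scaleR_add_left)
  qed simp
  hence "q (2^n *\<^sub>R x) <= 2^n * q x" .
  hence "q (2^n *\<^sub>R x) < r" using x(2) by (simp add: field_simps)
  hence "(1/2)^n *\<^sub>R (2^n *\<^sub>R x) : cB" by (intro small V x)
  hence "x : cB" by (simp add: power_one_over)
  thus "x : q_closure V q D" unfolding cB q_closure_def B_def by blast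
 qed
qed

text \<open>The barrel argument yields approximate solutions only. The remainder is doubled and
  treated again; convexity keeps the weighted sums in \<open>R\<close>, completeness of
  \<open>W\<close> makes the responses summable, and closedness of \<open>R\<close> passes to the
  limit. Applied to linear graphs it is the closed graph theorem.\<close>

theorem Robinson_Ursescu:
 assumes V: "fspace V p" and W: "fspace W q"
  and R: "R <= V \<times> W" "convex R" "(0, 0) : R"
  and absorb: "!!x. x : V ==> EX t>0. EX w. (t *\<^sub>R x, w) : R"
  and closed: "!!s u x w. (!!n::nat. (s n, u n) : R) ==> x : V ==> w : W ==>
   (%n. p (s n - x)) \<longlonglongrightarrow> 0 ==> (%n. q (u n - w)) \<longlonglongrightarrow> 0 ==> (x, w) : R"
  and e: "e > 0"
 obtains \<delta> where "\<delta> > 0" "!!x. x : V ==> p x < \<delta> ==> EX w. (x, w) : R & q w < e"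
proof -
 note V' = fspace_add[OF V] fspace_diff[OF V] fspace_neg[OF V] fspace_scale[OF V] fspace_zero[OF V]
 note W' = fspace_add[OF W] fspace_diff[OF W] fspace_neg[OF W] fspace_scale[OF W] fspace_zero[OF W]
 have "EX N. convex N & N <= {x:W. q x < e/4 * (1/2)^k} & (EX \<delta>>0. {x:W. q x < \<delta>} <= N)" for k
 proof -
  have "e/4 * (1/2)^k > 0" using e by simp
  thus ?thesis by (rule q_convex_nhd[OF W]) blast
 qed
 hence "ALL k. EX N. convex N & N <= {x:W. q x < e/4 * (1/2)^k} & (EX \<delta>>0. {x:W. q x < \<delta>} <= N)" by blast
 from choice[OF this] obtain N where N: "!!k. convex (N k)" "!!k. N k <= {x:W. q x < e/4 * (1/2)^k}"
   "!!k. EX \<delta>>0. {x:W. q x < \<delta>} <= N k" by blast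
 have N0: "0 : N k" for k using N(3)[of k] q_zero[OF W] W'(5) by auto
 \<comment> \<open>The inputs that have a response in \<open>N k\<close>. With radii
   \<open>e/4 * (1/2)^k\<close> the total response is at most \<open>e/2\<close>.\<close>
 define Q where "Q k = {x. EX w:N k. (x, w) : R}" for k
 have Qcon: "convex (Q k)" for k
 proof -
  have "Q k = fst ` (R \<inter> (UNIV \<times> N k))" unfolding Q_def by force
  thus ?thesis
   using N(1) R(2) by (auto intro!: convex_linear_image linear_fst convex_Int convex_Times)
 qed
 have QV: "Q k <= V" for k using R unfolding Q_def by auto
 have Qabs: "EX n0. ALL n>=n0. (1/2)^n *\<^sub>R x : Q k" if x: "x : V" for x k
 proof -
  obtain t w where t: "t > 0" "(t *\<^sub>R x, w) : R" using absorb[OF x] by blast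
  have wW: "w : W" using t R by auto
  obtain \<delta> where d: "\<delta> > 0" "{x:W. q x < \<delta>} <= N k" using N(3) by blast
  have "(%n. q ((1/t) *\<^sub>R ((1/2)^n *\<^sub>R w))) \<longlonglongrightarrow> 0"
   by (intro q_scale_tendsto[OF W] q_half_pow[OF W] wW W')
  from order_tendstoD(2)[OF this d(1)]
  have "\<forall>\<^sub>F n in sequentially. q ((1/t) *\<^sub>R ((1/2)^n *\<^sub>R w)) < \<delta>" .
  moreover have "\<forall>\<^sub>F n in sequentially. (1/2::real)^n < t"
   using t by (intro order_tendstoD(2)[OF LIMSEQ_power_zero]) auto
  ultimately have "\<forall>\<^sub>F n in sequentially. (1/2)^n *\<^sub>R x : Q k"
  proof eventually_elim
   case (elim n)
   let ?c = "(1/2)^n / t"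
   have "?c *\<^sub>R w : N k" using elim(1) d(2) W'(4)[OF wW, of ?c] by (auto simp: field_simps)
   moreover have "(1 - ?c) *\<^sub>R (0, 0) + ?c *\<^sub>R (t *\<^sub>R x, w) : R"
    using elim(2) t by (intro convexD_alt R) auto
   hence "((1/2)^n *\<^sub>R x, ?c *\<^sub>R w) : R" using t by simp
   ultimately show ?case unfolding Q_def by blast
  qed
  thus ?thesis unfolding eventually_sequentially .
 qed
 have "EX \<rho>>0. ALL x:V. p x < \<rho> --> x : q_closure V p (Q k)" for k
  by (rule absorbing_convex_closure_nhd[OF V Qcon QV Qabs, of k]) blast+
 hence "ALL k. EX \<rho>>0. ALL x:V. p x < \<rho> --> x : q_closure V p (Q k)" by blast
 from choice[OF this[unfolded Bex_def]]
 obtain \<rho> where \<rho>: "!!k. \<rho> k > 0" "!!k x. x : V ==> p x < \<rho> k ==> x : q_closure V p (Q k)" by blast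
 have "EX \<eta>>0. ALL x:V. p x < \<eta> --> (ALL c. 0 <= c --> c <= 1 --> p (c *\<^sub>R x) < (1/2)^k)" for k :: nat
  by (rule q_shrink[OF V, of "(1/2)^k"]) (simp, blast)
 hence "ALL k::nat. EX \<eta>>0. ALL x:V. p x < \<eta> --> (ALL c. 0 <= c --> c <= 1 --> p (c *\<^sub>R x) < (1/2)^k)" by blast
 from choice[OF this]
 obtain \<eta> where \<eta>: "!!k. \<eta> k > 0"
  "!!k x c. x : V ==> p x < \<eta> k ==> 0 <= c ==> c <= 1 ==> p (c *\<^sub>R x) < (1/2)^k" by blast
 \<comment> \<open>Below \<open>\<rho> k\<close> a remainder can be approximated from
   \<open>Q k\<close>; below \<open>\<eta> k\<close> its scaled copy has \<open>q\<close>-size less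
   than \<open>(1/2)^k\<close> and so tends to \<open>0\<close>.\<close>
 define \<sigma> where "\<sigma> k = min (\<rho> k) (\<eta> k)" for k :: nat
 have \<sigma>: "\<sigma> k > 0" for k using \<rho> \<eta> by (simp add: \<sigma>_def)
 show ?thesis
 proof (rule that[of "\<sigma> 0 / 2"])
  show "\<sigma> 0 / 2 > 0" using \<sigma> by simp
  fix x assume x: "x : V" "p x < \<sigma> 0 / 2"
  have x2: "p (2 *\<^sub>R x) < \<sigma> 0" using q_triangle[OF V x(1) x(1)] x by (simp add: scaleR_2)
  \<comment> \<open>\<open>z n\<close> is the magnified remainder in
    \<open>x = u n + (1/2)^(Suc n) *\<^sub>R z n\<close>, hence the initial value
    \<open>2 *\<^sub>R x\<close>.\<close>
  have "EX z. ALL n. (z n : V & p (z n) < \<sigma> n & (n = 0 --> z n = 2 *\<^sub>R x)) &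
    (EX a w. (a, w) : R & w : N n & z (Suc n) = 2 *\<^sub>R (z n - a))"
  proof (rule dependent_nat_choice)
   show "EX z. z : V & p z < \<sigma> 0 & (0 = (0::nat) --> z = 2 *\<^sub>R x)" using x2 V'(4)[OF x(1)] by auto
  next
   fix z n assume z: "z : V & p z < \<sigma> n & (n = 0 --> z = 2 *\<^sub>R x)"
   hence "z : q_closure V p (Q n)" by (intro \<rho>) (auto simp: \<sigma>_def)
   then obtain a where a: "a : Q n" "p (z - a) < \<sigma> (Suc n) / 2"
    using \<sigma>[of "Suc n"] unfolding q_closure_def by (auto dest!: spec[of _ "\<sigma> (Suc n) / 2"])
   then obtain w where w: "(a, w) : R" "w : N n" unfolding Q_def by blast
   have aV: "a : V" using a QV by blast
   have "p (2 *\<^sub>R (z - a)) < \<sigma> (Suc n)"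
    using q_triangle[OF V, of "z - a" "z - a"] V'(2)[of z a] z aV a by (simp add: scaleR_2)
   thus "EX y. (y : V & p y < \<sigma> (Suc n) & (Suc n = 0 --> y = 2 *\<^sub>R x)) &
    (EX a w. (a, w) : R & w : N n & y = 2 *\<^sub>R (z - a))"
    using w V'(4)[OF V'(2)[of z a]] z aV by (intro exI[of _ "2 *\<^sub>R (z - a)"]) auto
  qed
  then obtain z where z: "!!n. z n : V" "!!n. p (z n) < \<sigma> n" "z 0 = 2 *\<^sub>R x"
   "!!n. EX a w. (a, w) : R & w : N n & z (Suc n) = 2 *\<^sub>R (z n - a)" by blast
  from z(4) obtain a w where aw: "!!n. (a n, w n) : R" "!!n. w n : N n" "!!n. z (Suc n) = 2 *\<^sub>R (z n - a n)"
   by metis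
  have aV: "a n : V" and wW: "w n : W" for n using aw(1)[of n] R by auto
  define u where "u n = (SUM k<n. (1/2)^(Suc k) *\<^sub>R a k)" for n
  define v where "v n = (SUM k<n. (1/2)^(Suc k) *\<^sub>R w k)" for n
  have uvR: "(u n, v n) : R" for n
   using convex_weighted_halves[OF R(2), of "%n. (a n, w n)" n] R(3) aw(1)
   by (simp add: u_def v_def zero_prod_def sum_prod)
  have uV: "u n : V" for n using uvR R by auto
  have xu: "x = u n + (1/2)^(Suc n) *\<^sub>R z n" for n
  proof (induction n)
   case 0
   thus ?case by (simp add: u_def z)
  next
   case (Suc n)
   thus ?case by (simp add: u_def aw(3) algebra_simps)
  qed
  have "p (u n - x) < (1/2)^n" for n
  proof -
   have "x - u n = (1/2)^(Suc n) *\<^sub>R z n" using xu[of n] by (metis add_diff_cancel_left')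
   moreover have "(1/2::real)^(Suc n) <= 1" by (intro power_le_one) auto
   ultimately show ?thesis
    using \<eta>(2)[OF z(1), of n n "(1/2)^(Suc n)"] z(2)[of n] q_diff_commute[OF V uV x(1), of n] by (simp add: \<sigma>_def)
  qed
  hence ux: "(%n. p (u n - x)) \<longlonglongrightarrow> 0"
   using q_nonneg[OF V V'(2)[OF uV x(1)]]
   by (intro Lim_null_comparison[OF _ LIMSEQ_power_zero[of "1/2::real"]] always_eventually allI) (auto intro: less_imp_le)
  have wq: "q ((1/2)^(Suc k) *\<^sub>R w k) <= e/4 * (1/2)^k" for k
  proof -
   have "(1/2::real)^(Suc k) <= 1" by (intro power_le_one) auto
   hence "(1/2)^(Suc k) *\<^sub>R w k : N k"
    using convexD_alt[OF N(1) N0 aw(2), of "(1/2)^(Suc k)" k] by simp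
   thus ?thesis using N(2)[of k] by auto
  qed
  obtain y where y: "y : W" "(%n. q (v n - y)) \<longlonglongrightarrow> 0" "q y <= 2 * (e/4)"
   using geometric_series_converges[OF W W'(4)[OF wW] wq] unfolding v_def by blast
  have "(x, y) : R" by (rule closed[OF uvR x(1) y(1) ux y(2)])
  thus "EX w. (x, w) : R & q w < e" using y(3) e by (intro exI[of _ y]) auto
 qed
qed

section \<open>Constructions of complete spaces: seminorms, closed subspaces, products, bounded
  functions\<close>

lemma fspaceI:
 assumes "subspace V" "!!x. x : V ==> 0 <= q x" "!!x. x : V ==> q (- x) = q x"
  "!!x y. x : V ==> y : V ==> q (x + y) <= q x + q y"
  "!!x. x : V ==> (%n. q ((1/2)^n *\<^sub>R x)) \<longlonglongrightarrow> 0"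
  "!!e. e > 0 ==> EX N. convex N & N <= {x:V. q x < e} & (EX \<delta>>0. {x:V. q x < \<delta>} <= N)"
  "!!s::nat => 'v::real_vector. (!!n. s n : V) ==> (!!e. e > 0 ==> EX k. ALL i>=k. ALL j>=k. q (s i - s j) < e) ==>
   EX x:V. (%i. q (s i - x)) \<longlonglongrightarrow> 0"
 shows "fspace V q"
 unfolding fspace_def
proof (intro conjI ballI allI impI)
 fix s :: "nat => 'v" assume "range s <= V & (ALL e>0. EX k. ALL i>=k. ALL j>=k. q (s i - s j) < e)"
 thus "EX x:V. (%i. q (s i - x)) \<longlonglongrightarrow> 0" by (intro assms(7)) auto
qed (use assms in auto)

lemma fspace_seminorm:
 assumes V: "subspace V" and nn: "!!x. x : V ==> 0 <= q x"
  and scale: "!!c x. x : V ==> q (c *\<^sub>R x) = \<bar>c\<bar> * q x"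
  and tri: "!!x y. x : V ==> y : V ==> q (x + y) <= q x + q y"
  and compl: "!!s::nat => 'v::real_vector. (!!n. s n : V) ==> (!!e. e > 0 ==> EX k. ALL i>=k. ALL j>=k. q (s i - s j) < e) ==>
   EX x:V. (%i. q (s i - x)) \<longlonglongrightarrow> 0"
 shows "fspace V q"
proof (rule fspaceI)
 fix x assume x: "x : V"
 show "q (- x) = q x" using scale[OF x, of "-1"] by simp
 have "(%n. (1/2)^n * q x) \<longlonglongrightarrow> 0 * q x" by (intro tendsto_mult_right LIMSEQ_power_zero) auto
 thus "(%n. q ((1/2)^n *\<^sub>R x)) \<longlonglongrightarrow> 0" by (simp add: scale x)
next
 fix e :: real assume "e > 0"
 have "convex {x:V. q x < e}"
 proof (rule convexI)
  fix x y u v assume xy: "x : {x:V. q x < e}" "y : {x:V. q x < e}" and uv: "0 <= u" "0 <= v" "u + v = (1::real)"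
  have "q (u *\<^sub>R x + v *\<^sub>R y) <= q (u *\<^sub>R x) + q (v *\<^sub>R y)" using xy V by (intro tri) (auto intro: subspace_scale)
  also have "\<dots> = u * q x + v * q y" using xy uv by (simp add: scale)
  also have "\<dots> < e" using xy uv by (intro convex_bound_lt) auto
  finally show "u *\<^sub>R x + v *\<^sub>R y : {x:V. q x < e}" using xy V by (auto intro: subspace_add subspace_scale)
 qed
 thus "EX N. convex N & N <= {x:V. q x < e} & (EX \<delta>>0. {x:V. q x < \<delta>} <= N)" using \<open>e > 0\<close> by blast
qed (use assms in auto)

lemma fspace_real: "fspace UNIV (abs :: real => real)"
proof (rule fspace_seminorm)
 fix s :: "nat => real" assume "!!e. e > 0 ==> EX k. ALL i>=k. ALL j>=k. \<bar>s i - s j\<bar> < e"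
 hence "Cauchy s" unfolding Cauchy_def dist_real_def by blast
 then obtain x where "s \<longlonglongrightarrow> x" using Cauchy_convergent convergent_def by blast
 thus "EX x:UNIV. (%i. \<bar>s i - x\<bar>) \<longlonglongrightarrow> 0" by (auto simp: LIM_zero_iff tendsto_rabs_zero_iff)
qed (auto simp: abs_mult)

lemma fspace_closed_subspace:
 assumes "fspace V q" "subspace V0" "V0 <= V" "seq_closed_in V q V0"
 shows "fspace V0 q"
proof (rule fspaceI)
 fix e :: real assume "e > 0"
 obtain N \<delta> where N: "convex N" "N <= {x:V. q x < e}" "\<delta> > 0" "{x:V. q x < \<delta>} <= N"
  using q_convex_nhd[OF assms(1) \<open>e > 0\<close>] .
 show "EX N. convex N & N <= {x:V0. q x < e} & (EX \<delta>>0. {x:V0. q x < \<delta>} <= N)"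
  using N assms(3) subspace_imp_convex[OF assms(2)]
  by (intro exI[of _ "N \<inter> V0"] conjI convex_Int exI[of _ \<delta>]) auto
next
 fix s :: "nat => 'a" assume s: "!!n. s n : V0" "!!e. e > 0 ==> EX k. ALL i>=k. ALL j>=k. q (s i - s j) < e"
 obtain x where "x : V" "(%i. q (s i - x)) \<longlonglongrightarrow> 0" using q_complete[OF assms(1) _ s(2)] s(1) assms(3) by blast
 moreover from this have "x : V0" using assms(4) s(1) unfolding seq_closed_in_def by blast
 ultimately show "EX x:V0. (%i. q (s i - x)) \<longlonglongrightarrow> 0" by blast
qed (use assms in \<open>auto intro!: q_nonneg[OF assms(1)] q_minus[OF assms(1)] q_triangle[OF assms(1)] q_half_pow[OF assms(1)]\<close>)

lemma fspace_Times:
 assumes V: "fspace V p" and W: "fspace W q"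
 shows "fspace (V \<times> W) (%z. p (fst z) + q (snd z))"
proof (rule fspaceI)
 show "subspace (V \<times> W)" by (intro subspace_Times fspace_subspace[OF V] fspace_subspace[OF W])
next
 fix x assume x: "x : V \<times> W"
 show "0 <= p (fst x) + q (snd x)" using x by (auto intro!: add_nonneg_nonneg q_nonneg[OF V] q_nonneg[OF W])
 show "p (fst (- x)) + q (snd (- x)) = p (fst x) + q (snd x)" using x by (auto simp: q_minus[OF V] q_minus[OF W])
 show "(%n. p (fst ((1/2)^n *\<^sub>R x)) + q (snd ((1/2)^n *\<^sub>R x))) \<longlonglongrightarrow> 0"
  using tendsto_add[OF q_half_pow[OF V, of "fst x"] q_half_pow[OF W, of "snd x"]] x by auto
next
 fix x y assume "x : V \<times> W" "y : V \<times> W"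
 thus "p (fst (x + y)) + q (snd (x + y)) <= p (fst x) + q (snd x) + (p (fst y) + q (snd y))"
  using q_triangle[OF V, of "fst x" "fst y"] q_triangle[OF W, of "snd x" "snd y"] by auto
next
 fix e :: real assume "e > 0"
 hence e: "e/2 > 0" by simp
 obtain N \<delta> where N: "convex N" "N <= {x:V. p x < e/2}" "\<delta> > 0" "{x:V. p x < \<delta>} <= N"
  using q_convex_nhd[OF V e] .
 obtain N' \<delta>' where N': "convex N'" "N' <= {x:W. q x < e/2}" "\<delta>' > 0" "{x:W. q x < \<delta>'} <= N'"
  using q_convex_nhd[OF W e] .
 have "N \<times> N' <= {x : V \<times> W. p (fst x) + q (snd x) < e}" using N(2) N'(2) by fastforce
 moreover have "{x : V \<times> W. p (fst x) + q (snd x) < min \<delta> \<delta>'} <= N \<times> N'"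
 proof
  fix z assume z: "z : {x : V \<times> W. p (fst x) + q (snd x) < min \<delta> \<delta>'}"
  hence "p (fst z) < \<delta>" "q (snd z) < \<delta>'"
   using q_nonneg[OF V, of "fst z"] q_nonneg[OF W, of "snd z"] by auto
  thus "z : N \<times> N'" using z N(4) N'(4) by (auto simp: mem_Times_iff)
 qed
 ultimately show "EX N. convex N & N <= {x : V \<times> W. p (fst x) + q (snd x) < e} &
   (EX \<delta>>0. {x : V \<times> W. p (fst x) + q (snd x) < \<delta>} <= N)"
  using N N' by (intro exI[of _ "N \<times> N'"] conjI exI[of _ "min \<delta> \<delta>'"] convex_Times) auto
next
 fix s :: "nat => 'a \<times> 'b" assume s: "!!n. s n : V \<times> W"
  and C: "!!e. e > 0 ==> EX k. ALL i>=k. ALL j>=k. p (fst (s i - s j)) + q (snd (s i - s j)) < e"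
 have sV: "fst (s n) : V" "snd (s n) : W" for n using s[of n] by auto
 have nn: "p (fst (s i) - fst (s j)) >= 0" "q (snd (s i) - snd (s j)) >= 0" for i j
  using sV by (auto intro!: q_nonneg[OF V] q_nonneg[OF W] fspace_diff[OF V] fspace_diff[OF W])
 have C1: "EX k. ALL i>=k. ALL j>=k. p (fst (s i) - fst (s j)) < e" if "e > 0" for e
 proof -
  obtain k where k: "ALL i>=k. ALL j>=k. p (fst (s i - s j)) + q (snd (s i - s j)) < e" using C[OF \<open>e > 0\<close>] by blast
  have "p (fst (s i) - fst (s j)) < e" if "i >= k" "j >= k" for i j
   using k[rule_format, OF that] nn[of i j] by simp
  thus ?thesis by blast
 qed
 have C2: "EX k. ALL i>=k. ALL j>=k. q (snd (s i) - snd (s j)) < e" if "e > 0" for e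
 proof -
  obtain k where k: "ALL i>=k. ALL j>=k. p (fst (s i - s j)) + q (snd (s i - s j)) < e" using C[OF \<open>e > 0\<close>] by blast
  have "q (snd (s i) - snd (s j)) < e" if "i >= k" "j >= k" for i j
   using k[rule_format, OF that] nn[of i j] by simp
  thus ?thesis by blast
 qed
 obtain x where x: "x : V" "(%i. p (fst (s i) - x)) \<longlonglongrightarrow> 0" using q_complete[OF V sV(1) C1] .
 obtain y where y: "y : W" "(%i. q (snd (s i) - y)) \<longlonglongrightarrow> 0" using q_complete[OF W sV(2) C2] .
 show "EX x:V \<times> W. (%i. p (fst (s i - x)) + q (snd (s i - x))) \<longlonglongrightarrow> 0"
  using tendsto_add[OF x(2) y(2)] x(1) y(1) by (intro bexI[of _ "(x, y)"]) auto
qed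

lemma fspace_sequences:
 fixes V :: "'v::real_vector set" and T :: nat
 assumes V: "fspace V q"
 shows "fspace {x. ALL t<=T. x t : V} (%x. SUM t<=T. q (x t))" (is "fspace ?X ?q")
proof (rule fspaceI)
 note V' = fspace_add[OF V] fspace_diff[OF V] fspace_neg[OF V] fspace_scale[OF V] fspace_zero[OF V]
 show "subspace ?X" by (auto intro!: subspaceI V' simp: scaleR_fun_def)
 have le: "q (x t) <= ?q x" if "x : ?X" "t <= T" for x t
  using that by (intro member_le_sum) (auto intro!: q_nonneg[OF V])
 fix x assume x: "x : ?X"
 show "0 <= ?q x" using x by (auto intro!: sum_nonneg q_nonneg[OF V])
 show "?q (- x) = ?q x" using x by (auto intro!: sum.cong q_minus[OF V])
 have "(%n. SUM t<=T. q ((1/2)^n *\<^sub>R x t)) \<longlonglongrightarrow> (SUM t<=T. 0)"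
  using x by (intro tendsto_sum q_half_pow[OF V]) auto
 thus "(%n. ?q ((1/2)^n *\<^sub>R x)) \<longlonglongrightarrow> 0" by (simp add: scaleR_fun_def)
next
 fix x y assume "x : ?X" "y : ?X"
 thus "?q (x + y) <= ?q x + ?q y"
  unfolding sum.distrib[symmetric] by (intro sum_mono) (auto intro!: q_triangle[OF V])
next
 fix e :: real assume e: "e > 0"
 hence e': "e / (real T + 1) > 0" by simp
 obtain N \<delta> where N: "convex N" "N <= {x:V. q x < e / (real T + 1)}" "\<delta> > 0" "{x:V. q x < \<delta>} <= N"
  using q_convex_nhd[OF V e'] .
 let ?N = "{x. ALL t<=T. x t : N}"
 have "convex ?N" using N(1) by (auto simp: convex_def scaleR_fun_def)
 moreover have "?N <= {x : ?X. ?q x < e}"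
 proof
  fix x assume x: "x : ?N"
  have "?q x < (SUM t<=T. e / (real T + 1))" using x N(2) by (intro sum_strict_mono) auto
  also have "\<dots> = e" by (simp add: field_simps)
  finally show "x : {x : ?X. ?q x < e}" using x N(2) by auto
 qed
 moreover have "{x : ?X. ?q x < \<delta>} <= ?N"
 proof (intro subsetI CollectI allI impI)
  fix x t assume x: "x : {x : ?X. ?q x < \<delta>}" and t: "t <= T"
  have "q (x t) <= ?q x" using x t by (intro member_le_sum) (auto intro!: q_nonneg[OF V])
  thus "x t : N" using x t N(4) by auto
 qed
 ultimately show "EX N. convex N & N <= {x : ?X. ?q x < e} & (EX \<delta>>0. {x : ?X. ?q x < \<delta>} <= N)"
  using N(3) by (intro exI[of _ ?N] conjI exI[of _ \<delta>])
next
 note V' = fspace_add[OF V] fspace_diff[OF V] fspace_neg[OF V] fspace_scale[OF V] fspace_zero[OF V]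
 fix s :: "nat => nat => 'v" assume s: "!!n. s n : ?X"
  and C: "!!e. e > 0 ==> EX k. ALL i>=k. ALL j>=k. ?q (s i - s j) < e"
 have sV: "s n t : V" if "t <= T" for n t using s[of n] that by auto
 have "EX x. x : V & (%i. q (s i t - x)) \<longlonglongrightarrow> 0" if t: "t <= T" for t
 proof -
  have "EX k. ALL i>=k. ALL j>=k. q (s i t - s j t) < e" if "e > 0" for e
  proof -
   have "q (s i t - s j t) <= ?q (s i - s j)" for i j
    using t sV by (simp only: fun_diff_def) (intro member_le_sum[where f="%t. q (s i t - s j t)"], auto intro!: q_nonneg[OF V] V')
   moreover obtain k where "ALL i>=k. ALL j>=k. ?q (s i - s j) < e" using C[OF \<open>e > 0\<close>] by blast
   ultimately show ?thesis by (intro exI[of _ k]) (meson le_less_trans)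
  qed
  from q_complete[OF V sV[OF t] this] show ?thesis by blast
 qed
 then obtain x where x: "!!t. t <= T ==> x t : V" "!!t. t <= T ==> (%i. q (s i t - x t)) \<longlonglongrightarrow> 0"
  by metis
 have "(%i. SUM t<=T. q (s i t - x t)) \<longlonglongrightarrow> (SUM t<=T. 0)" using x by (intro tendsto_sum) auto
 thus "EX x:?X. (%i. ?q (s i - x)) \<longlonglongrightarrow> 0" using x by (intro bexI[of _ x]) auto
qed

text \<open>Bounded everywhere instead of almost surely, so that \<open>sup_norm\<close> is a plain
  supremum. This is the space of multipliers in \<open>functional_cut_bounded\<close>.\<close>

definition bounded_measurable :: "'a measure => ('a => real) set" where
 "bounded_measurable M = {f : borel_measurable M. EX c. ALL w. \<bar>f w\<bar> <= c}"

definition sup_norm :: "('a => real) => real" where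
 "sup_norm f = (SUP w. \<bar>f w\<bar>)"

lemma le_sup_norm: "f : bounded_measurable M ==> \<bar>f w\<bar> <= sup_norm f"
 unfolding bounded_measurable_def sup_norm_def by (intro cSUP_upper) (auto simp: bdd_above_def)

lemma sup_norm_le: "(!!w. \<bar>f w\<bar> <= c) ==> sup_norm f <= c"
 unfolding sup_norm_def by (intro cSUP_least) auto

lemma subspace_bounded_measurable: "subspace (bounded_measurable M)"
proof (rule subspaceI)
 show "0 : bounded_measurable M" by (auto simp: bounded_measurable_def zero_fun_def)
next
 fix x y assume xy: "x : bounded_measurable M" "y : bounded_measurable M"
 then obtain c d where cd: "!!w. \<bar>x w\<bar> <= c" "!!w. \<bar>y w\<bar> <= d" unfolding bounded_measurable_def by blast
 have "\<bar>x w + y w\<bar> <= c + d" for w using cd(1)[of w] cd(2)[of w] by linarith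
 thus "x + y : bounded_measurable M"
  using xy unfolding bounded_measurable_def plus_fun_def by (auto intro!: borel_measurable_add)
next
 fix c x assume x: "x : bounded_measurable M"
 then obtain d where d: "!!w. \<bar>x w\<bar> <= d" unfolding bounded_measurable_def by blast
 have "\<bar>c * x w\<bar> <= \<bar>c\<bar> * d" for w using d[of w] by (simp add: abs_mult mult_left_mono)
 thus "c *\<^sub>R x : bounded_measurable M"
  using x unfolding bounded_measurable_def scaleR_fun_def by auto
qed

lemma fspace_bounded_measurable: "fspace (bounded_measurable M) sup_norm"
proof (rule fspace_seminorm)
 show sub: "subspace (bounded_measurable M)" by (rule subspace_bounded_measurable)
 fix x assume x: "x : bounded_measurable M"
 have "0 <= \<bar>x undefined\<bar>" by simp
 thus nn: "0 <= sup_norm x" using le_sup_norm[OF x, of undefined] by linarith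
 fix c :: real
 show "sup_norm (c *\<^sub>R x) = \<bar>c\<bar> * sup_norm x"
 proof (rule antisym)
  show "sup_norm (c *\<^sub>R x) <= \<bar>c\<bar> * sup_norm x"
   by (rule sup_norm_le) (auto simp: scaleR_fun_def abs_mult intro!: mult_left_mono le_sup_norm[OF x])
  show "\<bar>c\<bar> * sup_norm x <= sup_norm (c *\<^sub>R x)"
  proof (cases "c = 0")
   case True
   have "0 <= \<bar>(c *\<^sub>R x) undefined\<bar>" by simp
   also have "\<dots> <= sup_norm (c *\<^sub>R x)" by (rule le_sup_norm[OF subspace_scale[OF sub x]])
   finally show ?thesis using True by simp
  next
   case False
   have "sup_norm x <= sup_norm (c *\<^sub>R x) / \<bar>c\<bar>"
   proof (rule sup_norm_le)
    fix w
    have "\<bar>c\<bar> * \<bar>x w\<bar> <= sup_norm (c *\<^sub>R x)"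
     using le_sup_norm[OF subspace_scale[OF sub x], of c w] by (simp add: scaleR_fun_def abs_mult)
    thus "\<bar>x w\<bar> <= sup_norm (c *\<^sub>R x) / \<bar>c\<bar>" using False by (simp add: field_simps)
   qed
   thus ?thesis using False by (simp add: field_simps)
  qed
 qed
next
 fix x y assume xy: "x : bounded_measurable M" "y : bounded_measurable M"
 show "sup_norm (x + y) <= sup_norm x + sup_norm y"
 proof (rule sup_norm_le)
  fix w
  show "\<bar>(x + y) w\<bar> <= sup_norm x + sup_norm y"
   using le_sup_norm[OF xy(1), of w] le_sup_norm[OF xy(2), of w] by simp
 qed
next
 fix s :: "nat => 'a => real" assume s: "!!n. s n : bounded_measurable M"
  and C: "!!e. e > 0 ==> EX k. ALL i>=k. ALL j>=k. sup_norm (s i - s j) < e"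
 have sub: "s i - s j : bounded_measurable M" for i j
  by (intro subspace_diff[OF subspace_bounded_measurable] s)
 have ptw: "\<bar>s i w - s j w\<bar> <= sup_norm (s i - s j)" for i j w using le_sup_norm[OF sub, of i j w] by simp
 have "convergent (%i. s i w)" for w
 proof (rule Cauchy_convergent, unfold Cauchy_def dist_real_def, intro allI impI)
  fix e :: real assume "e > 0"
  from C[OF this] obtain k where k: "ALL i>=k. ALL j>=k. sup_norm (s i - s j) < e" by blast
  have "\<bar>s m w - s n w\<bar> < e" if "m >= k" "n >= k" for m n
   using ptw[of m w n] k[rule_format, OF that] by linarith
  thus "EX k. ALL m>=k. ALL n>=k. \<bar>s m w - s n w\<bar> < e" by blast
 qed
 then obtain x where x: "!!w. (%i. s i w) \<longlonglongrightarrow> x w" unfolding convergent_def by metis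
 have unif: "EX k. ALL i>=k. ALL w. \<bar>s i w - x w\<bar> <= e" if "e > 0" for e
 proof -
  obtain k where k: "ALL i>=k. ALL j>=k. sup_norm (s i - s j) < e" using C[OF \<open>e > 0\<close>] by blast
  have "\<bar>s i w - x w\<bar> <= e" if "i >= k" for i w
  proof (rule LIMSEQ_le_const2)
   show "(%j. \<bar>s i w - s j w\<bar>) \<longlonglongrightarrow> \<bar>s i w - x w\<bar>" by (intro tendsto_intros x)
   have "\<bar>s i w - s n w\<bar> <= e" if "n >= k" for n
    using ptw[of i w n] k[rule_format, OF \<open>i >= k\<close> that] by linarith
   thus "EX N. ALL n>=N. \<bar>s i w - s n w\<bar> <= e" by blast
  qed
  thus ?thesis by blast
 qed
 obtain k where k: "ALL w. \<bar>s k w - x w\<bar> <= 1" using unif[of 1] by auto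
 obtain c where c: "ALL w. \<bar>s k w\<bar> <= c" using s[of k] unfolding bounded_measurable_def by blast
 have "\<bar>x w\<bar> <= c + 1" for w using k[rule_format, of w] c[rule_format, of w] by linarith
 moreover have "x : borel_measurable M"
  by (rule borel_measurable_LIMSEQ_real[of M s]) (use x s in \<open>auto simp: bounded_measurable_def\<close>)
 ultimately have xb: "x : bounded_measurable M" unfolding bounded_measurable_def by blast
 have "(%i. sup_norm (s i - x)) \<longlonglongrightarrow> 0"
 proof (rule LIMSEQ_I)
  fix e :: real assume e: "e > 0"
  then obtain k where k: "ALL i>=k. ALL w. \<bar>s i w - x w\<bar> <= e/2" using unif[of "e/2"] by auto
  have "norm (sup_norm (s i - x) - 0) < e" if "i >= k" for i
  proof -
   have "sup_norm (s i - x) <= e/2" by (rule sup_norm_le) (use k that in auto)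
   moreover have "0 <= \<bar>(s i - x) undefined\<bar>" by simp
   moreover have "s i - x : bounded_measurable M"
    by (intro subspace_diff[OF subspace_bounded_measurable] s xb)
   hence "\<bar>(s i - x) undefined\<bar> <= sup_norm (s i - x)" by (rule le_sup_norm)
   ultimately show ?thesis using e unfolding real_norm_def by linarith
  qed
  thus "EX no. ALL n>=no. norm (sup_norm (s n - x) - 0) < e" by blast
 qed
 thus "EX x:bounded_measurable M. (%i. sup_norm (s i - x)) \<longlonglongrightarrow> 0" using xb by blast
qed

section \<open>Linear functionals\<close>

definition linear_functional_on :: "'v::real_vector set => ('v => real) => bool" where
 "linear_functional_on V l \<longleftrightarrow>
  (ALL x:V. ALL y:V. l (x + y) = l x + l y) & (ALL c. ALL x:V. l (c *\<^sub>R x) = c * l x)"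

text \<open>The epigraph of a sublinear functional, seen as a convex cone. No lower bound is built
  in: cones are enlarged freely and tested only through their fibre over \<open>0\<close>.\<close>

definition cone_in :: "'v::real_vector set => ('v \<times> real) set => bool" where
 "cone_in V Q \<longleftrightarrow> Q <= V \<times> UNIV & (0, 0) : Q & (ALL z:Q. ALL w:Q. z + w : Q) & (ALL z:Q. ALL c>0. c *\<^sub>R z : Q)"

text \<open>A maximal cone whose fibre over \<open>0\<close> is nonnegative is the epigraph of a
  linear functional: if \<open>l x\<close> is the infimum of the fibre over \<open>x\<close>, the
  ray through \<open>(- x, - l x)\<close> can be added without spoiling the fibre over
  \<open>0\<close>. By maximality it was already there, which makes \<open>l\<close> odd and hence
  additive.\<close>

theorem Hahn_Banach_cone:
 assumes V: "subspace V" and Q: "cone_in V Q" and dom: "!!x. x : V ==> EX r. (x, r) : Q"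
  and nonneg: "!!r. (0, r) : Q ==> 0 <= r"
 obtains l where "linear_functional_on V l" "!!x r. (x, r) : Q ==> l x <= r"
proof -
 define \<A> where "\<A> = {P. Q <= P & cone_in V P & (ALL r. (0, r) : P --> 0 <= r)}"
 have "EX P:\<A>. ALL X:\<A>. P <= X --> X = P"
 proof (rule subset_Zorn_nonempty)
  show "\<A> ~= {}" using Q nonneg unfolding \<A>_def by blast
 next
  fix \<C> assume ne: "\<C> ~= {}" and ch: "subset.chain \<A> \<C>"
  have sub: "P : \<A>" if "P : \<C>" for P using ch that unfolding subset.chain_def by blast
  have tot: "P <= P' \<or> P' <= P" if "P : \<C>" "P' : \<C>" for P P' using ch that unfolding subset.chain_def by blast
  have "z + w : \<Union>\<C>" if zw: "z : \<Union>\<C>" "w : \<Union>\<C>" for z w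
  proof -
   obtain P P' where P: "P : \<C>" "P' : \<C>" "z : P" "w : P'" using zw by blast
   then obtain P'' where "P'' : \<C>" "z : P''" "w : P''" using tot[OF P(1,2)] by blast
   thus ?thesis using sub unfolding \<A>_def cone_in_def by blast
  qed
  moreover have "c *\<^sub>R z : \<Union>\<C>" if "z : \<Union>\<C>" "c > 0" for z c
   using sub that unfolding \<A>_def cone_in_def by blast
  moreover have "\<Union>\<C> <= V \<times> UNIV" "Q <= \<Union>\<C>" "(0, 0) : \<Union>\<C>" "!!r. (0, r) : \<Union>\<C> ==> 0 <= r"
   using sub ne unfolding \<A>_def cone_in_def by blast+
  ultimately show "\<Union>\<C> : \<A>" unfolding \<A>_def cone_in_def by simp
 qed
 then obtain P where P: "P : \<A>" and max: "!!X. X : \<A> ==> P <= X ==> X = P" by blast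
 have QP: "Q <= P" and PV: "P <= V \<times> UNIV" and P0: "(0, 0) : P" and nn: "!!r. (0, r) : P ==> 0 <= r"
  and Padd: "!!z w. z : P ==> w : P ==> z + w : P" and Psc: "!!z c. z : P ==> c > 0 ==> c *\<^sub>R z : P"
  using P unfolding \<A>_def cone_in_def by auto
 define l where "l x = Inf {r. (x, r) : P}" for x
 have ne: "{r. (x, r) : P} ~= {}" if "x : V" for x using dom[OF that] QP by blast
 have lower: "- s <= r" if "(x, r) : P" "(- x, s) : P" for x r s
  using nn[of "r + s"] Padd[OF that] by simp
 have bdd: "bdd_below {r. (x, r) : P}" if x: "x : V" for x
 proof -
  obtain s where "(- x, s) : P" using ne[OF subspace_neg[OF V x]] by blast
  thus ?thesis using lower by (intro bdd_belowI[of _ "- s"]) auto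
 qed
 have l_le: "l x <= r" if "(x, r) : P" for x r
 proof -
  have "x : V" using that PV by blast
  thus ?thesis unfolding l_def using that by (intro cInf_lower bdd) auto
 qed
 have inP: "(- x, - l x) : P" if x: "x : V" for x
 proof -
  define P' where "P' = {z + c *\<^sub>R (- x, - l x) | z c. z : P & c >= 0}"
  have PP': "P <= P'"
  proof
   fix z assume "z : P"
   thus "z : P'" unfolding P'_def by (intro CollectI exI[of _ z] exI[of _ 0]) (simp add: zero_prod_def)
  qed
  have xin: "(- x, - l x) : P'" using P0 unfolding P'_def
   by (intro CollectI exI[of _ "(0, 0)"] exI[of _ 1]) simp
  have "P' : \<A>" unfolding \<A>_def cone_in_def
  proof (intro CollectI conjI ballI allI impI)
   show "Q <= P'" "(0, 0) : P'" using QP PP' P0 by auto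
   show "P' <= V \<times> UNIV" unfolding P'_def using PV x
    by (auto intro!: subspace_diff[OF V] subspace_scale[OF V])
  next
   fix z w assume "z : P'" "w : P'"
   then obtain z' c w' d where "z = z' + c *\<^sub>R (- x, - l x)" "z' : P" "c >= 0" "w = w' + d *\<^sub>R (- x, - l x)" "w' : P" "d >= 0"
    unfolding P'_def by blast
   thus "z + w : P'" unfolding P'_def
    by (intro CollectI exI[of _ "z' + w'"] exI[of _ "c + d"]) (auto intro: Padd simp: algebra_simps)
  next
   fix z and d :: real assume "z : P'" "d > 0"
   then obtain z' c where "z = z' + c *\<^sub>R (- x, - l x)" "z' : P" "c >= 0" unfolding P'_def by blast
   thus "d *\<^sub>R z : P'" unfolding P'_def using \<open>d > 0\<close>
    by (intro CollectI exI[of _ "d *\<^sub>R z'"] exI[of _ "d * c"]) (auto intro: Psc simp: algebra_simps)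
  next
   fix r assume "(0, r) : P'"
   then obtain y s c where ys: "(y, s) : P" "c >= 0" "0 = y - c *\<^sub>R x" "r = s - c * l x"
    unfolding P'_def by auto
   show "0 <= r"
   proof (cases "c = 0")
    case True
    thus ?thesis using ys nn by simp
   next
    case False
    hence "(1/c) *\<^sub>R (y, s) : P" using ys by (intro Psc) auto
    moreover have "y = c *\<^sub>R x" using ys by simp
    ultimately have "(x, s/c) : P" using False by (simp add: divide_inverse mult.commute)
    thus ?thesis using l_le[of x "s/c"] ys False by (simp add: field_simps)
   qed
  qed
  thus ?thesis using max[OF _ PP'] xin by blast
 qed
 have neg: "l (- x) = - l x" if x: "x : V" for x
 proof (rule antisym)
  show "l (- x) <= - l x" by (intro l_le inP x)
  have "(- x, s) : P ==> - l x <= s" for s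
  proof -
   assume s: "(- x, s) : P"
   have "- s <= l x" unfolding l_def using ne[OF x] lower s by (intro cInf_greatest) auto
   thus "- l x <= s" by simp
  qed
  thus "- l x <= l (- x)" unfolding l_def[of "- x"]
   using ne[OF subspace_neg[OF V x]] by (intro cInf_greatest) auto
 qed
 have inP': "(x, l x) : P" if "x : V" for x using inP[OF subspace_neg[OF V that]] neg[OF that] by simp
 have sub: "l (x + y) <= l x + l y" if "x : V" "y : V" for x y
  using Padd[OF inP'[OF that(1)] inP'[OF that(2)]] l_le by simp
 have add: "l (x + y) = l x + l y" if xy: "x : V" "y : V" for x y
 proof (rule antisym[OF sub[OF xy]])
  have "l (- x + - y) <= l (- x) + l (- y)" using xy V by (intro sub) (auto intro: subspace_neg)
  moreover have "- x + - y = - (x + y)" by simp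
  ultimately show "l x + l y <= l (x + y)" using neg xy subspace_add[OF V xy] by (metis add.inverse_distrib_swap add.commute minus_add_distrib neg_le_iff_le)
 qed
 have pos: "l (c *\<^sub>R x) <= c * l x" if "x : V" "c > 0" for x c
  using l_le[of "c *\<^sub>R x" "c * l x"] Psc[OF inP'[OF that(1)] that(2)] by simp
 have pos': "l (c *\<^sub>R x) = c * l x" if x: "x : V" and c: "c > 0" for x c
  using pos[OF x c] pos[OF subspace_neg[OF V x] c] neg[OF x] neg[OF subspace_scale[OF V x, of c]] by simp
 have l0: "l 0 = 0" using add[OF subspace_0[OF V] subspace_0[OF V]] by simp
 have scale: "l (c *\<^sub>R x) = c * l x" if x: "x : V" for x c
 proof (cases c "0::real" rule: linorder_cases)
  case less
  thus ?thesis using pos'[OF x, of "- c"] neg[OF subspace_scale[OF V x, of c]] by simp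
 qed (use l0 pos' x in auto)
 show ?thesis
 proof (rule that)
  show "linear_functional_on V l" unfolding linear_functional_on_def using add scale by blast
  show "l x <= r" if "(x, r) : Q" for x r using l_le that QP by blast
 qed
qed

definition continuous_functional :: "'v::real_vector set => ('v => real) => ('v => real) => bool" where
 "continuous_functional V q l \<longleftrightarrow> linear_functional_on V l & (EX \<delta>>0. ALL x:V. q x < \<delta> --> \<bar>l x\<bar> <= 1)"

lemma linear_functional_onD:
 assumes "linear_functional_on V l"
 shows "x : V ==> y : V ==> l (x + y) = l x + l y" "x : V ==> l (c *\<^sub>R x) = c * l x"
 using assms unfolding linear_functional_on_def by blast+

lemma linear_functional_on_zero: "linear_functional_on V l ==> 0 : V ==> l 0 = 0"
 using linear_functional_onD(2)[of V l 0 0] by simp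

lemma linear_functional_on_minus: "linear_functional_on V l ==> x : V ==> l (- x) = - l x"
 using linear_functional_onD(2)[of V l x "-1"] by simp

lemma linear_functional_on_diff:
 "linear_functional_on V l ==> subspace V ==> x : V ==> y : V ==> l (x - y) = l x - l y"
 using linear_functional_onD(1)[of V l x "- y"] linear_functional_on_minus[of V l y] subspace_neg[of V y] by simp

context
 fixes V :: "'v::real_vector set" and q :: "'v => real"
 assumes fsp: "fspace V q"
begin

lemma q_tendsto_0I: "(!!e. e > 0 ==> EX k. ALL n>=k. q (s n) < e) ==> (!!n::nat. s n : V) ==> (%n. q (s n)) \<longlonglongrightarrow> 0"
 by (rule LIMSEQ_I) (use q_nonneg[OF fsp] in \<open>simp add: abs_of_nonneg\<close>)

lemma q_tendsto_0D: "(%n. q (s n)) \<longlonglongrightarrow> 0 ==> e > 0 ==> EX k. ALL n>=k::nat. q (s n) < e"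
 using order_tendstoD(2)[of "%n. q (s n)" 0 sequentially e] by (simp add: eventually_sequentially)

lemma small_sequence:
 assumes "!!n::nat. EX x. x : V & q x < 1 / real (Suc n) & P x"
 obtains s where "!!n::nat. s n : V" "(%n. q (s n)) \<longlonglongrightarrow> 0" "!!n. P (s n)"
proof -
 from assms obtain s where s: "!!n. s n : V" "!!n. q (s n) < 1 / real (Suc n)" "!!n. P (s n)" by metis
 have "(%n. q (s n)) \<longlonglongrightarrow> 0"
 proof (rule Lim_null_comparison)
  show "(%n. 1 / real (Suc n)) \<longlonglongrightarrow> 0" using LIMSEQ_inverse_real_of_nat by (simp add: inverse_eq_divide)
  show "\<forall>\<^sub>F n in sequentially. norm (q (s n)) <= 1 / real (Suc n)"
   using s(2) q_nonneg[OF fsp s(1)] by (intro always_eventually allI) (simp add: less_imp_le)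
 qed
 thus ?thesis using that s by blast
qed

lemma continuous_functional_tendsto_0:
 assumes l: "continuous_functional V q l" and s: "!!n::nat. s n : V" "(%n. q (s n)) \<longlonglongrightarrow> 0"
 shows "(%n. l (s n)) \<longlonglongrightarrow> 0"
proof (rule LIMSEQ_I)
 fix e :: real assume e: "e > 0"
 obtain \<delta> where d: "\<delta> > 0" "!!x. x : V ==> q x < \<delta> ==> \<bar>l x\<bar> <= 1"
  using l unfolding continuous_functional_def by blast
 have lin: "linear_functional_on V l" using l unfolding continuous_functional_def by blast
 have "(%n. q ((2/e) *\<^sub>R s n)) \<longlonglongrightarrow> 0" by (rule q_scale_tendsto[OF fsp s(2) s(1)])
 from q_tendsto_0D[OF this d(1)] obtain k where k: "!!n. n >= k ==> q ((2/e) *\<^sub>R s n) < \<delta>" by blast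
 have "norm (l (s n) - 0) < e" if "n >= k" for n
 proof -
  have "\<bar>l ((2/e) *\<^sub>R s n)\<bar> <= 1" using that k by (intro d) (auto intro!: fspace_scale[OF fsp] s)
  hence "2 * \<bar>l (s n)\<bar> <= e" using e linear_functional_onD(2)[OF lin s(1)] by (simp add: abs_mult field_simps)
  thus ?thesis using e by simp
 qed
 thus "EX no. ALL n>=no. norm (l (s n) - 0) < e" by blast
qed

lemma continuous_functional_tendsto:
 assumes l: "continuous_functional V q l" and s: "!!n::nat. s n : V" "x : V" "(%n. q (s n - x)) \<longlonglongrightarrow> 0"
 shows "(%n. l (s n)) \<longlonglongrightarrow> l x"
proof -
 have lin: "linear_functional_on V l" using l unfolding continuous_functional_def by blast
 have "(%n. l (s n - x)) \<longlonglongrightarrow> 0"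
  by (intro continuous_functional_tendsto_0[OF l] s fspace_diff[OF fsp])
 thus ?thesis by (simp add: linear_functional_on_diff[OF lin fspace_subspace[OF fsp] s(1,2)] LIM_zero_iff)
qed

text \<open>If the bound by 1 failed on every ball, points violating it could be collected into a
  null sequence.\<close>

lemma continuous_functionalI:
 assumes lin: "linear_functional_on V l"
  and seq: "!!s. (!!n::nat. s n : V) ==> (%n. q (s n)) \<longlonglongrightarrow> 0 ==> (%n. l (s n)) \<longlonglongrightarrow> 0"
 shows "continuous_functional V q l"
proof (rule ccontr)
 assume "~ ?thesis"
 hence no: "!!\<delta>. \<delta> > 0 ==> EX x. x : V & q x < \<delta> & \<bar>l x\<bar> > 1"
  using lin unfolding continuous_functional_def by (meson not_le)
 obtain s where s: "!!n::nat. s n : V" "(%n. q (s n)) \<longlonglongrightarrow> 0" "!!n. \<bar>l (s n)\<bar> > 1"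
  by (rule small_sequence[of "%x. \<bar>l x\<bar> > 1"]) (auto intro: no)
 have "EX k. ALL n>=k. norm (l (s n) - 0) < 1" by (rule LIMSEQ_D[OF seq[OF s(1,2)]]) simp
 thus False using s(3) by (metis diff_zero less_asym' order_refl real_norm_def)
qed

lemma continuous_functional_null:
 assumes "continuous_functional V q l" "x : V" "q x = 0"
 shows "l x = 0"
 using continuous_functional_tendsto_0[OF assms(1), of "%_. x"] assms(2,3) by (simp add: LIMSEQ_const_iff)

lemma continuous_functional_linear_comb:
 assumes "continuous_functional V q l" "continuous_functional V q m"
 shows "continuous_functional V q (%x. a * l x + b * m x)"
proof (rule continuous_functionalI)
 have "linear_functional_on V l" "linear_functional_on V m" using assms unfolding continuous_functional_def by auto
 thus "linear_functional_on V (%x. a * l x + b * m x)"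
  unfolding linear_functional_on_def by (simp add: algebra_simps)
 fix s assume s: "!!n::nat. s n : V" "(%n. q (s n)) \<longlonglongrightarrow> 0"
 have "(%n. a * l (s n) + b * m (s n)) \<longlonglongrightarrow> a * 0 + b * 0"
  by (intro tendsto_add tendsto_mult_left continuous_functional_tendsto_0[OF assms(1) s] continuous_functional_tendsto_0[OF assms(2) s])
 thus "(%n. a * l (s n) + b * m (s n)) \<longlonglongrightarrow> 0" by simp
qed

end

section \<open>From strong topologies to pseudo-metrics\<close>

definition singular_on :: "'a measure => ('a => 'b::euclidean_space) set => (('a => 'b) => real) => bool" where
 "singular_on M V l \<longleftrightarrow> (ALL x:V. EX B::nat => 'a set.
  range B <= sets M & decseq B & (%\<nu>. measure M (B \<nu>)) \<longlonglongrightarrow> 0 &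
  (ALL \<nu>. l (%w. indicator (space M - B \<nu>) w *\<^sub>R x w) = 0))"

lemma integrable_componentwise:
 fixes x :: "'a => 'b::euclidean_space"
 assumes "!!b. b : Basis ==> integrable M (%w. x w \<bullet> b)"
 shows "integrable M x"
proof -
 have "integrable M (%w. SUM b:Basis. (x w \<bullet> b) *\<^sub>R b)" using assms by (intro Bochner_Integration.integrable_sum integrable_scaleR_left) auto
 thus ?thesis by (simp add: euclidean_representation)
qed

lemma measurable_vec_nth [measurable]:
 fixes x :: "'a => real^'n"
 shows "x : borel_measurable M ==> (%w. x w $ i) : borel_measurable M"
 using borel_measurable_inner[of x M "%_. axis i 1"] by (simp add: inner_axis)

lemma measurable_vec_lambda [measurable (raw)]:
 fixes f :: "'a => 'n::finite => real"
 assumes "!!i. (%w. f w i) : borel_measurable M"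
 shows "(%w. \<chi> i. f w i) : borel_measurable M"
proof (subst borel_measurable_euclidean_space, rule ballI)
 fix b :: "real^'n" assume "b : Basis"
 then obtain i where "b = axis i 1" unfolding Basis_vec_def by auto
 thus "(%w. (\<chi> i. f w i) \<bullet> b) : borel_measurable M" using assms by (simp add: inner_axis)
qed

text \<open>\<open>q\<close> stands for the strong topology. \<open>q_null\<close> ties its kernel
  to almost sure equality, while \<open>pairing_continuous\<close> and \<open>dual_split\<close>
  describe the dual as sums of an integrable and a singular part.\<close>

locale rv_space = prob_space M for M :: "'a measure" +
 fixes S S' :: "('a => real^'n) set" and q :: "('a => real^'n) => real"
 assumes S_space: "solid_decomposable_space M S" and S'_space: "solid_decomposable_space M S'"
  and S_duality: "separating_duality M S S'"
  and S_fspace: "fspace S q"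
  and q_null: "x : S ==> q x = 0 \<longleftrightarrow> (AE w in M. x w = 0)"
  and pairing_continuous: "v : S' ==> continuous_functional S q (%x. \<integral>w. x w \<bullet> v w \<partial>M)"
  and dual_split: "continuous_functional S q l ==>
   EX v:S'. EX \<sigma>. continuous_functional S q \<sigma> & singular_on M S \<sigma> & (ALL x:S. l x = (LINT w|M. x w \<bullet> v w) + \<sigma> x)"

lemma solidD:
 fixes x z :: "'a => real^'n"
 assumes "solid_decomposable_space M V" "z : V" "x : borel_measurable M" "AE w in M. ALL i. \<bar>x w $ i\<bar> <= \<bar>z w $ i\<bar>"
 shows "x : V"
proof -
 have "solid M V" using assms(1) by (simp add: solid_decomposable_space_def)
 from this[unfolded solid_def, THEN bspec, OF assms(2), THEN bspec, OF assms(3)] assms(4) show ?thesis by (rule mp)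
qed

lemma solid_decomposable_bounded:
 fixes x :: "'a => real^'n"
 assumes "solid_decomposable_space M V" "x : borel_measurable M" "AE w in M. norm (x w) <= c"
 shows "x : V"
proof -
 have V: "subspace V" "decomposable M V" "solid M V" using assms(1) unfolding solid_decomposable_space_def by auto
 have "x : Linf M" using assms unfolding Linf_def by blast
 \<comment> \<open>Decomposability with the empty set and the vector \<open>0\<close> gives
   \<open>x\<close> cut to \<open>space M\<close>; solidity removes the cut.\<close>
 hence "(%w. indicator {} w *\<^sub>R (0 :: 'a => real^'n) w + indicator (space M - {}) w *\<^sub>R x w) : V"
  by (intro V(2)[unfolded decomposable_def, THEN bspec, THEN bspec, THEN bspec] subspace_0[OF V(1)]) auto
 hence "(%w. indicator (space M) w *\<^sub>R x w) : V" by simp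
 moreover have "AE w in M. ALL i. \<bar>x w $ i\<bar> <= \<bar>(indicator (space M) w *\<^sub>R x w) $ i\<bar>" by (rule AE_I2) simp
 ultimately show ?thesis using solidD[OF assms(1) _ assms(2)] by blast
qed

lemma solid_AE_eq:
 fixes x z :: "'a => real^'n"
 assumes "solid_decomposable_space M V" "z : V" "x : borel_measurable M" "AE w in M. x w = z w"
 shows "x : V"
 using assms(4) by (intro solidD[OF assms(1-3)]) auto

lemma solid_scaled:
 fixes x :: "'a => real^'n"
 assumes "solid_decomposable_space M V" "x : V" "\<xi> : borel_measurable M" "AE w in M. \<bar>\<xi> w\<bar> <= 1"
 shows "(%w. \<xi> w *\<^sub>R x w) : V"
proof (rule solidD[OF assms(1,2)])
 show "(%w. \<xi> w *\<^sub>R x w) : borel_measurable M"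
  using assms unfolding solid_decomposable_space_def by (auto intro!: borel_measurable_scaleR)
 show "AE w in M. ALL i. \<bar>(\<xi> w *\<^sub>R x w) $ i\<bar> <= \<bar>x w $ i\<bar>"
  using assms(4) by eventually_elim (auto simp: abs_mult intro: mult_left_le_one_le)
qed

lemma solid_abs:
 fixes x :: "'a => real^'n"
 assumes "solid_decomposable_space M V" "x : V"
 shows "(%w. \<chi> i. \<bar>x w $ i\<bar>) : V"
proof (rule solidD[OF assms])
 have [measurable]: "x : borel_measurable M" using assms unfolding solid_decomposable_space_def by blast
 show "(%w. \<chi> i. \<bar>x w $ i\<bar>) : borel_measurable M" by measurable
qed auto

lemma solid_component:
 fixes x :: "'a => real^'n"
 assumes "solid_decomposable_space M V" "x : V"
 shows "(%w. axis i (x w $ i)) : V"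
proof (rule solidD[OF assms])
 have [measurable]: "x : borel_measurable M" using assms unfolding solid_decomposable_space_def by blast
 show "(%w. axis i (x w $ i)) : borel_measurable M"
  unfolding axis_def by (intro measurable_vec_lambda) measurable
qed (auto simp: axis_def)

text \<open>Everything is read off from \<open>q x = d x 0\<close> by translation invariance. Open
  sets are returned as well as closed ones, because closedness in a product topology has to be
  unfolded into rectangles of open sets.\<close>

lemma strong_topology_rv_space:
 fixes S S' :: "('a => real^'n) set"
 assumes prob: "prob_space M" and sp: "solid_decomposable_space M S" "solid_decomposable_space M S'"
  and dual: "separating_duality M S S'" and strong: "strong_topology M S S' \<tau>"
 obtains q where "rv_space M S S' q"
  "!!D. closedin \<tau> D ==> seq_closed_in S q D"
  "!!G x. openin \<tau> G ==> x : G ==> EX e>0. ALL y:S. q (y - x) < e --> y : G"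
proof -
 interpret prob_space M by fact
 have fr: "frechet_ae M S \<tau>" and ds: "is_direct_sum (topological_dual S \<tau>) (pairing_functional M S ` S') (singular_functionals M S \<tau>)"
  using strong unfolding strong_topology_def by auto
 have lc: "locally_convex_tvs S \<tau>" using fr unfolding frechet_ae_def by blast
 have sub: "subspace S" and top: "topspace \<tau> = S"
  and cscale: "continuous_map (prod_topology euclideanreal \<tau>) \<tau> (%(c, x). c *\<^sub>R x)"
  and conv: "!!G. openin \<tau> G ==> 0 : G ==> EX K. openin \<tau> K & convex K & 0 : K & K <= G"
  using lc unfolding locally_convex_tvs_def by auto
 obtain d where d: "ALL x:S. ALL y:S. 0 <= d x y & d x y = d y x & (d x y = 0 \<longleftrightarrow> (AE w in M. x w = y w))"
  "ALL x:S. ALL y:S. ALL z:S. d x z <= d x y + d y z & d (x + z) (y + z) = d x y"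
  "ALL G. openin \<tau> G \<longleftrightarrow> G <= S & (ALL x:G. EX e>(0::real). ALL y:S. d x y < e --> y : G)"
  "ALL s::nat => 'a => real^'n. range s <= S & (ALL e>0. EX k. ALL i>=k. ALL j>=k. d (s i) (s j) < e) -->
      (EX x:S. (%i. d (s i) x) \<longlonglongrightarrow> 0)"
  using conjunct2[OF fr[unfolded frechet_ae_def]] by (elim exE conjE) (rule that; assumption)
 define q where "q x = d x 0" for x
 note S' = subspace_add[OF sub] subspace_diff[OF sub] subspace_neg[OF sub] subspace_scale[OF sub] subspace_0[OF sub]
 have dq: "d x y = q (x - y)" if "x : S" "y : S" for x y
 proof -
  have "d ((x - y) + y) (0 + y) = d (x - y) 0" using d(2) that S'(2,5) by blast
  thus ?thesis unfolding q_def by simp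
 qed
 have dq': "d x y = q (y - x)" if "x : S" "y : S" for x y using dq[OF that(2,1)] d(1) that by metis
 have op: "openin \<tau> G \<longleftrightarrow> G <= S & (ALL x:G. EX e>0. ALL y:S. q (y - x) < e --> y : G)" for G
 proof -
  have "(EX e>0. ALL y:S. d x y < e --> y : G) \<longleftrightarrow> (EX e>0. ALL y:S. q (y - x) < e --> y : G)" if "x : S" for x
   using dq'[OF that] by auto
  hence "(G <= S & (ALL x:G. EX e>0. ALL y:S. d x y < e --> y : G)) \<longleftrightarrow> (G <= S & (ALL x:G. EX e>0. ALL y:S. q (y - x) < e --> y : G))"
   by (intro conj_cong refl ball_cong) auto
  with d(3)[THEN spec, of G] show ?thesis by (rule trans)
 qed
 have nonneg: "0 <= q x" and null: "q x = 0 \<longleftrightarrow> (AE w in M. x w = 0)" if "x : S" for x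
  using d(1) that S'(5) unfolding q_def by (auto simp: zero_fun_def)
 have minus: "q (- x) = q x" if x: "x : S" for x using dq'[OF x S'(5)] dq[OF x S'(5)] by simp
 have tri: "q (x + y) <= q x + q y" if xy: "x : S" "y : S" for x y
 proof -
  have "d (x + y) 0 <= d (x + y) y + d y 0" using d(2) xy S'(1,5) by blast
  thus ?thesis using dq[of "x + y" y] xy S'(1) unfolding q_def by simp
 qed
 have ball: "openin \<tau> {x:S. q x < e}" for e
  unfolding op
 proof (intro conjI ballI)
  fix x assume x: "x : {x:S. q x < e}"
  show "EX e'>0. ALL y:S. q (y - x) < e' --> y : {x:S. q x < e}"
  proof (intro exI[of _ "e - q x"] conjI ballI impI)
   fix y assume "y : S" "q (y - x) < e - q x"
   thus "y : {x:S. q x < e}" using tri[of "y - x" x] x S'(2)[of y x] by auto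
  qed (use x in auto)
 qed auto
 have q0: "q 0 = 0" using null[OF S'(5)] by simp
 have fs: "fspace S q"
 proof (rule fspaceI, rule sub, erule nonneg, erule minus, erule (1) tri)
  fix x assume x: "x : S"
  show "(%n. q ((1/2)^n *\<^sub>R x)) \<longlonglongrightarrow> 0"
  proof (rule LIMSEQ_I)
   fix e :: real assume e: "e > 0"
   have "continuous_map euclideanreal (prod_topology euclideanreal \<tau>) (%c. (c, x))"
    using x top by (intro continuous_map_pairedI) auto
   from continuous_map_compose[OF this cscale]
   have "continuous_map euclideanreal \<tau> (%c. c *\<^sub>R x)" by (simp add: o_def)
   from openin_continuous_map_preimage[OF this ball[of e]]
   have "open {c. c *\<^sub>R x : S & q (c *\<^sub>R x) < e}" by simp
   moreover have "0 : {c. c *\<^sub>R x : S & q (c *\<^sub>R x) < e}" using S'(5) q0 e by simp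
   moreover have "(%n. (1/2::real)^n) \<longlonglongrightarrow> 0" by (rule LIMSEQ_power_zero) simp
   ultimately have "\<forall>\<^sub>F n in sequentially. (1/2::real)^n : {c. c *\<^sub>R x : S & q (c *\<^sub>R x) < e}"
    by (rule topological_tendstoD[rotated])
   thus "EX no. ALL n>=no. norm (q ((1/2)^n *\<^sub>R x) - 0) < e"
    using nonneg[OF S'(4)[OF x]] unfolding eventually_sequentially by auto
  qed
 next
  fix e :: real assume e: "e > 0"
  obtain K where K: "openin \<tau> K" "convex K" "0 : K" "K <= {x:S. q x < e}"
   using conv[OF ball[of e]] S'(5) q0 e by auto
  obtain \<delta> where "\<delta> > 0" "ALL y:S. q (y - 0) < \<delta> --> y : K" using K(1,3) unfolding op by blast
  thus "EX N. convex N & N <= {x : S. q x < e} & (EX \<delta>>0. {x : S. q x < \<delta>} <= N)"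
   using K by (intro exI[of _ K] conjI exI[of _ \<delta>]) auto
 next
  fix s :: "nat => 'a => real^'n"
  assume s: "!!n. s n : S" "!!e. e > 0 ==> EX k. ALL i>=k. ALL j>=k. q (s i - s j) < e"
  have "ALL e>0. EX k. ALL i>=k. ALL j>=k. d (s i) (s j) < e" using s by (simp add: dq)
  hence "EX x:S. (%i. d (s i) x) \<longlonglongrightarrow> 0" using d(4)[THEN spec, of s] s(1) by blast
  then obtain x where "x : S" "(%i. d (s i) x) \<longlonglongrightarrow> 0" by blast
  thus "EX x:S. (%i. q (s i - x)) \<longlonglongrightarrow> 0" using s(1) by (intro bexI[of _ x]) (simp_all add: dq)
 qed
 have cf_dual: "continuous_functional S q l" if l: "l : topological_dual S \<tau>" for l
 proof -
  have lin: "linear_functional_on S l" and cm: "continuous_map \<tau> euclideanreal l"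
   using l unfolding topological_dual_def linear_functional_on_def by auto
  have "openin \<tau> {x : topspace \<tau>. l x : {-1<..<1}}"
   by (rule openin_continuous_map_preimage[OF cm]) simp
  moreover have "0 : {x : topspace \<tau>. l x : {-1<..<1}}" using top S'(5) linear_functional_on_zero[OF lin] by simp
  ultimately obtain \<delta> where "\<delta> > 0" "ALL y:S. q (y - 0) < \<delta> --> y : {x : topspace \<tau>. l x : {-1<..<1}}"
   unfolding op by blast
  thus ?thesis unfolding continuous_functional_def using lin by (intro conjI exI[of _ \<delta>]) auto
 qed
 \<comment> \<open>Elements of \<open>topological_dual\<close> vanish off \<open>S\<close>, hence
   the extension by \<open>0\<close>.\<close>
 have dual_cf: "(%x. if x : S then l x else 0) : topological_dual S \<tau>" if l: "continuous_functional S q l" for l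
 proof -
  have lin: "linear_functional_on S l" using l unfolding continuous_functional_def by blast
  have "continuous_map \<tau> euclideanreal (%x. if x : S then l x else 0)"
   unfolding continuous_map
  proof (intro conjI allI impI)
   fix G :: "real set" assume "openin euclideanreal G"
   hence G: "open G" by simp
   show "openin \<tau> {x : topspace \<tau>. (if x : S then l x else 0) : G}"
    unfolding op top
   proof (intro conjI ballI)
    show "{x : S. (if x : S then l x else 0) : G} <= S" by blast
   next
    fix x assume x: "x : {x : S. (if x : S then l x else 0) : G}"
    show "EX e>0. ALL y:S. q (y - x) < e --> y : {x : S. (if x : S then l x else 0) : G}"
    proof (rule ccontr)
    assume "~ (EX e>0. ALL y:S. q (y - x) < e --> y : {x : S. (if x : S then l x else 0) : G})"
    hence no: "EX y. y : S & q (y - x) < e & l y ~: G" if "e > 0" for e using that by auto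
    have no': "EX z. z : S & q z < e & l (z + x) ~: G" if e: "e > 0" for e
    proof -
     obtain y where "y : S" "q (y - x) < e" "l y ~: G" using no[OF e] by blast
     thus ?thesis using x S'(2) by (intro exI[of _ "y - x"]) auto
    qed
    obtain s where s: "!!n::nat. s n : S" "(%n. q (s n)) \<longlonglongrightarrow> 0" "!!n. l (s n + x) ~: G"
     by (rule small_sequence[OF fs, of "%z. l (z + x) ~: G"]) (auto intro: no')
    have xS: "x : S" and xG: "l x : G" using x by auto
    have "(%n. l (s n + x)) \<longlonglongrightarrow> l x"
     by (rule continuous_functional_tendsto[OF fs l]) (use s S'(1) xS in auto)
    from topological_tendstoD[OF this G xG] show False using s(3) by (auto simp: eventually_sequentially)
    qed
   qed
  qed auto
  thus ?thesis using lin S' unfolding topological_dual_def linear_functional_on_def by auto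
 qed
 have rv: "rv_space M S S' q"
 proof (intro rv_space.intro rv_space_axioms.intro prob sp dual fs null)
  have dir: "subspace (pairing_functional M S ` S')" "subspace (singular_functionals M S \<tau>)"
   "topological_dual S \<tau> = {a + b | a b. a : pairing_functional M S ` S' & b : singular_functionals M S \<tau>}"
   using ds unfolding is_direct_sum_def by auto
  fix v assume v: "v : S'"
  have "pairing_functional M S v + 0 : topological_dual S \<tau>"
   unfolding dir(3) using v subspace_0[OF dir(2)] by blast
  hence "continuous_functional S q (pairing_functional M S v)" using cf_dual by simp
  thus "continuous_functional S q (%x. \<integral>w. x w \<bullet> v w \<partial>M)"
   unfolding continuous_functional_def linear_functional_on_def pairing_functional_def using S'(1,4) by simp
 next
  fix l assume l: "continuous_functional S q l"
  obtain v \<sigma> where vs: "v : S'" "\<sigma> : singular_functionals M S \<tau>"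
   "(%x. if x : S then l x else 0) = pairing_functional M S v + \<sigma>"
   using dual_cf[OF l] ds unfolding is_direct_sum_def by auto
  have "\<sigma> : topological_dual S \<tau>" using vs(2) unfolding singular_functionals_def by blast
  from cf_dual[OF this] have "continuous_functional S q \<sigma>" .
  moreover have "singular_on M S \<sigma>" using vs(2) unfolding singular_functionals_def singular_on_def by blast
  moreover have "l x = (LINT w|M. x w \<bullet> v w) + \<sigma> x" if "x : S" for x
   using fun_cong[OF vs(3), of x] that by (simp add: pairing_functional_def)
  ultimately show "EX v:S'. EX \<sigma>. continuous_functional S q \<sigma> & singular_on M S \<sigma> &
    (ALL x:S. l x = (LINT w|M. x w \<bullet> v w) + \<sigma> x)" using vs(1) by blast
 qed
 show ?thesis
 proof (rule that[OF rv])
  show "EX e>0. ALL y:S. q (y - x) < e --> y : G" if "openin \<tau> G" "x : G" for G x using that op by blast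
  show "seq_closed_in S q D" if D: "closedin \<tau> D" for D
   unfolding seq_closed_in_def
  proof (intro allI impI, elim conjE, rule ccontr)
   fix s x assume s: "ALL n::nat. s n : D" "x : S" "(%n. q (s n - x)) \<longlonglongrightarrow> 0" and x: "x ~: D"
   have "openin \<tau> (S - D)" using D top unfolding closedin_def by simp
   then obtain e where e: "e > 0" "ALL y:S. q (y - x) < e --> y : S - D" using s(2) x op by blast
   have DS: "D <= S" using D top closedin_subset by blast
   obtain k where "ALL n>=k. q (s n - x) < e" using q_tendsto_0D[OF fs, of "%n. s n - x" e] s(3) e(1) by blast
   thus False using e(2) s(1) DS by blast
  qed
 qed
qed

lemma scaleR_fun_apply [simp]: "(c *\<^sub>R f) x = c *\<^sub>R f x"
 by (simp add: scaleR_fun_def)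

lemma Robinson_Ursescu_ex:
 assumes "fspace V p" "fspace W q" "R <= V \<times> W" "convex R" "(0, 0) : R"
  and "!!x. x : V ==> EX t>0. EX w. (t *\<^sub>R x, w) : R"
  and "!!s u x w. (!!n::nat. (s n, u n) : R) ==> x : V ==> w : W ==>
   (%n. p (s n - x)) \<longlonglongrightarrow> 0 ==> (%n. q (u n - w)) \<longlonglongrightarrow> 0 ==> (x, w) : R"
  and "e > 0"
 shows "EX \<delta>>0. ALL x:V. p x < \<delta> --> (EX w. (x, w) : R & q w < e)"
proof -
 obtain \<delta> where "\<delta> > 0" and d: "!!x. x : V ==> p x < \<delta> ==> EX w. (x, w) : R & q w < e"
  using Robinson_Ursescu[of V p W q R e thesis] assms by auto
 thus ?thesis by blast
qed

lemma inner_sgn_self: "x \<bullet> sgn x = norm (x :: 'b::real_inner)"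
 by (cases "x = 0") (auto simp: sgn_div_norm dot_square_norm power2_eq_square)

section \<open>Spaces of random vectors\<close>

text \<open>Constant vectors belong to \<open>V\<close>, so the components of \<open>v\<close> are
  themselves pairings.\<close>

lemma duality_integrable:
 fixes V V' :: "('a => real^'n) set"
 assumes V: "solid_decomposable_space M V" and int: "!!x. x : V ==> integrable M (%w. x w \<bullet> v w)"
 shows "integrable M v"
proof (rule integrable_componentwise)
 fix b :: "real^'n" assume "b : Basis"
 have "(%_. b) : V" by (rule solid_decomposable_bounded[OF V, of _ "norm b"]) auto
 from int[OF this] show "integrable M (%w. v w \<bullet> b)" by (simp add: inner_commute)
qed

lemma (in prob_space) AE_eventually_notin_decseq:
 assumes B: "range B <= sets M" "decseq B" "(%n. measure M (B n)) \<longlonglongrightarrow> 0"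
 shows "AE w in M. EX k. ALL n>=k. w ~: B n"
proof -
 have "(%n. measure M (B n)) \<longlonglongrightarrow> measure M (INT n. B n)"
  using B(1,2) by (intro finite_Lim_measure_decseq) auto
 hence "measure M (INT n. B n) = 0" using B(3) LIMSEQ_unique by blast
 hence "(INT n. B n) : null_sets M"
  using B(1) by (auto simp: null_sets_def emeasure_eq_measure)
 from AE_not_in[OF this] show ?thesis
 proof eventually_elim
  case (elim w)
  then obtain k where "w ~: B k" by blast
  thus ?case using B(2) unfolding decseq_def by blast
 qed
qed

context rv_space
begin

lemma S_measurable: "x : S ==> x : borel_measurable M"
 and S'_measurable: "x : S' ==> x : borel_measurable M"
 and subspace_S: "subspace S" and subspace_S': "subspace S'"
 using S_space S'_space unfolding solid_decomposable_space_def by auto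

lemma pairing_integrable: "x : S ==> v : S' ==> integrable M (%w. x w \<bullet> v w)"
 using S_duality unfolding separating_duality_def by blast

lemma S'_integrable: "v : S' ==> integrable M v"
 by (rule duality_integrable[OF S_space]) (rule pairing_integrable)

lemma S_integrable: "x : S ==> integrable M x"
 by (rule duality_integrable[OF S'_space]) (subst inner_commute, rule pairing_integrable)

lemma S_bounded: "x : borel_measurable M ==> (!!w. norm (x w) <= c) ==> x : S"
 and S'_bounded: "x : borel_measurable M ==> (!!w. norm (x w) <= c) ==> x : S'"
 using solid_decomposable_bounded[OF S_space, of x c] solid_decomposable_bounded[OF S'_space, of x c] by auto

lemma S_add: "x : S ==> y : S ==> x + y : S"
 and S_diff: "x : S ==> y : S ==> x - y : S"
 and S_scale: "x : S ==> c *\<^sub>R x : S"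
 and S_minus: "x : S ==> - x : S"
 and S_zero: "0 : S"
 using subspace_S by (simp_all add: subspace_add subspace_diff subspace_neg subspace_scale subspace_0)

lemma S'_add: "x : S' ==> y : S' ==> x + y : S'"
 and S'_diff: "x : S' ==> y : S' ==> x - y : S'"
 and S'_scale: "x : S' ==> c *\<^sub>R x : S'"
 and S'_minus: "x : S' ==> - x : S'"
 and S'_zero: "0 : S'"
 using subspace_S' by (simp_all add: subspace_add subspace_diff subspace_neg subspace_scale subspace_0)

lemma S_cut: "x : S ==> A : sets M ==> (%w. indicator A w *\<^sub>R x w) : S"
 by (rule solid_scaled[OF S_space]) (auto simp: indicator_def)

lemma q_AE_eq: "x : S ==> y : S ==> AE w in M. x w = y w ==> q x = q y"
proof -
 assume xy: "x : S" "y : S" "AE w in M. x w = y w"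
 have "q (x - y) = 0" "q (y - x) = 0" using xy by (auto simp: q_null S_diff)
 thus "q x = q y"
  using q_triangle[OF S_fspace, of "x - y" y] q_triangle[OF S_fspace, of "y - x" x] xy S_diff by auto
qed

lemma functional_AE_eq:
 assumes l: "continuous_functional S q l" and xy: "x : S" "y : S" "AE w in M. x w = y w"
 shows "l x = l y"
proof -
 have "q (x - y) = 0" using xy by (auto simp: q_null S_diff)
 hence "l (x - y) = 0" using continuous_functional_null[OF S_fspace l] xy S_diff by blast
 thus ?thesis
  using l xy linear_functional_on_diff[OF _ subspace_S xy(1,2), of l] unfolding continuous_functional_def by simp
qed

text \<open>Strong convergence implies L1 convergence. \<open>R\<close> is the epigraph of the L1
  norm; it is closed because the norm of the limit \<open>x\<close> is its pairing with the bounded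
  dual vector \<open>sgn x\<close>, and that pairing is continuous. Robinson--Ursescu then bounds
  the norm near \<open>0\<close>.\<close>

lemma L1_small:
 assumes e: "e > 0"
 obtains \<delta> where "\<delta> > 0" "!!x. x : S ==> q x < \<delta> ==> (LINT h|M. norm (x h)) < e"
proof -
 define R where "R = {(x, r). x : S & (LINT h|M. norm (x h)) <= r}"
 have int: "integrable M (%h. norm (x h))" if "x : S" for x using S_integrable[OF that] by simp
 have R1: "R <= S \<times> UNIV" unfolding R_def by auto
 have R2: "convex R"
 proof (rule convexI)
  fix z w and u v :: real assume zw: "z : R" "w : R" and uv: "0 <= u" "0 <= v" "u + v = 1"
  obtain x r y s where [simp]: "z = (x, r)" "w = (y, s)" by (metis surj_pair)
  have xy: "x : S" "y : S" "(LINT h|M. norm (x h)) <= r" "(LINT h|M. norm (y h)) <= s" using zw unfolding R_def by auto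
  have "(LINT h|M. norm ((u *\<^sub>R x + v *\<^sub>R y) h)) <= (LINT h|M. u * norm (x h) + v * norm (y h))"
  proof (rule integral_mono)
   show "integrable M (%h. norm ((u *\<^sub>R x + v *\<^sub>R y) h))" using xy by (intro int S_add S_scale)
   show "integrable M (%h. u * norm (x h) + v * norm (y h))"
    using int xy by (intro Bochner_Integration.integrable_add integrable_mult_right) auto
   show "norm ((u *\<^sub>R x + v *\<^sub>R y) h) <= u * norm (x h) + v * norm (y h)" for h
    using norm_triangle_ineq[of "u *\<^sub>R x h" "v *\<^sub>R y h"] uv by simp
  qed
  also have "\<dots> = u * (LINT h|M. norm (x h)) + v * (LINT h|M. norm (y h))"
   using int xy by (subst Bochner_Integration.integral_add) auto
  also have "\<dots> <= u * r + v * s" using xy uv by (intro add_mono mult_left_mono) auto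
  finally show "u *\<^sub>R z + v *\<^sub>R w : R" using xy unfolding R_def by (auto intro: S_add S_scale)
 qed
 have R3: "(0, 0) : R" unfolding R_def using S_zero by simp
 have Rabs: "EX t>0. EX w. (t *\<^sub>R x, w) : R" if "x : S" for x
  using that by (intro exI[of _ 1] conjI exI[of _ "\<integral>h. norm (x h) \<partial>M"]) (auto simp: R_def)
 have Rcl: "(x, w) : R"
  if s: "!!n. (s n, u n) : R" and x: "x : S" and lim: "(%n. q (s n - x)) \<longlonglongrightarrow> 0" "(%n. \<bar>u n - w\<bar>) \<longlonglongrightarrow> 0"
  for s u x w
 proof -
  have sS: "s n : S" and su: "(LINT h|M. norm (s n h)) <= u n" for n using s[of n] unfolding R_def by auto
  have [measurable]: "x : borel_measurable M" by (rule S_measurable[OF x])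
  define v where "v h = sgn (x h)" for h
  have [measurable]: "v : borel_measurable M" unfolding v_def sgn_div_norm by measurable
  have nv: "norm (v h) <= 1" for h unfolding v_def by (simp add: norm_sgn)
  have v: "v : S'" by (rule S'_bounded[OF _ nv]) measurable
  have "(%n. \<integral>h. s n h \<bullet> v h \<partial>M) \<longlonglongrightarrow> (LINT h|M. x h \<bullet> v h)"
   by (rule continuous_functional_tendsto[OF S_fspace pairing_continuous[OF v], OF sS x lim(1)])
  moreover have "u \<longlonglongrightarrow> w" using lim(2) by (simp add: tendsto_rabs_zero_iff LIM_zero_iff)
  moreover have "(LINT h|M. s n h \<bullet> v h) <= u n" for n
  proof -
   have "(LINT h|M. s n h \<bullet> v h) <= (LINT h|M. norm (s n h))"
   proof (rule integral_mono[OF pairing_integrable[OF sS v] int[OF sS]])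
    fix h
    have "s n h \<bullet> v h <= norm (s n h) * norm (v h)" by (rule norm_cauchy_schwarz)
    also have "\<dots> <= norm (s n h)" using nv by (simp add: mult_right_le_one_le)
    finally show "s n h \<bullet> v h <= norm (s n h)" .
   qed
   thus ?thesis using su[of n] by linarith
  qed
  ultimately have "(LINT h|M. x h \<bullet> v h) <= w" by (intro LIMSEQ_le) auto
  moreover have "x h \<bullet> v h = norm (x h)" for h
   unfolding v_def by (rule inner_sgn_self)
  ultimately show ?thesis unfolding R_def using x by simp
 qed
 have "EX \<delta>>0. ALL x:S. q x < \<delta> --> (EX w. (x, w) : R & \<bar>w\<bar> < e)"
  by (rule Robinson_Ursescu_ex[OF S_fspace fspace_real R1 R2 R3 _ _ e]) (erule Rabs, rule Rcl)
 then obtain \<delta> where "\<delta> > 0" "!!x. x : S ==> q x < \<delta> ==> EX w. (x, w) : R & \<bar>w\<bar> < e"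
  by blast
 thus ?thesis using that[of \<delta>] unfolding R_def by fastforce
qed

lemma L1_tendsto:
 assumes s: "!!n::nat. s n : S" "x : S" "(%n. q (s n - x)) \<longlonglongrightarrow> 0"
 shows "(%n. \<integral>w. norm (s n w - x w) \<partial>M) \<longlonglongrightarrow> 0"
proof (rule LIMSEQ_I)
 fix e :: real assume "e > 0"
 then obtain \<delta> where d: "\<delta> > 0" "!!x. x : S ==> q x < \<delta> ==> (LINT w|M. norm (x w)) < e" using L1_small by blast
 obtain k where k: "!!n. n >= k ==> q (s n - x) < \<delta>" using q_tendsto_0D[OF S_fspace, OF s(3) d(1)] by blast
 show "EX no. ALL n>=no. norm ((LINT w|M. norm (s n w - x w)) - 0) < e"
 proof (intro exI[of _ k] allI impI)
  fix n assume "n >= k"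
  hence "(LINT w|M. norm ((s n - x) w)) < e" using k[of n] d(2)[OF S_diff[OF s(1) s(2), of n]] by blast
  moreover have "0 <= (LINT w|M. norm (s n w - x w))" by (rule Bochner_Integration.integral_nonneg) simp
  ultimately show "norm ((LINT w|M. norm (s n w - x w)) - 0) < e" by simp
 qed
qed

lemma AE_subseq:
 assumes s: "!!n::nat. s n : S" "x : S" "(%n. q (s n - x)) \<longlonglongrightarrow> 0"
 obtains r where "strict_mono r" "AE w in M. (%n. s (r n) w) \<longlonglongrightarrow> x w"
proof -
 have "integrable M (%w. s n w - x w)" for n using s S_integrable by simp
 from tendsto_L1_AE_subseq[OF this L1_tendsto[OF s]]
 obtain r where r: "strict_mono r" "AE w in M. (%n. s (r n) w - x w) \<longlonglongrightarrow> 0" by blast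
 have "AE w in M. (%n. s (r n) w) \<longlonglongrightarrow> x w" using r(2) by eventually_elim (simp add: LIM_zero_iff)
 thus ?thesis using that r(1) by blast
qed

text \<open>The metric need not be monotone, so a small vector could have a large modulus. The
  relation between \<open>x\<close> and its majorants \<open>w\<close> is convex and closed and has
  full domain, so the open mapping argument still finds a small majorant.\<close>

lemma dominate_small:
 assumes e: "e > 0"
 obtains \<delta> where "\<delta> > 0" "!!x. x : S ==> q x < \<delta> ==> EX w. w : S & q w < e & (AE h in M. ALL i. \<bar>x h $ i\<bar> <= w h $ i)"
proof -
 define R where "R = {(x, w). x : S & w : S & (AE h in M. ALL i. \<bar>x h $ i\<bar> <= w h $ i)}"
 have R1: "R <= S \<times> S" unfolding R_def by auto
 have R2: "convex R"
 proof (rule convexI)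
  fix z w and u v :: real assume zw: "z : R" "w : R" and uv: "0 <= u" "0 <= v" "u + v = 1"
  obtain x r y s where [simp]: "z = (x, r)" "w = (y, s)" by (metis surj_pair)
  have xy: "x : S" "y : S" "r : S" "s : S" "AE h in M. ALL i. \<bar>x h $ i\<bar> <= r h $ i" "AE h in M. ALL i. \<bar>y h $ i\<bar> <= s h $ i"
   using zw unfolding R_def by auto
  have "AE h in M. ALL i. \<bar>(u *\<^sub>R x + v *\<^sub>R y) h $ i\<bar> <= (u *\<^sub>R r + v *\<^sub>R s) h $ i"
   using xy(5,6)
  proof eventually_elim
   case (elim h)
   show ?case
   proof
    fix i
    have "\<bar>u * x h $ i + v * y h $ i\<bar> <= u * \<bar>x h $ i\<bar> + v * \<bar>y h $ i\<bar>"
     using abs_triangle_ineq[of "u * x h $ i" "v * y h $ i"] uv by (simp add: abs_mult)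
    also have "\<dots> <= u * r h $ i + v * s h $ i" using elim uv by (intro add_mono mult_left_mono) auto
    finally show "\<bar>(u *\<^sub>R x + v *\<^sub>R y) h $ i\<bar> <= (u *\<^sub>R r + v *\<^sub>R s) h $ i" by simp
   qed
  qed
  thus "u *\<^sub>R z + v *\<^sub>R w : R" using xy unfolding R_def by (auto intro: S_add S_scale)
 qed
 have R3: "(0, 0) : R" unfolding R_def using S_zero by simp
 have Rabs: "EX t>0. EX w. (t *\<^sub>R x, w) : R" if "x : S" for x
  using that solid_abs[OF S_space that]
  by (intro exI[of _ 1] conjI exI[of _ "%h. \<chi> i. \<bar>x h $ i\<bar>"]) (auto simp: R_def)
 have Rcl: "(x, w) : R"
  if s: "!!n. (s n, u n) : R" and x: "x : S" "w : S" and lim: "(%n. q (s n - x)) \<longlonglongrightarrow> 0" "(%n. q (u n - w)) \<longlonglongrightarrow> 0"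
  for s u x w
 proof -
  have sS: "s n : S" "u n : S" and su: "AE h in M. ALL i. \<bar>s n h $ i\<bar> <= u n h $ i" for n using s[of n] unfolding R_def by auto
  obtain r where r: "strict_mono r" "AE h in M. (%n. s (r n) h) \<longlonglongrightarrow> x h" by (rule AE_subseq[OF sS(1) x(1) lim(1)])
  have "(%n. q (u (r n) - w)) \<longlonglongrightarrow> 0" using LIMSEQ_subseq_LIMSEQ[OF lim(2) r(1)] by (simp add: o_def)
  then obtain r' where r': "strict_mono r'" "AE h in M. (%n. u (r (r' n)) h) \<longlonglongrightarrow> w h"
   using AE_subseq[of "%n. u (r n)"] sS x by blast
  have "AE h in M. ALL n. ALL i. \<bar>s n h $ i\<bar> <= u n h $ i" using su by (simp add: AE_all_countable)
  hence "AE h in M. ALL i. \<bar>x h $ i\<bar> <= w h $ i" using r(2) r'(2)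
  proof eventually_elim
   case (elim h)
   have "(%n. s (r (r' n)) h) \<longlonglongrightarrow> x h" using LIMSEQ_subseq_LIMSEQ[OF elim(2) r'(1)] by (simp add: o_def)
   thus ?case using elim(1,3)
    by (intro allI LIMSEQ_le[OF tendsto_rabs[OF tendsto_vec_nth] tendsto_vec_nth]) auto
  qed
  thus ?thesis unfolding R_def using x by simp
 qed
 have "EX \<delta>>0. ALL x:S. q x < \<delta> --> (EX w. (x, w) : R & q w < e)"
  by (rule Robinson_Ursescu_ex[OF S_fspace S_fspace R1 R2 R3 _ _ e]) (erule Rabs, rule Rcl)
 then obtain \<delta> where "\<delta> > 0" "!!x. x : S ==> q x < \<delta> ==> EX w. (x, w) : R & q w < e"
  by blast
 thus ?thesis using that[of \<delta>] unfolding R_def by blast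
qed

lemma S_positive_closed:
 assumes s: "!!n::nat. s n : S" "x : S" "(%n. q (s n - x)) \<longlonglongrightarrow> 0"
  and ge: "!!n. n >= k ==> AE w in M. ALL i. y w $ i <= s n w $ i"
 shows "AE w in M. ALL i. y w $ i <= x w $ i"
proof -
 obtain r where r: "strict_mono r" "AE w in M. (%n. s (r n) w) \<longlonglongrightarrow> x w" by (rule AE_subseq[OF s])
 have "AE w in M. ALL n. n >= k --> (ALL i. y w $ i <= s n w $ i)" using ge by (simp add: AE_all_countable)
 thus ?thesis using r(2)
 proof eventually_elim
  case (elim w)
  show ?case
  proof
   fix i
   have "y w $ i <= s (r n) w $ i" if "n >= k" for n using elim(1) that seq_suble[OF r(1), of n] by auto
   thus "y w $ i <= x w $ i" by (intro LIMSEQ_le_const[OF tendsto_vec_nth[OF elim(2)]]) blast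
  qed
 qed
qed

text \<open>Small elements are dominated by small elements, and a fast subsequence makes the dominating
  elements summable.\<close>

lemma dominated_subseq:
 assumes s: "!!n::nat. s n : S" "x : S" "(%n. q (s n - x)) \<longlonglongrightarrow> 0"
 obtains r z where "strict_mono r" "z : S" "AE h in M. ALL n i. \<bar>s (r n) h $ i\<bar> <= z h $ i"
  "AE h in M. (%n. s (r n) h) \<longlonglongrightarrow> x h"
proof -
 have "EX \<delta>>0. ALL x:S. q x < \<delta> --> (EX w. w : S & q w < (1/2)^k & (AE h in M. ALL i. \<bar>x h $ i\<bar> <= w h $ i))" for k :: nat
  by (rule dominate_small[of "(1/2)^k"]) (simp, blast)
 hence "ALL k::nat. EX \<delta>>0. ALL x:S. q x < \<delta> --> (EX w. w : S & q w < (1/2)^k & (AE h in M. ALL i. \<bar>x h $ i\<bar> <= w h $ i))" by blast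
 from choice[OF this] obtain \<delta> where d: "!!k. \<delta> k > 0"
  "!!k x. x : S ==> q x < \<delta> k ==> EX w. w : S & q w < (1/2)^k & (AE h in M. ALL i. \<bar>x h $ i\<bar> <= w h $ i)" by blast
 \<comment> \<open>The deviation at the \<open>n\<close>-th chosen index is small enough to have a
   majorant with \<open>q\<close> below \<open>(1/2)^n\<close>.\<close>
 have "EX r. ALL n. q (s (r n) - x) < \<delta> n & r n < r (Suc n)"
 proof (rule dependent_nat_choice)
  show "EX m. q (s m - x) < \<delta> 0" using q_tendsto_0D[OF S_fspace, OF s(3) d(1)] by blast
  show "EX m'. q (s m' - x) < \<delta> (Suc n) & m < m'" for m n
  proof -
   obtain k where "ALL n'>=k. q (s n' - x) < \<delta> (Suc n)" using q_tendsto_0D[OF S_fspace, OF s(3) d(1)] by blast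
   thus ?thesis by (intro exI[of _ "max k (Suc m)"]) auto
  qed
 qed
 then obtain r where r: "!!n. q (s (r n) - x) < \<delta> n" "!!n. r n < r (Suc n)" by blast
 have rm: "strict_mono r" using r(2) by (rule strict_mono_Suc_iff[THEN iffD2, OF allI])
 have "ALL k. EX w. w : S & q w < (1/2)^k & (AE h in M. ALL i. \<bar>(s (r k) - x) h $ i\<bar> <= w h $ i)"
  using d(2) r(1) s S_diff by blast
 from choice[OF this] obtain w where w: "!!k. w k : S" "!!k. q (w k) < (1/2)^k"
  "!!k. AE h in M. ALL i. \<bar>(s (r k) - x) h $ i\<bar> <= w k h $ i" by blast
 have "q (w k) <= 1 * (1/2)^k" for k using w(2)[of k] by simp
 then obtain y where y: "y : S" "(%n. q ((SUM k<n. w k) - y)) \<longlonglongrightarrow> 0"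
  using geometric_series_converges[OF S_fspace, of w 1] w(1) by blast
 have pos: "AE h in M. ALL k i. 0 <= w k h $ i"
 proof (rule AE_all_countable[THEN iffD2], rule allI)
  fix k show "AE h in M. ALL i. 0 <= w k h $ i" using w(3)[of k] by eventually_elim (meson abs_ge_zero order_trans)
 qed
 have sumS: "(SUM k<n. w k) : S" for n by (intro subspace_sum[OF subspace_S] w)
 have sumapp: "(SUM k<n. w k) h = (SUM k<n. w k h)" for n h by (induction n) auto
 \<comment> \<open>Partial sums of nonnegative vectors increase, so their limit \<open>y\<close>
   dominates every single \<open>w k\<close>.\<close>
 have wy: "AE h in M. ALL i. w k h $ i <= y h $ i" for k
 proof (rule S_positive_closed[OF sumS y, of "Suc k"])
  fix n assume n: "n >= Suc k"
  show "AE h in M. ALL i. w k h $ i <= (SUM k<n. w k) h $ i" using pos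
  proof eventually_elim
   case (elim h)
   show ?case
   proof
    fix i show "w k h $ i <= (SUM k<n. w k) h $ i"
     unfolding sumapp sum_component using n elim by (intro member_le_sum) auto
   qed
  qed
 qed
 define z where "z = (%h. \<chi> i. \<bar>x h $ i\<bar>) + y"
 have "z : S" unfolding z_def by (intro S_add solid_abs[OF S_space] s y)
 have dom: "AE h in M. ALL n i. \<bar>s (r n) h $ i\<bar> <= z h $ i"
 proof (rule AE_all_countable[THEN iffD2], rule allI)
  fix n show "AE h in M. ALL i. \<bar>s (r n) h $ i\<bar> <= z h $ i" using w(3)[of n] wy[of n]
  proof eventually_elim
   case (elim h)
   show ?case
   proof
    fix i show "\<bar>s (r n) h $ i\<bar> <= z h $ i" using elim[THEN spec, of i] by (simp add: z_def)
   qed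
  qed
 qed
 have lim': "(%n. q (s (r n) - x)) \<longlonglongrightarrow> 0" using LIMSEQ_subseq_LIMSEQ[OF s(3) rm] by (simp add: o_def)
 obtain r' where r': "strict_mono r'" "AE h in M. (%n. s (r (r' n)) h) \<longlonglongrightarrow> x h"
  using AE_subseq[of "%n. s (r n)", OF s(1) s(2) lim'] by blast
 show ?thesis
 proof (rule that[of "r \<circ> r'" z])
  show "strict_mono (r \<circ> r')" using rm r'(1) by (rule strict_mono_o)
  show "z : S" by fact
  show "AE h in M. ALL n i. \<bar>s ((r \<circ> r') n) h $ i\<bar> <= z h $ i" using dom by eventually_elim simp
  show "AE h in M. (%n. s ((r \<circ> r') n) h) \<longlonglongrightarrow> x h" using r'(2) by simp
 qed
qed

text \<open>Closed graph theorem for the map from bounded multipliers to the space.\<close>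

lemma functional_cut_bounded:
 assumes l: "continuous_functional S q l" and x: "x : S"
 obtains c where "!!A. A : sets M ==> \<bar>l (%h. indicator A h *\<^sub>R x h)\<bar> <= c"
proof -
 have lin: "linear_functional_on S l" using l unfolding continuous_functional_def by blast
 obtain \<eta> where \<eta>: "\<eta> > 0" "!!x. x : S ==> q x < \<eta> ==> \<bar>l x\<bar> <= 1"
  using l unfolding continuous_functional_def by blast
 note [measurable] = S_measurable[OF x]
 define R where "R = {(\<xi>, w). \<xi> : bounded_measurable M & w : S & (AE h in M. w h = \<xi> h *\<^sub>R x h)}"
 \<comment> \<open>Division by a bound reduces to multipliers of modulus at most 1, which solidity
   covers; the bound is raised by 1 to be positive.\<close>
 have mult: "(%h. \<xi> h *\<^sub>R x h) : S" if \<xi>: "\<xi> : bounded_measurable M" for \<xi>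
 proof -
  obtain c where c: "!!h. \<bar>\<xi> h\<bar> <= c" and [measurable]: "\<xi> : borel_measurable M"
   using \<xi> unfolding bounded_measurable_def by blast
  define d where "d = \<bar>c\<bar> + 1"
  have d: "d > 0" unfolding d_def by simp
  have d': "\<bar>\<xi> h\<bar> <= d" for h using c[of h] unfolding d_def by linarith
  have "(%h. (\<xi> h / d) *\<^sub>R (d *\<^sub>R x) h) : S"
   using d d' by (intro solid_scaled[OF S_space] S_scale x) (auto simp: divide_le_eq)
  thus ?thesis using d by simp
 qed
 have R1: "R <= bounded_measurable M \<times> S" unfolding R_def by auto
 have "subspace R"
 proof (rule subspaceI)
  show "0 : R" unfolding R_def zero_prod_def using subspace_0[OF subspace_bounded_measurable] S_zero by auto
 next
  fix z w assume zw: "z : R" "w : R"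
  thus "z + w : R" unfolding R_def
   by (auto intro!: subspace_add[OF subspace_bounded_measurable] S_add simp: scaleR_add_left elim: eventually_elim2)
 next
  fix c z assume "z : R"
  thus "c *\<^sub>R z : R" unfolding R_def
   by (auto intro!: subspace_scale[OF subspace_bounded_measurable] S_scale elim: eventually_mono)
 qed
 hence R2: "convex R" and R3: "(0, 0) : R" using subspace_imp_convex[of R] subspace_0[of R] by (auto simp: zero_prod_def)
 have Rabs: "EX t>0. EX w. (t *\<^sub>R \<xi>, w) : R" if "\<xi> : bounded_measurable M" for \<xi>
  using that mult[OF that] by (intro exI[of _ 1] conjI exI[of _ "%h. \<xi> h *\<^sub>R x h"]) (auto simp: R_def)
 have Rcl: "(\<xi>, w) : R"
  if s: "!!n. (s n, u n) : R" and \<xi>: "\<xi> : bounded_measurable M" "w : S"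
   and lim: "(%n. sup_norm (s n - \<xi>)) \<longlonglongrightarrow> 0" "(%n. q (u n - w)) \<longlonglongrightarrow> 0"
  for s u \<xi> w
 proof -
  have sS: "s n : bounded_measurable M" "u n : S" and su: "AE h in M. u n h = s n h *\<^sub>R x h" for n
   using s[of n] unfolding R_def by auto
  have ptw: "(%n. s n h) \<longlonglongrightarrow> \<xi> h" for h
  proof -
   have "\<bar>s n h - \<xi> h\<bar> <= sup_norm (s n - \<xi>)" for n
    using le_sup_norm[OF subspace_diff[OF subspace_bounded_measurable sS(1) \<xi>(1)], of n h] by simp
   hence "(%n. s n h - \<xi> h) \<longlonglongrightarrow> 0"
    by (intro Lim_null_comparison[OF always_eventually lim(1)]) auto
   thus ?thesis by (simp add: LIM_zero_iff)
  qed
  obtain r where r: "strict_mono r" "AE h in M. (%n. u (r n) h) \<longlonglongrightarrow> w h" by (rule AE_subseq[OF sS(2) \<xi>(2) lim(2)])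
  have "AE h in M. ALL n. u n h = s n h *\<^sub>R x h" using su by (simp add: AE_all_countable)
  hence "AE h in M. w h = \<xi> h *\<^sub>R x h" using r(2)
  proof eventually_elim
   case (elim h)
   have "(%n. s (r n) h *\<^sub>R x h) \<longlonglongrightarrow> \<xi> h *\<^sub>R x h"
    using LIMSEQ_subseq_LIMSEQ[OF ptw r(1)] by (intro tendsto_scaleR tendsto_const) (simp add: o_def)
   thus ?case using elim LIMSEQ_unique by auto
  qed
  thus ?thesis unfolding R_def using \<xi> by simp
 qed
 have "EX \<delta>>0. ALL x:bounded_measurable M. sup_norm x < \<delta> --> (EX w. (x, w) : R & q w < \<eta>)"
  by (rule Robinson_Ursescu_ex[OF fspace_bounded_measurable[of M] S_fspace R1 R2 R3 _ _ \<eta>(1)]) (erule Rabs, rule Rcl)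
 then obtain \<delta> where \<delta>: "\<delta> > 0" "!!\<xi>. \<xi> : bounded_measurable M ==> sup_norm \<xi> < \<delta> ==> EX w. (\<xi>, w) : R & q w < \<eta>"
  by blast
 show ?thesis
 proof (rule that)
  fix A assume A: "A : sets M"
  \<comment> \<open>Half of \<open>\<delta>\<close> keeps the multiplier strictly inside the ball;
    dividing it out again gives the bound \<open>2/\<delta>\<close>.\<close>
  define \<xi> where "\<xi> h = (\<delta>/2) * indicator A h" for h
  have \<xi>: "\<xi> : bounded_measurable M" unfolding bounded_measurable_def \<xi>_def using A \<delta>(1)
   by (auto intro!: exI[of _ "\<delta>/2"] simp: indicator_def)
  have "sup_norm \<xi> <= \<delta>/2" by (rule sup_norm_le) (use \<delta>(1) in \<open>auto simp: \<xi>_def indicator_def\<close>)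
  then obtain w where w: "w : S" "q w < \<eta>" "AE h in M. w h = \<xi> h *\<^sub>R x h"
   using \<delta>(2)[OF \<xi>] \<delta>(1) unfolding R_def by auto
  have eq: "(%h. \<xi> h *\<^sub>R x h) = (\<delta>/2) *\<^sub>R (%h. indicator A h *\<^sub>R x h)" by (auto simp: \<xi>_def)
  have "\<bar>l w\<bar> <= 1" using \<eta> w by blast
  moreover have "l w = l (%h. \<xi> h *\<^sub>R x h)" by (rule functional_AE_eq[OF l w(1) mult[OF \<xi>] w(3)])
  ultimately have "\<delta>/2 * \<bar>l (%h. indicator A h *\<^sub>R x h)\<bar> <= 1"
   unfolding eq linear_functional_onD(2)[OF lin S_cut[OF x A]] using \<delta>(1) by (simp add: abs_mult)
  thus "\<bar>l (%h. indicator A h *\<^sub>R x h)\<bar> <= 2/\<delta>" using \<delta>(1) by (simp add: field_simps)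
 qed
qed

text \<open>Almost maximizing the additive set function \<open>A \<mapsto> l (1\<^sub>A x)\<close> yields an approximate Hahn
  decomposition; off the exceptional sets of its two parts, \<open>l\<close> is small on all sets.\<close>

lemma singular_exhaust:
 assumes l: "continuous_functional S q l" "singular_on M S l" and x: "x : S" and e: "e > 0" "\<rho> > 0"
 obtains D where "D : sets M" "measure M D < \<rho>"
  "!!E. E : sets M ==> E \<inter> D = {} ==> \<bar>l (%w. indicator E w *\<^sub>R x w)\<bar> <= e"
proof -
 have lin: "linear_functional_on S l" using l unfolding continuous_functional_def by blast
 define m where "m A = l (%w. indicator A w *\<^sub>R x w)" for A
 have mun: "m (A \<union> B) = m A + m B" if "A : sets M" "B : sets M" "A \<inter> B = {}" for A B
 proof -
  have "(%w. indicator (A \<union> B) w *\<^sub>R x w) = (%w. indicator A w *\<^sub>R x w) + (%w. indicator B w *\<^sub>R x w)"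
   using that(3) by (auto simp: indicator_def fun_eq_iff)
  thus ?thesis unfolding m_def using linear_functional_onD(1)[OF lin] S_cut[OF x] that by simp
 qed
 obtain c where "!!A. A : sets M ==> \<bar>l (%w. indicator A w *\<^sub>R x w)\<bar> <= c"
  by (rule functional_cut_bounded[OF l(1) x]) blast
 hence c: "\<bar>m A\<bar> <= c" if "A : sets M" for A unfolding m_def using that by blast
 \<comment> \<open>Singularity is applied to the vector already cut to \<open>A\<close>, so that
   \<open>m\<close> vanishes on \<open>A\<close> up to a set of small probability.\<close>
 have sing: "EX B. B : sets M & measure M B < \<rho>/2 & m (A - B) = 0" if A: "A : sets M" for A
 proof -
  obtain B :: "nat => 'a set" where B: "range B <= sets M" "(%n. measure M (B n)) \<longlonglongrightarrow> 0"
   "!!n. l (%w. indicator (space M - B n) w *\<^sub>R (indicator A w *\<^sub>R x w)) = 0"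
   using l(2)[unfolded singular_on_def, THEN bspec, OF S_cut[OF x A]] by blast
  have "\<forall>\<^sub>F n in sequentially. measure M (B n) < \<rho>/2" by (rule order_tendstoD(2)[OF B(2)]) (use e in simp)
  then obtain n where n: "measure M (B n) < \<rho>/2" unfolding eventually_sequentially by blast
  have "(%w. indicator (space M - B n) w *\<^sub>R (indicator A w *\<^sub>R x w)) = (%w. indicator (A - B n) w *\<^sub>R x w)"
   using sets.sets_into_space[OF A] by (auto simp: indicator_def fun_eq_iff)
  hence "m (A - B n) = 0" using B(3)[of n] unfolding m_def by simp
  thus ?thesis using n B(1) by blast
 qed
 define s where "s = (SUP A\<in>sets M. m A)"
 have bdd: "bdd_above (m ` sets M)" using c by (intro bdd_aboveI[of _ c]) (auto simp: abs_le_iff)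
 have "EX A:sets M. s - e/2 < m A"
 proof (rule ccontr)
  assume "~ ?thesis"
  hence "s <= s - e/2" unfolding s_def by (intro cSUP_least) (auto simp: not_less)
  thus False using e by simp
 qed
 then obtain A where A: "A : sets M" "s - e/2 < m A" by blast
 have ms: "m E <= s" if "E : sets M" for E unfolding s_def using that bdd by (rule cSUP_upper)
 \<comment> \<open>Removing a part from the near maximizer \<open>A\<close> cannot gain more than
   \<open>e/2\<close>; in \<open>up\<close>, neither can adding a disjoint set.\<close>
 have low: "- e/2 <= m E" if "E : sets M" "E <= A" for E
 proof -
  have "m A = m E + m (A - E)" using mun[of E "A - E"] that A by (simp add: Un_absorb1)
  thus ?thesis using ms[of "A - E"] A that by auto
 qed
 have up: "m E <= e/2" if "E : sets M" "E \<inter> A = {}" for E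
  using mun[of E A] ms[of "E \<union> A"] that A by auto
 obtain B1 where B1: "B1 : sets M" "measure M B1 < \<rho>/2" "m (A - B1) = 0" using sing[OF A(1)] by blast
 obtain B2 where B2: "B2 : sets M" "measure M B2 < \<rho>/2" "m ((space M - A) - B2) = 0"
  using sing[of "space M - A"] A(1) by blast
 show ?thesis
 proof (rule that[of "B1 \<union> B2"])
  show "B1 \<union> B2 : sets M" using B1 B2 by blast
  show "measure M (B1 \<union> B2) < \<rho>" using measure_Un_le[OF B1(1) B2(1)] B1 B2 by simp
  fix E assume E: "E : sets M" "E \<inter> (B1 \<union> B2) = {}"
  have EM: "E <= space M" using sets.sets_into_space[OF E(1)] .
  let ?P = "E \<inter> A" and ?N = "E - A"
  \<comment> \<open>\<open>m\<close> vanishes on \<open>A - B1\<close>, so the part of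
    \<open>E\<close> inside \<open>A\<close> is balanced by the rest of \<open>A - B1\<close>, whose
    value is at least \<open>- e/2\<close>.\<close>
  have "?P \<union> ((A - B1) - ?P) = A - B1" using E(2) by blast
  hence "m (A - B1) = m ?P + m ((A - B1) - ?P)"
   using mun[of ?P "(A - B1) - ?P"] E A B1 by auto
  moreover have "- e/2 <= m ((A - B1) - ?P)" by (rule low) (use A B1 E in blast)+
  ultimately have P1: "m ?P <= e/2" using B1(3) by linarith
  have P2: "- e/2 <= m ?P" by (rule low) (use A E in blast)+
  have "m ((space M - A) - B2) = m ?N + m (((space M - A) - B2) - ?N)"
  proof -
   have "?N \<union> (((space M - A) - B2) - ?N) = (space M - A) - B2" using E EM by blast
   thus ?thesis using mun[of ?N "((space M - A) - B2) - ?N"] E A B2 by auto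
  qed
  moreover have "m (((space M - A) - B2) - ?N) <= e/2" by (rule up) (use A B2 E in auto)
  ultimately have N1: "- e/2 <= m ?N" using B2(3) by linarith
  have N2: "m ?N <= e/2" by (rule up) (use A E in auto)
  have "?P \<union> ?N = E" by blast
  hence "m E = m ?P + m ?N" using mun[of ?P ?N] A E by auto
  thus "\<bar>l (%w. indicator E w *\<^sub>R x w)\<bar> <= e" unfolding m_def[symmetric] using P1 P2 N1 N2 by linarith
 qed
qed

end

text \<open>Closed graph theorem in which closedness is tested in L1, where both spaces embed
  continuously. \<open>J\<close> is linear up to null sets only, so the graph contains all versions
  of \<open>J x\<close>.\<close>

lemma operator_continuous:
 fixes J :: "('a => real^'n) => ('a => real^'k)"
 assumes S: "rv_space M S S' q" and S2: "rv_space M S2 S2' q2"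
  and J: "!!x. x : S ==> J x : S2"
  and add: "!!x y. x : S ==> y : S ==> AE h in M. J (x + y) h = J x h + J y h"
  and scale: "!!c x. x : S ==> AE h in M. J (c *\<^sub>R x) h = c *\<^sub>R J x h"
  and close: "!!s x w. (!!n::nat. s n : S) ==> x : S ==> w : S2 ==>
   (%n. \<integral>h. norm (s n h - x h) \<partial>M) \<longlonglongrightarrow> 0 ==> (%n. \<integral>h. norm (J (s n) h - w h) \<partial>M) \<longlonglongrightarrow> 0 ==>
   AE h in M. w h = J x h"
  and s: "!!n::nat. s n : S" "(%n. q (s n)) \<longlonglongrightarrow> 0"
 shows "(%n. q2 (J (s n))) \<longlonglongrightarrow> 0"
proof (rule q_tendsto_0I[OF rv_space.S_fspace[OF S2]])
 interpret S: rv_space M S S' q by fact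
 interpret S2: rv_space M S2 S2' q2 by fact
 show "J (s n) : S2" for n using J s by blast
 fix e :: real assume e: "e > 0"
 define R where "R = {(x, w). x : S & w : S2 & (AE h in M. w h = J x h)}"
 have R1: "R <= S \<times> S2" unfolding R_def by auto
 have "subspace R"
 proof (rule subspaceI)
  have "AE h in M. J 0 h = 0" using scale[OF S.S_zero, of 0] by simp
  thus "0 : R" unfolding R_def zero_prod_def using S.S_zero S2.S_zero by auto
 next
  fix z w assume zw: "z : R" "w : R"
  obtain x u y v where [simp]: "z = (x, u)" "w = (y, v)" by (metis surj_pair)
  have xy: "x : S" "y : S" "u : S2" "v : S2" "AE h in M. u h = J x h" "AE h in M. v h = J y h"
   using zw unfolding R_def by auto
  have "AE h in M. (u + v) h = J (x + y) h" using xy(5,6) add[OF xy(1,2)] by eventually_elim simp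
  thus "z + w : R" unfolding R_def using xy S.S_add S2.S_add by auto
 next
  fix c z assume z: "z : R"
  obtain x u where [simp]: "z = (x, u)" by (metis surj_pair)
  have xy: "x : S" "u : S2" "AE h in M. u h = J x h" using z unfolding R_def by auto
  have "AE h in M. (c *\<^sub>R u) h = J (c *\<^sub>R x) h" using xy(3) scale[OF xy(1), of c] by eventually_elim simp
  thus "c *\<^sub>R z : R" unfolding R_def using xy S.S_scale S2.S_scale by auto
 qed
 hence R2: "convex R" and R3: "(0, 0) : R" using subspace_imp_convex[of R] subspace_0[of R] by (auto simp: zero_prod_def)
 have Rabs: "EX t>0. EX w. (t *\<^sub>R x, w) : R" if "x : S" for x
  using that J[OF that] by (intro exI[of _ 1] conjI exI[of _ "J x"]) (auto simp: R_def)
 have Rcl: "(x, w) : R"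
  if s: "!!n. (s n, u n) : R" and x: "x : S" "w : S2"
   and lim: "(%n. q (s n - x)) \<longlonglongrightarrow> 0" "(%n. q2 (u n - w)) \<longlonglongrightarrow> 0"
  for s u x w
 proof -
  have sS: "s n : S" "u n : S2" and su: "AE h in M. u n h = J (s n) h" for n
   using s[of n] unfolding R_def by auto
  have [measurable]: "u n : borel_measurable M" "J (s n) : borel_measurable M" "w : borel_measurable M" for n
   using sS x J S2.S_measurable by auto
  have "(LINT h|M. norm (J (s n) h - w h)) = (LINT h|M. norm (u n h - w h))" for n
   using su[of n] by (intro integral_cong_AE) (auto elim: eventually_mono)
  hence "(%n. \<integral>h. norm (J (s n) h - w h) \<partial>M) \<longlonglongrightarrow> 0" using S2.L1_tendsto[OF sS(2) x(2) lim(2)] by simp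
  from close[OF sS(1) x S.L1_tendsto[OF sS(1) x(1) lim(1)] this] show ?thesis unfolding R_def using x by simp
 qed
 have "EX \<delta>>0. ALL x:S. q x < \<delta> --> (EX w. (x, w) : R & q2 w < e)"
  by (rule Robinson_Ursescu_ex[OF S.S_fspace S2.S_fspace R1 R2 R3 _ _ e]) (erule Rabs, rule Rcl)
 then obtain \<delta> where \<delta>: "\<delta> > 0" "!!x. x : S ==> q x < \<delta> ==> EX w. (x, w) : R & q2 w < e"
  by blast
 obtain k where k: "!!n. n >= k ==> q (s n) < \<delta>" using q_tendsto_0D[OF S.S_fspace, OF s(2) \<delta>(1)] by blast
 have "q2 (J (s n)) < e" if "n >= k" for n
 proof -
  obtain w where w: "(s n, w) : R" "q2 w < e" using \<delta>(2)[OF s(1) k[OF \<open>n >= k\<close>]] by blast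
  hence "q2 w = q2 (J (s n))" using J s(1) unfolding R_def by (intro S2.q_AE_eq) auto
  thus ?thesis using w by simp
 qed
 thus "EX k. ALL n>=k. q2 (J (s n)) < e" by blast
qed

text \<open>\<open>J\<close> respects sums and multiples only up to null sets, which continuous
  functionals do not see.\<close>

lemma functional_compose:
 fixes J :: "('a => real^'n) => ('a => real^'k)"
 assumes S: "rv_space M S S' q" and S2: "rv_space M S2 S2' q2"
  and J: "!!x. x : S ==> J x : S2"
  and add: "!!x y. x : S ==> y : S ==> AE w in M. J (x + y) w = J x w + J y w"
  and scale: "!!c x. x : S ==> AE w in M. J (c *\<^sub>R x) w = c *\<^sub>R J x w"
  and cont: "!!s. (!!n::nat. s n : S) ==> (%n. q (s n)) \<longlonglongrightarrow> 0 ==> (%n. q2 (J (s n))) \<longlonglongrightarrow> 0"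
  and l: "continuous_functional S2 q2 l"
 shows "continuous_functional S q (%x. l (J x))"
proof (rule continuous_functionalI[OF rv_space.S_fspace[OF S]])
 interpret S: rv_space M S S' q by fact
 interpret S2: rv_space M S2 S2' q2 by fact
 have lin: "linear_functional_on S2 l" using l unfolding continuous_functional_def by blast
 show "linear_functional_on S (%x. l (J x))"
  unfolding linear_functional_on_def
 proof (intro conjI ballI allI)
  fix x y assume xy: "x : S" "y : S"
  have "l (J (x + y)) = l (J x + J y)"
   using add[OF xy] J xy S.S_add S2.S_add by (intro S2.functional_AE_eq[OF l]) auto
  thus "l (J (x + y)) = l (J x) + l (J y)" using linear_functional_onD(1)[OF lin] J xy by simp
 next
  fix c x assume x: "x : S"
  have "l (J (c *\<^sub>R x)) = l (c *\<^sub>R J x)"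
   using scale[OF x] J x S.S_scale S2.S_scale by (intro S2.functional_AE_eq[OF l]) auto
  thus "l (J (c *\<^sub>R x)) = c * l (J x)" using linear_functional_onD(2)[OF lin] J x by simp
 qed
 fix s assume s: "!!n::nat. s n : S" "(%n. q (s n)) \<longlonglongrightarrow> 0"
 show "(%n. l (J (s n))) \<longlonglongrightarrow> 0"
  by (rule continuous_functional_tendsto_0[OF S2.S_fspace l, OF J[OF s(1)] cont[OF s]])
qed

text \<open>Split \<open>l\<close> into pairing with \<open>v\<close> and a singular
  \<open>\<sigma>\<close>. On bounded vectors \<open>\<sigma>\<close> is integration against
  \<open>u = w - v\<close>; testing with \<open>sgn u\<close> off the exceptional sets gives
  \<open>0\<close>, and dominated convergence forces \<open>u = 0\<close>. This is how adjoint
  operators are seen to map into the dual space.\<close>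

lemma (in rv_space) representing_function_mem:
 assumes l: "continuous_functional S q l" and w: "integrable M w"
  and eq: "!!x c. x : borel_measurable M ==> (!!h. norm (x h) <= c) ==> l x = (LINT h|M. x h \<bullet> w h)"
 shows "w : S'"
proof -
 obtain v \<sigma> where v: "v : S'" and \<sigma>: "continuous_functional S q \<sigma>" "singular_on M S \<sigma>"
  "!!x. x : S ==> l x = (LINT h|M. x h \<bullet> v h) + \<sigma> x" using dual_split[OF l] by blast
 define u where "u h = w h - v h" for h
 have vint: "integrable M v" by (rule S'_integrable[OF v])
 have uint: "integrable M u" unfolding u_def using w vint by simp
 have [measurable]: "u : borel_measurable M" "w : borel_measurable M" "v : borel_measurable M" using uint w vint by auto
 have bint: "integrable M (%h. x h \<bullet> f h)"
  if [measurable]: "x : borel_measurable M" and c: "!!h. norm (x h) <= c" and f: "integrable M f" for x f :: "'a => real^'n" and c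
 proof (rule Bochner_Integration.integrable_bound[of M "%h. c * norm (f h)"])
  have [measurable]: "f : borel_measurable M" using f by auto
  show "integrable M (%h. c * norm (f h))" using f by simp
  show "(%h. x h \<bullet> f h) : borel_measurable M" by measurable
  show "AE h in M. norm (x h \<bullet> f h) <= norm (c * norm (f h))"
  proof (rule AE_I2)
   fix h
   have "norm (x h \<bullet> f h) <= norm (x h) * norm (f h)" using Cauchy_Schwarz_ineq2 by simp
   also have "\<dots> <= c * norm (f h)" using c by (intro mult_right_mono) auto
   finally show "norm (x h \<bullet> f h) <= norm (c * norm (f h))" by simp
  qed
 qed
 have su: "\<sigma> x = (LINT h|M. x h \<bullet> u h)" if x: "x : borel_measurable M" "!!h. norm (x h) <= c" for x c
  using eq[OF x] \<sigma>(3)[OF S_bounded[OF x]] bint[OF x w] bint[OF x vint] unfolding u_def inner_diff_right by simp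
 define x where "x h = sgn (u h)" for h
 have xm [measurable]: "x : borel_measurable M" unfolding x_def sgn_div_norm by measurable
 have nx: "norm (x h) <= 1" for h unfolding x_def by (simp add: norm_sgn)
 obtain B :: "nat => 'a set" where B: "range B <= sets M" "decseq B" "(%n. measure M (B n)) \<longlonglongrightarrow> 0"
   "!!n. \<sigma> (%h. indicator (space M - B n) h *\<^sub>R x h) = 0"
  using \<sigma>(2)[unfolded singular_on_def, THEN bspec, OF S_bounded[OF xm nx]] by blast
 have [measurable]: "B n : sets M" for n using B(1) by auto
 have zero: "(LINT h|M. (indicator (space M - B n) h *\<^sub>R x h) \<bullet> u h) = 0" for n
 proof -
  have "norm (indicator (space M - B n) h *\<^sub>R x h) <= 1" for h using nx[of h] by (simp add: indicator_def)
  from su[of "%h. indicator (space M - B n) h *\<^sub>R x h", OF _ this] B(4)[of n] show ?thesis by simp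
 qed
 have "(%n. \<integral>h. (indicator (space M - B n) h *\<^sub>R x h) \<bullet> u h \<partial>M) \<longlonglongrightarrow> (LINT h|M. x h \<bullet> u h)"
 proof (rule integral_dominated_convergence[where w="%h. norm (x h \<bullet> u h)"])
  show "integrable M (%h. norm (x h \<bullet> u h))" using bint[OF xm nx uint] by simp
  show "AE h in M. (%n. (indicator (space M - B n) h *\<^sub>R x h) \<bullet> u h) \<longlonglongrightarrow> x h \<bullet> u h"
   using AE_eventually_notin_decseq[OF B(1-3)] AE_space
  proof eventually_elim
   case (elim h)
   then obtain k where "ALL n>=k. h ~: B n" by blast
   hence "\<forall>\<^sub>F n in sequentially. (indicator (space M - B n) h *\<^sub>R x h) \<bullet> u h = x h \<bullet> u h"
    unfolding eventually_sequentially using elim(2) by (intro exI[of _ k]) auto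
   thus ?case by (rule tendsto_eventually)
  qed
  show "AE h in M. norm ((indicator (space M - B n) h *\<^sub>R x h) \<bullet> u h) <= norm (x h \<bullet> u h)" for n
   by (rule AE_I2) (simp add: indicator_def)
 qed auto
 hence "(LINT h|M. x h \<bullet> u h) = 0" unfolding zero by (simp add: LIMSEQ_const_iff)
 moreover have "x h \<bullet> u h = norm (u h)" for h
  unfolding x_def inner_commute[of "sgn _"] by (rule inner_sgn_self)
 ultimately have "(LINT h|M. norm (u h)) = 0" by simp
 hence "AE h in M. u h = 0" using uint by (subst (asm) integral_nonneg_eq_0_iff_AE) auto
 hence "AE h in M. w h = v h" unfolding u_def by eventually_elim simp
 thus ?thesis by (rule solid_AE_eq[OF S'_space v, rotated]) measurable
qed

section \<open>Conditional expectations of random vectors\<close>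

lemma AE_eq_componentwise:
 fixes x y :: "'a => 'b::euclidean_space"
 assumes "!!b. b : Basis ==> AE w in M. x w \<bullet> b = y w \<bullet> b"
 shows "AE w in M. x w = y w"
proof -
 have "AE w in M. ALL b:Basis. x w \<bullet> b = y w \<bullet> b" using assms by (intro AE_finite_allI) auto
 thus ?thesis by eventually_elim (simp add: euclidean_eq_iff[of "x _"])
qed

lemma integrable_inner_bounded:
 fixes x f :: "'a => 'b::euclidean_space"
 assumes [measurable]: "x : borel_measurable M" and c: "!!w. norm (x w) <= c" and f: "integrable M f"
 shows "integrable M (%w. x w \<bullet> f w)"
proof (rule Bochner_Integration.integrable_bound[of M "%w. c * norm (f w)"])
 have [measurable]: "f : borel_measurable M" using f by auto
 show "integrable M (%w. c * norm (f w))" using f by simp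
 show "(%w. x w \<bullet> f w) : borel_measurable M" by measurable
 show "AE w in M. norm (x w \<bullet> f w) <= norm (c * norm (f w))"
 proof (rule AE_I2)
  fix w
  have "norm (x w \<bullet> f w) <= norm (x w) * norm (f w)" using Cauchy_Schwarz_ineq2 by simp
  also have "\<dots> <= c * norm (f w)" using c by (intro mult_right_mono) auto
  finally show "norm (x w \<bullet> f w) <= norm (c * norm (f w))" by simp
 qed
qed

locale prob_subalgebra = prob_space M for M :: "'a measure" +
 fixes G :: "'a measure"
 assumes subalgebra_G: "subalgebra M G"

sublocale prob_subalgebra \<subseteq> finite_measure_subalgebra M G
  by unfold_locales (rule subalgebra_G)

context prob_subalgebra
begin

lemma cond_exp_inner: "b : Basis ==> cond_exp M G x w \<bullet> b = real_cond_exp M G (%w. x w \<bullet> b) w"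
 unfolding cond_exp_def by simp

lemma cond_exp_measurable: "cond_exp M G x : borel_measurable G"
 unfolding cond_exp_def by (intro borel_measurable_sum borel_measurable_scaleR borel_measurable_cond_exp) auto

lemma measurable_G: "f : borel_measurable G ==> f : borel_measurable M"
 by (rule measurable_from_subalg[OF subalgebra_G])

lemma cond_exp_integrable: "integrable M x ==> integrable M (cond_exp M G x)"
 by (rule integrable_componentwise) (auto simp: cond_exp_inner intro!: real_cond_exp_int(1))

lemma cond_exp_add:
 assumes "integrable M x" "integrable M y"
 shows "AE w in M. cond_exp M G (x + y) w = cond_exp M G x w + cond_exp M G y w"
proof (rule AE_eq_componentwise)
 fix b :: 'b assume b: "b : Basis"
 show "AE w in M. cond_exp M G (x + y) w \<bullet> b = (cond_exp M G x w + cond_exp M G y w) \<bullet> b"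
  using real_cond_exp_add[of "%w. x w \<bullet> b" "%w. y w \<bullet> b"] assms b
  by (simp add: cond_exp_inner inner_add_left)
qed

lemma cond_exp_scaleR:
 assumes "integrable M x"
 shows "AE w in M. cond_exp M G (c *\<^sub>R x) w = c *\<^sub>R cond_exp M G x w"
proof (rule AE_eq_componentwise)
 fix b :: 'b assume b: "b : Basis"
 show "AE w in M. cond_exp M G (c *\<^sub>R x) w \<bullet> b = (c *\<^sub>R cond_exp M G x w) \<bullet> b"
  using real_cond_exp_cmult[of "%w. x w \<bullet> b" c] assms b
  by (simp add: cond_exp_inner)
qed

lemma cond_exp_diff:
 assumes "integrable M x" "integrable M y"
 shows "AE w in M. cond_exp M G (x - y) w = cond_exp M G x w - cond_exp M G y w"
proof (rule AE_eq_componentwise)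
 fix b :: 'b assume b: "b : Basis"
 show "AE w in M. cond_exp M G (x - y) w \<bullet> b = (cond_exp M G x w - cond_exp M G y w) \<bullet> b"
  using real_cond_exp_diff[of "%w. x w \<bullet> b" "%w. y w \<bullet> b"] assms b
  by (simp add: cond_exp_inner inner_diff_left)
qed

lemma cond_exp_ident:
 assumes "integrable M x" "x : borel_measurable G"
 shows "AE w in M. cond_exp M G x w = x w"
proof (rule AE_eq_componentwise)
 fix b :: 'b assume b: "b : Basis"
 have "(%w. x w \<bullet> b) : borel_measurable G" using assms(2) by (intro borel_measurable_inner) auto
 thus "AE w in M. cond_exp M G x w \<bullet> b = x w \<bullet> b"
  using real_cond_exp_F_meas[of "%w. x w \<bullet> b"] assms b by (simp add: cond_exp_inner)
qed

lemma integral_abs_real_cond_exp_le: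
 fixes f :: "'a => real"
 assumes f: "integrable M f"
 shows "(LINT w|M. \<bar>real_cond_exp M G f w\<bar>) <= (LINT w|M. \<bar>f w\<bar>)"
proof -
 have a: "integrable M (%w. \<bar>f w\<bar>)" "integrable M (%w. - \<bar>f w\<bar>)" using f by auto
 have "AE w in M. real_cond_exp M G f w <= real_cond_exp M G (%w. \<bar>f w\<bar>) w"
  by (rule real_cond_exp_mono) (use f a in auto)
 moreover have "AE w in M. real_cond_exp M G (%w. (-1) * \<bar>f w\<bar>) w <= real_cond_exp M G f w"
  by (rule real_cond_exp_mono) (use f a in auto)
 moreover have "AE w in M. real_cond_exp M G (%w. (-1) * \<bar>f w\<bar>) w = (-1) * real_cond_exp M G (%w. \<bar>f w\<bar>) w"
  by (rule real_cond_exp_cmult) (rule a)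
 ultimately have "AE w in M. \<bar>real_cond_exp M G f w\<bar> <= real_cond_exp M G (%w. \<bar>f w\<bar>) w"
  by eventually_elim auto
 hence "(LINT w|M. \<bar>real_cond_exp M G f w\<bar>) <= (LINT w|M. real_cond_exp M G (%w. \<bar>f w\<bar>) w)"
  using real_cond_exp_int(1)[OF f] real_cond_exp_int(1)[OF a(1)] by (intro integral_mono_AE) auto
 thus ?thesis by (simp add: real_cond_exp_int(2)[OF a(1)])
qed

lemma integral_norm_cond_exp_le:
 fixes x :: "'a => 'b::euclidean_space"
 assumes x: "integrable M x"
 shows "(LINT w|M. norm (cond_exp M G x w)) <= real DIM('b) * (LINT w|M. norm (x w))"
proof -
 have comp: "integrable M (%w. x w \<bullet> b)" for b using x by simp
 have compE: "integrable M (%w. cond_exp M G x w \<bullet> b)" for b using cond_exp_integrable[OF x] by simp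
 have "(LINT w|M. norm (cond_exp M G x w)) <= (LINT w|M. (SUM b:Basis. \<bar>cond_exp M G x w \<bullet> b\<bar>))"
  using cond_exp_integrable[OF x] compE by (intro integral_mono Bochner_Integration.integrable_sum norm_le_l1) auto
 also have "\<dots> = (SUM b:Basis. \<integral>w. \<bar>cond_exp M G x w \<bullet> b\<bar> \<partial>M)"
  using compE by (intro Bochner_Integration.integral_sum) auto
 also have "\<dots> <= (SUM b:(Basis :: 'b set). \<integral>w. norm (x w) \<partial>M)"
 proof (rule sum_mono)
  fix b :: 'b assume b: "b : Basis"
  have "(LINT w|M. \<bar>cond_exp M G x w \<bullet> b\<bar>) <= (LINT w|M. \<bar>x w \<bullet> b\<bar>)"
   unfolding cond_exp_inner[OF b] by (rule integral_abs_real_cond_exp_le[OF comp])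
  also have "\<dots> <= (LINT w|M. norm (x w))"
   using comp x b by (intro integral_mono Basis_le_norm) auto
  finally show "(LINT w|M. \<bar>cond_exp M G x w \<bullet> b\<bar>) <= (LINT w|M. norm (x w))" .
 qed
 also have "\<dots> = real DIM('b) * (LINT w|M. norm (x w))" by simp
 finally show ?thesis .
qed

lemma cond_exp_integral_inner:
 fixes f x :: "'a => 'b::euclidean_space"
 assumes f: "f : borel_measurable G" and x: "x : borel_measurable M"
  and int: "!!b. b : Basis ==> integrable M (%w. (f w \<bullet> b) * (x w \<bullet> b))"
 shows "(LINT w|M. f w \<bullet> cond_exp M G x w) = (LINT w|M. f w \<bullet> x w)"
proof -
 have fb: "(%w. f w \<bullet> b) : borel_measurable G" and xb: "(%w. x w \<bullet> b) : borel_measurable M" for b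
  using f x by (auto intro!: borel_measurable_inner)
 have "(LINT w|M. f w \<bullet> cond_exp M G x w) = (LINT w|M. (SUM b:Basis. (f w \<bullet> b) * (cond_exp M G x w \<bullet> b)))"
  by (intro Bochner_Integration.integral_cong refl) (rule euclidean_inner)
 also have "\<dots> = (LINT w|M. (SUM b:Basis. (f w \<bullet> b) * real_cond_exp M G (%w. x w \<bullet> b) w))"
  by (intro Bochner_Integration.integral_cong sum.cong refl) (simp add: cond_exp_inner)
 also have "\<dots> = (SUM b:Basis. \<integral>w. (f w \<bullet> b) * real_cond_exp M G (%w. x w \<bullet> b) w \<partial>M)"
  by (intro Bochner_Integration.integral_sum real_cond_exp_intg(1) int fb xb)
 also have "\<dots> = (SUM b:Basis. \<integral>w. (f w \<bullet> b) * (x w \<bullet> b) \<partial>M)"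
  by (intro sum.cong refl real_cond_exp_intg(2) int fb xb)
 also have "\<dots> = (LINT w|M. (SUM b:Basis. (f w \<bullet> b) * (x w \<bullet> b)))"
  by (intro Bochner_Integration.integral_sum[symmetric] int)
 also have "\<dots> = (LINT w|M. f w \<bullet> x w)"
  by (intro Bochner_Integration.integral_cong refl) (rule euclidean_inner[symmetric])
 finally show ?thesis .
qed

lemma integrable_bounded_components:
 fixes f x :: "'a => 'b::euclidean_space"
 assumes f: "f : borel_measurable M" "!!w. norm (f w) <= c" and x: "integrable M x" and b: "b : Basis"
 shows "integrable M (%w. (f w \<bullet> b) * (x w \<bullet> b))"
proof -
 have "integrable M (%w. (f w \<bullet> b) \<bullet> (x w \<bullet> b))"
 proof (rule integrable_inner_bounded[where c=c])
  show "(%w. f w \<bullet> b) : borel_measurable M" using f(1) by (intro borel_measurable_inner) auto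
  show "norm (f w \<bullet> b) <= c" for w using Basis_le_norm[OF b, of "f w"] f(2)[of w] by simp
  show "integrable M (%w. x w \<bullet> b)" using x by simp
 qed
 thus ?thesis by simp
qed

lemma cond_exp_integral_inner_bounded:
 fixes f x :: "'a => 'b::euclidean_space"
 assumes f: "f : borel_measurable G" "!!w. norm (f w) <= c" and x: "integrable M x"
 shows "(LINT w|M. f w \<bullet> cond_exp M G x w) = (LINT w|M. f w \<bullet> x w)"
 using x by (intro cond_exp_integral_inner f integrable_bounded_components[OF measurable_G[OF f(1)] f(2)]) auto

text \<open>Test vectors bounded by 1 suffice, because the difference can be tested against its own
  sign.\<close>

lemma cond_exp_charact:
 fixes u x :: "'a => 'b::euclidean_space"
 assumes u: "u : borel_measurable G" "integrable M u" and x: "integrable M x"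
  and eq: "!!f. f : borel_measurable G ==> (!!h. norm (f h) <= 1) ==>
   (LINT h|M. f h \<bullet> u h) = (LINT h|M. f h \<bullet> x h)"
 shows "AE h in M. u h = cond_exp M G x h"
proof -
 define w where "w h = u h - cond_exp M G x h" for h
 have w: "integrable M w" unfolding w_def using u cond_exp_integrable[OF x] by simp
 have wG [measurable]: "w : borel_measurable G" unfolding w_def using u(1) cond_exp_measurable[of x] by simp
 have fG: "(%h. sgn (w h)) : borel_measurable G" unfolding sgn_div_norm by measurable
 have nf: "norm (sgn (w h)) <= 1" for h by (simp add: norm_sgn)
 have "(LINT h|M. sgn (w h) \<bullet> w h) = (LINT h|M. sgn (w h) \<bullet> u h) - (LINT h|M. sgn (w h) \<bullet> cond_exp M G x h)"
  unfolding w_def inner_diff_right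
  using integrable_inner_bounded[OF measurable_G[OF fG] nf u(2)]
   integrable_inner_bounded[OF measurable_G[OF fG] nf cond_exp_integrable[OF x]]
  unfolding w_def by (rule Bochner_Integration.integral_diff)
 also have "\<dots> = 0" using eq[OF fG nf] cond_exp_integral_inner_bounded[OF fG nf x] by simp
 finally have "(LINT h|M. norm (w h)) = 0" by (simp add: inner_sgn_self inner_commute[of "sgn _"])
 hence "AE h in M. w h = 0" using w by (subst (asm) integral_nonneg_eq_0_iff_AE) auto
 thus ?thesis unfolding w_def by eventually_elim simp
qed

end

lemma cond_exp_fst: "fst (cond_exp M G x w) = cond_exp M G (%w. fst (x w)) w"
 and cond_exp_snd: "snd (cond_exp M G x w) = cond_exp M G (%w. snd (x w)) w"
 for x :: "'a => 'b::euclidean_space \<times> 'c::euclidean_space"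
proof -
 have inj: "inj_on (%u::'b. (u, 0::'c)) Basis" "inj_on (%v::'c. (0::'b, v)) Basis" by (auto simp: inj_on_def)
 have disj: "(%u::'b. (u, 0::'c)) ` Basis \<inter> (%v::'c. (0::'b, v)) ` Basis = {}" by auto
 have "cond_exp M G x w = (SUM b:Basis. real_cond_exp M G (%w. x w \<bullet> (b, 0)) w *\<^sub>R (b, 0)) +
   (SUM b:Basis. real_cond_exp M G (%w. x w \<bullet> (0, b)) w *\<^sub>R (0, b))"
  unfolding cond_exp_def Basis_prod_def
  by (subst sum.union_disjoint) (auto simp: sum.reindex[OF inj(1)] sum.reindex[OF inj(2)] disj)
 thus "fst (cond_exp M G x w) = cond_exp M G (%w. fst (x w)) w"
  and "snd (cond_exp M G x w) = cond_exp M G (%w. snd (x w)) w"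
  unfolding cond_exp_def by (simp_all add: fst_sum snd_sum inner_prod_def)
qed

section \<open>Conditional expectation as a continuous self-adjoint operator\<close>

context rv_space
begin

text \<open>Solidity allows all other components of \<open>x\<close> to be set to \<open>0\<close>.
  Conditional expectations act componentwise and need each product to be integrable on its
  own.\<close>

lemma component_integrable:
 assumes x: "x : S" and v: "v : S'" and b: "b : Basis"
 shows "integrable M (%w. (x w \<bullet> b) * (v w \<bullet> b))"
proof -
 obtain i where i: "b = axis i 1" using b unfolding Basis_vec_def by auto
 from pairing_integrable[OF solid_component[OF S_space x] v, of i] show ?thesis
  unfolding i by (simp add: inner_axis inner_axis')
qed

context
 fixes G :: "'a measure"
 assumes sub: "subalgebra M G" and ES: "cond_exp M G ` S <= S"
begin

interpretation G: prob_subalgebra M G by unfold_locales (rule sub)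

lemma cond_exp_mem: "x : S ==> cond_exp M G x : S"
 using ES by blast

lemma cond_exp_continuous:
 assumes "!!n::nat. s n : S" "(%n. q (s n)) \<longlonglongrightarrow> 0"
 shows "(%n. q (cond_exp M G (s n))) \<longlonglongrightarrow> 0"
proof (rule operator_continuous[OF rv_space_axioms rv_space_axioms cond_exp_mem _ _ _ assms])
 fix x y assume "x : S" "y : S"
 thus "AE h in M. cond_exp M G (x + y) h = cond_exp M G x h + cond_exp M G y h"
  by (intro G.cond_exp_add S_integrable)
next
 fix c x assume "x : S"
 thus "AE h in M. cond_exp M G (c *\<^sub>R x) h = c *\<^sub>R cond_exp M G x h"
  by (intro G.cond_exp_scaleR S_integrable)
next
 fix s :: "nat => 'a => real^'n" and x w
 assume s: "!!n. s n : S" and x: "x : S" and w: "w : S"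
  and l1: "(%n. \<integral>h. norm (s n h - x h) \<partial>M) \<longlonglongrightarrow> 0"
  and l2: "(%n. \<integral>h. norm (cond_exp M G (s n) h - w h) \<partial>M) \<longlonglongrightarrow> 0"
 let ?d = "real DIM(real^'n)"
 have int: "integrable M (s n)" "integrable M x" "integrable M w" "integrable M (s n - x)" for n
  using S_integrable[OF s] S_integrable[OF x] S_integrable[OF w] S_integrable[OF S_diff[OF s x]] by auto
 have intE: "integrable M (cond_exp M G (s n))" "integrable M (cond_exp M G x)" for n
  using int by (auto intro: G.cond_exp_integrable)
 \<comment> \<open>The L1 bound for conditional expectations, applied to \<open>s n - x\<close>,
   identifies the limit \<open>w\<close>.\<close>
 have le: "(LINT h|M. norm (w h - cond_exp M G x h)) <=
   (LINT h|M. norm (cond_exp M G (s n) h - w h)) + ?d * (LINT h|M. norm (s n h - x h))" for n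
 proof -
  have "(LINT h|M. norm (w h - cond_exp M G x h)) <=
   (LINT h|M. norm (cond_exp M G (s n) h - w h) + norm (cond_exp M G (s n - x) h))"
  proof (rule integral_mono_AE)
   show "integrable M (%h. norm (w h - cond_exp M G x h))" using int intE by simp
   show "integrable M (%h. norm (cond_exp M G (s n) h - w h) + norm (cond_exp M G (s n - x) h))"
    using int intE G.cond_exp_integrable[OF int(4)] by simp
   show "AE h in M. norm (w h - cond_exp M G x h) <= norm (cond_exp M G (s n) h - w h) + norm (cond_exp M G (s n - x) h)"
    using G.cond_exp_diff[OF int(1,2), of n]
   proof eventually_elim
    case (elim h)
    have eq: "w h - cond_exp M G x h = cond_exp M G (s n - x) h - (cond_exp M G (s n) h - w h)"
     using elim by simp
    show ?case unfolding eq using norm_triangle_ineq4[of "cond_exp M G (s n - x) h" "cond_exp M G (s n) h - w h"] by linarith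
   qed
  qed
  also have "\<dots> = (LINT h|M. norm (cond_exp M G (s n) h - w h)) + (LINT h|M. norm (cond_exp M G (s n - x) h))"
   using int intE G.cond_exp_integrable[OF int(4)] by (intro Bochner_Integration.integral_add) auto
  also have "(LINT h|M. norm (cond_exp M G (s n - x) h)) <= ?d * (LINT h|M. norm ((s n - x) h))"
   by (rule G.integral_norm_cond_exp_le[OF int(4)])
  finally show ?thesis by simp
 qed
 have "(%n. (LINT h|M. norm (cond_exp M G (s n) h - w h)) + ?d * (LINT h|M. norm (s n h - x h))) \<longlonglongrightarrow> 0 + ?d * 0"
  by (intro tendsto_add tendsto_mult_left l1 l2)
 hence "(LINT h|M. norm (w h - cond_exp M G x h)) <= 0 + ?d * 0"
  by (rule LIMSEQ_le_const) (use le in auto)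
 moreover have "0 <= (LINT h|M. norm (w h - cond_exp M G x h))" by (rule Bochner_Integration.integral_nonneg) simp
 ultimately have "(LINT h|M. norm (w h - cond_exp M G x h)) = 0" by simp
 hence "AE h in M. w h - cond_exp M G x h = 0" using int intE by (subst (asm) integral_nonneg_eq_0_iff_AE) auto
 thus "AE h in M. w h = cond_exp M G x h" by eventually_elim simp
qed

lemma functional_cond_exp:
 assumes "continuous_functional S q l"
 shows "continuous_functional S q (%x. l (cond_exp M G x))"
proof (rule functional_compose[OF rv_space_axioms rv_space_axioms cond_exp_mem _ _ cond_exp_continuous assms])
 fix x y assume "x : S" "y : S"
 thus "AE w in M. cond_exp M G (x + y) w = cond_exp M G x w + cond_exp M G y w"
  by (intro G.cond_exp_add S_integrable)
next
 fix c x assume "x : S"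
 thus "AE w in M. cond_exp M G (c *\<^sub>R x) w = c *\<^sub>R cond_exp M G x w"
  by (intro G.cond_exp_scaleR S_integrable)
qed

text \<open>Pairing \<open>cond_exp M G x\<close> with \<open>v\<close> is a continuous functional
  of \<open>x\<close>. For bounded \<open>x\<close> all products are integrable, and the conditional
  expectation can be moved to \<open>v\<close>, which gives the representing function.\<close>

lemma cond_exp_dual_mem:
 assumes v: "v : S'"
 shows "cond_exp M G v : S'"
proof (rule representing_function_mem[OF functional_cond_exp[OF pairing_continuous[OF v]]])
 have vi: "integrable M v" by (rule S'_integrable[OF v])
 show Ev: "integrable M (cond_exp M G v)" by (rule G.cond_exp_integrable[OF vi])
 fix x :: "'a => real^'n" and c assume x: "x : borel_measurable M" "!!w. norm (x w) <= c"
 have xS: "x : S" by (rule S_bounded[OF x])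
 have "(LINT w|M. cond_exp M G x w \<bullet> cond_exp M G v w) = (LINT w|M. cond_exp M G x w \<bullet> v w)"
  by (intro G.cond_exp_integral_inner G.cond_exp_measurable component_integrable cond_exp_mem xS v S'_measurable)
 moreover have "(LINT w|M. cond_exp M G v w \<bullet> cond_exp M G x w) = (LINT w|M. cond_exp M G v w \<bullet> x w)"
 proof (intro G.cond_exp_integral_inner G.cond_exp_measurable x(1))
  fix b :: "real^'n" assume "b : Basis"
  from G.integrable_bounded_components[OF x Ev this]
  show "integrable M (%w. (cond_exp M G v w \<bullet> b) * (x w \<bullet> b))" by (simp add: mult.commute)
 qed
 ultimately show "(LINT w|M. cond_exp M G x w \<bullet> v w) = (LINT w|M. x w \<bullet> cond_exp M G v w)"
  by (simp add: inner_commute)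
qed

lemma cond_exp_selfadjoint:
 assumes x: "x : S" and v: "v : S'"
 shows "(LINT w|M. cond_exp M G x w \<bullet> v w) = (LINT w|M. x w \<bullet> cond_exp M G v w)"
proof -
 have "(LINT w|M. cond_exp M G x w \<bullet> cond_exp M G v w) = (LINT w|M. cond_exp M G x w \<bullet> v w)"
  by (intro G.cond_exp_integral_inner G.cond_exp_measurable component_integrable cond_exp_mem x v S'_measurable)
 moreover have "(LINT w|M. cond_exp M G v w \<bullet> cond_exp M G x w) = (LINT w|M. cond_exp M G v w \<bullet> x w)"
 proof (intro G.cond_exp_integral_inner G.cond_exp_measurable S_measurable[OF x])
  fix b :: "real^'n" assume "b : Basis"
  from component_integrable[OF x cond_exp_dual_mem[OF v] this]
  show "integrable M (%w. (cond_exp M G v w \<bullet> b) * (x w \<bullet> b))" by (simp add: mult.commute)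
 qed
 ultimately show ?thesis by (simp add: inner_commute)
qed

lemma cond_exp_pairing:
 assumes x: "x : S" "x : borel_measurable G" and v: "v : S'"
 shows "(LINT w|M. x w \<bullet> cond_exp M G v w) = (LINT w|M. x w \<bullet> v w)"
 by (intro G.cond_exp_integral_inner x component_integrable v S'_measurable)

end

end

section \<open>Multiplication by random matrices\<close>

lemma measurable_vec_nth':
 fixes x :: "'a => 'b::euclidean_space^'n"
 assumes "x : borel_measurable M"
 shows "(%w. x w $ i) : borel_measurable M"
 by (rule measurable_compose[OF assms]) (intro borel_measurable_continuous_onI continuous_intros)

lemma measurable_matrix_vector_mult:
 fixes A :: "'a => real^'k^'n"
 assumes "A : borel_measurable M" "x : borel_measurable M"
 shows "(%w. A w *v x w) : borel_measurable M"
 unfolding matrix_vector_mult_def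
 using measurable_vec_nth[OF measurable_vec_nth'[OF assms(1)]] measurable_vec_nth[OF assms(2)]
 by (intro measurable_vec_lambda borel_measurable_sum borel_measurable_times) auto

lemma inner_transpose_mult: "x \<bullet> (transpose A *v y) = (A *v x) \<bullet> y"
 for A :: "real^'k^'n"
 unfolding transpose_matrix_vector by (metis dot_lmul_matrix inner_commute)

context
 fixes M :: "'a measure" and S S' :: "('a => real^'k) set" and S2 S2' :: "('a => real^'n) set" and q q2
  and A :: "'a => real^'k^'n"
 assumes S: "rv_space M S S' q" and S2: "rv_space M S2 S2' q2"
  and A: "A : borel_measurable M" and AS: "!!x. x : S ==> (%w. A w *v x w) : S2"
begin

interpretation S: rv_space M S S' q by (rule S)
interpretation S2: rv_space M S2 S2' q2 by (rule S2)

text \<open>The matrix may be unbounded, so L1 convergence does not pass through it. Along a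
  subsequence both sequences converge almost surely, and there the matrix is continuous
  pointwise.\<close>

lemma matrix_continuous:
 assumes "!!n::nat. s n : S" "(%n. q (s n)) \<longlonglongrightarrow> 0"
 shows "(%n. q2 (%h. A h *v s n h)) \<longlonglongrightarrow> 0"
proof (rule operator_continuous[OF S S2 AS _ _ _ assms])
 fix s :: "nat => 'a => real^'k" and x w
 assume s: "!!n. s n : S" and x: "x : S" and w: "w : S2"
  and l1: "(%n. \<integral>h. norm (s n h - x h) \<partial>M) \<longlonglongrightarrow> 0"
  and l2: "(%n. \<integral>h. norm (A h *v s n h - w h) \<partial>M) \<longlonglongrightarrow> 0"
 have "integrable M (%h. s n h - x h)" for n
  using S.S_integrable[OF s] S.S_integrable[OF x] by simp
 from tendsto_L1_AE_subseq[OF this l1] obtain r where r: "strict_mono r" "AE h in M. (%n. s (r n) h - x h) \<longlonglongrightarrow> 0"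
  by blast
 have int2: "integrable M (%h. A h *v s (r n) h - w h)" for n
  using S2.S_integrable[OF AS[OF s]] S2.S_integrable[OF w] by simp
 have "(%n. \<integral>h. norm (A h *v s (r n) h - w h) \<partial>M) \<longlonglongrightarrow> 0"
  using LIMSEQ_subseq_LIMSEQ[OF l2 r(1)] by (simp add: o_def)
 from tendsto_L1_AE_subseq[OF int2 this]
 obtain r' where r': "strict_mono r'" "AE h in M. (%n. A h *v s (r (r' n)) h - w h) \<longlonglongrightarrow> 0" by blast
 show "AE h in M. w h = A h *v x h" using r(2) r'(2)
 proof eventually_elim
  case (elim h)
  have "(%n. s (r (r' n)) h - x h) \<longlonglongrightarrow> 0" using LIMSEQ_subseq_LIMSEQ[OF elim(1) r'(1)] by (simp add: o_def)
  hence "(%n. A h *v (s (r (r' n)) h - x h)) \<longlonglongrightarrow> A h *v 0"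
   by (rule bounded_linear.tendsto[OF matrix_vector_mul_bounded_linear])
  hence "(%n. A h *v (s (r (r' n)) h - x h) - (A h *v s (r (r' n)) h - w h)) \<longlonglongrightarrow> A h *v 0 - 0"
   using elim(2) by (rule tendsto_diff)
  hence "(%n. w h - A h *v x h) \<longlonglongrightarrow> 0" by (simp add: matrix_vector_mult_diff_distrib)
  thus "w h = A h *v x h" by (simp add: LIMSEQ_const_iff)
 qed
qed (auto simp: matrix_vector_right_distrib matrix_vector_mult_scaleR)

lemma matrix_functional:
 assumes "continuous_functional S2 q2 l"
 shows "continuous_functional S q (%x. l (%w. A w *v x w))"
 by (rule functional_compose[OF S S2 AS _ _ matrix_continuous assms])
  (auto simp: matrix_vector_right_distrib matrix_vector_mult_scaleR)

text \<open>Pairing \<open>A x\<close> with \<open>v\<close> is a continuous functional of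
  \<open>x\<close> represented by the transposed product; constant \<open>x\<close> show that this
  product is integrable.\<close>

lemma matrix_adjoint_mem:
 assumes v: "v : S2'"
 shows "(%w. transpose (A w) *v v w) : S'"
proof (rule S.representing_function_mem[OF matrix_functional[OF S2.pairing_continuous[OF v]]])
 show "integrable M (%w. transpose (A w) *v v w)"
 proof (rule integrable_componentwise)
  fix b :: "real^'k"
  have "(%_. b) : S" by (rule S.S_bounded[of _ "norm b"]) auto
  from S2.pairing_integrable[OF AS[OF this] v]
  show "integrable M (%w. (transpose (A w) *v v w) \<bullet> b)"
   unfolding inner_commute[of _ b] inner_transpose_mult .
 qed
qed (simp only: inner_transpose_mult)

end

section \<open>Extended expectations\<close>

lemma ext_expectation_integrable:
 assumes g: "integrable M g" and h: "AE w in M. h w = ereal (g w)"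
 shows "ext_expectation M h = ereal (LINT w|M. g w)"
proof -
 have 1: "(\<integral>\<^sup>+w. e2ennreal (h w) \<partial>M) = (\<integral>\<^sup>+w. ennreal (g w) \<partial>M)"
  by (rule nn_integral_cong_AE) (use h in eventually_elim, simp)
 have 2: "(\<integral>\<^sup>+w. e2ennreal (- h w) \<partial>M) = (\<integral>\<^sup>+w. ennreal (- g w) \<partial>M)"
  by (rule nn_integral_cong_AE) (use h in eventually_elim, simp)
 have fin: "(\<integral>\<^sup>+w. ennreal (g w) \<partial>M) ~= \<infinity>" "(\<integral>\<^sup>+w. ennreal (- g w) \<partial>M) ~= \<infinity>"
  using g unfolding real_integrable_def by auto
 obtain r where r: "(\<integral>\<^sup>+w. ennreal (g w) \<partial>M) = ennreal r" "0 <= r" using fin(1) by (cases "\<integral>\<^sup>+w. ennreal (g w) \<partial>M") auto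
 obtain s where s: "(\<integral>\<^sup>+w. ennreal (- g w) \<partial>M) = ennreal s" "0 <= s" using fin(2) by (cases "\<integral>\<^sup>+w. ennreal (- g w) \<partial>M") auto
 show ?thesis unfolding ext_expectation_def 1 2 real_lebesgue_integral_def[OF g] r(1) s(1) using r s by simp
qed

lemma AE_e2ennreal_finite:
 assumes "h : borel_measurable M" "(\<integral>\<^sup>+w. e2ennreal (h w) \<partial>M) ~= \<infinity>"
 shows "AE w in M. h w ~= \<infinity>"
proof -
 have "(%w. e2ennreal (h w)) : borel_measurable M" using assms(1) by (rule measurable_compose[OF _ measurable_e2ennreal])
 from nn_integral_PInf_AE[OF this assms(2)] show ?thesis by eventually_elim (auto simp: e2ennreal_infty)
qed

lemma ext_expectation_finiteD:
 assumes h: "h : borel_measurable M" and fin: "ext_expectation M h < \<infinity>" "ext_expectation M h > - \<infinity>"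
 shows "integrable M (%w. real_of_ereal (h w))" "AE w in M. h w = ereal (real_of_ereal (h w))"
proof -
 have p: "(\<integral>\<^sup>+w. e2ennreal (h w) \<partial>M) ~= \<infinity>" using fin(1) unfolding ext_expectation_def by (auto split: if_splits)
 then obtain r where r: "(\<integral>\<^sup>+w. e2ennreal (h w) \<partial>M) = ennreal r" "0 <= r" by (cases "\<integral>\<^sup>+w. e2ennreal (h w) \<partial>M") auto
 have n: "(\<integral>\<^sup>+w. e2ennreal (- h w) \<partial>M) ~= \<infinity>"
 proof
  assume "(\<integral>\<^sup>+w. e2ennreal (- h w) \<partial>M) = \<infinity>"
  hence "ext_expectation M h = - \<infinity>" unfolding ext_expectation_def r using r(2) by simp
  thus False using fin(2) by simp
 qed
 have hm: "(%w. - h w) : borel_measurable M" using h by simp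
 have ae1: "AE w in M. h w ~= \<infinity>" by (rule AE_e2ennreal_finite[OF h p])
 have ae2: "AE w in M. - h w ~= \<infinity>" by (rule AE_e2ennreal_finite[OF hm n])
 show ae: "AE w in M. h w = ereal (real_of_ereal (h w))" using ae1 ae2
 proof eventually_elim
  case (elim w)
  thus ?case by (cases "h w") auto
 qed
 have 1: "(\<integral>\<^sup>+w. e2ennreal (h w) \<partial>M) = (\<integral>\<^sup>+w. ennreal (real_of_ereal (h w)) \<partial>M)"
  by (rule nn_integral_cong_AE) (use ae in eventually_elim, metis e2ennreal_ereal)
 have 2: "(\<integral>\<^sup>+w. e2ennreal (- h w) \<partial>M) = (\<integral>\<^sup>+w. ennreal (- real_of_ereal (h w)) \<partial>M)"
  by (rule nn_integral_cong_AE) (use ae in eventually_elim, metis e2ennreal_ereal uminus_ereal.simps(1))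
 show "integrable M (%w. real_of_ereal (h w))"
  unfolding real_integrable_def using h p n 1 2 by auto
qed

lemma ext_expectation_less_top:
 assumes g: "integrable M g" and h: "AE w in M. h w <= ereal (g w)"
 shows "ext_expectation M h < \<infinity>"
proof -
 have "(\<integral>\<^sup>+w. e2ennreal (h w) \<partial>M) <= (\<integral>\<^sup>+w. ennreal (g w) \<partial>M)"
  by (rule nn_integral_mono_AE) (use h in eventually_elim, metis e2ennreal_ereal e2ennreal_mono)
 moreover have "(\<integral>\<^sup>+w. ennreal (g w) \<partial>M) ~= \<infinity>" using g unfolding real_integrable_def by auto
 ultimately have p: "(\<integral>\<^sup>+w. e2ennreal (h w) \<partial>M) ~= \<infinity>" by (auto simp: top_unique)
 then obtain r where r: "(\<integral>\<^sup>+w. e2ennreal (h w) \<partial>M) = ennreal r" "0 <= r" by (cases "\<integral>\<^sup>+w. e2ennreal (h w) \<partial>M") auto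
 have "0 <= enn2ereal (\<integral>\<^sup>+w. e2ennreal (- h w) \<partial>M)" by simp
 thus ?thesis unfolding ext_expectation_def r using r(2)
  by (cases "enn2ereal (\<integral>\<^sup>+w. e2ennreal (- h w) \<partial>M)") auto
qed

lemma ext_expectation_upper:
 assumes h: "h : borel_measurable M" and fin: "ext_expectation M h < \<infinity>"
 obtains g where "integrable M g" "AE w in M. h w <= ereal (g w)"
proof -
 have p: "(\<integral>\<^sup>+w. e2ennreal (h w) \<partial>M) ~= \<infinity>" using fin unfolding ext_expectation_def by (auto split: if_splits)
 have ae: "AE w in M. h w ~= \<infinity>" by (rule AE_e2ennreal_finite[OF h p])
 define g where "g w = max 0 (real_of_ereal (h w))" for w
 have gm: "g : borel_measurable M" unfolding g_def using h by simp
 have "(\<integral>\<^sup>+w. ennreal (g w) \<partial>M) = (\<integral>\<^sup>+w. e2ennreal (h w) \<partial>M)"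
 proof (rule nn_integral_cong_AE, use ae in eventually_elim)
  fix w assume "h w ~= \<infinity>"
  thus "ennreal (g w) = e2ennreal (h w)"
   by (cases "h w") (auto simp: g_def e2ennreal_neg max_def ennreal_neg)
 qed
 moreover have "(\<integral>\<^sup>+w. ennreal (- g w) \<partial>M) = 0"
  by (subst nn_integral_0_iff_AE) (use gm in \<open>auto simp: g_def ennreal_neg\<close>)
 ultimately have "integrable M g" unfolding real_integrable_def using gm p by auto
 moreover have "AE w in M. h w <= ereal (g w)" using ae
 proof eventually_elim
  case (elim w)
  thus ?case by (cases "h w") (auto simp: g_def)
 qed
 ultimately show ?thesis using that by blast
qed

lemma integrable_between:
 fixes h :: "'a => ereal"
 assumes h: "h : borel_measurable M" and g: "integrable M g" "integrable M k"
  and b: "AE w in M. ereal (g w) <= h w" "AE w in M. h w <= ereal (k w)"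
 shows "integrable M (%w. real_of_ereal (h w))" "AE w in M. h w = ereal (real_of_ereal (h w))"
proof -
 show ae: "AE w in M. h w = ereal (real_of_ereal (h w))" using b
 proof eventually_elim
  case (elim w)
  thus ?case by (cases "h w") auto
 qed
 show "integrable M (%w. real_of_ereal (h w))"
 proof (rule Bochner_Integration.integrable_bound[of M "%w. \<bar>g w\<bar> + \<bar>k w\<bar>"])
  show "integrable M (%w. \<bar>g w\<bar> + \<bar>k w\<bar>)" using g by auto
  show "(%w. real_of_ereal (h w)) : borel_measurable M" using h by simp
  show "AE w in M. norm (real_of_ereal (h w)) <= norm (\<bar>g w\<bar> + \<bar>k w\<bar>)" using b
  proof eventually_elim
   case (elim w)
   thus ?case by (cases "h w") auto
  qed
 qed
qed

section \<open>Measurable selections\<close>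

lemma countable_dense_sequence:
 obtains d :: "nat => 'c::euclidean_space" where "!!x e. e > 0 ==> EX k. d k : ball x e"
proof -
 obtain D :: "'c set" where D: "countable D" "!!X. open X ==> X ~= {} ==> EX d:D. d : X"
  using countable_dense_setE by blast
 show ?thesis
 proof (rule that[of "from_nat_into D"])
  fix x :: 'c and e :: real assume "e > 0"
  hence "ball x e ~= {}" by simp
  then obtain y where y: "y : D" "y : ball x e" using D(2)[OF open_ball] by blast
  obtain k where "from_nat_into D k = y" using from_nat_into_surj[OF D(1) y(1)] by blast
  thus "EX k. from_nat_into D k : ball x e" using y(2) by blast
 qed
qed

context
 fixes M :: "'a measure" and E :: "'a => 'c::euclidean_space set"
 assumes closed_E: "!!w. w : space M ==> closed (E w)"
  and meas_E: "!!G. open G ==> {w:space M. E w \<inter> G ~= {}} : sets M"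
begin

text \<open>Closedness turns membership into approximation: at each scale some ball around a dense
  point contains the value and meets \<open>E h\<close>. Both are measurable conditions.\<close>

lemma sets_mem_multifunction:
 assumes z: "z : borel_measurable M"
 shows "{h:space M. z h : E h} : sets M"
proof -
 obtain d :: "nat => 'c" where d: "!!x e. e > 0 ==> EX k. d k : ball x e" by (rule countable_dense_sequence) blast
 define r where "r n = 1 / real (Suc n)" for n
 have r: "r n > 0" for n by (simp add: r_def)
 have "{h:space M. z h : E h} =
   (INT n. UN k. {h:space M. dist (d k) (z h) < r n} \<inter> {h:space M. E h \<inter> ball (d k) (r n) ~= {}})" (is "?L = ?R")
 proof (intro set_eqI iffI)
  fix h assume w: "h : ?L"
  show "h : ?R"
  proof
   fix n
   obtain k where "d k : ball (z h) (r n)" using d[OF r] by blast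
   thus "h : (UN k. {h:space M. dist (d k) (z h) < r n} \<inter> {h:space M. E h \<inter> ball (d k) (r n) ~= {}})"
    using w by (intro UN_I[of k]) (auto simp: dist_commute)
  qed
 next
  fix h assume w: "h : ?R"
  have sp: "h : space M" using w by auto
  have "z h : closure (E h)"
   unfolding closure_approachable
  proof (intro allI impI)
   fix e :: real assume "e > 0"
   then obtain n where n: "r n < e/2" unfolding r_def using nat_approx_posE[of "e/2"] by auto
   obtain k where k: "dist (d k) (z h) < r n" "E h \<inter> ball (d k) (r n) ~= {}" using w by blast
   then obtain y where "y : E h" "dist (d k) y < r n" by auto
   thus "EX y:E h. dist y (z h) < e"
    using k(1) n dist_triangle[of y "z h" "d k"] by (intro bexI[of _ y]) (auto simp: dist_commute)
  qed
  thus "h : ?L" using closed_E[OF sp] sp by simp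
 qed
 also have "\<dots> : sets M"
 proof (intro sets.countable_INT image_subsetI sets.countable_UN'' sets.Int meas_E)
  fix n k
  have [measurable]: "z : borel_measurable M" by fact
  show "{h:space M. dist (d k) (z h) < r n} : sets M" by measurable
 qed auto
 finally show ?thesis .
qed

text \<open>The projection is the limit of measurable maps \<open>y n\<close> that take the first
  dense point close both to \<open>E h\<close> and to the minimal distance. Near minimizers converge
  because of the obtuse angle at a projection onto a convex set.\<close>

lemma measurable_closest_point:
 assumes convex: "!!h. h : space M ==> convex (E h)"
 shows "(%h. if E h = {} then 0 else closest_point (E h) p) : borel_measurable M"
proof -
 have ne: "{h:space M. E h ~= {}} : sets M" using meas_E[of UNIV] by simp
 obtain d :: "nat => 'c" where d: "!!x e. e > 0 ==> EX k. d k : ball x e" by (rule countable_dense_sequence) blast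
 define r where "r n = 1 / real (Suc n)" for n
 have r: "r n > 0" for n by (simp add: r_def)
 define \<delta> where "\<delta> h = (if E h = {} then 0 else infdist p (E h))" for h
 have \<delta>m: "\<delta> : borel_measurable M"
 proof (rule borel_measurableI_less)
  fix y
  show "{h:space M. \<delta> h < y} : sets M"
  proof (cases "y > 0")
   case True
   have "{h:space M. \<delta> h < y} = {h:space M. E h \<inter> ball p y ~= {}} \<union> (space M - {h:space M. E h ~= {}})"
   proof -
    have "infdist p (E h) < y \<longleftrightarrow> E h \<inter> ball p y ~= {}" if "E h ~= {}" for h
    proof -
     have "bdd_below (dist p ` E h)" by (intro bdd_belowI[of _ 0]) auto
     from cINF_less_iff[OF that this, of y] show ?thesis using that by (auto simp: infdist_notempty)
    qed
    thus ?thesis using True unfolding \<delta>_def by auto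
   qed
   thus ?thesis using ne meas_E[of "ball p y"] by auto
  next
   case False
   hence "{h:space M. \<delta> h < y} = {}" unfolding \<delta>_def using infdist_nonneg[of p] by (auto simp: not_less intro: order_trans)
   thus ?thesis by (simp only: sets.empty_sets)
  qed
 qed
 define P where "P n k h \<longleftrightarrow> E h \<inter> ball (d k) (r n) ~= {} & dist p (d k) < \<delta> h + r n" for n k h
 have Pm: "{h:space M. P n k h} : sets M" for n k
 proof -
  have "{h:space M. P n k h} = {h:space M. E h \<inter> ball (d k) (r n) ~= {}} \<inter> {h:space M. dist p (d k) < \<delta> h + r n}"
   unfolding P_def by auto
  moreover have "{h:space M. dist p (d k) < \<delta> h + r n} : sets M" using \<delta>m by simp
  ultimately show ?thesis using meas_E[of "ball (d k) (r n)"] by auto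
 qed
 define y where "y n h = (if E h = {} then 0 else d (LEAST k. P n k h))" for n h
 have ym: "y n : borel_measurable M" for n
 proof -
  have "(%h. LEAST k. P n k h) : measurable M (count_space UNIV)"
   using Pm by (intro measurable_Least) (simp add: pred_def)
  hence "(%h. d (LEAST k. P n k h)) : borel_measurable M"
   by (rule measurable_compose) simp
  moreover have "{h:space M. E h = {}} : sets M"
  proof -
   have "{h:space M. E h = {}} = space M - {h:space M. E h ~= {}}" by auto
   thus ?thesis using ne by auto
  qed
  ultimately show ?thesis unfolding y_def by (intro measurable_If) auto
 qed
 show ?thesis
 proof (rule borel_measurable_LIMSEQ_metric[OF ym])
  fix h assume w: "h : space M"
  show "(%n. y n h) \<longlonglongrightarrow> (if E h = {} then 0 else closest_point (E h) p)"
  proof (cases "E h = {}")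
   case False
   let ?c = "closest_point (E h) p"
   have cl: "closed (E h)" and cv: "convex (E h)" using closed_E convex w by auto
   have cE: "?c : E h" by (rule closest_point_in_set[OF cl False])
   have dc: "\<delta> h = dist p ?c"
   proof (rule antisym)
    show "\<delta> h <= dist p ?c" unfolding \<delta>_def using cE by (simp add: infdist_le)
    show "dist p ?c <= \<delta> h" unfolding \<delta>_def infdist_def using False closest_point_le[OF cl]
     by (auto intro!: cINF_greatest)
   qed
   \<comment> \<open>Some \<open>z\<close> in \<open>E h\<close> exceeds the minimal distance by at
     most \<open>2 * r n\<close>, so its squared distance from the projection is at most
     \<open>(\<delta> h + 2 * r n)\<^sup>2 - (\<delta> h)\<^sup>2\<close>.\<close>
   have near: "dist (y n h) ?c <= r n + sqrt (4 * r n * \<delta> h + 4 * (r n)\<^sup>2)" for n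
   proof -
    obtain k where k: "d k : ball ?c (r n)" using d[OF r] by blast
    have "P n k h" unfolding P_def dc
     using k cE dist_triangle[of p "d k" ?c] by (auto simp: dist_commute)
    hence "P n (LEAST k. P n k h) h" by (rule LeastI)
    then obtain z where z: "z : E h" "dist (y n h) z < r n" "dist p (y n h) < \<delta> h + r n"
     unfolding P_def y_def using False by auto
    have "dist p z <= \<delta> h + 2 * r n" using dist_triangle[of p z "y n h"] z by simp
    hence "(norm (p - z))\<^sup>2 <= (\<delta> h + 2 * r n)\<^sup>2" by (intro power_mono) (auto simp: dist_norm)
    moreover have "(norm (p - z))\<^sup>2 = (norm (p - ?c))\<^sup>2 + (norm (z - ?c))\<^sup>2 - 2 * ((p - ?c) \<bullet> (z - ?c))"
     by (simp add: power2_norm_eq_inner inner_diff_left inner_diff_right inner_commute algebra_simps)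
    moreover have "(p - ?c) \<bullet> (z - ?c) <= 0" by (rule closest_point_dot[OF cv cl z(1)])
    moreover have "norm (p - ?c) = \<delta> h" using dc by (simp add: dist_norm)
    ultimately have "(norm (z - ?c))\<^sup>2 <= 4 * r n * \<delta> h + 4 * (r n)\<^sup>2"
     by (simp add: power2_eq_square algebra_simps)
    hence "dist z ?c <= sqrt (4 * r n * \<delta> h + 4 * (r n)\<^sup>2)" by (simp add: dist_norm real_le_rsqrt)
    thus ?thesis using dist_triangle[of "y n h" ?c z] z(2) by linarith
   qed
   have r0: "r \<longlonglongrightarrow> 0" unfolding r_def using LIMSEQ_inverse_real_of_nat by (simp add: inverse_eq_divide)
   have "(%n. r n + sqrt (4 * r n * \<delta> h + 4 * (r n)\<^sup>2)) \<longlonglongrightarrow> 0 + sqrt (4 * 0 * \<delta> h + 4 * 0\<^sup>2)"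
    by (intro tendsto_intros r0)
   hence lim: "(%n. r n + sqrt (4 * r n * \<delta> h + 4 * (r n)\<^sup>2)) \<longlonglongrightarrow> 0" by simp
   have "(%n. dist (y n h) ?c) \<longlonglongrightarrow> 0"
    using near by (intro Lim_null_comparison[OF always_eventually lim]) auto
   thus ?thesis using False by (simp add: tendsto_dist_iff[symmetric])
  qed (simp add: y_def)
 qed
qed

text \<open>Project a dense sequence: projections are nonexpansive and fix the points of
  \<open>E h\<close>, so the images are dense in \<open>E h\<close>.\<close>

lemma Castaing_representation:
 assumes convex: "!!h. h : space M ==> convex (E h)"
 shows "EX e::nat => 'a => 'c. (ALL k. e k : borel_measurable M) &
  (ALL k. ALL h:space M. E h ~= {} --> e k h : E h) &
  (ALL h:space M. ALL z:E h. ALL \<epsilon>>0. EX k. dist (e k h) z < \<epsilon>)"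
proof -
 obtain d :: "nat => 'c" where d: "!!x e. e > 0 ==> EX k. d k : ball x e" by (rule countable_dense_sequence) blast
 define e where "e k h = (if E h = {} then 0 else closest_point (E h) (d k))" for k h
 show ?thesis
 proof (intro exI[of _ e] conjI allI ballI impI)
  show "e k : borel_measurable M" for k unfolding e_def by (rule measurable_closest_point[OF convex])
  show "e k h : E h" if "h : space M" "E h ~= {}" for k h
   unfolding e_def using that closest_point_in_set[OF closed_E] by simp
  fix h z and \<epsilon> :: real assume w: "h : space M" and z: "z : E h" and "\<epsilon> > 0"
  then obtain k where k: "d k : ball z \<epsilon>" using d by blast
  have ne: "E h ~= {}" using z by auto
  have "dist (closest_point (E h) (d k)) (closest_point (E h) z) <= dist (d k) z"
   by (rule closest_point_lipschitz[OF convex[OF w] closed_E[OF w] ne])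
  hence "dist (e k h) z < \<epsilon>" unfolding e_def using ne k closest_point_self[OF z] by (simp add: dist_commute)
  thus "EX k. dist (e k h) z < \<epsilon>" by blast
 qed
qed

end

section \<open>Convex normal integrands\<close>

text \<open>This form has finite terms only and is indexed by the epigraph, the set-valued map that
  has measurable selections. A value \<open>- \<infinity>\<close> contributes a whole vertical line
  and hence an infinite supremum.\<close>

lemma fenchel_conjugate_epi: "fenchel_conjugate f v = (SUP z\<in>epi f. ereal (fst z \<bullet> v - snd z))"
proof (rule antisym)
 show "fenchel_conjugate f v <= (SUP z\<in>epi f. ereal (fst z \<bullet> v - snd z))"
  unfolding fenchel_conjugate_def
 proof (rule SUP_least)
  fix x
  show "ereal (x \<bullet> v) - f x <= (SUP z\<in>epi f. ereal (fst z \<bullet> v - snd z))"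
  proof (cases "f x")
   case (real a)
   hence "(x, a) : epi f" by (simp add: epi_def)
   hence "ereal (fst (x, a) \<bullet> v - snd (x, a)) <= (SUP z\<in>epi f. ereal (fst z \<bullet> v - snd z))" by (rule SUP_upper)
   thus ?thesis using real by simp
  next
   case MInf
   have "ereal r <= (SUP z\<in>epi f. ereal (fst z \<bullet> v - snd z))" for r
   proof -
    have "(x, x \<bullet> v - r) : epi f" using MInf by (simp add: epi_def)
    hence "ereal (fst (x, x \<bullet> v - r) \<bullet> v - snd (x, x \<bullet> v - r)) <= (SUP z\<in>epi f. ereal (fst z \<bullet> v - snd z))" by (rule SUP_upper)
    thus ?thesis by simp
   qed
   hence "(SUP z\<in>epi f. ereal (fst z \<bullet> v - snd z)) = \<infinity>" by (intro ereal_top)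
   thus ?thesis by simp
  qed simp
 qed
 show "(SUP z\<in>epi f. ereal (fst z \<bullet> v - snd z)) <= fenchel_conjugate f v"
  unfolding fenchel_conjugate_def
 proof (rule SUP_least)
  fix z assume z: "z : epi f"
  hence "f (fst z) <= ereal (snd z)" by (cases z) (simp add: epi_def)
  hence "ereal (fst z \<bullet> v - snd z) <= ereal (fst z \<bullet> v) - f (fst z)" by (cases "f (fst z)") auto
  also have "\<dots> <= (SUP x. ereal (x \<bullet> v) - f x)" by (rule SUP_upper) simp
  finally show "ereal (fst z \<bullet> v - snd z) <= (SUP x. ereal (x \<bullet> v) - f x)" .
 qed
qed

text \<open>Segments from \<open>(x, a)\<close> to points very far down above \<open>z\<close> pass
  through height \<open>a - 1\<close> arbitrarily close to \<open>x\<close>; closedness would put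
  \<open>(x, a - 1)\<close> into the epigraph.\<close>

lemma closed_convex_proper:
 fixes f :: "'b::euclidean_space => ereal"
 assumes cl: "closed (epi f)" and cv: "convex (epi f)" and x: "f x = ereal a"
 shows "f z ~= - \<infinity>"
proof
 assume z: "f z = - \<infinity>"
 have "(x, a - 1) : epi f"
 proof (rule closed_sequentially[OF cl])
  define s where "s n = 1 / real (Suc n)" for n
  have s: "0 <= s n" "s n <= 1" "s n > 0" for n unfolding s_def by (auto simp: field_simps)
  \<comment> \<open>Chosen so that the convex combination has height exactly
    \<open>a - 1\<close>.\<close>
  define r where "r n = a - 1 / s n" for n
  show "((1 - s n) *\<^sub>R x + s n *\<^sub>R z, a - 1) : epi f" for n
  proof -
   have "(1 - s n) *\<^sub>R (x, a) + s n *\<^sub>R (z, r n) : epi f"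
    by (rule convexD_alt[OF cv _ _ s(1,2)]) (auto simp: epi_def x z)
   moreover have "(1 - s n) * a + s n * r n = a - 1" using s(3)[of n] unfolding r_def by (simp add: field_simps)
   ultimately show ?thesis by simp
  qed
  have s0: "s \<longlonglongrightarrow> 0" unfolding s_def using LIMSEQ_inverse_real_of_nat by (simp add: inverse_eq_divide)
  have "(%n. ((1 - s n) *\<^sub>R x + s n *\<^sub>R z, a - 1)) \<longlonglongrightarrow> ((1 - 0) *\<^sub>R x + 0 *\<^sub>R z, a - 1)"
   by (intro tendsto_intros s0)
  thus "(%n. ((1 - s n) *\<^sub>R x + s n *\<^sub>R z, a - 1)) \<longlonglongrightarrow> (x, a - 1)" by simp
 qed
 thus False by (simp add: epi_def x)
qed

lemma Fenchel_Young:
 assumes "f x = ereal a"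
 shows "ereal (x \<bullet> v - a) <= fenchel_conjugate f v"
 unfolding fenchel_conjugate_def using SUP_upper[of x UNIV "%x. ereal (x \<bullet> v) - f x"] by (simp add: assms)

lemma Fenchel_Young_eq:
 assumes x: "f x = ereal a" and c: "fenchel_conjugate f v = ereal c"
 shows "a + c = x \<bullet> v \<longleftrightarrow> v : subdifferential f x"
proof
 assume eq: "a + c = x \<bullet> v"
 show "v : subdifferential f x" unfolding subdifferential_def
 proof (intro CollectI allI)
  fix z
  have "ereal (z \<bullet> v) - f z <= ereal c" unfolding c[symmetric] fenchel_conjugate_def by (rule SUP_upper) simp
  thus "f x + ereal (v \<bullet> (z - x)) <= f z"
   unfolding x using eq by (cases "f z") (auto simp: inner_diff_right inner_commute algebra_simps)
 qed
next
 assume v: "v : subdifferential f x"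
 have "fenchel_conjugate f v <= ereal (x \<bullet> v - a)" unfolding fenchel_conjugate_def
 proof (rule SUP_least)
  fix z
  have "f x + ereal (v \<bullet> (z - x)) <= f z" using v unfolding subdifferential_def by blast
  thus "ereal (z \<bullet> v) - f z <= ereal (x \<bullet> v - a)"
   unfolding x by (cases "f z") (auto simp: inner_diff_right inner_commute algebra_simps)
 qed
 thus "a + c = x \<bullet> v" using Fenchel_Young[of f x a v, OF x] unfolding c by simp
qed

context
 fixes M :: "'a measure" and L :: "'b::euclidean_space => 'a => ereal"
 assumes normal: "convex_normal_integrand M L"
begin

lemma closed_epi: "w : space M ==> closed (epi (%x. L x w))"
 and convex_epi: "w : space M ==> convex (epi (%x. L x w))"
 and sets_epi: "open U ==> {w:space M. epi (%x. L x w) \<inter> U ~= {}} : sets M"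
 using normal unfolding convex_normal_integrand_def by auto

lemma normal_integrand_measurable:
 assumes x: "x : borel_measurable M"
 shows "(%h. L (x h) h) : borel_measurable M"
proof -
 have le: "{h:space M. L (x h) h <= ereal r} : sets M" for r
 proof -
  have "(%h. (x h, r)) : borel_measurable M" using x by simp
  from sets_mem_multifunction[OF closed_epi sets_epi this] show ?thesis by (simp add: epi_def)
 qed
 show ?thesis
  unfolding borel_measurable_iff_Iic_ereal
 proof
  fix a :: ereal
  show "(%h. L (x h) h) -` {..a} \<inter> space M : sets M"
  proof (cases a)
   case (real r)
   have "(%h. L (x h) h) -` {..a} \<inter> space M = {h:space M. L (x h) h <= ereal r}" using real by auto
   thus ?thesis using le by simp
  next
   case MInf
   have "(%h. L (x h) h) -` {..a} \<inter> space M = (INT n::nat. {h:space M. L (x h) h <= ereal (- real n)})"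
   proof (intro set_eqI iffI)
    fix h assume w: "h : (INT n::nat. {h:space M. L (x h) h <= ereal (- real n)})"
    have "L (x h) h = - \<infinity>"
    proof (rule ereal_bot)
     fix B
     obtain n where "- real n <= B" using real_arch_simple[of "- B"] by (auto simp: minus_le_iff)
     thus "L (x h) h <= ereal B" using w by (auto intro: order_trans)
    qed
    thus "h : (%h. L (x h) h) -` {..a} \<inter> space M" using w by auto
   qed (use MInf in auto)
   moreover have "(INT n::nat. {h:space M. L (x h) h <= ereal (- real n)}) : sets M"
    by (intro sets.countable_INT image_subsetI le) auto
   ultimately show ?thesis by simp
  next
   case PInf
   have "(%h. L (x h) h) -` {..a} \<inter> space M = space M" using PInf by auto
   thus ?thesis by simp
  qed
 qed
qed

text \<open>The selections are dense in the epigraph and the affine expression is continuous, so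
  countably many points suffice, the same ones for every \<open>v\<close>.\<close>

lemma conjugate_countable_sup:
 obtains e :: "nat => 'a => 'b \<times> real" where "!!k. e k : borel_measurable M"
  "!!k h. h : space M ==> epi (%x. L x h) ~= {} ==> L (fst (e k h)) h <= ereal (snd (e k h))"
  "!!h v. h : space M ==> epi (%x. L x h) ~= {} ==>
   fenchel_conjugate (%x. L x h) v = (SUP k. ereal (fst (e k h) \<bullet> v - snd (e k h)))"
proof -
 obtain e :: "nat => 'a => 'b \<times> real" where e: "!!k. e k : borel_measurable M"
  "!!k h. h : space M ==> epi (%x. L x h) ~= {} ==> e k h : epi (%x. L x h)"
  "!!h z \<epsilon>. h : space M ==> z : epi (%x. L x h) ==> \<epsilon> > 0 ==> EX k. dist (e k h) z < \<epsilon>"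
 proof -
  have "EX e::nat => 'a => 'b \<times> real. (ALL k. e k : borel_measurable M) &
   (ALL k. ALL h:space M. epi (%x. L x h) ~= {} --> e k h : epi (%x. L x h)) &
   (ALL h:space M. ALL z:epi (%x. L x h). ALL \<epsilon>>0. EX k. dist (e k h) z < \<epsilon>)"
   by (rule Castaing_representation) (fact closed_epi sets_epi convex_epi)+
  then obtain e' :: "nat => 'a => 'b \<times> real" where e': "ALL k. e' k : borel_measurable M"
   "ALL k. ALL h:space M. epi (%x. L x h) ~= {} --> e' k h : epi (%x. L x h)"
   "ALL h:space M. ALL z:epi (%x. L x h). ALL \<epsilon>>0. EX k. dist (e' k h) z < \<epsilon>" by blast
  show thesis by (rule that[of e']) (use e' in blast)+
 qed
 show ?thesis
 proof (rule that[of e, OF e(1)])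
  fix h k assume w: "h : space M" "epi (%x. L x h) ~= {}"
  show "L (fst (e k h)) h <= ereal (snd (e k h))" using e(2)[OF w, of k] by (cases "e k h") (simp add: epi_def)
 next
  fix h v assume w: "h : space M" "epi (%x. L x h) ~= {}"
  let ?E = "epi (%x. L x h)"
  let ?g = "%z::'b \<times> real. fst z \<bullet> v - snd z"
  show "fenchel_conjugate (%x. L x h) v = (SUP k. ereal (fst (e k h) \<bullet> v - snd (e k h)))"
   unfolding fenchel_conjugate_epi
  proof (rule antisym)
   show "(SUP k. ereal (?g (e k h))) <= (SUP z\<in>?E. ereal (?g z))"
    by (rule SUP_least) (rule SUP_upper[OF e(2)[OF w]])
   show "(SUP z\<in>?E. ereal (?g z)) <= (SUP k. ereal (?g (e k h)))"
   proof (rule SUP_least, rule ereal_le_epsilon2)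
    fix z and \<epsilon> :: real assume z: "z : ?E" and "\<epsilon> > 0"
    have "continuous (at z) ?g" by (intro continuous_intros)
    then obtain \<eta> where \<eta>: "\<eta> > 0" "!!y. dist y z < \<eta> ==> dist (?g y) (?g z) < \<epsilon>"
     unfolding continuous_at_eps_delta using \<open>\<epsilon> > 0\<close> by blast
    obtain k where "dist (e k h) z < \<eta>" using e(3)[OF w(1) z \<eta>(1)] by blast
    hence "?g z <= ?g (e k h) + \<epsilon>" using \<eta>(2)[of "e k h"] by (simp add: dist_real_def)
    hence "ereal (?g z) <= ereal (?g (e k h)) + ereal \<epsilon>" by simp
    also have "\<dots> <= (SUP k. ereal (?g (e k h))) + ereal \<epsilon>" by (intro add_right_mono SUP_upper) simp
    finally show "ereal (?g z) <= (SUP k. ereal (?g (e k h))) + ereal \<epsilon>" .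
   qed
  qed
 qed
qed

lemma sets_epi_nonempty: "{w:space M. epi (%x. L x w) ~= {}} : sets M"
 using sets_epi[of UNIV] by simp

lemma conjugate_measurable:
 assumes v: "v : borel_measurable M"
 shows "(%w. fenchel_conjugate (%x. L x w) (v w)) : borel_measurable M"
proof -
 obtain e :: "nat => 'a => 'b \<times> real" where e: "!!k. e k : borel_measurable M"
  "!!w v. w : space M ==> epi (%x. L x w) ~= {} ==>
   fenchel_conjugate (%x. L x w) v = (SUP k. ereal (fst (e k w) \<bullet> v - snd (e k w)))"
  by (rule conjugate_countable_sup) blast
 \<comment> \<open>An empty epigraph gives the supremum of the empty set.\<close>
 have "(%w. if epi (%x. L x w) ~= {} then (SUP k. ereal (fst (e k w) \<bullet> v w - snd (e k w))) else - \<infinity>) : borel_measurable M"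
 proof (rule measurable_If)
  have fe: "(%w. fst (e k w)) : borel_measurable M" "(%w. snd (e k w)) : borel_measurable M" for k
   using measurable_compose[OF e(1) borel_measurable_continuous_onI[of fst, OF continuous_on_fst[OF continuous_on_id]]]
    measurable_compose[OF e(1) borel_measurable_continuous_onI[of snd, OF continuous_on_snd[OF continuous_on_id]]] by auto
  show "(%w. SUP k. ereal (fst (e k w) \<bullet> v w - snd (e k w))) : borel_measurable M"
   using fe v by (intro borel_measurable_SUP) auto
 qed (use sets_epi_nonempty in auto)
 thus ?thesis
 proof (rule measurable_cong[THEN iffD1, rotated])
  fix w assume "w : space M"
  thus "(if epi (%x. L x w) ~= {} then (SUP k. ereal (fst (e k w) \<bullet> v w - snd (e k w))) else - \<infinity>) = fenchel_conjugate (%x. L x w) (v w)"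
   using e(2) by (auto simp: fenchel_conjugate_epi bot_ereal_def)
 qed
qed

end

text \<open>Interchange of supremum and integral. The test pairs in \<open>bound\<close> are bounded
  on \<open>B\<close> and equal to the reference \<open>x0\<close> elsewhere, which is the kind of
  modification that decomposable spaces permit; near maximizers are reached from them by truncation
  and monotone convergence. The selections are \<open>G\<close>-measurable, so the result also
  covers suprema over \<open>G\<close>-measurable vectors.\<close>

lemma (in prob_space) conjugate_integral_le:
 fixes L :: "'b::euclidean_space => 'a => ereal"
 assumes sub: "subalgebra M G" and normal: "convex_normal_integrand G L"
  and x0: "x0 : borel_measurable G" "integrable M (%i. real_of_ereal (L (x0 i) i))" "AE i in M. \<bar>L (x0 i) i\<bar> ~= \<infinity>"
  and w: "w : borel_measurable G" "integrable M w" "integrable M (%i. x0 i \<bullet> w i)"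
  and bound: "!!B \<xi> \<rho> c. B : sets G ==> \<xi> : borel_measurable G ==> \<rho> : borel_measurable G ==>
   (!!i. norm (\<xi> i) <= c) ==> (!!i. \<bar>\<rho> i\<bar> <= c) ==> (!!i. i : B ==> L (\<xi> i) i <= ereal (\<rho> i)) ==>
   (LINT i|M. (if i : B then \<xi> i \<bullet> w i - \<rho> i else x0 i \<bullet> w i - real_of_ereal (L (x0 i) i))) <= \<kappa>"
 shows "integrable M (%i. real_of_ereal (fenchel_conjugate (%x. L x i) (w i)))"
  "AE i in M. fenchel_conjugate (%x. L x i) (w i) = ereal (real_of_ereal (fenchel_conjugate (%x. L x i) (w i)))"
  "(LINT i|M. real_of_ereal (fenchel_conjugate (%x. L x i) (w i))) <= \<kappa>"
proof -
 have toM: "f : borel_measurable G ==> f : borel_measurable M" for f :: "'a => 'd::topological_space"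
  by (rule measurable_from_subalg[OF sub])
 have GM: "A : sets G ==> A : sets M" for A using sub unfolding subalgebra_def by blast
 have sp: "space G = space M" using sub unfolding subalgebra_def by simp
 obtain e :: "nat => 'a => 'b \<times> real" where em: "!!k. e k : borel_measurable G"
  and eL: "!!k i. i : space G ==> epi (%x. L x i) ~= {} ==> L (fst (e k i)) i <= ereal (snd (e k i))"
  and esup: "!!i v. i : space G ==> epi (%x. L x i) ~= {} ==>
   fenchel_conjugate (%x. L x i) v = (SUP k. ereal (fst (e k i) \<bullet> v - snd (e k i)))"
  by (rule conjugate_countable_sup[OF normal]) blast
 define \<rho>0 where "\<rho>0 i = real_of_ereal (L (x0 i) i)" for i
 have Lx0: "(%i. L (x0 i) i) : borel_measurable G" by (rule normal_integrand_measurable[OF normal x0(1)])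
 have \<rho>0m: "\<rho>0 : borel_measurable G" unfolding \<rho>0_def using Lx0 by simp
 define g where "g z i = fst z \<bullet> w i - snd z" for z :: "'b \<times> real" and i
 \<comment> \<open>The best among \<open>x0\<close> and the first \<open>k\<close> selections.
   Starting from \<open>x0\<close> keeps all values above the integrable function
   \<open>h 0\<close>.\<close>
 define sel where "sel = rec_nat (%i. (x0 i, \<rho>0 i)) (%k s i. if g (e k i) i > g (s i) i then e k i else s i)"
 have sel0: "sel 0 i = (x0 i, \<rho>0 i)" and selS: "sel (Suc k) i = (if g (e k i) i > g (sel k i) i then e k i else sel k i)" for k i
  unfolding sel_def by simp_all
 have fs: "(%i. fst (f i)) : borel_measurable G" "(%i. snd (f i)) : borel_measurable G"
  if "f : borel_measurable G" for f :: "'a => 'b \<times> real"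
  using measurable_compose[OF that borel_measurable_continuous_onI[of fst, OF continuous_on_fst[OF continuous_on_id]]]
   measurable_compose[OF that borel_measurable_continuous_onI[of snd, OF continuous_on_snd[OF continuous_on_id]]] by auto
 have gm: "(%i. g (f i) i) : borel_measurable G" if "f : borel_measurable G" for f
  unfolding g_def using fs[OF that] w(1) by simp
 have selm: "sel k : borel_measurable G" for k
 proof (induction k)
  case 0
  have "sel 0 = (%i. (x0 i, \<rho>0 i))" using sel0 by auto
  thus ?case using x0(1) \<rho>0m by simp
 next
  case (Suc k)
  have "sel (Suc k) = (%i. if g (e k i) i > g (sel k i) i then e k i else sel k i)" using selS by auto
  moreover have "(%i. if g (e k i) i > g (sel k i) i then e k i else sel k i) : borel_measurable G"
   using gm[OF Suc] gm[OF em[of k]] Suc em[of k] by (intro measurable_If) auto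
  ultimately show ?case by simp
 qed
 define h where "h k i = g (sel k i) i" for k i
 have hm: "h k : borel_measurable M" for k unfolding h_def using toM[OF gm[OF selm]] by simp
 have hS: "h (Suc k) i = max (h k i) (g (e k i) i)" for k i unfolding h_def selS by auto
 have hinc: "incseq (%k. h k i)" for i by (rule incseq_SucI) (simp add: hS)
 have h0: "h 0 i = x0 i \<bullet> w i - \<rho>0 i" for i unfolding h_def sel0 g_def by simp
 have h0i: "integrable M (h 0)" unfolding h0 using w(3) x0(2) by (simp add: \<rho>0_def[symmetric])
 have h0le: "h 0 i <= h k i" for k i using hinc unfolding incseq_def by simp
 define Z where "Z = {i:space G. \<bar>L (x0 i) i\<bar> ~= \<infinity>} \<inter> {i:space G. epi (%x. L x i) ~= {}}"
 have ZG: "Z : sets G" unfolding Z_def using sets_epi_nonempty[OF normal] Lx0 by (intro sets.Int) auto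
 have L0: "L (x0 i) i = ereal (\<rho>0 i)" if "i : Z" for i using that unfolding Z_def \<rho>0_def by (auto simp: ereal_real)
 have AEZ: "AE i in M. i : Z" using x0(3) AE_space
 proof eventually_elim
  case (elim i)
  hence "(x0 i, \<rho>0 i) : epi (%x. L x i)" by (auto simp: epi_def \<rho>0_def ereal_real)
  thus ?case using elim unfolding Z_def sp by auto
 qed
 have selL: "L (fst (sel k i)) i <= ereal (snd (sel k i))" if w: "i : Z" for k i
 proof (induction k)
  case 0
  thus ?case using L0[OF w] by (simp add: sel0)
 next
  case (Suc k)
  thus ?case using eL[of i k] w unfolding selS Z_def by auto
 qed
 define \<Phi> where "\<Phi> i = fenchel_conjugate (%x. L x i) (w i)" for i
 have \<Phi>m: "\<Phi> : borel_measurable M" unfolding \<Phi>_def by (rule toM[OF conjugate_measurable[OF normal w(1)]])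
 have \<Phi>le: "\<Phi> i <= ereal r" if w: "i : Z" and r: "!!k. h k i <= r" for i r
 proof -
  have "\<Phi> i = (SUP k. ereal (fst (e k i) \<bullet> w i - snd (e k i)))"
   unfolding \<Phi>_def by (rule esup) (use w in \<open>auto simp: Z_def\<close>)
  also have "\<dots> <= ereal r"
  proof (rule SUP_least)
   fix k
   have "g (e k i) i <= r" using r[of "Suc k"] unfolding hS by simp
   thus "ereal (fst (e k i) \<bullet> w i - snd (e k i)) <= ereal r" unfolding g_def by simp
  qed
  finally show ?thesis .
 qed
 have h0\<Phi>: "ereal (h 0 i) <= \<Phi> i" if "i : Z" for i
  unfolding h0 \<Phi>_def by (rule Fenchel_Young[of "%x. L x i" "x0 i"]) (rule L0[OF that])
 let ?\<kappa> = "\<kappa> - (LINT i|M. h 0 i)"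
 have step: "(\<integral>\<^sup>+i. ennreal (h k i - h 0 i) \<partial>M) <= ennreal ?\<kappa>" for k
 proof -
  \<comment> \<open>On \<open>B j\<close> the current selection is bounded by \<open>j\<close> and
    therefore admissible in \<open>bound\<close>; these sets increase to \<open>Z\<close>.\<close>
  define B where "B j = Z \<inter> {i:space G. norm (fst (sel k i)) <= real j & \<bar>snd (sel k i)\<bar> <= real j}" for j :: nat
  have BG: "B j : sets G" for j unfolding B_def using ZG fs[OF selm[of k]] by (intro sets.Int) auto
  define u where "u j i = (if i : B j then ennreal (h k i - h 0 i) else 0)" for j i
  have um: "u j : borel_measurable M" for j unfolding u_def using hm GM[OF BG]
   by (intro measurable_If) auto
  have ubound: "(\<integral>\<^sup>+i. u j i \<partial>M) <= ennreal ?\<kappa>" for j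
  proof -
   define \<xi> where "\<xi> i = (if i : B j then fst (sel k i) else 0)" for i
   define \<rho> where "\<rho> i = (if i : B j then snd (sel k i) else 0)" for i
   have m: "\<xi> : borel_measurable G" "\<rho> : borel_measurable G"
    unfolding \<xi>_def \<rho>_def using fs[OF selm[of k]] BG by (auto intro!: measurable_If)
   have b: "norm (\<xi> i) <= real j" "\<bar>\<rho> i\<bar> <= real j" for i unfolding \<xi>_def \<rho>_def B_def by auto
   have Lb: "L (\<xi> i) i <= ereal (\<rho> i)" if "i : B j" for i
    unfolding \<xi>_def \<rho>_def using that selL[of i k] by (simp add: B_def)
   define f where "f i = (if i : B j then \<xi> i \<bullet> w i - \<rho> i else x0 i \<bullet> w i - real_of_ereal (L (x0 i) i))" for i
   have fh: "f i = (if i : B j then h k i else h 0 i)" for i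
    unfolding f_def h0 \<rho>0_def by (simp add: \<xi>_def \<rho>_def h_def g_def)
   have fm: "f : borel_measurable M" unfolding fh using hm GM[OF BG] by (intro measurable_If) auto
   have fi: "integrable M f"
   proof (rule Bochner_Integration.integrable_bound[of M "%i. real j * norm (w i) + real j + \<bar>h 0 i\<bar>", OF _ fm])
    show "integrable M (%i. real j * norm (w i) + real j + \<bar>h 0 i\<bar>)" using w(2) h0i by simp
    show "AE i in M. norm (f i) <= norm (real j * norm (w i) + real j + \<bar>h 0 i\<bar>)"
    proof (rule AE_I2)
     fix i
     have "\<bar>\<xi> i \<bullet> w i\<bar> <= norm (\<xi> i) * norm (w i)" by (rule Cauchy_Schwarz_ineq2)
     also have "\<dots> <= real j * norm (w i)" using b by (intro mult_right_mono) auto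
     finally have "\<bar>\<xi> i \<bullet> w i - \<rho> i\<bar> <= real j * norm (w i) + real j" using b(2)[of i] by linarith
     moreover have "0 <= real j * norm (w i)" by simp
     moreover have "~ i : B j ==> f i = h 0 i" by (simp add: fh)
     moreover have "i : B j ==> f i = \<xi> i \<bullet> w i - \<rho> i" by (simp add: f_def)
     ultimately show "norm (f i) <= norm (real j * norm (w i) + real j + \<bar>h 0 i\<bar>)"
      unfolding real_norm_def by (cases "i : B j") linarith+
    qed
   qed
   have "(\<integral>\<^sup>+i. u j i \<partial>M) = (\<integral>\<^sup>+i. ennreal (f i - h 0 i) \<partial>M)"
    by (rule nn_integral_cong) (auto simp: u_def fh)
   also have "\<dots> = ennreal (LINT i|M. f i - h 0 i)"
    by (rule nn_integral_eq_integral[OF Bochner_Integration.integrable_diff[OF fi h0i]], rule AE_I2)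
     (use h0le in \<open>simp add: fh\<close>)
   also have "(LINT i|M. f i - h 0 i) = (LINT i|M. f i) - (LINT i|M. h 0 i)"
    by (rule Bochner_Integration.integral_diff[OF fi h0i])
   also have "ennreal \<dots> <= ennreal ?\<kappa>"
    using bound[of "B j" \<xi> \<rho> "real j", OF BG m b Lb] unfolding f_def by (intro ennreal_leI) simp
   finally show ?thesis .
  qed
  have "incseq u"
  proof (rule incseq_SucI, rule le_funI)
   fix j i
   have "B j <= B (Suc j)" unfolding B_def by auto
   thus "u j i <= u (Suc j) i" unfolding u_def by auto
  qed
  hence mono: "(\<integral>\<^sup>+i. (SUP j. u j i) \<partial>M) = (SUP j. \<integral>\<^sup>+i. u j i \<partial>M)"
   using um by (rule nn_integral_monotone_convergence_SUP)
  have "(\<integral>\<^sup>+i. ennreal (h k i - h 0 i) \<partial>M) <= (\<integral>\<^sup>+i. (SUP j. u j i) \<partial>M)"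
  proof (rule nn_integral_mono_AE, use AEZ in eventually_elim)
   fix i assume w: "i : Z"
   obtain j :: nat where "max (norm (fst (sel k i))) \<bar>snd (sel k i)\<bar> <= real j" using real_arch_simple by blast
   hence "i : B j" unfolding B_def using w by (auto simp: Z_def)
   hence "u j i = ennreal (h k i - h 0 i)" unfolding u_def by simp
   thus "ennreal (h k i - h 0 i) <= (SUP j. u j i)" by (metis SUP_upper UNIV_I)
  qed
  also have "\<dots> <= ennreal ?\<kappa>" unfolding mono using ubound by (rule SUP_least)
  finally show ?thesis .
 qed
 define v where "v i = (SUP k. ennreal (h k i - h 0 i))" for i
 have vm: "v : borel_measurable M" unfolding v_def using hm by (intro borel_measurable_SUP) auto
 have "incseq (%k i. ennreal (h k i - h 0 i))"
  by (rule incseq_SucI, rule le_funI) (auto simp: hS intro!: ennreal_leI)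
 hence "(\<integral>\<^sup>+i. v i \<partial>M) = (SUP k. \<integral>\<^sup>+i. ennreal (h k i - h 0 i) \<partial>M)"
  unfolding v_def using hm by (intro nn_integral_monotone_convergence_SUP) auto
 also have "\<dots> <= ennreal ?\<kappa>" using step by (rule SUP_least)
 finally have vle: "(\<integral>\<^sup>+i. v i \<partial>M) <= ennreal ?\<kappa>" .
 hence vfin: "(\<integral>\<^sup>+i. v i \<partial>M) ~= \<infinity>" by (auto simp: top_unique)
 have vAE: "AE i in M. v i = ennreal (enn2real (v i))"
  using nn_integral_PInf_AE[OF vm vfin] by eventually_elim (simp add: ennreal_enn2real_if)
 have vint: "(\<integral>\<^sup>+i. ennreal (enn2real (v i)) \<partial>M) <= ennreal ?\<kappa>"
  using vle nn_integral_cong_AE[OF vAE] by simp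
 have vi: "integrable M (%i. enn2real (v i))"
 proof (rule integrableI_bounded)
  have "(\<integral>\<^sup>+i. ennreal (enn2real (v i)) \<partial>M) < \<infinity>" using vint by (rule le_less_trans) simp
  thus "(\<integral>\<^sup>+i. ennreal (norm (enn2real (v i))) \<partial>M) < \<infinity>" by simp
 qed (use vm in simp)
 \<comment> \<open>With the empty set, \<open>bound\<close> tests \<open>x0\<close> itself.\<close>
 have \<kappa>0: "0 <= ?\<kappa>"
 proof -
  have "(LINT i|M. (if i : {} then (0::'b) \<bullet> w i - 0 else x0 i \<bullet> w i - real_of_ereal (L (x0 i) i))) <= \<kappa>"
   by (rule bound[of "{}" "%_. 0" "%_. 0" 0]) auto
  thus ?thesis unfolding h0 \<rho>0_def by simp
 qed
 have vle': "(LINT i|M. enn2real (v i)) <= ?\<kappa>"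
  using vint \<kappa>0 unfolding nn_integral_eq_integral[OF vi AE_I2[OF enn2real_nonneg]] by (simp add: ennreal_le_iff)
 have up: "AE i in M. \<Phi> i <= ereal (h 0 i + enn2real (v i))" using vAE AEZ
 proof eventually_elim
  case (elim i)
  show ?case
  proof (rule \<Phi>le[OF elim(2)])
   fix k
   have "ennreal (h k i - h 0 i) <= v i" unfolding v_def by (rule SUP_upper) simp
   hence "ennreal (h k i - h 0 i) <= ennreal (enn2real (v i))" using elim(1) by simp
   hence "h k i - h 0 i <= enn2real (v i)" by (subst (asm) ennreal_le_iff) auto
   thus "h k i <= h 0 i + enn2real (v i)" by simp
  qed
 qed
 have lo: "AE i in M. ereal (h 0 i) <= \<Phi> i" using AEZ by eventually_elim (rule h0\<Phi>)
 have hv: "integrable M (%i. h 0 i + enn2real (v i))" using h0i vi by simp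
 note res = integrable_between[OF \<Phi>m h0i hv lo up]
 show "integrable M (%i. real_of_ereal (fenchel_conjugate (%x. L x i) (w i)))"
  using res(1) unfolding \<Phi>_def .
 show "AE i in M. fenchel_conjugate (%x. L x i) (w i) = ereal (real_of_ereal (fenchel_conjugate (%x. L x i) (w i)))"
  using res(2) unfolding \<Phi>_def .
 have "(LINT i|M. real_of_ereal (\<Phi> i)) <= (LINT i|M. h 0 i + enn2real (v i))"
 proof (rule integral_mono_AE[OF res(1) hv])
  show "AE i in M. real_of_ereal (\<Phi> i) <= h 0 i + enn2real (v i)" using up res(2)
   by eventually_elim (metis ereal_less_eq(3))
 qed
 also have "\<dots> = (LINT i|M. h 0 i) + (LINT i|M. enn2real (v i))" by (rule Bochner_Integration.integral_add[OF h0i vi])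
 also have "\<dots> <= \<kappa>" using vle' by simp
 finally show "(LINT i|M. real_of_ereal (fenchel_conjugate (%x. L x i) (w i))) <= \<kappa>" unfolding \<Phi>_def .
qed

section \<open>Integral functionals on a product of two spaces\<close>

locale control_integrand = S: rv_space M S S' qS + C: rv_space M C C' qC
 for M :: "'a measure" and S S' :: "('a => real^'n) set" and qS and C C' :: "('a => real^'m) set" and qC +
 fixes L :: "(real^'n) \<times> (real^'m) => 'a => ereal"
 assumes normal: "convex_normal_integrand M L" and proper: "proper_E_on M S C L"
begin

definition Lz :: "('a => real^'n) \<times> ('a => real^'m) => 'a => ereal" where
 "Lz z w = L (fst z w, snd z w) w"

definition lz :: "('a => real^'n) \<times> ('a => real^'m) => 'a => real" where
 "lz z w = real_of_ereal (Lz z w)"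

definition val :: "('a => real^'n) \<times> ('a => real^'m) => real" where
 "val z = (LINT w|M. lz z w)"

definition D where "D = dom_E M S C L"

definition pairing :: "('a => real^'n) \<times> ('a => real^'m) => ('a => real^'n) \<times> ('a => real^'m) => real" where
 "pairing z v = (LINT w|M. fst z w \<bullet> fst v w) + (LINT w|M. snd z w \<bullet> snd v w)"

lemma Lz_measurable: "z : S \<times> C ==> Lz z : borel_measurable M"
 unfolding Lz_def using S.S_measurable[of "fst z"] C.S_measurable[of "snd z"]
 by (intro normal_integrand_measurable[OF normal]) auto

lemma D_iff: "z : D \<longleftrightarrow> z : S \<times> C & ext_expectation M (Lz z) < \<infinity>"
 unfolding D_def dom_E_def integral_functional_def Lz_def by (cases z) auto

lemma D_sub: "z : D ==> z : S \<times> C"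
 by (simp add: D_iff)

lemma D_fst: "z : D ==> fst z : S" and D_snd: "z : D ==> snd z : C"
 using D_sub[of z] by (auto simp: mem_Times_iff)

lemma ext_expectation_Lz: "z : S \<times> C ==> ext_expectation M (Lz z) > - \<infinity>"
 using proper unfolding proper_E_on_def integral_functional_def Lz_def by (cases z) auto

lemma D_integrable: "z : D ==> integrable M (lz z)"
 and D_finite: "z : D ==> AE w in M. Lz z w = ereal (lz z w)"
 unfolding lz_def using ext_expectation_finiteD[OF Lz_measurable] ext_expectation_Lz D_iff by auto

lemma D_expectation: "z : D ==> ext_expectation M (Lz z) = ereal (val z)"
 unfolding val_def by (rule ext_expectation_integrable[OF D_integrable D_finite])

lemma D_I:
 assumes z: "z : S \<times> C" and \<rho>: "integrable M \<rho>" "AE w in M. Lz z w <= ereal (\<rho> w)"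
 shows "z : D" "val z <= (LINT w|M. \<rho> w)"
proof -
 show zD: "z : D" unfolding D_iff using z ext_expectation_less_top[OF \<rho>] by simp
 show "val z <= (LINT w|M. \<rho> w)" unfolding val_def
 proof (rule integral_mono_AE[OF D_integrable[OF zD] \<rho>(1)])
  show "AE w in M. lz z w <= \<rho> w" using \<rho>(2) D_finite[OF zD] by eventually_elim simp
 qed
qed

lemma D_nonempty: "EX z. z : D"
 using proper unfolding proper_E_on_def D_def by auto

lemma AE_proper: "AE w in M. ALL x. L x w ~= - \<infinity>"
proof -
 obtain z where z: "z : D" using D_nonempty by blast
 show ?thesis using D_finite[OF z] AE_space
 proof eventually_elim
  case (elim w)
  hence "L (fst z w, snd z w) w = ereal (lz z w)" by (simp add: Lz_def)
  from closed_convex_proper[OF closed_epi[OF normal elim(2)] convex_epi[OF normal elim(2)], of "(fst z w, snd z w)", OF this]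
  show ?case by blast
 qed
qed

lemma D_AE_eq:
 assumes z: "z : D" and y: "y : S \<times> C" and eq: "AE w in M. fst y w = fst z w" "AE w in M. snd y w = snd z w"
 shows "y : D" "val y <= val z"
proof -
 have "AE w in M. Lz y w <= ereal (lz z w)" using eq D_finite[OF z] by eventually_elim (simp add: Lz_def)
 from D_I[OF y D_integrable[OF z] this] show "y : D" "val y <= val z" unfolding val_def by auto
qed

lemma D_convex_comb:
 assumes z: "z : D" "y : D" and uv: "0 <= u" "0 <= v" "u + v = 1"
 shows "u *\<^sub>R z + v *\<^sub>R y : D" "val (u *\<^sub>R z + v *\<^sub>R y) <= u * val z + v * val y"
proof -
 have mem: "u *\<^sub>R z + v *\<^sub>R y : S \<times> C" using z[THEN D_fst] z[THEN D_snd]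
  by (auto simp: mem_Times_iff intro!: S.S_add S.S_scale C.S_add C.S_scale)
 have int: "integrable M (%w. u * lz z w + v * lz y w)" using D_integrable[OF z(1)] D_integrable[OF z(2)] by simp
 have "AE w in M. Lz (u *\<^sub>R z + v *\<^sub>R y) w <= ereal (u * lz z w + v * lz y w)"
  using D_finite[OF z(1)] D_finite[OF z(2)] AE_space
 proof eventually_elim
  case (elim w)
  have "u *\<^sub>R ((fst z w, snd z w), lz z w) + v *\<^sub>R ((fst y w, snd y w), lz y w) : epi (%x. L x w)"
   using elim by (intro convexD[OF convex_epi[OF normal]] uv) (auto simp: epi_def Lz_def)
  thus ?case by (simp add: epi_def Lz_def)
 qed
 note D_I[OF mem int this]
 moreover have "(LINT w|M. u * lz z w + v * lz y w) = u * val z + v * val y"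
  unfolding val_def using D_integrable[OF z(1)] D_integrable[OF z(2)] by simp
 ultimately show "u *\<^sub>R z + v *\<^sub>R y : D" "val (u *\<^sub>R z + v *\<^sub>R y) <= u * val z + v * val y" by auto
qed

definition paste where
 "paste A z y = (%w. if w : A then fst z w else fst y w, %w. if w : A then snd z w else snd y w)"

lemma paste_mem:
 assumes z: "z : S \<times> C" "y : S \<times> C" and A: "A : sets M"
 shows "paste A z y : S \<times> C"
proof -
 have "(%w. if w : A then fst z w else fst y w) = (%w. indicator A w *\<^sub>R (fst z - fst y) w) + fst y" by (auto simp: fun_eq_iff)
 moreover have "\<dots> : S" using z A by (intro S.S_add S.S_cut S.S_diff) auto
 moreover have "(%w. if w : A then snd z w else snd y w) = (%w. indicator A w *\<^sub>R (snd z - snd y) w) + snd y" by (auto simp: fun_eq_iff)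
 moreover have "\<dots> : C" using z A by (intro C.S_add C.S_cut C.S_diff) auto
 ultimately show ?thesis unfolding paste_def by simp
qed

lemma paste_Lz: "Lz (paste A z y) w = (if w : A then Lz z w else Lz y w)"
 unfolding Lz_def paste_def by simp

lemma integrable_if: "integrable M f ==> integrable M g ==> A : sets M ==> integrable M (%w. if w : A then f w else g w)"
 for f g :: "'a => real"
proof (rule Bochner_Integration.integrable_bound[of M "%w. \<bar>f w\<bar> + \<bar>g w\<bar>"])
 assume "integrable M f" "integrable M g" "A : sets M"
 thus "integrable M (%w. \<bar>f w\<bar> + \<bar>g w\<bar>)" "(%w. if w : A then f w else g w) : borel_measurable M"
  by (auto intro!: measurable_If)
qed auto

lemma paste_D:
 assumes z: "z : D" "y : D" and A: "A : sets M"
 shows "paste A z y : D" "val (paste A z y) = (LINT w|M. (if w : A then lz z w else lz y w))"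
proof -
 have "AE w in M. Lz (paste A z y) w <= ereal (if w : A then lz z w else lz y w)"
  using D_finite[OF z(1)] D_finite[OF z(2)] by eventually_elim (simp add: paste_Lz)
 from D_I(1)[OF paste_mem[OF D_sub[OF z(1)] D_sub[OF z(2)] A] integrable_if[OF D_integrable[OF z(1)] D_integrable[OF z(2)] A] this]
 show "paste A z y : D" .
 show "val (paste A z y) = (LINT w|M. (if w : A then lz z w else lz y w))"
  unfolding val_def by (intro Bochner_Integration.integral_cong refl) (simp add: lz_def paste_Lz)
qed

lemma integral_if_tendsto:
 fixes f g :: "'a => real"
 assumes f: "integrable M f" "integrable M g" and B: "!!n::nat. B n : sets M"
  and ae: "AE h in M. \<forall>\<^sub>F n in sequentially. h ~: B n"
 shows "(%n. \<integral>h. (if h : space M - B n then f h else g h) \<partial>M) \<longlonglongrightarrow> (LINT h|M. f h)"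
proof (rule integral_dominated_convergence[where w="%h. \<bar>f h\<bar> + \<bar>g h\<bar>"])
 show "f : borel_measurable M" using f by auto
 show "(%h. if h : space M - B n then f h else g h) : borel_measurable M" for n
  by (rule borel_measurable_integrable, rule integrable_if[OF f]) (use B in auto)
 show "integrable M (%h. \<bar>f h\<bar> + \<bar>g h\<bar>)" using f by simp
 show "AE h in M. (%n. if h : space M - B n then f h else g h) \<longlonglongrightarrow> f h" using ae AE_space
 proof eventually_elim
  case (elim h)
  from elim(1) have "\<forall>\<^sub>F n in sequentially. (if h : space M - B n then f h else g h) = f h"
   by eventually_elim (use elim(2) in simp)
  thus ?case by (rule tendsto_eventually)
 qed
qed auto

lemma pairing_paste:
 assumes z: "z : S \<times> C" "y : S \<times> C" and v: "v : S' \<times> C'" and A: "A : sets M"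
 shows "pairing (paste A z y) v =
  (LINT w|M. (if w : A then fst z w \<bullet> fst v w else fst y w \<bullet> fst v w)) + (LINT w|M. (if w : A then snd z w \<bullet> snd v w else snd y w \<bullet> snd v w))"
 unfolding pairing_def paste_def
 by (intro arg_cong2[where f="(+)"] Bochner_Integration.integral_cong refl) auto

text \<open>The argument of the integral functional is modified on small sets that carry the singular parts.\<close>

lemma eliminate_singular:
 assumes lS: "continuous_functional S qS lS" "singular_on M S lS"
  and lC: "continuous_functional C qC lC" "singular_on M C lC"
  and v: "v : S' \<times> C'"
  and lower: "!!y. y : D ==> c + pairing y v + lS (fst y) + lC (snd y) <= val y"
  and z: "z : D" "z' : D"
 shows "c + pairing z v + lS (fst z') + lC (snd z') <= val z"
proof -
 have linS: "linear_functional_on S lS" and linC: "linear_functional_on C lC"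
  using lS lC unfolding continuous_functional_def by auto
 have zS: "fst z : S" "fst z' : S" and zC: "snd z : C" "snd z' : C" using z D_fst D_snd by auto
 define \<epsilon> where "\<epsilon> n = 1 / real (Suc n)" for n
 have \<epsilon>: "\<epsilon> n > 0" for n unfolding \<epsilon>_def by simp
 \<comment> \<open>One exceptional set serves both functionals and the difference
   \<open>z - z'\<close>. The sets need not decrease in \<open>n\<close>; their geometric
   probabilities prepare the Borel--Cantelli lemma.\<close>
 have "EX B. B : sets M & measure M B <= 2 * (1/2)^n &
   (ALL E. E : sets M --> E \<inter> B = {} --> \<bar>lS (%w. indicator E w *\<^sub>R (fst z - fst z') w)\<bar> <= \<epsilon> n &
    \<bar>lC (%w. indicator E w *\<^sub>R (snd z - snd z') w)\<bar> <= \<epsilon> n)" for n :: nat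
 proof -
  have h: "(1/2::real)^n > 0" by simp
  obtain B1 where B1: "B1 : sets M" "measure M B1 < (1/2)^n"
   "!!E. E : sets M ==> E \<inter> B1 = {} ==> \<bar>lS (%w. indicator E w *\<^sub>R (fst z - fst z') w)\<bar> <= \<epsilon> n"
   by (rule S.singular_exhaust[OF lS S.S_diff[OF zS] \<epsilon>[of n] h]) blast
  obtain B2 where B2: "B2 : sets M" "measure M B2 < (1/2)^n"
   "!!E. E : sets M ==> E \<inter> B2 = {} ==> \<bar>lC (%w. indicator E w *\<^sub>R (snd z - snd z') w)\<bar> <= \<epsilon> n"
   by (rule C.singular_exhaust[OF lC C.S_diff[OF zC] \<epsilon>[of n] h]) blast
  have "measure M (B1 \<union> B2) <= 2 * (1/2)^n" using measure_Un_le[OF B1(1) B2(1)] B1(2) B2(2) by linarith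
  moreover have "\<bar>lS (%w. indicator E w *\<^sub>R (fst z - fst z') w)\<bar> <= \<epsilon> n &
    \<bar>lC (%w. indicator E w *\<^sub>R (snd z - snd z') w)\<bar> <= \<epsilon> n" if "E : sets M" "E \<inter> (B1 \<union> B2) = {}" for E
   using B1(3)[OF that(1)] B2(3)[OF that(1)] that(2) by (simp add: Int_Un_distrib)
  ultimately show ?thesis using B1(1) B2(1) by (intro exI[of _ "B1 \<union> B2"]) auto
 qed
 hence "ALL n. EX B. B : sets M & measure M B <= 2 * (1/2)^n &
   (ALL E. E : sets M --> E \<inter> B = {} --> \<bar>lS (%w. indicator E w *\<^sub>R (fst z - fst z') w)\<bar> <= \<epsilon> n &
    \<bar>lC (%w. indicator E w *\<^sub>R (snd z - snd z') w)\<bar> <= \<epsilon> n)" by (rule allI)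
 from choice[OF this] obtain B where B0: "ALL n. B n : sets M & measure M (B n) <= 2 * (1/2)^n &
   (ALL E. E : sets M --> E \<inter> B n = {} --> \<bar>lS (%w. indicator E w *\<^sub>R (fst z - fst z') w)\<bar> <= \<epsilon> n &
    \<bar>lC (%w. indicator E w *\<^sub>R (snd z - snd z') w)\<bar> <= \<epsilon> n)" by (rule exE)
 have B: "B n : sets M" and Bm: "measure M (B n) <= 2 * (1/2)^n" for n using B0[THEN spec, of n] by auto
 have small: "\<bar>lS (%w. indicator (space M - B n) w *\<^sub>R (fst z - fst z') w)\<bar> <= \<epsilon> n"
  "\<bar>lC (%w. indicator (space M - B n) w *\<^sub>R (snd z - snd z') w)\<bar> <= \<epsilon> n" for n
 proof -
  have "space M - B n : sets M" "(space M - B n) \<inter> B n = {}" using B[of n] by auto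
  with B0[THEN spec, of n, THEN conjunct2, THEN conjunct2, THEN spec, of "space M - B n"]
  show "\<bar>lS (%w. indicator (space M - B n) w *\<^sub>R (fst z - fst z') w)\<bar> <= \<epsilon> n"
   "\<bar>lC (%w. indicator (space M - B n) w *\<^sub>R (snd z - snd z') w)\<bar> <= \<epsilon> n" by blast+
 qed
 have sm: "summable (%n. measure M (B n))"
 proof (rule summable_comparison_test[OF _ summable_mult[OF summable_geometric[of "1/2::real"], of 2]])
  show "EX N. ALL n>=N. norm (measure M (B n)) <= 2 * (1/2)^n" using Bm by auto
 qed simp
 have "AE w in M. \<forall>\<^sub>F n in sequentially. w : space M - B n"
  by (rule borel_cantelli_AE1[OF B _ sm]) (simp add: less_top[symmetric])
 hence ae: "AE w in M. \<forall>\<^sub>F n in sequentially. w ~: B n" by eventually_elim (auto elim: eventually_mono)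
 \<comment> \<open>Equal to \<open>z\<close> off \<open>B n\<close> and to \<open>z'\<close> on it:
   the integrals tend to those of \<open>z\<close>, while the singular functionals stay within
   \<open>\<epsilon> n\<close> of their values at \<open>z'\<close>.\<close>
 define y where "y n = paste (space M - B n) z z'" for n
 have yD: "y n : D" and yval: "val (y n) = (LINT w|M. (if w : space M - B n then lz z w else lz z' w))" for n
  unfolding y_def using paste_D[OF z, of "space M - B n"] B by auto
 have ypair: "pairing (y n) v = (LINT w|M. (if w : space M - B n then fst z w \<bullet> fst v w else fst z' w \<bullet> fst v w)) +
  (LINT w|M. (if w : space M - B n then snd z w \<bullet> snd v w else snd z' w \<bullet> snd v w))" for n
  unfolding y_def by (rule pairing_paste) (use z D_sub v B in auto)
 have lim1: "(%n. val (y n)) \<longlonglongrightarrow> val z"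
  unfolding yval unfolding val_def[of z] by (rule integral_if_tendsto[OF D_integrable[OF z(1)] D_integrable[OF z(2)] B ae])
 have v': "fst v : S'" "snd v : C'" using v by auto
 have lim2: "(%n. pairing (y n) v) \<longlonglongrightarrow> pairing z v"
  unfolding ypair unfolding pairing_def[of z]
  by (intro tendsto_add integral_if_tendsto[OF S.pairing_integrable S.pairing_integrable B ae]
    integral_if_tendsto[OF C.pairing_integrable C.pairing_integrable B ae] zS zC v')
 have yS: "lS (fst (y n)) = lS (fst z') + lS (%w. indicator (space M - B n) w *\<^sub>R (fst z - fst z') w)" for n
 proof -
  have cut: "(%w. indicator (space M - B n) w *\<^sub>R (fst z - fst z') w) : S" using zS B by (intro S.S_cut S.S_diff) auto
  have "fst (y n) = fst z' + (%w. indicator (space M - B n) w *\<^sub>R (fst z - fst z') w)"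
   unfolding y_def paste_def by (auto simp: fun_eq_iff indicator_def)
  thus ?thesis using linear_functional_onD(1)[OF linS zS(2) cut] by simp
 qed
 have yC: "lC (snd (y n)) = lC (snd z') + lC (%w. indicator (space M - B n) w *\<^sub>R (snd z - snd z') w)" for n
 proof -
  have cut: "(%w. indicator (space M - B n) w *\<^sub>R (snd z - snd z') w) : C" using zC B by (intro C.S_cut C.S_diff) auto
  have "snd (y n) = snd z' + (%w. indicator (space M - B n) w *\<^sub>R (snd z - snd z') w)"
   unfolding y_def paste_def by (auto simp: fun_eq_iff indicator_def)
  thus ?thesis using linear_functional_onD(1)[OF linC zC(2) cut] by simp
 qed
 have ineq: "c + pairing (y n) v + lS (fst z') + lC (snd z') - 2 * \<epsilon> n <= val (y n)" for n
  using lower[OF yD[of n]] small[of n] unfolding yS[of n] yC[of n] by linarith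
 have \<epsilon>0: "\<epsilon> \<longlonglongrightarrow> 0" unfolding \<epsilon>_def using LIMSEQ_inverse_real_of_nat by (simp add: inverse_eq_divide)
 have "(%n. c + pairing (y n) v + lS (fst z') + lC (snd z') - 2 * \<epsilon> n) \<longlonglongrightarrow> c + pairing z v + lS (fst z') + lC (snd z') - 2 * 0"
  by (intro tendsto_diff tendsto_add tendsto_const tendsto_mult_left lim2 \<epsilon>0)
 from LIMSEQ_le[OF this lim1] ineq show ?thesis by auto
qed

text \<open>Fatou's lemma needs an integrable minorant, which is not given. It is produced from the
  sequence: a subsequence is dominated in the solid spaces, so choosing at each point an index that
  nearly minimizes the integrand gives again an element of \<open>D\<close>, whose integrand lowered
  by 1 lies below all others.\<close>

lemma val_lsc_bounded:
 assumes s: "!!n::nat. s n : D" "!!n. val (s n) <= r" and z: "z : S \<times> C"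
  and lim: "(%n. qS (fst (s n) - fst z)) \<longlonglongrightarrow> 0" "(%n. qC (snd (s n) - snd z)) \<longlonglongrightarrow> 0"
 shows "z : D" "val z <= r"
proof -
 have zS: "fst z : S" and zC: "snd z : C" using z by auto
 obtain r1 gS where r1: "strict_mono r1" "gS : S" "AE w in M. ALL n i. \<bar>fst (s (r1 n)) w $ i\<bar> <= gS w $ i"
  "AE w in M. (%n. fst (s (r1 n)) w) \<longlonglongrightarrow> fst z w"
  by (rule S.dominated_subseq[OF D_fst[OF s(1)] zS lim(1)]) blast
 have lim': "(%n. qC (snd (s (r1 n)) - snd z)) \<longlonglongrightarrow> 0" using LIMSEQ_subseq_LIMSEQ[OF lim(2) r1(1)] by (simp add: o_def)
 obtain r2 gC where r2: "strict_mono r2" "gC : C" "AE w in M. ALL n i. \<bar>snd (s (r1 (r2 n))) w $ i\<bar> <= gC w $ i"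
  "AE w in M. (%n. snd (s (r1 (r2 n))) w) \<longlonglongrightarrow> snd z w"
  by (rule C.dominated_subseq[of "%n. snd (s (r1 n))", OF D_snd[OF s(1)] zC lim']) blast
 define x where "x n = s (r1 (r2 n))" for n
 have xD: "x n : D" and xval: "val (x n) <= r" for n using s unfolding x_def by auto
 have xfin: "AE w in M. ALL n. Lz (x n) w = ereal (lz (x n) w)" using D_finite[OF xD] by (simp add: AE_all_countable)
 have domS: "AE w in M. ALL n i. \<bar>fst (x n) w $ i\<bar> <= gS w $ i" using r1(3) unfolding x_def by eventually_elim blast
 have domC: "AE w in M. ALL n i. \<bar>snd (x n) w $ i\<bar> <= gC w $ i" using r2(3) unfolding x_def .
 have conv: "AE w in M. (%n. (fst (x n) w, snd (x n) w)) \<longlonglongrightarrow> (fst z w, snd z w)" using r1(4) r2(4)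
 proof eventually_elim
  case (elim w)
  have "(%n. fst (s (r1 (r2 n))) w) \<longlonglongrightarrow> fst z w" using LIMSEQ_subseq_LIMSEQ[OF elim(1) r2(1)] by (simp add: o_def)
  thus ?case unfolding x_def using elim(2) by (rule tendsto_Pair)
 qed
 have above: "\<forall>\<^sub>F n in sequentially. m < lz (x n) w"
  if fin: "ALL n. Lz (x n) w = ereal (lz (x n) w)" and c: "(%n. (fst (x n) w, snd (x n) w)) \<longlonglongrightarrow> (fst z w, snd z w)"
   and m: "ereal m < Lz z w" and w: "w : space M" for w m
 proof -
  have "open (- epi (%x. L x w))" using closed_epi[OF normal w] by (rule open_Compl)
  moreover have "((fst z w, snd z w), m) : - epi (%x. L x w)" using m by (simp add: epi_def Lz_def)
  moreover have "(%n. ((fst (x n) w, snd (x n) w), m)) \<longlonglongrightarrow> ((fst z w, snd z w), m)" by (intro tendsto_Pair c tendsto_const)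
  ultimately have "\<forall>\<^sub>F n in sequentially. ((fst (x n) w, snd (x n) w), m) : - epi (%x. L x w)"
   by (rule topological_tendstoD[rotated])
  thus ?thesis
  proof eventually_elim
   case (elim n)
   hence "ereal m < Lz (x n) w" by (simp add: epi_def Lz_def)
   thus ?case using fin by simp
  qed
 qed
 define h where "h w = (INF n. Lz (x n) w)" for w
 have hm: "h : borel_measurable M" unfolding h_def using Lz_measurable[OF D_sub[OF xD]] by (intro borel_measurable_INF) auto
 \<comment> \<open>The slack 1 guarantees that such an index exists wherever \<open>h\<close> is
   finite.\<close>
 define \<iota> where "\<iota> w = (LEAST n. Lz (x n) w <= h w + 1)" for w
 have \<iota>m: "\<iota> : measurable M (count_space UNIV)"
  unfolding \<iota>_def using hm Lz_measurable[OF D_sub[OF xD]] by (intro measurable_Least) (auto simp: pred_def)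
 define y where "y = (%w. fst (x (\<iota> w)) w, %w. snd (x (\<iota> w)) w)"
 have y1: "(%w. fst (x (\<iota> w)) w) : S"
 proof (rule solidD[OF S.S_space r1(2)])
  show "(%w. fst (x (\<iota> w)) w) : borel_measurable M"
   by (rule measurable_compose_countable[where f="%n w. fst (x n) w", OF S.S_measurable[OF D_fst[OF xD]] \<iota>m])
  show "AE w in M. ALL i. \<bar>fst (x (\<iota> w)) w $ i\<bar> <= \<bar>gS w $ i\<bar>" using domS
   by eventually_elim (blast intro: order_trans abs_ge_self)
 qed
 have y2: "(%w. snd (x (\<iota> w)) w) : C"
 proof (rule solidD[OF C.S_space r2(2)])
  show "(%w. snd (x (\<iota> w)) w) : borel_measurable M"
   by (rule measurable_compose_countable[where f="%n w. snd (x n) w", OF C.S_measurable[OF D_snd[OF xD]] \<iota>m])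
  show "AE w in M. ALL i. \<bar>snd (x (\<iota> w)) w $ i\<bar> <= \<bar>gC w $ i\<bar>" using domC
   by eventually_elim (blast intro: order_trans abs_ge_self)
 qed
 have yy: "y : S \<times> C" unfolding y_def using y1 y2 by simp
 have Ly: "Lz y w = Lz (x (\<iota> w)) w" for w unfolding y_def Lz_def by simp
 have yh: "AE w in M. Lz y w <= h w + 1 & h w <= ereal (lz (x 0) w)" using xfin conv AE_proper AE_space
 proof eventually_elim
  case (elim w)
  have "Lz z w ~= - \<infinity>" using elim(3) by (simp add: Lz_def)
  then obtain m where m: "ereal m < Lz z w" using ereal_dense2[of "- \<infinity>" "Lz z w"] by auto
  obtain N where N: "!!n. n >= N ==> m < lz (x n) w" using above[OF elim(1,2) m elim(4)] unfolding eventually_sequentially by blast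
  \<comment> \<open>The infimum is finite: from \<open>N\<close> on the values exceed
    \<open>m\<close>, and before that there are finitely many of them.\<close>
  define b where "b = Min (insert m ((%n. lz (x n) w) ` {..N}))"
  have "b <= lz (x n) w" for n
  proof (cases "n <= N")
   case True
   thus ?thesis unfolding b_def by (intro Min_le) auto
  next
   case False
   have "b <= m" unfolding b_def by (intro Min_le) auto
   thus ?thesis using N[of n] False by simp
  qed
  hence lo: "ereal b <= h w" unfolding h_def using elim(1) by (intro INF_greatest) simp
  have up: "h w <= ereal (lz (x 0) w)" unfolding h_def using elim(1) by (metis INF_lower UNIV_I)
  have "h w < h w + 1" using lo up by (cases "h w") auto
  then obtain n where "Lz (x n) w < h w + 1" unfolding h_def INF_less_iff by blast
  hence "Lz (x n) w <= h w + 1" by simp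
  hence "Lz (x (\<iota> w)) w <= h w + 1" unfolding \<iota>_def by (rule LeastI)
  thus ?case using up unfolding Ly by simp
 qed
 have "AE w in M. Lz y w <= ereal (lz (x 0) w + 1)" using yh
 proof eventually_elim
  case (elim w)
  have "Lz y w <= h w + 1" using elim by simp
  also have "\<dots> <= ereal (lz (x 0) w) + 1" using elim by (intro add_right_mono) simp
  finally show ?case by simp
 qed
 from D_I(1)[OF yy _ this] have yD: "y : D" using D_integrable[OF xD[of 0]] by simp
 \<comment> \<open>The integrable minorant for Fatou's lemma; the subtracted 1 is the slack in the
   choice of the index.\<close>
 define k where "k w = lz y w - 1" for w
 have ki: "integrable M k" unfolding k_def using D_integrable[OF yD] by simp
 have kle: "AE w in M. ALL n. k w <= lz (x n) w" using yh D_finite[OF yD] xfin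
 proof eventually_elim
  case (elim w)
  show ?case
  proof
   fix n
   have "ereal (lz y w) <= h w + 1" using elim by simp
   also have "\<dots> <= Lz (x n) w + 1" unfolding h_def by (intro add_right_mono INF_lower) simp
   also have "\<dots> = ereal (lz (x n) w + 1)" using elim by simp
   finally show "k w <= lz (x n) w" unfolding k_def by simp
  qed
 qed
 define U where "U w = liminf (%n. ennreal (lz (x n) w - k w))" for w
 have um: "(%w. ennreal (lz (x n) w - k w)) : borel_measurable M" for n
  using D_integrable[OF xD[of n]] ki by simp
 have Um: "U : borel_measurable M" unfolding U_def using um by (rule borel_measurable_liminf)
 have each: "(\<integral>\<^sup>+w. ennreal (lz (x n) w - k w) \<partial>M) = ennreal (val (x n) - (LINT w|M. k w))" for n
 proof -
  have i: "integrable M (%w. lz (x n) w - k w)" using D_integrable[OF xD[of n]] ki by simp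
  have "AE w in M. 0 <= lz (x n) w - k w" using kle by eventually_elim simp
  from nn_integral_eq_integral[OF i this] show ?thesis
   unfolding val_def using D_integrable[OF xD[of n]] ki by simp
 qed
 have "(\<integral>\<^sup>+w. U w \<partial>M) <= liminf (%n. \<integral>\<^sup>+w. ennreal (lz (x n) w - k w) \<partial>M)"
  unfolding U_def using um by (rule nn_integral_liminf)
 also have "\<dots> <= liminf (%n::nat. ennreal (r - (LINT w|M. k w)))"
  unfolding each using xval by (intro Liminf_mono always_eventually allI ennreal_leI) simp
 also have "\<dots> = ennreal (r - (LINT w|M. k w))" by (simp add: Liminf_const)
 finally have Ule: "(\<integral>\<^sup>+w. U w \<partial>M) <= ennreal (r - (LINT w|M. k w))" .
 hence Ufin: "(\<integral>\<^sup>+w. U w \<partial>M) ~= \<infinity>" by (auto simp: top_unique)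
 have UAE: "AE w in M. U w = ennreal (enn2real (U w))"
  using nn_integral_PInf_AE[OF Um Ufin] by eventually_elim (simp add: ennreal_enn2real_if)
 have Uint: "(\<integral>\<^sup>+w. ennreal (enn2real (U w)) \<partial>M) <= ennreal (r - (LINT w|M. k w))"
  using Ule nn_integral_cong_AE[OF UAE] by simp
 have Ui: "integrable M (%w. enn2real (U w))"
 proof (rule integrableI_bounded)
  have "(\<integral>\<^sup>+w. ennreal (enn2real (U w)) \<partial>M) < \<infinity>" using Uint by (rule le_less_trans) simp
  thus "(\<integral>\<^sup>+w. ennreal (norm (enn2real (U w))) \<partial>M) < \<infinity>" by simp
 qed (use Um in simp)
 have kr: "(LINT w|M. k w) <= r"
 proof -
  have "(LINT w|M. k w) <= val (x 0)" unfolding val_def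
   by (rule integral_mono_AE[OF ki D_integrable[OF xD]]) (use kle in eventually_elim, simp)
  thus ?thesis using xval[of 0] by simp
 qed
 have Ule': "(LINT w|M. enn2real (U w)) <= r - (LINT w|M. k w)"
  using Uint kr unfolding nn_integral_eq_integral[OF Ui AE_I2[OF enn2real_nonneg]] by (simp add: ennreal_le_iff)
 have "AE w in M. Lz z w <= ereal (k w + enn2real (U w))" using xfin conv UAE kle AE_space
 proof eventually_elim
  case (elim w)
  show ?case
  proof (rule ccontr)
   assume "~ ?thesis"
   hence "ereal (k w + enn2real (U w)) < Lz z w" by simp
   then obtain m where m: "ereal (k w + enn2real (U w)) < ereal m" "ereal m < Lz z w" using ereal_dense2 by blast
   have "\<forall>\<^sub>F n in sequentially. ennreal (m - k w) <= ennreal (lz (x n) w - k w)"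
    using above[OF elim(1,2) m(2) elim(5)] by eventually_elim (auto intro!: ennreal_leI)
   hence "ennreal (m - k w) <= U w" unfolding U_def by (rule Liminf_bounded)
   hence "ennreal (m - k w) <= ennreal (enn2real (U w))" using elim(3) by simp
   hence "m - k w <= enn2real (U w)" by (subst (asm) ennreal_le_iff) auto
   thus False using m(1) by simp
  qed
 qed
 from D_I[OF z _ this] have zz: "z : D" "val z <= (LINT w|M. k w + enn2real (U w))" using ki Ui by auto
 show "z : D" by fact
 show "val z <= r" using zz(2) Ule' ki Ui by simp
qed

text \<open>A subsequence realizing the lower limit eventually stays below any larger number, which
  reduces the claim to a uniform bound.\<close>

lemma val_lsc:
 assumes s: "!!n::nat. s n : S \<times> C" and z: "z : S \<times> C"
  and lim: "(%n. qS (fst (s n) - fst z)) \<longlonglongrightarrow> 0" "(%n. qC (snd (s n) - snd z)) \<longlonglongrightarrow> 0"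
 shows "ext_expectation M (Lz z) <= liminf (%n. ext_expectation M (Lz (s n)))"
proof (rule ccontr)
 let ?I = "%n. ext_expectation M (Lz (s n))"
 assume "~ ?thesis"
 hence "liminf ?I < ext_expectation M (Lz z)" by simp
 then obtain c where c: "liminf ?I < ereal c" "ereal c < ext_expectation M (Lz z)" using ereal_dense2 by blast
 obtain \<rho> where \<rho>: "strict_mono \<rho>" "(?I \<circ> \<rho>) \<longlonglongrightarrow> liminf ?I" using liminf_subseq_lim by blast
 obtain N where N: "!!n. n >= N ==> ?I (\<rho> n) < ereal c"
  using order_tendstoD(2)[OF \<rho>(2) c(1)] unfolding eventually_sequentially by auto
 define y where "y n = s (\<rho> (n + N))" for n
 have yD: "y n : D" for n unfolding D_iff y_def using s N[of "n + N"] by (auto intro: less_le_trans[of _ "ereal c"])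
 have yv: "val (y n) <= c" for n
  using N[of "n + N"] D_expectation[OF yD[of n]] unfolding y_def by simp
 have sub: "strict_mono (%n. \<rho> (n + N))" using \<rho>(1) by (auto simp: strict_mono_def)
 have "(%n. qS (fst (y n) - fst z)) \<longlonglongrightarrow> 0" "(%n. qC (snd (y n) - snd z)) \<longlonglongrightarrow> 0"
  using LIMSEQ_subseq_LIMSEQ[OF lim(1) sub] LIMSEQ_subseq_LIMSEQ[OF lim(2) sub] by (simp_all add: y_def o_def)
 from val_lsc_bounded[OF yD yv z this] have "z : D" "val z <= c" by auto
 thus False using c(2) D_expectation by simp
qed

text \<open>A bounded vector pasted with \<open>x0\<close> stays in \<open>D\<close> and keeps the
  measurability with respect to \<open>G\<close>, so the inequality for elements of \<open>D\<close>
  supplies all test pairs of the interchange.\<close>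

lemma conjugate_le:
 assumes G: "subalgebra M G" "convex_normal_integrand G L"
  and x0: "x0 : D" "fst x0 : borel_measurable G" "snd x0 : borel_measurable G"
  and v: "v : S' \<times> C'" "fst v : borel_measurable G" "snd v : borel_measurable G"
  and bound: "!!z. z : D ==> fst z : borel_measurable G ==> snd z : borel_measurable G ==> pairing z v - val z <= \<kappa>"
 shows "integrable M (%w. real_of_ereal (fenchel_conjugate (%x. L x w) (fst v w, snd v w)))"
  "AE w in M. fenchel_conjugate (%x. L x w) (fst v w, snd v w) = ereal (real_of_ereal (fenchel_conjugate (%x. L x w) (fst v w, snd v w)))"
  "(LINT w|M. real_of_ereal (fenchel_conjugate (%x. L x w) (fst v w, snd v w))) <= \<kappa>"
proof -
 have GM: "A : sets G ==> A : sets M" for A using G(1) unfolding subalgebra_def by blast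
 have toM: "f : borel_measurable G ==> f : borel_measurable M" for f :: "'a => 'z::topological_space"
  by (rule measurable_from_subalg[OF G(1)])
 have x0S: "fst x0 : S" and x0C: "snd x0 : C" using D_fst[OF x0(1)] D_snd[OF x0(1)] by auto
 have vS: "fst v : S'" and vC: "snd v : C'" using v by auto
 have wi: "integrable M (%w. (fst v w, snd v w))" 
  by (rule integrable_componentwise) (use S.S'_integrable[OF vS] C.S'_integrable[OF vC] in \<open>simp add: inner_prod_def\<close>)
 have x0w: "integrable M (%w. (fst x0 w, snd x0 w) \<bullet> (fst v w, snd v w))"
  using S.pairing_integrable[OF x0S vS] C.pairing_integrable[OF x0C vC] by simp
 have x0i: "integrable M (%w. real_of_ereal (L (fst x0 w, snd x0 w) w))"
  using D_integrable[OF x0(1)] unfolding lz_def Lz_def .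
 have x0f: "AE w in M. \<bar>L (fst x0 w, snd x0 w) w\<bar> ~= \<infinity>"
  using D_finite[OF x0(1)] by eventually_elim (simp add: Lz_def)
 have xG: "(%w. (fst x0 w, snd x0 w)) : borel_measurable G" "(%w. (fst v w, snd v w)) : borel_measurable G"
  using x0(2,3) v(2,3) by (auto intro: borel_measurable_Pair)
 have b: "(LINT w|M. (if w : B then \<xi> w \<bullet> (fst v w, snd v w) - \<rho> w
    else (fst x0 w, snd x0 w) \<bullet> (fst v w, snd v w) - real_of_ereal (L (fst x0 w, snd x0 w) w))) <= \<kappa>"
  if B: "B : sets G" and \<xi>: "\<xi> : borel_measurable G" and \<rho>: "\<rho> : borel_measurable G"
   and \<xi>c: "!!w. norm (\<xi> w) <= c" and \<rho>c: "!!w. \<bar>\<rho> w\<bar> <= c" and Lb: "!!w. w : B ==> L (\<xi> w) w <= ereal (\<rho> w)"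
  for B \<xi> \<rho> c
 proof -
  define y where "y = (%w. fst (\<xi> w), %w. snd (\<xi> w))"
  have ym: "fst y : borel_measurable G" "snd y : borel_measurable G" unfolding y_def
   using measurable_compose[OF \<xi> borel_measurable_continuous_onI[of fst, OF continuous_on_fst[OF continuous_on_id]]]
    measurable_compose[OF \<xi> borel_measurable_continuous_onI[of snd, OF continuous_on_snd[OF continuous_on_id]]] by auto
  have nf: "norm (fst y w) <= c" "norm (snd y w) <= c" for w
   using norm_fst_le[of "fst (\<xi> w)" "snd (\<xi> w)"] norm_snd_le[of "snd (\<xi> w)" "fst (\<xi> w)"] \<xi>c[of w]
   unfolding y_def by auto
  have yS: "fst y : S" and yC: "snd y : C"
   using S.S_bounded[OF toM[OF ym(1)] nf(1)] C.S_bounded[OF toM[OF ym(2)] nf(2)] by auto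
  have ySC: "y : S \<times> C" using yS yC by (simp add: mem_Times_iff)
  have \<rho>i: "integrable M \<rho>" by (rule S.integrable_const_bound[of _ c]) (use \<rho>c toM[OF \<rho>] in auto)
  define z where "z = paste B y x0"
  have zS: "z : S \<times> C" unfolding z_def by (rule paste_mem[OF ySC D_sub[OF x0(1)] GM[OF B]])
  have zi: "integrable M (%w. if w : B then \<rho> w else lz x0 w)" by (rule integrable_if[OF \<rho>i D_integrable[OF x0(1)] GM[OF B]])
  have "AE w in M. Lz z w <= ereal (if w : B then \<rho> w else lz x0 w)" using D_finite[OF x0(1)]
   by eventually_elim (use Lb in \<open>auto simp: z_def paste_def Lz_def y_def\<close>)
  from D_I[OF zS zi this] have zD: "z : D" and zv: "val z <= (LINT w|M. (if w : B then \<rho> w else lz x0 w))" by auto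
  have zm: "fst z : borel_measurable G" "snd z : borel_measurable G"
   unfolding z_def paste_def using ym x0(2,3) B by (auto intro!: measurable_If)
  have i1: "integrable M (%w. if w : B then fst y w \<bullet> fst v w else fst x0 w \<bullet> fst v w)"
   by (rule integrable_if[OF S.pairing_integrable[OF yS vS] S.pairing_integrable[OF x0S vS] GM[OF B]])
  have i2: "integrable M (%w. if w : B then snd y w \<bullet> snd v w else snd x0 w \<bullet> snd v w)"
   by (rule integrable_if[OF C.pairing_integrable[OF yC vC] C.pairing_integrable[OF x0C vC] GM[OF B]])
  have "(LINT w|M. (if w : B then \<xi> w \<bullet> (fst v w, snd v w) - \<rho> w
    else (fst x0 w, snd x0 w) \<bullet> (fst v w, snd v w) - real_of_ereal (L (fst x0 w, snd x0 w) w))) =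
   (LINT w|M. ((if w : B then fst y w \<bullet> fst v w else fst x0 w \<bullet> fst v w) +
    (if w : B then snd y w \<bullet> snd v w else snd x0 w \<bullet> snd v w)) - (if w : B then \<rho> w else lz x0 w))"
   by (intro Bochner_Integration.integral_cong refl) (auto simp: y_def inner_prod_def lz_def Lz_def)
  also have "\<dots> = pairing z v - (LINT w|M. (if w : B then \<rho> w else lz x0 w))"
   unfolding z_def pairing_paste[OF ySC D_sub[OF x0(1)] v(1) GM[OF B]]
   using i1 i2 zi by (simp add: Bochner_Integration.integral_diff Bochner_Integration.integral_add)
  also have "\<dots> <= pairing z v - val z" using zv by simp
  also have "\<dots> <= \<kappa>" by (rule bound[OF zD zm])
  finally show ?thesis .
 qed
 note res = S.conjugate_integral_le[OF G xG(1) x0i x0f xG(2) wi x0w b]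
 show "integrable M (%w. real_of_ereal (fenchel_conjugate (%x. L x w) (fst v w, snd v w)))"
  "AE w in M. fenchel_conjugate (%x. L x w) (fst v w, snd v w) = ereal (real_of_ereal (fenchel_conjugate (%x. L x w) (fst v w, snd v w)))"
  "(LINT w|M. real_of_ereal (fenchel_conjugate (%x. L x w) (fst v w, snd v w))) <= \<kappa>"
  by (rule res; assumption)+
qed

end

section \<open>Annihilators of adapted processes\<close>

text \<open>The integrability of a sum of products of an adapted process and an annihilating process follows
  from a one-sided bound: truncate at the first time, where truncation preserves adaptedness of all
  later components.\<close>

lemma (in prob_space) annihilating_sum_integrable:
 fixes x p :: "nat => 'a => 'b::euclidean_space"
 assumes sub: "!!t. t0 <= t ==> t < t0 + n ==> subalgebra M (F t)"
  and nest: "!!s t. t0 <= s ==> s <= t ==> t < t0 + n ==> subalgebra (F t) (F s)"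
  and x: "!!t. t0 <= t ==> t < t0 + n ==> x t : borel_measurable (F t)"
  and p: "!!t. t0 <= t ==> t < t0 + n ==> integrable M (p t)"
  and ann: "!!t \<xi> c. t0 <= t ==> t < t0 + n ==> \<xi> : borel_measurable (F t) ==> (!!h. norm (\<xi> h) <= c) ==>
   (LINT h|M. \<xi> h \<bullet> p t h) = 0"
  and z: "integrable M z" "AE h in M. (SUM t:{t0..<t0+n}. x t h \<bullet> p t h) <= z h"
 shows "integrable M (%h. SUM t:{t0..<t0+n}. x t h \<bullet> p t h) & (LINT h|M. (SUM t:{t0..<t0+n}. x t h \<bullet> p t h)) = 0"
 using assms
proof (induction n arbitrary: t0 x z)
 case 0
 thus ?case by simp
next
 case (Suc n)
 note sub = Suc.prems(1) and nest = Suc.prems(2) and x = Suc.prems(3) and p = Suc.prems(4) and ann = Suc.prems(5) and z = Suc.prems(6,7)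
 define Z where "Z h = (SUM t:{t0..<t0+Suc n}. x t h \<bullet> p t h)" for h
 have split: "Z h = x t0 h \<bullet> p t0 h + (SUM t:{Suc t0..<Suc t0+n}. x t h \<bullet> p t h)" for h
  unfolding Z_def by (subst sum.atLeast_Suc_lessThan) auto
 have xM: "x t : borel_measurable M" if "t0 <= t" "t < t0 + Suc n" for t
  using measurable_from_subalg[OF sub[OF that] x[OF that]] .
 have Zm: "Z : borel_measurable M" unfolding Z_def
  using xM p by (intro borel_measurable_sum borel_measurable_inner) auto
 define A where "A k = {h:space (F t0). norm (x t0 h) <= real k}" for k :: nat
 have t0: "t0 <= t0" "t0 < t0 + Suc n" by auto
 have AF: "A k : sets (F t0)" for k unfolding A_def using x[OF t0] by simp
 have spF: "space (F t0) = space M" using sub[OF t0] unfolding subalgebra_def by simp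
 have AFt: "A k : sets (F t)" if "t0 <= t" "t < t0 + Suc n" for k t
  using nest[OF order_refl that(1,2)] AF[of k] unfolding subalgebra_def by blast
 have AM: "A k : sets M" for k using sub[OF t0] AF unfolding subalgebra_def by blast
 have key: "integrable M (%h. indicator (A k) h * Z h) & (LINT h|M. indicator (A k) h * Z h) = 0" for k
 proof -
  define x' where "x' t h = indicator (A k) h *\<^sub>R x t h" for t h
  have x'm: "x' t : borel_measurable (F t)" if "t0 <= t" "t < t0 + Suc n" for t
   unfolding x'_def using x[OF that] AFt[OF that] by (intro borel_measurable_scaleR borel_measurable_indicator) auto
  have nx: "norm (x' t0 h) <= real k" for h unfolding x'_def A_def by (auto simp: indicator_def)
  have i0: "integrable M (%h. x' t0 h \<bullet> p t0 h)"
   by (rule integrable_inner_bounded[OF measurable_from_subalg[OF sub[OF t0] x'm[OF t0]] nx p[OF t0]])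
  have e0: "(LINT h|M. x' t0 h \<bullet> p t0 h) = 0" by (rule ann[OF t0 x'm[OF t0] nx])
  have IH: "integrable M (%h. SUM t:{Suc t0..<Suc t0+n}. x' t h \<bullet> p t h) & (LINT h|M. (SUM t:{Suc t0..<Suc t0+n}. x' t h \<bullet> p t h)) = 0"
  proof (rule Suc.IH)
   \<comment> \<open>After truncation the first term has an integrable bound; subtracting it leaves
     a one-sided bound for the remaining times.\<close>
   show "integrable M (%h. \<bar>z h\<bar> + real k * norm (p t0 h))" using z(1) p[OF t0] by simp
   show "AE h in M. (SUM t:{Suc t0..<Suc t0+n}. x' t h \<bullet> p t h) <= \<bar>z h\<bar> + real k * norm (p t0 h)" using z(2)
   proof eventually_elim
    case (elim h)
    have "(SUM t:{Suc t0..<Suc t0+n}. x' t h \<bullet> p t h) = indicator (A k) h * (SUM t:{Suc t0..<Suc t0+n}. x t h \<bullet> p t h)"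
     unfolding x'_def by (cases "h : A k") simp_all
    also have "\<dots> = indicator (A k) h * Z h - x' t0 h \<bullet> p t0 h" unfolding split x'_def by (simp add: algebra_simps)
    also have "indicator (A k) h * Z h <= \<bar>z h\<bar>" using elim unfolding Z_def by (auto simp: indicator_def)
    finally have "(SUM t:{Suc t0..<Suc t0+n}. x' t h \<bullet> p t h) <= \<bar>z h\<bar> - x' t0 h \<bullet> p t0 h" by simp
    moreover have "\<bar>x' t0 h \<bullet> p t0 h\<bar> <= real k * norm (p t0 h)"
     using Cauchy_Schwarz_ineq2[of "x' t0 h" "p t0 h"] mult_right_mono[OF nx[of h] norm_ge_zero[of "p t0 h"]] by linarith
    ultimately show ?case by linarith
   qed
   show "(LINT h|M. \<xi> h \<bullet> p t h) = 0"
    if "Suc t0 <= t" "t < Suc t0 + n" "\<xi> : borel_measurable (F t)" "!!h. norm (\<xi> h) <= c" for t \<xi> c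
    by (rule ann[OF _ _ that(3,4)]) (use that(1,2) in auto)
  qed (use sub nest x'm p in auto)
  have eq: "indicator (A k) h * Z h = x' t0 h \<bullet> p t0 h + (SUM t:{Suc t0..<Suc t0+n}. x' t h \<bullet> p t h)" for h
   unfolding split x'_def by (simp add: algebra_simps sum_distrib_left)
  show ?thesis unfolding eq using i0 e0 IH by simp
 qed
 \<comment> \<open>A vanishing integral turns the one-sided bound into an L1 bound that does not
   depend on \<open>k\<close>: the modulus is twice the positive part minus the function, and the
   positive part is at most the modulus of \<open>z\<close>.\<close>
 have bound: "(\<integral>\<^sup>+h. ennreal (indicator (A k) h * \<bar>Z h\<bar>) \<partial>M) <= ennreal (2 * (LINT h|M. \<bar>z h\<bar>))" for k
 proof -
  have i: "integrable M (%h. indicator (A k) h * \<bar>Z h\<bar>)"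
   using integrable_abs[OF conjunct1[OF key[of k]]] by (simp add: abs_mult)
  have "(LINT h|M. indicator (A k) h * \<bar>Z h\<bar>) <= (LINT h|M. 2 * \<bar>z h\<bar> - indicator (A k) h * Z h)"
  proof (rule integral_mono_AE[OF i])
   show "integrable M (%h. 2 * \<bar>z h\<bar> - indicator (A k) h * Z h)" using z(1) key[of k] by simp
   show "AE h in M. indicator (A k) h * \<bar>Z h\<bar> <= 2 * \<bar>z h\<bar> - indicator (A k) h * Z h"
    using z(2)[folded Z_def] by eventually_elim (auto simp: indicator_def)
  qed
  also have "\<dots> = 2 * (LINT h|M. \<bar>z h\<bar>)" using z(1) key[of k] by simp
  finally show ?thesis using nn_integral_eq_integral[OF i] by (simp add: ennreal_leI)
 qed
 have Zi: "integrable M Z"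
 proof (rule integrableI_bounded[OF Zm])
  have inc: "incseq (%k h. ennreal (indicator (A k) h * \<bar>Z h\<bar>))"
   by (rule incseq_SucI, rule le_funI) (auto simp: A_def indicator_def intro!: ennreal_leI)
  have "(\<integral>\<^sup>+h. ennreal (norm (Z h)) \<partial>M) <= (\<integral>\<^sup>+h. (SUP k. ennreal (indicator (A k) h * \<bar>Z h\<bar>)) \<partial>M)"
  proof (rule nn_integral_mono)
   fix h assume "h : space M"
   moreover obtain k :: nat where "norm (x t0 h) <= real k" using real_arch_simple by blast
   ultimately have "h : A k" unfolding A_def spF by simp
   hence "ennreal (norm (Z h)) = ennreal (indicator (A k) h * \<bar>Z h\<bar>)" by simp
   also have "\<dots> <= (SUP k. ennreal (indicator (A k) h * \<bar>Z h\<bar>))" by (rule SUP_upper) simp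
   finally show "ennreal (norm (Z h)) <= (SUP k. ennreal (indicator (A k) h * \<bar>Z h\<bar>))" .
  qed
  also have "\<dots> = (SUP k. \<integral>\<^sup>+h. ennreal (indicator (A k) h * \<bar>Z h\<bar>) \<partial>M)"
   using Zm AM by (intro nn_integral_monotone_convergence_SUP[OF inc]) auto
  also have "\<dots> <= ennreal (2 * (LINT h|M. \<bar>z h\<bar>))" using bound by (rule SUP_least)
  finally show "(\<integral>\<^sup>+h. ennreal (norm (Z h)) \<partial>M) < \<infinity>" by (rule le_less_trans) simp
 qed
 have "(%k. \<integral>h. indicator (A k) h * Z h \<partial>M) \<longlonglongrightarrow> (LINT h|M. Z h)"
 proof (rule integral_dominated_convergence[where w="%h. \<bar>Z h\<bar>"])
  show "AE h in M. (%k. indicator (A k) h * Z h) \<longlonglongrightarrow> Z h"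
  proof (rule AE_I2)
   fix h assume w: "h : space M"
   obtain k :: nat where k: "norm (x t0 h) <= real k" using real_arch_simple by blast
   have "\<forall>\<^sub>F j in sequentially. indicator (A j) h * Z h = Z h"
    unfolding eventually_sequentially using w k by (intro exI[of _ k]) (auto simp: A_def spF indicator_def)
   thus "(%k. indicator (A k) h * Z h) \<longlonglongrightarrow> Z h" by (rule tendsto_eventually)
  qed
  show "(%h. indicator (A k) h * Z h) : borel_measurable M" for k using key[of k] by auto
 qed (use Zm Zi in \<open>auto simp: indicator_def\<close>)
 hence "(LINT h|M. Z h) = 0" using key by (simp add: LIMSEQ_const_iff)
 thus ?case using Zi unfolding Z_def by simp
qed

section \<open>Weak duality\<close>

text \<open>Discrete integration by parts. The general upper limit makes the induction possible; its
  boundary terms vanish at \<open>n = T\<close> by the zero extension of \<open>y\<close>.\<close>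

lemma adjoint_summation_by_parts:
 "(SUM t=0..n. (X t, U t) \<bullet> adjoint_term T A B y t w) =
  zero_ext T y (Suc n) w \<bullet> (X n + A (Suc n) w *v X n + B (Suc n) w *v U n) - zero_ext T y 0 w \<bullet> X 0 -
  (SUM s=1..n. zero_ext T y s w \<bullet> (X s - X (s - 1) - A s w *v X (s - 1) - B s w *v U (s - 1)))"
proof (induction n)
 case 0
 show ?case
  by (simp add: adjoint_term_def inner_add_right inner_diff_right inner_transpose_mult inner_commute del: transpose_matrix_vector)
next
 case (Suc n)
 show ?case unfolding sum.atLeast0_atMost_Suc Suc
  by (simp add: adjoint_term_def inner_add_right inner_diff_right inner_transpose_mult inner_commute del: transpose_matrix_vector)
qed

lemma adjoint_summation_by_parts_T:
 "(SUM t=0..T. (X t, U t) \<bullet> adjoint_term T A B y t w) =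
  - (SUM s=1..T. y s w \<bullet> (X s - X (s - 1) - A s w *v X (s - 1) - B s w *v U (s - 1)))"
proof -
 have "(SUM s=1..T. zero_ext T y s w \<bullet> (X s - X (s - 1) - A s w *v X (s - 1) - B s w *v U (s - 1))) =
  (SUM s=1..T. y s w \<bullet> (X s - X (s - 1) - A s w *v X (s - 1) - B s w *v U (s - 1)))"
  by (intro sum.cong refl) (simp add: zero_ext_def)
 thus ?thesis unfolding adjoint_summation_by_parts by (simp add: zero_ext_def)
qed

locale control = S: rv_space M S S' qS + C: rv_space M C C' qC
 for M :: "'a measure" and S S' :: "('a => real^'n) set" and qS and C C' :: "('a => real^'m) set" and qC +
 fixes T :: nat and F :: "nat => 'a measure"
  and A :: "nat => 'a => real^'n^'n" and B :: "nat => 'a => real^'m^'n"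
  and L :: "nat => (real^'n) \<times> (real^'m) => 'a => ereal"
 assumes filt: "finite_filtration M T F"
  and ES: "t <= T ==> cond_exp M (F t) ` S <= S" and EC: "t <= T ==> cond_exp M (F t) ` C <= C"
  and A_meas: "t : {1..T} ==> A t : borel_measurable (F t)" and B_meas: "t : {1..T} ==> B t : borel_measurable (F t)"
  and A_S: "t : {1..T} ==> x : S ==> (%w. A t w *v x w) : S"
  and B_C: "t : {1..T} ==> u : C ==> (%w. B t w *v u w) : S"
  and normal: "t <= T ==> convex_normal_integrand M (L t)" and proper: "t <= T ==> proper_E_on M S C (L t)"
begin

lemma sub: "t <= T ==> subalgebra M (F t)" and nested: "s <= t ==> t <= T ==> subalgebra (F t) (F s)"
 using filt unfolding finite_filtration_def by auto

lemma toM: "t <= T ==> f : borel_measurable (F t) ==> f : borel_measurable M"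
 by (rule measurable_from_subalg[OF sub])

lemma toF: "s <= t ==> t <= T ==> f : borel_measurable (F s) ==> f : borel_measurable (F t)"
 by (rule measurable_from_subalg[OF nested])

lemma integrand: "t <= T ==> control_integrand M S S' qS C C' qC (L t)"
 by (intro control_integrand.intro control_integrand_axioms.intro S.rv_space_axioms C.rv_space_axioms normal proper)

lemma A_adjoint: "t : {1..T} ==> y : S' ==> (%w. transpose (A t w) *v y w) : S'"
 by (rule matrix_adjoint_mem[OF S.rv_space_axioms S.rv_space_axioms]) (auto intro!: toM[of t] A_meas A_S)

lemma B_adjoint: "t : {1..T} ==> y : S' ==> (%w. transpose (B t w) *v y w) : C'"
 by (rule matrix_adjoint_mem[OF C.rv_space_axioms S.rv_space_axioms]) (auto intro!: toM[of t] B_meas B_C)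

lemma zero_ext_mem: "y : sequences_in T S' ==> zero_ext T y t : S'"
 using S.S'_zero unfolding zero_ext_def sequences_in_def by (auto simp: zero_fun_def)

lemma adjoint_mem:
 assumes y: "y : sequences_in T S'" and t: "t <= T"
 shows "(%w. fst (adjoint_term T A B y t w)) : S'" "(%w. snd (adjoint_term T A B y t w)) : C'"
proof -
 let ?z = "zero_ext T y"
 have z: "?z s : S'" for s by (rule zero_ext_mem[OF y])
 have "(%w. transpose (A (t+1) w) *v ?z (t+1) w) : S' & (%w. transpose (B (t+1) w) *v ?z (t+1) w) : C'"
 proof (cases "t < T")
  case True
  thus ?thesis using A_adjoint[OF _ z] B_adjoint[OF _ z] by auto
 next
  \<comment> \<open>At the last time the matrices have index \<open>T + 1\<close>, about which
    nothing is known, but they act on the zero extension.\<close>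
  case False
  hence "?z (t+1) = (%w. 0)" using t by (auto simp: zero_ext_def)
  thus ?thesis using S.S'_zero C.S'_zero by (simp add: zero_fun_def)
 qed
 hence zA: "(%w. transpose (A (t+1) w) *v ?z (t+1) w) : S'" and zB: "(%w. transpose (B (t+1) w) *v ?z (t+1) w) : C'" by auto
 have "?z (t+1) - ?z t + (%w. transpose (A (t+1) w) *v ?z (t+1) w) : S'" by (intro S.S'_add S.S'_diff z zA)
 thus "(%w. fst (adjoint_term T A B y t w)) : S'" unfolding adjoint_term_def by (simp add: plus_fun_def fun_diff_def)
 show "(%w. snd (adjoint_term T A B y t w)) : C'" unfolding adjoint_term_def using zB by simp
qed

lemma annihilatorD:
 assumes "p : annihilator M T F S S' C C'" "t <= T"
 shows "(%w. fst (p t w)) : S'" "(%w. snd (p t w)) : C'"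
 using assms unfolding annihilator_def by auto

lemma pair_integrable:
 assumes "(%w. fst (f w)) : S'" "(%w. snd (f w)) : C'"
 shows "integrable M f"
proof -
 have "integrable M (%w. (fst (f w), 0::real^'m) + (0::real^'n, snd (f w)))"
  by (rule Bochner_Integration.integrable_add[OF
     integrable_bounded_linear[OF bounded_linear_Pair[OF bounded_linear_ident bounded_linear_zero] S.S'_integrable[OF assms(1)]]
     integrable_bounded_linear[OF bounded_linear_Pair[OF bounded_linear_zero bounded_linear_ident] C.S'_integrable[OF assms(2)]]])
 thus ?thesis by simp
qed

text \<open>The annihilating process is tested with the adapted strategy that equals
  \<open>\<xi>\<close> at time \<open>t\<close> and \<open>0\<close> at all other times.\<close>

lemma annihilator_orthogonal:
 assumes p: "p : annihilator M T F S S' C C'" and t: "t <= T"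
  and \<xi>: "\<xi> : borel_measurable (F t)" "!!w. norm (\<xi> w) <= c"
 shows "(LINT w|M. \<xi> w \<bullet> p t w) = 0"
proof -
 define X where "X s w = (if s = t then fst (\<xi> w) else 0)" for s w
 define U where "U s w = (if s = t then snd (\<xi> w) else 0)" for s w
 have m: "(%w. fst (\<xi> w)) : borel_measurable (F t)" "(%w. snd (\<xi> w)) : borel_measurable (F t)"
  using measurable_compose[OF \<xi>(1) borel_measurable_continuous_onI[of fst, OF continuous_on_fst[OF continuous_on_id]]]
   measurable_compose[OF \<xi>(1) borel_measurable_continuous_onI[of snd, OF continuous_on_snd[OF continuous_on_id]]] by auto
 have nf: "norm (fst (\<xi> w)) <= c" "norm (snd (\<xi> w)) <= c" for w
  using norm_fst_le[of "fst (\<xi> w)" "snd (\<xi> w)"] norm_snd_le[of "snd (\<xi> w)" "fst (\<xi> w)"] \<xi>(2)[of w] by auto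
 have "X s : borel_measurable (F s)" "U s : borel_measurable (F s)" for s
  unfolding X_def U_def using m by (cases "s = t", auto)+
 moreover have "X s : S" "U s : C" for s
  using S.S_bounded[OF toM[OF t m(1)] nf(1)] C.S_bounded[OF toM[OF t m(2)] nf(2)] S.S_zero C.S_zero
  unfolding X_def U_def by (cases "s = t", auto simp: zero_fun_def)+
 ultimately have "(X, U) : adapted_strategies T F S C" unfolding adapted_strategies_def adapted_processes_def by auto
 hence "(LINT w|M. (SUM s=0..T. (X s w, U s w) \<bullet> p s w)) = 0" using p unfolding annihilator_def by blast
 moreover have "(SUM s=0..T. (X s w, U s w) \<bullet> p s w) = \<xi> w \<bullet> p t w" for w
 proof -
  have "(SUM s=0..T. (X s w, U s w) \<bullet> p s w) = (SUM s=0..T. if s = t then \<xi> w \<bullet> p t w else 0)"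
   by (intro sum.cong refl) (auto simp: X_def U_def inner_prod_def)
  thus ?thesis using t by simp
 qed
 ultimately show ?thesis by simp
qed

text \<open>\<open>X\<close> and \<open>U\<close> are merely adapted, so their products with
  \<open>p\<close> are not integrable a priori. Fenchel--Young bounds the sum of these products from
  above by an integrable function, which is what \<open>annihilating_sum_integrable\<close>
  requires. The difference of the two values is then the integral of the nonnegative Fenchel--Young
  gaps.\<close>

lemma weak_duality:
 assumes xu: "(X, U) : oc_constraints M T F A B W" and y: "y : sequences_in T S'"
  and p: "p : annihilator M T F S S' C C'" and W: "!!t. t : {1..T} ==> W t : S"
  and fin: "oc_objective M T L X U < \<infinity>" "dual_objective M T A B W L p y > - \<infinity>"
 obtains a b where "oc_objective M T L X U = ereal a" "dual_objective M T A B W L p y = ereal b" "b <= a"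
  "a = b \<longleftrightarrow> (AE h in M. ALL t<=T. p t h - adjoint_term T A B y t h : subdifferential (%z. L t z h) (X t h, U t h))"
proof -
 have XU: "X t : borel_measurable (F t)" "U t : borel_measurable (F t)" if "t <= T" for t
  using xu that unfolding oc_constraints_def adapted_processes_def by auto
 have sys: "AE h in M. ALL t:{1..T}. X t h - X (t - 1) h = A t h *v X (t - 1) h + B t h *v U (t - 1) h + W t h"
  using xu unfolding oc_constraints_def system_equations_def by (intro AE_finite_allI) auto
 define x where "x t h = (X t h, U t h)" for t h
 define v where "v t h = p t h - adjoint_term T A B y t h" for t h
 have xF: "x t : borel_measurable (F t)" if "t <= T" for t unfolding x_def using XU[OF that] by (rule borel_measurable_Pair)
 have pi: "integrable M (p t)" if "t <= T" for t by (rule pair_integrable[OF annihilatorD[OF p that]])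
 have vi: "integrable M (v t)" if "t <= T" for t unfolding v_def using pi[OF that] pair_integrable[OF adjoint_mem[OF y that]] by simp
 define Lx where "Lx t h = L t (x t h) h" for t h
 define Lv where "Lv t h = fenchel_conjugate (%z. L t z h) (v t h)" for t h
 have Lxm: "Lx t : borel_measurable M" if "t <= T" for t
  unfolding Lx_def by (rule normal_integrand_measurable[OF normal[OF that] toM[OF that xF[OF that]]])
 have Lvm: "Lv t : borel_measurable M" if "t <= T" for t
  unfolding Lv_def by (rule conjugate_measurable[OF normal[OF that]]) (use vi[OF that] in auto)
 define w where "w h = (SUM t=1..T. W t h \<bullet> y t h)" for h
 have ym: "y t : S'" if "t : {1..T}" for t using y that unfolding sequences_in_def by blast
 have wm: "w : borel_measurable M" unfolding w_def
  using S.S_measurable[OF W] S.S'_measurable[OF ym] by (intro borel_measurable_sum borel_measurable_inner) auto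
 define P where "P h = (SUM t=0..T. Lx t h)" for h
 define N where "N h = - (ereal (w h) - (SUM t=0..T. Lv t h))" for h
 have Pm: "P : borel_measurable M" unfolding P_def using Lxm by (intro borel_measurable_ereal_sum) auto
 have Nm: "N : borel_measurable M" unfolding N_def
  using Lvm wm by (intro borel_measurable_uminus_ereal borel_measurable_ereal_diff borel_measurable_ereal_sum) auto
 have obj: "oc_objective M T L X U = ext_expectation M P" unfolding oc_objective_def P_def Lx_def x_def ..
 have dual: "dual_objective M T A B W L p y = - ext_expectation M N"
  unfolding dual_objective_def dual_value_def N_def w_def Lv_def v_def ..
 have Nfin: "ext_expectation M N < \<infinity>" using fin(2) unfolding dual by (cases "ext_expectation M N") auto
 obtain g1 where g1: "integrable M g1" "AE h in M. P h <= ereal (g1 h)"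
  using fin(1) unfolding obj by (rule ext_expectation_upper[OF Pm]) blast
 obtain g2 where g2: "integrable M g2" "AE h in M. N h <= ereal (g2 h)"
  by (rule ext_expectation_upper[OF Nm Nfin]) blast
 have properL: "AE h in M. ALL t:{0..T}. ALL z. L t z h ~= - \<infinity>"
  using control_integrand.AE_proper[OF integrand] by (intro AE_finite_allI) auto
 define l where "l t h = real_of_ereal (Lx t h)" for t h
 define c where "c t h = real_of_ereal (Lv t h)" for t h
 have realL: "AE h in M. ALL t:{0..T}. Lx t h = ereal (l t h)" using properL g1(2)
 proof eventually_elim
  case (elim h)
  have "P h ~= \<infinity>" using elim(2) by auto
  hence "Lx t h ~= \<infinity>" if "t : {0..T}" for t using that unfolding P_def sum_Pinfty by auto
  moreover have "Lx t h ~= - \<infinity>" if "t : {0..T}" for t using elim(1) that unfolding Lx_def by blast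
  ultimately show ?case unfolding l_def by (auto simp: ereal_real)
 qed
 have realC: "AE h in M. ALL t:{0..T}. Lv t h = ereal (c t h)" using realL g2(2)
 proof eventually_elim
  case (elim h)
  have lo: "Lv t h ~= - \<infinity>" if "t : {0..T}" for t
   using Fenchel_Young[of "%z. L t z h" "x t h" "l t h" "v t h"] elim(1) that unfolding Lv_def Lx_def by auto
  have "(SUM t=0..T. Lv t h) ~= \<infinity>" using elim(2) unfolding N_def by auto
  hence "Lv t h ~= \<infinity>" if "t : {0..T}" for t using that unfolding sum_Pinfty by auto
  thus ?case using lo unfolding c_def by (auto simp: ereal_real)
 qed
 have Preal: "AE h in M. P h = ereal (SUM t=0..T. l t h)" using realL by eventually_elim (simp add: P_def sum_ereal)
 have Nreal: "AE h in M. N h = ereal ((SUM t=0..T. c t h) - w h)" using realC by eventually_elim (simp add: N_def sum_ereal)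
 define Z where "Z h = (SUM t:{0..<0+Suc T}. x t h \<bullet> p t h)" for h
 have T': "{0..<0+Suc T} = {0..T}" by auto
 \<comment> \<open>Summation by parts and the system equations turn the adjoint terms into
   \<open>- w\<close>.\<close>
 have Zeq: "AE h in M. Z h = (SUM t=0..T. x t h \<bullet> v t h) - w h" using sys
 proof eventually_elim
  case (elim h)
  have "(SUM t=0..T. x t h \<bullet> v t h) = (SUM t=0..T. x t h \<bullet> p t h) - (SUM t=0..T. x t h \<bullet> adjoint_term T A B y t h)"
   unfolding v_def inner_diff_right sum_subtractf ..
  also have "(SUM t=0..T. x t h \<bullet> adjoint_term T A B y t h) =
   - (SUM s=1..T. y s h \<bullet> (X s h - X (s - 1) h - A s h *v X (s - 1) h - B s h *v U (s - 1) h))"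
   unfolding x_def by (rule adjoint_summation_by_parts_T)
  also have "(SUM s=1..T. y s h \<bullet> (X s h - X (s - 1) h - A s h *v X (s - 1) h - B s h *v U (s - 1) h)) = w h"
   unfolding w_def
  proof (intro sum.cong refl)
   fix s assume s: "s : {1..T}"
   have "X s h - X (s - 1) h - A s h *v X (s - 1) h - B s h *v U (s - 1) h = W s h"
    using elim s by auto
   thus "y s h \<bullet> (X s h - X (s - 1) h - A s h *v X (s - 1) h - B s h *v U (s - 1) h) = W s h \<bullet> y s h"
    by (simp add: inner_commute)
  qed
  finally show ?case unfolding Z_def T' by simp
 qed
 have FY: "AE h in M. ALL t:{0..T}. x t h \<bullet> v t h <= l t h + c t h &
   (l t h + c t h = x t h \<bullet> v t h \<longleftrightarrow> v t h : subdifferential (%z. L t z h) (x t h))" using realL realC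
 proof eventually_elim
  case (elim h)
  show ?case
  proof
   fix t assume t: "t : {0..T}"
   have 1: "L t (x t h) h = ereal (l t h)" "fenchel_conjugate (%z. L t z h) (v t h) = ereal (c t h)"
    using elim t unfolding Lx_def Lv_def by auto
   show "x t h \<bullet> v t h <= l t h + c t h &
    (l t h + c t h = x t h \<bullet> v t h \<longleftrightarrow> v t h : subdifferential (%z. L t z h) (x t h))"
    using Fenchel_Young[of "%z. L t z h" "x t h" "l t h" "v t h"]
     Fenchel_Young_eq[of "%z. L t z h" "x t h" "l t h" "v t h" "c t h"] 1 by auto
  qed
 qed
 define sl where "sl h = (SUM t=0..T. l t h)" for h
 define sn where "sn h = (SUM t=0..T. c t h) - w h" for h
 have Zle: "AE h in M. Z h <= sl h + sn h" using Zeq FY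
 proof eventually_elim
  case (elim h)
  have "(SUM t=0..T. x t h \<bullet> v t h) <= (SUM t=0..T. l t h + c t h)" using elim by (intro sum_mono) auto
  thus ?case using elim(1) unfolding sl_def sn_def by (simp add: sum.distrib)
 qed
 have slg: "AE h in M. sl h <= g1 h" using Preal g1(2) by eventually_elim (simp add: sl_def)
 have sng: "AE h in M. sn h <= g2 h" using Nreal g2(2) by eventually_elim (simp add: sn_def)
 have "AE h in M. Z h <= g1 h + g2 h" using Zle slg sng by eventually_elim simp
 moreover have "integrable M (%h. g1 h + g2 h)" using g1(1) g2(1) by simp
 ultimately have Zi: "integrable M Z & (LINT h|M. Z h) = 0"
  unfolding Z_def
  by (intro S.annihilating_sum_integrable[where ?t0.0=0 and n="Suc T" and F=F and z="%h. g1 h + g2 h"] sub nested xF pi annihilator_orthogonal[OF p]) auto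
 have slm: "sl : borel_measurable M" unfolding sl_def l_def using Lxm by (intro borel_measurable_sum borel_measurable_real_of_ereal) auto
 have snm: "sn : borel_measurable M" unfolding sn_def c_def using Lvm wm
  by (intro borel_measurable_diff borel_measurable_sum borel_measurable_real_of_ereal) auto
 have sli: "integrable M sl"
 proof (rule Bochner_Integration.integrable_bound[of M "%h. \<bar>g1 h\<bar> + \<bar>Z h\<bar> + \<bar>g2 h\<bar>", OF _ slm])
  show "integrable M (%h. \<bar>g1 h\<bar> + \<bar>Z h\<bar> + \<bar>g2 h\<bar>)" using g1(1) g2(1) Zi by simp
  show "AE h in M. norm (sl h) <= norm (\<bar>g1 h\<bar> + \<bar>Z h\<bar> + \<bar>g2 h\<bar>)" using Zle slg sng by eventually_elim auto
 qed
 have sni: "integrable M sn"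
 proof (rule Bochner_Integration.integrable_bound[of M "%h. \<bar>g1 h\<bar> + \<bar>Z h\<bar> + \<bar>g2 h\<bar>", OF _ snm])
  show "integrable M (%h. \<bar>g1 h\<bar> + \<bar>Z h\<bar> + \<bar>g2 h\<bar>)" using g1(1) g2(1) Zi by simp
  show "AE h in M. norm (sn h) <= norm (\<bar>g1 h\<bar> + \<bar>Z h\<bar> + \<bar>g2 h\<bar>)" using Zle slg sng by eventually_elim auto
 qed
 have e1: "oc_objective M T L X U = ereal (LINT h|M. sl h)"
  unfolding obj by (rule ext_expectation_integrable[OF sli]) (use Preal in \<open>simp add: sl_def\<close>)
 have e2: "dual_objective M T A B W L p y = ereal (- (LINT h|M. sn h))"
  unfolding dual using ext_expectation_integrable[OF sni, of N] Nreal by (simp add: sn_def)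
 \<comment> \<open>Almost surely the sum over time of the Fenchel--Young gaps.\<close>
 define G where "G h = sl h + sn h - Z h" for h
 have Gi: "integrable M G" unfolding G_def using sli sni Zi by simp
 have G0: "AE h in M. 0 <= G h" unfolding G_def using Zle by eventually_elim simp
 have Gint: "(LINT h|M. G h) = (LINT h|M. sl h) - (- (LINT h|M. sn h))" unfolding G_def using sli sni Zi by simp
 have "- (LINT h|M. sn h) <= (LINT h|M. sl h)" using integral_nonneg_AE[OF G0] Gint by simp
 moreover have "((LINT h|M. sl h) = - (LINT h|M. sn h)) \<longleftrightarrow>
  (AE h in M. ALL t<=T. p t h - adjoint_term T A B y t h : subdifferential (%z. L t z h) (X t h, U t h))"
 proof -
  have "((LINT h|M. sl h) = - (LINT h|M. sn h)) \<longleftrightarrow> (LINT h|M. G h) = 0" unfolding Gint by auto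
  also have "\<dots> \<longleftrightarrow> (AE h in M. G h = 0)" by (rule integral_nonneg_eq_0_iff_AE[OF Gi G0])
  also have "\<dots> \<longleftrightarrow> (AE h in M. ALL t<=T. v t h : subdifferential (%z. L t z h) (x t h))"
  proof (rule eventually_subst, use Zeq FY in eventually_elim)
   fix h assume Ze: "Z h = (SUM t=0..T. x t h \<bullet> v t h) - w h"
    and fy: "ALL t:{0..T}. x t h \<bullet> v t h <= l t h + c t h &
     (l t h + c t h = x t h \<bullet> v t h \<longleftrightarrow> v t h : subdifferential (%z. L t z h) (x t h))"
   have "G h = (SUM t=0..T. l t h + c t h - x t h \<bullet> v t h)"
    unfolding G_def sl_def sn_def Ze by (simp add: sum.distrib sum_subtractf)
   also have "\<dots> = 0 \<longleftrightarrow> (ALL t:{0..T}. l t h + c t h - x t h \<bullet> v t h = 0)"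
    using fy by (intro sum_nonneg_eq_0_iff) auto
   finally show "(G h = 0) = (ALL t<=T. v t h : subdifferential (%z. L t z h) (x t h))" using fy by auto
  qed
  finally show ?thesis unfolding v_def x_def .
 qed
 ultimately show ?thesis using that[OF e1 e2] by blast
qed

end

section \<open>A duality theorem in complete spaces\<close>

text \<open>Two nonnegative multiples merge into one multiple of a convex combination; if the total
  weight is \<open>0\<close>, any point with \<open>P\<close> will do.\<close>

lemma conic_combination:
 fixes a a' :: real and x x' :: "'v::real_vector"
 assumes aa: "0 <= a" "0 <= a'" and P: "P x" "P x'"
  and comb: "!!u v. 0 <= u ==> 0 <= v ==> u + v = (1::real) ==> P (u *\<^sub>R x + v *\<^sub>R x')"
 shows "EX y. (a + a') *\<^sub>R y = a *\<^sub>R x + a' *\<^sub>R x' & P y"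
proof (cases "a + a' = 0")
 case True
 hence "a = 0" "a' = 0" using aa by auto
 thus ?thesis using P by auto
next
 case False
 hence pos: "a + a' > 0" using aa by auto
 have "P ((a / (a + a')) *\<^sub>R x + (a' / (a + a')) *\<^sub>R x')"
  by (rule comb) (use aa pos in \<open>auto simp: add_divide_distrib[symmetric]\<close>)
 moreover have "(a + a') *\<^sub>R ((a / (a + a')) *\<^sub>R x + (a' / (a + a')) *\<^sub>R x') = a *\<^sub>R x + a' *\<^sub>R x'"
  using pos by (simp add: scaleR_add_right)
 ultimately show ?thesis by blast
qed

text \<open>Perturbations of the constraint \<open>x - xb \<in> G\<close> are only considered in the closed subspace \<open>H\<close>, where
  the value function is bounded above near \<open>0\<close> by the Robinson--Ursescu theorem; the separating functional
  is then extended to all of \<open>V\<close> together with a bound on a convex neighbourhood of \<open>0\<close>.\<close>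

lemma fspace_duality:
 assumes V: "fspace V q" and G: "subspace G" "G <= H" "seq_closed_in V q G"
  and H: "subspace H" "H <= V" "seq_closed_in V q H"
  and D: "D <= V"
  and conv: "!!x y u v. x : D ==> y : D ==> 0 <= u ==> 0 <= v ==> u + v = 1 ==>
   u *\<^sub>R x + v *\<^sub>R y : D & \<Phi> (u *\<^sub>R x + v *\<^sub>R y) <= u * \<Phi> x + v * \<Phi> y"
  and xb: "xb : D" and DH: "!!x. x : D ==> x - xb : H"
  and reach: "!!h. h : H ==> EX t>0. EX g:G. xb + t *\<^sub>R h + g : D"
  and closed: "!!s r x c. (!!n::nat. s n : D) ==> x : V ==> (%n. q (s n - x)) \<longlonglongrightarrow> 0 ==>
   (!!n. \<Phi> (s n) <= r n) ==> r \<longlonglongrightarrow> c ==> x : D & \<Phi> x <= c"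
  and lower: "!!g. g : G ==> xb + g : D ==> m <= \<Phi> (xb + g)"
 shows "EX v. continuous_functional V q v & (ALL g:G. v g = 0) & (ALL x:D. m + v (x - xb) <= \<Phi> x)"
proof -
 have GV: "G <= V" using G(2) H(2) by blast
 have sV: "subspace V" by (rule fspace_subspace[OF V])
 have fH: "fspace H q" by (rule fspace_closed_subspace[OF V H])
 have fG: "fspace G q" by (rule fspace_closed_subspace[OF V G(1) GV G(3)])
 have fGR: "fspace (G \<times> UNIV) (%z. q (fst z) + \<bar>snd z :: real\<bar>)" by (rule fspace_Times[OF fG fspace_real])
 \<comment> \<open>Relates a perturbation \<open>h\<close> to a correction \<open>g\<close> that
   restores feasibility, together with a bound for the increase of the cost.\<close>
 define R where "R = {(h, (g, r)). h : H & g : G & xb + h + g : D & \<Phi> (xb + h + g) <= \<Phi> xb + r}"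
 have "EX \<delta>>0. ALL h:H. q h < \<delta> --> (EX w. (h, w) : R & q (fst w) + \<bar>snd w\<bar> < 1)"
 proof (rule Robinson_Ursescu_ex[OF fH fGR])
  show "R <= H \<times> (G \<times> UNIV)" unfolding R_def by auto
  show "convex R"
  proof (rule convexI)
   fix z w and u v :: real assume zw: "z : R" "w : R" and uv: "0 <= u" "0 <= v" "u + v = 1"
   obtain h g r where z: "z = (h, (g, r))" "h : H" "g : G" "xb + h + g : D" "\<Phi> (xb + h + g) <= \<Phi> xb + r"
    using zw(1) unfolding R_def by auto
   obtain h' g' r' where w: "w = (h', (g', r'))" "h' : H" "g' : G" "xb + h' + g' : D" "\<Phi> (xb + h' + g') <= \<Phi> xb + r'"
    using zw(2) unfolding R_def by auto
   have "u *\<^sub>R xb + v *\<^sub>R xb = xb" using uv(3) by (metis scaleR_add_left scaleR_one)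
   hence eq: "u *\<^sub>R (xb + h + g) + v *\<^sub>R (xb + h' + g') = xb + (u *\<^sub>R h + v *\<^sub>R h') + (u *\<^sub>R g + v *\<^sub>R g')"
    by (simp add: scaleR_add_right algebra_simps)
   have "u * \<Phi> (xb + h + g) + v * \<Phi> (xb + h' + g') <= u * (\<Phi> xb + r) + v * (\<Phi> xb + r')"
    using z(5) w(5) uv by (intro add_mono mult_left_mono)
   also have "\<dots> = (u + v) * \<Phi> xb + (u * r + v * r')" by (simp add: algebra_simps)
   finally have "u * \<Phi> (xb + h + g) + v * \<Phi> (xb + h' + g') <= \<Phi> xb + (u * r + v * r')" using uv(3) by simp
   moreover have "u *\<^sub>R h + v *\<^sub>R h' : H" "u *\<^sub>R g + v *\<^sub>R g' : G"
    using z w H(1) G(1) by (auto intro: subspace_add subspace_scale)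
   ultimately have "(u *\<^sub>R h + v *\<^sub>R h', (u *\<^sub>R g + v *\<^sub>R g', u * r + v * r')) : R"
    using conv[OF z(4) w(4) uv] unfolding R_def eq by auto
   thus "u *\<^sub>R z + v *\<^sub>R w : R" unfolding z w by simp
  qed
  show "(0, 0) : R" unfolding R_def zero_prod_def using H(1) G(1) xb by (auto simp: subspace_0)
  show "EX t>0. EX w. (t *\<^sub>R h, w) : R" if "h : H" for h
  proof -
   obtain t g where t: "t > 0" "g : G" "xb + t *\<^sub>R h + g : D" using reach[OF \<open>h : H\<close>] by blast
   have "(t *\<^sub>R h, (g, \<Phi> (xb + t *\<^sub>R h + g) - \<Phi> xb)) : R" unfolding R_def using t subspace_scale[OF H(1) \<open>h : H\<close>] by auto
   thus ?thesis using t(1) by blast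
  qed
  show "(x, w) : R" if su: "!!n::nat. (s n, u n) : R" and x: "x : H" and w: "w : G \<times> UNIV"
   and lim: "(%n. q (s n - x)) \<longlonglongrightarrow> 0" "(%n. q (fst (u n - w)) + \<bar>snd (u n - w)\<bar>) \<longlonglongrightarrow> 0" for s u x w
  proof -
   have m: "s n : H" "fst (u n) : G" "xb + s n + fst (u n) : D" "\<Phi> (xb + s n + fst (u n)) <= \<Phi> xb + snd (u n)" for n
    using su[of n] unfolding R_def by (auto simp: case_prod_beta)
   have wG: "fst w : G" using w by auto
   have dG: "fst (u n) - fst w : G" for n using m(2) wG G(1) by (simp add: subspace_diff)
   have dH: "s n - x : H" for n using m(1) x H(1) by (simp add: subspace_diff)
   have l1: "(%n. q (fst (u n) - fst w)) \<longlonglongrightarrow> 0"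
    by (rule tendsto_sandwich[OF _ _ tendsto_const lim(2)]) (use q_nonneg[OF fG dG] in auto)
   have l2: "(%n. \<bar>snd (u n) - snd w\<bar>) \<longlonglongrightarrow> 0"
    by (rule tendsto_sandwich[OF _ _ tendsto_const lim(2)]) (use q_nonneg[OF fG dG] in auto)
   have "(%n. snd (u n)) \<longlonglongrightarrow> snd w" using l2 by (simp add: tendsto_rabs_zero_iff LIM_zero_iff)
   hence lr: "(%n. \<Phi> xb + snd (u n)) \<longlonglongrightarrow> \<Phi> xb + snd w" by (intro tendsto_add tendsto_const)
   have "(%n. q ((s n - x) + (fst (u n) - fst w))) \<longlonglongrightarrow> 0"
    by (rule q_add_tendsto[OF V lim(1) _ l1]) (use dH dG H(2) GV in auto)
   hence lx: "(%n. q ((xb + s n + fst (u n)) - (xb + x + fst w))) \<longlonglongrightarrow> 0" by (simp add: algebra_simps)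
   have "xb + x + fst w : V" using xb D x H(2) wG GV by (intro subspace_add[OF sV]) auto
   from closed[OF m(3) this lx m(4) lr] show ?thesis using x wG unfolding R_def by (auto simp: case_prod_beta)
  qed
 qed simp
 then obtain \<delta> where \<delta>: "\<delta> > 0" "!!h. h : H ==> q h < \<delta> ==> EX w. (h, w) : R & q (fst w) + \<bar>snd w\<bar> < 1" by blast
 have near: "EX g:G. xb + h + g : D & \<Phi> (xb + h + g) <= \<Phi> xb + 1" if h: "h : H" "q h < \<delta>" for h
 proof -
  obtain w where w: "(h, w) : R" "q (fst w) + \<bar>snd w\<bar> < 1" using \<delta>(2)[OF h] by blast
  hence "fst w : G" "xb + h + fst w : D" "\<Phi> (xb + h + fst w) <= \<Phi> xb + snd w" unfolding R_def by (auto simp: case_prod_beta)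
  moreover have "snd w <= 1" using w(2) q_nonneg[OF fG \<open>fst w : G\<close>] by linarith
  ultimately show ?thesis by (intro bexI[of _ "fst w"]) auto
 qed
 obtain N \<eta> where N: "convex N" "N <= {x:V. q x < \<delta>}" "\<eta> > 0" "{x:V. q x < \<eta>} <= N"
  by (rule q_convex_nhd[OF V \<delta>(1)])
 \<comment> \<open>Bounds the excess over \<open>m\<close> at the points provided by
   \<open>near\<close>.\<close>
 define c where "c = \<Phi> xb + 1 - m"
 have c1: "1 <= c" using lower[of 0] xb G(1) unfolding c_def by (simp add: subspace_0)
 \<comment> \<open>The cone collects three demands on the functional: to stay below the excess of
   \<open>\<Phi>\<close> over \<open>m\<close>, to be at most \<open>0\<close> on the subspace
   \<open>G\<close> and hence vanish there, and to be at most \<open>c\<close> on \<open>N\<close>,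
   which gives continuity.\<close>
 define Q where "Q = {(a *\<^sub>R k + g + b *\<^sub>R n, a * r + b * c) | a k g b n r.
  0 <= a & 0 <= b & xb + k : D & \<Phi> (xb + k) - m <= r & g : G & n : N}"
 have Q_I: "(a *\<^sub>R k + g + b *\<^sub>R n, a * r + b * c) : Q"
  if "0 <= a" "0 <= b" "xb + k : D" "\<Phi> (xb + k) - m <= r" "g : G" "n : N" for a k g b n r
  unfolding Q_def using that by blast
 have N0: "0 : N" using N(3,4) q_zero[OF V] fspace_zero[OF V] by auto
 have G0: "0 : G" using G(1) by (rule subspace_0)
 have kV: "k : V" if "xb + k : D" for k using DH[OF \<open>xb + k : D\<close>] H(2) by auto
 have "EX l. linear_functional_on V l & (ALL x r. (x, r) : Q --> l x <= r)"
 proof -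
  have cone: "cone_in V Q" unfolding cone_in_def
  proof (intro conjI ballI allI impI)
   show "Q <= V \<times> UNIV"
   proof
    fix z assume "z : Q"
    then obtain a k g b n r where "z = (a *\<^sub>R k + g + b *\<^sub>R n, a * r + b * c)" "xb + k : D" "g : G" "n : N"
     unfolding Q_def by blast
    thus "z : V \<times> UNIV" using kV GV N(2) by (auto intro!: subspace_add[OF sV] subspace_scale[OF sV])
   qed
   show "(0, 0) : Q" using Q_I[of 0 0 0 "\<Phi> xb - m" 0 0] xb N0 G0 by simp
   show "t *\<^sub>R z : Q" if "z : Q" "t > 0" for z t
   proof -
    obtain a k g b n r where z: "z = (a *\<^sub>R k + g + b *\<^sub>R n, a * r + b * c)" "0 <= a" "0 <= b" "xb + k : D"
     "\<Phi> (xb + k) - m <= r" "g : G" "n : N" using \<open>z : Q\<close> unfolding Q_def by blast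
    have "((t * a) *\<^sub>R k + t *\<^sub>R g + (t * b) *\<^sub>R n, (t * a) * r + (t * b) * c) : Q"
     using z \<open>t > 0\<close> by (intro Q_I subspace_scale[OF G(1)]) auto
    thus ?thesis unfolding z(1) by (simp add: algebra_simps)
   qed
   show "z + z' : Q" if "z : Q" "z' : Q" for z z'
   proof -
    obtain a k g b n r where z: "z = (a *\<^sub>R k + g + b *\<^sub>R n, a * r + b * c)" "0 <= a" "0 <= b" "xb + k : D"
     "\<Phi> (xb + k) - m <= r" "g : G" "n : N" using \<open>z : Q\<close> unfolding Q_def by blast
    obtain a' k' g' b' n' r' where z': "z' = (a' *\<^sub>R k' + g' + b' *\<^sub>R n', a' * r' + b' * c)" "0 <= a'" "0 <= b'" "xb + k' : D"
     "\<Phi> (xb + k') - m <= r'" "g' : G" "n' : N" using \<open>z' : Q\<close> unfolding Q_def by blast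
    have "EX y. (a + a') *\<^sub>R y = a *\<^sub>R (k, r) + a' *\<^sub>R (k', r') & xb + fst y : D & \<Phi> (xb + fst y) - m <= snd y"
    proof (rule conic_combination[where P="%y. xb + fst y : D & \<Phi> (xb + fst y) - m <= snd y"])
     fix u v :: real assume uv: "0 <= u" "0 <= v" "u + v = 1"
     have "u *\<^sub>R xb + v *\<^sub>R xb = xb" using uv(3) by (metis scaleR_add_left scaleR_one)
     hence eq: "u *\<^sub>R (xb + k) + v *\<^sub>R (xb + k') = xb + (u *\<^sub>R k + v *\<^sub>R k')"
      by (simp add: scaleR_add_right algebra_simps)
     have "u * \<Phi> (xb + k) + v * \<Phi> (xb + k') <= u * (r + m) + v * (r' + m)"
      using z(5) z'(5) uv by (intro add_mono mult_left_mono) auto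
     also have "\<dots> = (u * r + v * r') + (u + v) * m" by (simp add: algebra_simps)
     finally have "u * \<Phi> (xb + k) + v * \<Phi> (xb + k') - m <= u * r + v * r'" using uv(3) by simp
     thus "xb + fst (u *\<^sub>R (k, r) + v *\<^sub>R (k', r')) : D &
       \<Phi> (xb + fst (u *\<^sub>R (k, r) + v *\<^sub>R (k', r'))) - m <= snd (u *\<^sub>R (k, r) + v *\<^sub>R (k', r'))"
      using conv[OF z(4) z'(4) uv] unfolding eq by auto
    qed (use z z' in auto)
    then obtain y where y: "(a + a') *\<^sub>R y = a *\<^sub>R (k, r) + a' *\<^sub>R (k', r')" "xb + fst y : D" "\<Phi> (xb + fst y) - m <= snd y" by blast
    have "EX y. (b + b') *\<^sub>R y = b *\<^sub>R n + b' *\<^sub>R n' & y : N"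
     by (rule conic_combination[where P="%y. y : N"]) (use z z' convexD[OF N(1)] in auto)
    then obtain w where w: "(b + b') *\<^sub>R w = b *\<^sub>R n + b' *\<^sub>R n'" "w : N" by blast
    have "((a + a') *\<^sub>R fst y + (g + g') + (b + b') *\<^sub>R w, (a + a') * snd y + (b + b') * c) : Q"
     using z z' y w by (intro Q_I subspace_add[OF G(1)]) auto
    moreover have "(a + a') *\<^sub>R fst y = a *\<^sub>R k + a' *\<^sub>R k'" "(a + a') * snd y = a * r + a' * r'"
     using arg_cong[OF y(1), of fst] arg_cong[OF y(1), of snd] by auto
    ultimately show ?thesis unfolding z(1) z'(1) w(1) by (simp add: algebra_simps)
   qed
  qed
  have tot: "EX r. (x, r) : Q" if x: "x : V" for x
  proof -
   obtain n where n: "q ((1/2)^n *\<^sub>R x) < \<eta>"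
    using q_tendsto_0D[OF V q_half_pow[OF V x] N(3)] by blast
   hence "(1/2)^n *\<^sub>R x : N" using N(4) fspace_scale[OF V x] by auto
   hence "(0 *\<^sub>R 0 + 0 + (2^n) *\<^sub>R ((1/2)^n *\<^sub>R x), 0 * (\<Phi> xb - m) + 2^n * c) : Q"
    using xb G0 by (intro Q_I) auto
   moreover have "(2::real)^n * (1/2)^n = 1" by (simp add: power_divide)
   ultimately have "(x, 0 * (\<Phi> xb - m) + 2^n * c) : Q" by simp
   thus ?thesis by blast
  qed
  have nonneg: "0 <= \<rho>" if "(0, \<rho>) : Q" for \<rho>
  proof -
   obtain a k g b n r where "(0, \<rho>) = (a *\<^sub>R k + g + b *\<^sub>R n, a * r + b * c)"
    and e': "0 <= a" "0 <= b" "xb + k : D" "\<Phi> (xb + k) - m <= r" "g : G" "n : N"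
    using \<open>(0, \<rho>) : Q\<close> unfolding Q_def by blast
   hence e: "a *\<^sub>R k + g + b *\<^sub>R n = 0" "\<rho> = a * r + b * c" "0 <= a" "0 <= b" "xb + k : D"
    "\<Phi> (xb + k) - m <= r" "g : G" "n : N" by simp_all
   have kH: "k : H" using DH[OF e(5)] by simp
   \<comment> \<open>\<open>k\<close> and \<open>g\<close> lie in \<open>H\<close>, hence so does
     \<open>n\<close> unless its weight is \<open>0\<close>, in which case \<open>0\<close> replaces
     it. Being in \<open>H\<close> and small makes \<open>n'\<close> correctable by
     \<open>near\<close>.\<close>
   have "EX n':H. q n' < \<delta> & b *\<^sub>R n' = b *\<^sub>R n"
   proof (cases "b = 0")
    case True thus ?thesis using \<delta>(1) H(1) q_zero[OF V] by (intro bexI[of _ 0]) (auto simp: subspace_0)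
   next
    case False
    have "b *\<^sub>R n = - (a *\<^sub>R k + g)" using minus_unique[OF e(1)] by simp
    moreover have "- (a *\<^sub>R k + g) : H" using kH e(7) G(2) H(1) by (intro subspace_neg subspace_add subspace_scale) auto
    ultimately have "(1 / b) *\<^sub>R (b *\<^sub>R n) : H" using H(1) by (simp add: subspace_scale)
    hence "n : H" using False by simp
    thus ?thesis using e(8) N(2) by auto
   qed
   then obtain n' where n': "n' : H" "q n' < \<delta>" "b *\<^sub>R n' = b *\<^sub>R n" by blast
   obtain g' where g': "g' : G" "xb + n' + g' : D" "\<Phi> (xb + n' + g') <= \<Phi> xb + 1" using near[OF n'(1,2)] by blast
   \<comment> \<open>Merging \<open>k\<close> with the corrected \<open>n' + g'\<close> gives a
     point that differs from \<open>xb\<close> by an element of \<open>G\<close>, where the cost is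
     at least \<open>m\<close>.\<close>
   have "EX y. (a + b) *\<^sub>R y = a *\<^sub>R (k, r) + b *\<^sub>R (n' + g', c) & xb + fst y : D & \<Phi> (xb + fst y) - m <= snd y"
   proof (rule conic_combination[where P="%y. xb + fst y : D & \<Phi> (xb + fst y) - m <= snd y"])
    fix u v :: real assume uv: "0 <= u" "0 <= v" "u + v = 1"
    have "u *\<^sub>R xb + v *\<^sub>R xb = xb" using uv(3) by (metis scaleR_add_left scaleR_one)
    hence eq: "u *\<^sub>R (xb + k) + v *\<^sub>R (xb + n' + g') = xb + (u *\<^sub>R k + v *\<^sub>R (n' + g'))"
     by (simp add: scaleR_add_right algebra_simps)
    have "u * \<Phi> (xb + k) + v * \<Phi> (xb + n' + g') <= u * (r + m) + v * (c + m)"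
     using e(6) g'(3) uv unfolding c_def by (intro add_mono mult_left_mono) auto
    also have "\<dots> = (u * r + v * c) + (u + v) * m" by (simp add: algebra_simps)
    finally have "u * \<Phi> (xb + k) + v * \<Phi> (xb + n' + g') - m <= u * r + v * c" using uv(3) by simp
    thus "xb + fst (u *\<^sub>R (k, r) + v *\<^sub>R (n' + g', c)) : D &
      \<Phi> (xb + fst (u *\<^sub>R (k, r) + v *\<^sub>R (n' + g', c))) - m <= snd (u *\<^sub>R (k, r) + v *\<^sub>R (n' + g', c))"
     using conv[OF e(5) g'(2) uv] unfolding eq by auto
   qed (use e g' in \<open>auto simp: c_def add.assoc\<close>)
   then obtain y where y: "(a + b) *\<^sub>R y = a *\<^sub>R (k, r) + b *\<^sub>R (n' + g', c)" "xb + fst y : D" "\<Phi> (xb + fst y) - m <= snd y" by blast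
   have y1: "(a + b) *\<^sub>R fst y = b *\<^sub>R g' - g" "(a + b) * snd y = \<rho>"
    using arg_cong[OF y(1), of fst] arg_cong[OF y(1), of snd] e(2) n'(3) minus_unique[OF e(1), symmetric]
    by (simp_all add: scaleR_add_right)
   show ?thesis
   proof (cases "a + b = 0")
    case True thus ?thesis using y1(2) by simp
   next
    case False
    have "b *\<^sub>R g' - g : G" using g'(1) e(7) G(1) by (auto intro!: subspace_diff subspace_scale)
    hence "(1 / (a + b)) *\<^sub>R ((a + b) *\<^sub>R fst y) : G" unfolding y1(1) using G(1) by (simp add: subspace_scale)
    hence "fst y : G" using False by simp
    hence "0 <= snd y" using lower[OF _ y(2)] y(3) by simp
    thus ?thesis using e(3,4) unfolding y1(2)[symmetric] by simp
   qed
  qed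
  show ?thesis by (rule Hahn_Banach_cone[OF sV cone tot nonneg]) (assumption, assumption, blast)
 qed
 then obtain v where v: "linear_functional_on V v" "!!x r. (x, r) : Q ==> v x <= r" by blast
 have vG: "v g = 0" if g: "g : G" for g
 proof -
  have "v g <= 0" if "g : G" for g using v(2)[of g 0] Q_I[of 0 0 0 "\<Phi> xb - m" g 0] xb N0 \<open>g : G\<close> by simp
  from this[OF g] this[OF subspace_neg[OF G(1) g]] show ?thesis
   using linear_functional_on_minus[OF v(1)] g GV by fastforce
 qed
 have vD: "m + v (x - xb) <= \<Phi> x" if x: "x : D" for x
  using v(2)[of "x - xb" "\<Phi> x - m"] Q_I[of 1 0 "x - xb" "\<Phi> x - m" 0 0] x N0 G0 by simp
 have vN: "\<bar>v x\<bar> <= c" if x: "x : V" "q x < \<eta>" for x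
 proof -
  have "v x <= c" if "x : V" "q x < \<eta>" for x
   using v(2)[of x c] Q_I[of 0 1 0 "\<Phi> xb - m" 0 x] xb N(4) G0 that by auto
  from this[OF x] this[of "- x"] show ?thesis
   using linear_functional_on_minus[OF v(1) x(1)] q_minus[OF V x(1)] fspace_neg[OF V x(1)] x(2) by auto
 qed
 have "continuous_functional V q v"
 proof (rule continuous_functionalI[OF V v(1)])
  fix s :: "nat => _" assume s: "!!n. s n : V" "(%n. q (s n)) \<longlonglongrightarrow> 0"
  show "(%n. v (s n)) \<longlonglongrightarrow> 0"
  proof (rule LIMSEQ_I)
   fix e :: real assume e: "e > 0"
   \<comment> \<open>A bound \<open>c\<close> after scaling by \<open>(c + 1) / e\<close> is a bound
     below \<open>e\<close> before it.\<close>
   define K where "K = (c + 1) / e"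
   have K: "K > 0" unfolding K_def using c1 e by simp
   obtain k where k: "!!n. n >= k ==> q (K *\<^sub>R s n) < \<eta>"
    using q_tendsto_0D[OF V q_scale_tendsto[OF V s(2,1)] N(3)] by blast
   have "norm (v (s n) - 0) < e" if "n >= k" for n
   proof -
    have "\<bar>K * v (s n)\<bar> <= c"
     using vN[OF fspace_scale[OF V s(1)] k[OF that]] linear_functional_onD(2)[OF v(1) s(1)] by simp
    hence "\<bar>v (s n)\<bar> * (c + 1) <= c * e" using K e unfolding K_def abs_mult by (simp add: field_simps)
    also have "\<dots> < e * (c + 1)" using e by (simp add: algebra_simps)
    finally show ?thesis using c1 by simp
   qed
   thus "EX no. ALL n>=no. norm (v (s n) - 0) < e" by blast
  qed
 qed
 thus ?thesis using vG vD by blast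
qed

text \<open>The summands are minimized one at a time. Each infimum is finite because the other
  arguments can be frozen, and subtracting it leaves a lower bound for the remaining sum.\<close>

lemma separable_lower_bound:
 fixes f :: "'i => 'b => real"
 assumes "finite I" "!!i. i : I ==> D i ~= {}" "!!x. (!!i. i : I ==> x i : D i) ==> m <= (SUM i:I. f i (x i))"
 shows "EX \<mu>. m <= sum \<mu> I & (ALL i:I. ALL z:D i. \<mu> i <= f i z)"
 using assms
proof (induction I arbitrary: m rule: finite_induct)
 case empty
 thus ?case by auto
next
 case (insert i I)
 define a where "a = (INF z\<in>D i. f i z)"
 have "ALL j:I. EX z. z : D j" using insert.prems(1) by auto
 from bchoice[OF this] obtain x0 where x0: "!!j. j : I ==> x0 j : D j" by blast
 have le: "m - (SUM j:I. f j (x j)) <= f i z" if x: "!!j. j : I ==> x j : D j" and z: "z : D i" for x z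
 proof -
  have "m <= (SUM j:insert i I. f j ((x(i := z)) j))" by (rule insert.prems(2)) (use x z in auto)
  also have "\<dots> = f i z + (SUM j:I. f j ((x(i := z)) j))" using insert.hyps by simp
  also have "(SUM j:I. f j ((x(i := z)) j)) = (SUM j:I. f j (x j))" using insert.hyps by (intro sum.cong) auto
  finally show ?thesis by simp
 qed
 have bdd: "bdd_below (f i ` D i)" using le[OF x0] by (intro bdd_belowI2) auto
 have "EX \<mu>. m - a <= sum \<mu> I & (ALL j:I. ALL z:D j. \<mu> j <= f j z)"
 proof (rule insert.IH)
  show "m - a <= (SUM j:I. f j (x j))" if "!!j. j : I ==> x j : D j" for x
   using cINF_greatest[of "D i" "m - (SUM j:I. f j (x j))" "f i"] insert.prems(1)[of i] le[OF that] unfolding a_def by fastforce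
 qed (use insert.prems(1) in auto)
 then obtain \<mu> where \<mu>: "m - a <= sum \<mu> I" "!!j z. j : I ==> z : D j ==> \<mu> j <= f j z" by blast
 have "sum (\<mu>(i := a)) I = sum \<mu> I" using insert.hyps by (intro sum.cong) auto
 hence "m <= sum (\<mu>(i := a)) (insert i I)" using insert.hyps \<mu>(1) by simp
 moreover have "(\<mu>(i := a)) j <= f j z" if "j : insert i I" "z : D j" for j z
  using that \<mu>(2) cINF_lower[OF bdd] unfolding a_def by auto
 ultimately show ?case by blast
qed

section \<open>The control problem under recourse conditions\<close>

context control
begin

abbreviation "Dom t \<equiv> control_integrand.D M S C (L t)"
abbreviation "V t \<equiv> control_integrand.val M (L t)"

text \<open>Times beyond \<open>T\<close> are unrestricted and invisible to
  \<open>procs_norm\<close>; this is compatible with \<open>fspace\<close>, where \<open>q\<close>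
  may vanish at nonzero elements.\<close>

definition procs :: "(nat => ('a => real^'n) \<times> ('a => real^'m)) set" where
 "procs = {x. ALL t<=T. x t : S \<times> C}"

definition procs_norm :: "(nat => ('a => real^'n) \<times> ('a => real^'m)) => real" where
 "procs_norm x = (SUM t<=T. qS (fst (x t)) + qC (snd (x t)))"

definition cexp :: "nat => ('a => real^'n) \<times> ('a => real^'m) => ('a => real^'n) \<times> ('a => real^'m)" where
 "cexp t z = (cond_exp M (F t) (fst z), cond_exp M (F t) (snd z))"

definition eqv :: "('a => real^'n) \<times> ('a => real^'m) => ('a => real^'n) \<times> ('a => real^'m) => bool" where
 "eqv z y \<longleftrightarrow> (AE w in M. fst z w = fst y w & snd z w = snd y w)"

definition defect :: "(nat => ('a => real^'n) \<times> ('a => real^'m)) => nat => 'a => real^'n" where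
 "defect x t w = fst (x t) w - fst (x (t - 1)) w - A t w *v fst (x (t - 1)) w - B t w *v snd (x (t - 1)) w"

text \<open>Adaptedness is expressed as invariance under conditional expectation up to null sets.
  This form passes to limits, whereas a limit of adapted functions is determined only up to almost
  sure equality.\<close>

definition homogeneous :: "(nat => ('a => real^'n) \<times> ('a => real^'m)) set" where
 "homogeneous = {g : procs. (ALL t<=T. eqv (cexp t (g t)) (g t)) & (ALL t:{1..T}. AE w in M. defect g t w = 0)}"

lemma sub_alg: "t <= T ==> prob_subalgebra M (F t)"
 by (intro prob_subalgebra.intro prob_subalgebra_axioms.intro S.prob_space_axioms sub)

lemma SC_zero: "0 : S \<times> C" and SC_add: "z : S \<times> C ==> y : S \<times> C ==> z + y : S \<times> C"
 and SC_diff: "z : S \<times> C ==> y : S \<times> C ==> z - y : S \<times> C"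
 and SC_scale: "z : S \<times> C ==> c *\<^sub>R z : S \<times> C"
 using S.S_zero C.S_zero S.S_add C.S_add S.S_diff C.S_diff S.S_scale C.S_scale
 by (auto simp: zero_prod_def)

lemma eqv_refl: "eqv z z" unfolding eqv_def by simp

lemma eqv_trans: assumes "eqv z y" "eqv y x" shows "eqv z x"
 using assms unfolding eqv_def by eventually_elim simp

lemma eqv_add: assumes "eqv z y" "eqv z' y'" shows "eqv (z + z') (y + y')"
 using assms unfolding eqv_def by eventually_elim simp

lemma eqv_diff: assumes "eqv z y" "eqv z' y'" shows "eqv (z - z') (y - y')"
 using assms unfolding eqv_def by eventually_elim simp

lemma eqv_scale: assumes "eqv z y" shows "eqv (c *\<^sub>R z) (c *\<^sub>R y)"
 using assms unfolding eqv_def by eventually_elim simp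

lemma cexp_mem: "t <= T ==> z : S \<times> C ==> cexp t z : S \<times> C"
 using ES[of t] EC[of t] unfolding cexp_def by auto

lemma cexp_add: assumes "t <= T" "z : S \<times> C" "y : S \<times> C" shows "eqv (cexp t (z + y)) (cexp t z + cexp t y)"
 using prob_subalgebra.cond_exp_add[OF sub_alg[OF assms(1)] S.S_integrable S.S_integrable, of "fst z" "fst y"]
  prob_subalgebra.cond_exp_add[OF sub_alg[OF assms(1)] C.S_integrable C.S_integrable, of "snd z" "snd y"] assms(2,3)
 unfolding eqv_def cexp_def by (auto simp: mem_Times_iff)

lemma cexp_diff: assumes "t <= T" "z : S \<times> C" "y : S \<times> C" shows "eqv (cexp t (z - y)) (cexp t z - cexp t y)"
 using prob_subalgebra.cond_exp_diff[OF sub_alg[OF assms(1)] S.S_integrable S.S_integrable, of "fst z" "fst y"]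
  prob_subalgebra.cond_exp_diff[OF sub_alg[OF assms(1)] C.S_integrable C.S_integrable, of "snd z" "snd y"] assms(2,3)
 unfolding eqv_def cexp_def by (auto simp: mem_Times_iff)

lemma cexp_scale: assumes "t <= T" "z : S \<times> C" shows "eqv (cexp t (c *\<^sub>R z)) (c *\<^sub>R cexp t z)"
 using prob_subalgebra.cond_exp_scaleR[OF sub_alg[OF assms(1)] S.S_integrable, of "fst z" c]
  prob_subalgebra.cond_exp_scaleR[OF sub_alg[OF assms(1)] C.S_integrable, of "snd z" c] assms(2)
 unfolding eqv_def cexp_def by (auto simp: mem_Times_iff)

lemma cexp_adapted:
 assumes "t <= T" "z : S \<times> C" "fst z : borel_measurable (F t)" "snd z : borel_measurable (F t)"
 shows "eqv (cexp t z) z"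
 using prob_subalgebra.cond_exp_ident[OF sub_alg[OF assms(1)] S.S_integrable assms(3)]
  prob_subalgebra.cond_exp_ident[OF sub_alg[OF assms(1)] C.S_integrable assms(4)] assms(2)
 unfolding eqv_def cexp_def by (auto simp: mem_Times_iff)

lemma cexp_measurable:
 assumes "t <= T" shows "fst (cexp t z) : borel_measurable (F t)" "snd (cexp t z) : borel_measurable (F t)"
 using prob_subalgebra.cond_exp_measurable[OF sub_alg[OF assms]] unfolding cexp_def by auto

lemma Dom_sub: "t <= T ==> z : Dom t ==> z : S \<times> C"
 by (rule control_integrand.D_sub[OF integrand])

lemma Dom_eqv: assumes "t <= T" "z : Dom t" "y : S \<times> C" "eqv y z" shows "y : Dom t" "V t y <= V t z"
 using control_integrand.D_AE_eq[OF integrand[OF assms(1)] assms(2,3)] assms(4) unfolding eqv_def by auto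

lemma procs_fspace: "fspace procs procs_norm"
 using fspace_sequences[OF fspace_Times[OF S.S_fspace C.S_fspace], of T]
 unfolding procs_def procs_norm_def[abs_def] .

lemma procsD: "x : procs ==> t <= T ==> x t : S \<times> C"
 unfolding procs_def by blast

lemma component_norms_le:
 assumes x: "x : procs" and t: "t <= T"
 shows "qS (fst (x t)) <= procs_norm x" "qC (snd (x t)) <= procs_norm x"
proof -
 have nn: "0 <= qS (fst (x s))" "0 <= qC (snd (x s))" if "s <= T" for s
  using procsD[OF x that] q_nonneg[OF S.S_fspace] q_nonneg[OF C.S_fspace] by auto
 have "qS (fst (x t)) + qC (snd (x t)) <= procs_norm x"
  unfolding procs_norm_def by (rule member_le_sum[where f="%t. qS (fst (x t)) + qC (snd (x t))"]) (use t nn in auto)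
 thus "qS (fst (x t)) <= procs_norm x" "qC (snd (x t)) <= procs_norm x" using nn[OF t] by auto
qed

lemma component_tendsto:
 assumes s: "!!n::nat. s n : procs" and lim: "(%n. procs_norm (s n)) \<longlonglongrightarrow> 0" and t: "t <= T"
 shows "(%n. qS (fst (s n t))) \<longlonglongrightarrow> 0" "(%n. qC (snd (s n t))) \<longlonglongrightarrow> 0"
proof -
 have nn: "0 <= qS (fst (s n t))" "0 <= qC (snd (s n t))" for n
  using procsD[OF s t] q_nonneg[OF S.S_fspace] q_nonneg[OF C.S_fspace] by (auto simp: mem_Times_iff)
 show "(%n. qS (fst (s n t))) \<longlonglongrightarrow> 0"
  by (rule tendsto_sandwich[OF _ _ tendsto_const lim]) (use component_norms_le[OF s t] nn in auto)
 show "(%n. qC (snd (s n t))) \<longlonglongrightarrow> 0"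
  by (rule tendsto_sandwich[OF _ _ tendsto_const lim]) (use component_norms_le[OF s t] nn in auto)
qed

lemma null_eqv_zero:
 assumes "z : S \<times> C" shows "qS (fst z) = 0 & qC (snd z) = 0 \<longleftrightarrow> eqv z 0"
 using S.q_null[of "fst z"] C.q_null[of "snd z"] assms unfolding eqv_def by auto

lemma eqv_limit:
 assumes s: "!!n::nat. s n : S \<times> C" and z: "z : S \<times> C" and y: "y : S \<times> C"
  and lz: "(%n. qS (fst (s n) - fst z)) \<longlonglongrightarrow> 0" "(%n. qC (snd (s n) - snd z)) \<longlonglongrightarrow> 0"
  and ly: "(%n. qS (fst (s n) - fst y)) \<longlonglongrightarrow> 0" "(%n. qC (snd (s n) - snd y)) \<longlonglongrightarrow> 0"
 shows "eqv z y"
proof -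
 have "qS (fst z - fst y) = 0"
 proof -
  have "(%n. qS (- 1 *\<^sub>R (fst (s n) - fst z) + (fst (s n) - fst y))) \<longlonglongrightarrow> 0"
   by (rule q_add_tendsto[OF S.S_fspace, OF q_scale_tendsto[OF S.S_fspace, OF lz(1)] _ ly(1)])
    (use s z y in \<open>auto intro!: S.S_diff S.S_minus simp: mem_Times_iff\<close>)
  moreover have "- 1 *\<^sub>R (fst (s n) - fst z) + (fst (s n) - fst y) = fst z - fst y" for n by (simp add: algebra_simps)
  ultimately show ?thesis by (simp add: LIMSEQ_const_iff)
 qed
 moreover have "qC (snd z - snd y) = 0"
 proof -
  have "(%n. qC (- 1 *\<^sub>R (snd (s n) - snd z) + (snd (s n) - snd y))) \<longlonglongrightarrow> 0"
   by (rule q_add_tendsto[OF C.S_fspace, OF q_scale_tendsto[OF C.S_fspace, OF lz(2)] _ ly(2)])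
    (use s z y in \<open>auto intro!: C.S_diff C.S_minus simp: mem_Times_iff\<close>)
  moreover have "- 1 *\<^sub>R (snd (s n) - snd z) + (snd (s n) - snd y) = snd z - snd y" for n by (simp add: algebra_simps)
  ultimately show ?thesis by (simp add: LIMSEQ_const_iff)
 qed
 ultimately have "eqv (z - y) 0" using null_eqv_zero[OF SC_diff[OF z y]] by simp
 thus ?thesis unfolding eqv_def by (auto elim!: AE_mp)
qed

lemma cexp_continuous:
 assumes t: "t <= T" and s: "!!n::nat. s n : S \<times> C" and z: "z : S \<times> C"
  and lim: "(%n. qS (fst (s n) - fst z)) \<longlonglongrightarrow> 0" "(%n. qC (snd (s n) - snd z)) \<longlonglongrightarrow> 0"
 shows "(%n. qS (fst (cexp t (s n)) - fst (cexp t z))) \<longlonglongrightarrow> 0" "(%n. qC (snd (cexp t (s n)) - snd (cexp t z))) \<longlonglongrightarrow> 0"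
proof -
 have m: "fst (s n) : S" "snd (s n) : C" "fst z : S" "snd z : C" for n using s[of n] z by (auto simp: mem_Times_iff)
 have c: "cond_exp M (F t) x : S" if "x : S" for x using ES[OF t] that by auto
 have c': "cond_exp M (F t) x : C" if "x : C" for x using EC[OF t] that by auto
 have d: "cexp t y : S \<times> C" if "y : S \<times> C" for y by (rule cexp_mem[OF t that])
 have e1: "qS (fst (cexp t (s n)) - fst (cexp t z)) = qS (cond_exp M (F t) (fst (s n) - fst z))" for n
 proof (rule S.q_AE_eq)
  show "AE w in M. (fst (cexp t (s n)) - fst (cexp t z)) w = cond_exp M (F t) (fst (s n) - fst z) w"
   using prob_subalgebra.cond_exp_diff[OF sub_alg[OF t] S.S_integrable[OF m(1)] S.S_integrable[OF m(3)], of n]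
   by (auto simp: cexp_def)
 qed (use m c S.S_diff in \<open>auto simp: cexp_def\<close>)
 have e2: "qC (snd (cexp t (s n)) - snd (cexp t z)) = qC (cond_exp M (F t) (snd (s n) - snd z))" for n
 proof (rule C.q_AE_eq)
  show "AE w in M. (snd (cexp t (s n)) - snd (cexp t z)) w = cond_exp M (F t) (snd (s n) - snd z) w"
   using prob_subalgebra.cond_exp_diff[OF sub_alg[OF t] C.S_integrable[OF m(2)] C.S_integrable[OF m(4)], of n]
   by (auto simp: cexp_def)
 qed (use m c' C.S_diff in \<open>auto simp: cexp_def\<close>)
 show "(%n. qS (fst (cexp t (s n)) - fst (cexp t z))) \<longlonglongrightarrow> 0" unfolding e1
  by (rule S.cond_exp_continuous[OF sub[OF t] ES[OF t] S.S_diff[OF m(1,3)] lim(1)])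
 show "(%n. qC (snd (cexp t (s n)) - snd (cexp t z))) \<longlonglongrightarrow> 0" unfolding e2
  by (rule C.cond_exp_continuous[OF sub[OF t] EC[OF t] C.S_diff[OF m(2,4)] lim(2)])
qed

lemma defect_linear:
 "defect (x + y) t w = defect x t w + defect y t w" "defect (x - y) t w = defect x t w - defect y t w"
 "defect (c *\<^sub>R x) t w = c *\<^sub>R defect x t w"
 unfolding defect_def
 by (simp_all add: matrix_vector_right_distrib matrix_vector_mult_diff_distrib matrix_vector_mult_scaleR algebra_simps)

lemma prev_le: "t : {1..T} ==> t - 1 <= T" by auto

lemma defect_mem:
 assumes x: "x : procs" and t: "t : {1..T}" shows "defect x t : S"
proof -
 have m: "fst (x t) : S" "fst (x (t - 1)) : S" "snd (x (t - 1)) : C"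
  using procsD[OF x, of t] procsD[OF x prev_le[OF t]] t by (auto simp: mem_Times_iff)
 have "fst (x t) - fst (x (t - 1)) - (%w. A t w *v fst (x (t - 1)) w) - (%w. B t w *v snd (x (t - 1)) w) : S"
  by (intro S.S_diff m A_S[OF t] B_C[OF t])
 moreover have "fst (x t) - fst (x (t - 1)) - (%w. A t w *v fst (x (t - 1)) w) - (%w. B t w *v snd (x (t - 1)) w) = defect x t"
  unfolding defect_def by (simp add: fun_eq_iff)
 ultimately show ?thesis by simp
qed

lemma homogeneous_subspace: "subspace homogeneous"
proof (rule subspaceI)
 have P: "subspace procs" by (rule fspace_subspace[OF procs_fspace])
 show "0 : homogeneous"
 proof -
  have "eqv (cexp t 0) 0" if "t <= T" for t using cexp_adapted[OF that SC_zero] by (simp add: zero_fun_def)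
  moreover have "defect 0 t w = 0" for t w unfolding defect_def by simp
  ultimately show ?thesis using subspace_0[OF P] unfolding homogeneous_def by simp
 qed
 show "x + y : homogeneous" if xy: "x : homogeneous" "y : homogeneous" for x y
 proof -
  have "eqv (cexp t ((x + y) t)) ((x + y) t)" if "t <= T" for t
   using eqv_trans[OF cexp_add[OF that, of "x t" "y t"] eqv_add] xy that procsD unfolding homogeneous_def by auto
  moreover have "AE w in M. defect (x + y) t w = 0" if t: "t : {1..T}" for t
  proof -
   have "AE w in M. defect x t w = 0" "AE w in M. defect y t w = 0" using xy t unfolding homogeneous_def by auto
   thus ?thesis by eventually_elim (simp add: defect_linear)
  qed
  ultimately show ?thesis using xy subspace_add[OF P] unfolding homogeneous_def by simp
 qed
 show "c *\<^sub>R x : homogeneous" if x: "x : homogeneous" for c x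
 proof -
  have "eqv (cexp t ((c *\<^sub>R x) t)) ((c *\<^sub>R x) t)" if "t <= T" for t
   using eqv_trans[OF cexp_scale[OF that, of "x t" c] eqv_scale] x that procsD unfolding homogeneous_def by auto
  moreover have "AE w in M. defect (c *\<^sub>R x) t w = 0" if t: "t : {1..T}" for t
  proof -
   have "AE w in M. defect x t w = 0" using x t unfolding homogeneous_def by auto
   thus ?thesis by eventually_elim (simp add: defect_linear)
  qed
  ultimately show ?thesis using x subspace_scale[OF P] unfolding homogeneous_def by simp
 qed
qed

lemma homogeneous_closed: "seq_closed_in procs procs_norm homogeneous"
 unfolding seq_closed_in_def
proof (intro allI impI, elim conjE)
 fix s :: "nat => _" and x assume s: "ALL n. s n : homogeneous" and x: "x : procs" and lim: "(%n. procs_norm (s n - x)) \<longlonglongrightarrow> 0"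
 have sp: "s n : procs" for n using s unfolding homogeneous_def by blast
 have sd: "s n - x : procs" for n by (rule fspace_diff[OF procs_fspace sp x])
 have l: "(%n. qS (fst (s n t) - fst (x t))) \<longlonglongrightarrow> 0" "(%n. qC (snd (s n t) - snd (x t))) \<longlonglongrightarrow> 0" if "t <= T" for t
  using component_tendsto[OF sd lim that] by simp_all
 have "eqv (cexp t (x t)) (x t)" if t: "t <= T" for t
 proof -
  note st = procsD[OF sp t] and xt = procsD[OF x t]
  have e: "eqv (cexp t (s n t)) (s n t)" for n using s t unfolding homogeneous_def by blast
  have "qS (fst (cexp t (s n t)) - fst (x t)) = qS (fst (s n t) - fst (x t))" for n
   by (rule S.q_AE_eq) (use st[of n] xt cexp_mem[OF t st[of n]] e[of n] S.S_diff in \<open>auto simp: eqv_def mem_Times_iff\<close>)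
  hence l1: "(%n. qS (fst (cexp t (s n t)) - fst (x t))) \<longlonglongrightarrow> 0" using l(1)[OF t] by simp
  have "qC (snd (cexp t (s n t)) - snd (x t)) = qC (snd (s n t) - snd (x t))" for n
   by (rule C.q_AE_eq) (use st[of n] xt cexp_mem[OF t st[of n]] e[of n] C.S_diff in \<open>auto simp: eqv_def mem_Times_iff\<close>)
  hence l2: "(%n. qC (snd (cexp t (s n t)) - snd (x t))) \<longlonglongrightarrow> 0" using l(2)[OF t] by simp
  show ?thesis by (rule eqv_limit[OF cexp_mem[OF t st] cexp_mem[OF t xt] xt cexp_continuous[OF t st xt l[OF t]] l1 l2])
 qed
 moreover have "AE w in M. defect x t w = 0" if t: "t : {1..T}" for t
 proof -
  have tT: "t <= T" "t - 1 <= T" using t by auto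
  have m: "fst ((s n - x) t) : S" "fst ((s n - x) (t - 1)) : S" "snd ((s n - x) (t - 1)) : C" for n
   using procsD[OF sd tT(1), of n] procsD[OF sd tT(2), of n] by (auto simp: mem_Times_iff)
  have lA: "(%n. qS (%w. A t w *v fst ((s n - x) (t - 1)) w)) \<longlonglongrightarrow> 0"
   by (rule matrix_continuous[OF S.rv_space_axioms S.rv_space_axioms toM[OF tT(1) A_meas[OF t]] A_S[OF t] m(2) component_tendsto(1)[OF sd lim tT(2)]])
  have lB: "(%n. qS (%w. B t w *v snd ((s n - x) (t - 1)) w)) \<longlonglongrightarrow> 0"
   by (rule matrix_continuous[OF C.rv_space_axioms S.rv_space_axioms toM[OF tT(1) B_meas[OF t]] B_C[OF t] m(3) component_tendsto(2)[OF sd lim tT(2)]])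
  have mA: "(%w. A t w *v fst ((s n - x) (t - 1)) w) : S" and mB: "(%w. B t w *v snd ((s n - x) (t - 1)) w) : S" for n
   using A_S[OF t m(2)] B_C[OF t m(3)] .
  have "(%n. qS (fst ((s n - x) t) + - 1 *\<^sub>R (fst ((s n - x) (t - 1)) +
    ((%w. A t w *v fst ((s n - x) (t - 1)) w) + (%w. B t w *v snd ((s n - x) (t - 1)) w))))) \<longlonglongrightarrow> 0"
   by (intro q_add_tendsto[OF S.S_fspace] q_scale_tendsto[OF S.S_fspace] component_tendsto[OF sd lim] tT lA lB
     S.S_add S.S_scale m mA mB)
  moreover have "fst ((s n - x) t) + - 1 *\<^sub>R (fst ((s n - x) (t - 1)) +
    ((%w. A t w *v fst ((s n - x) (t - 1)) w) + (%w. B t w *v snd ((s n - x) (t - 1)) w))) = defect (s n - x) t" for n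
   by (simp add: fun_eq_iff defect_def)
  ultimately have "(%n. qS (defect (s n - x) t)) \<longlonglongrightarrow> 0" by simp
  \<comment> \<open>All \<open>s n\<close> are homogeneous, so the sequence just shown to tend to
    \<open>0\<close> is constant.\<close>
  moreover have "qS (defect (s n - x) t) = qS (defect x t)" for n
  proof -
   have "AE w in M. defect (s n) t w = 0" using s t unfolding homogeneous_def by blast
   hence "AE w in M. defect (s n - x) t w = (- defect x t) w" by eventually_elim (simp add: defect_linear)
   hence "qS (defect (s n - x) t) = qS (- defect x t)"
    by (rule S.q_AE_eq[OF defect_mem[OF sd t] S.S_minus[OF defect_mem[OF x t]]])
   thus ?thesis using q_minus[OF S.S_fspace defect_mem[OF x t]] by simp
  qed
  ultimately have "qS (defect x t) = 0" by (simp add: LIMSEQ_const_iff)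
  thus ?thesis using S.q_null[OF defect_mem[OF x t]] by simp
 qed
 ultimately show "x : homogeneous" using x unfolding homogeneous_def by blast
qed

text \<open>Forward recursion: the controls are selected from the state, which is thereby determined.\<close>

lemma recourse_strategy:
 assumes Q: "!!t x. t <= T ==> x : S ==> x : borel_measurable (F t) ==>
   EX u. u : C & u : borel_measurable (F t) & (x, u) : Q t"
  and x0: "x0 : S" "x0 : borel_measurable (F 0)" and W': "W' : adapted_sequences_in T F S"
 shows "EX X U. (X, U) : adapted_strategies T F S C & (ALL t<=T. (X t, U t) : Q t) & X 0 = x0 &
  (ALL t:{1..T}. ALL h. X t h - X (t - 1) h = A t h *v X (t - 1) h + B t h *v U (t - 1) h + W' t h)"
proof -
 \<comment> \<open>Choosing for all pairs of a time and a state at once makes the forward recursion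
   a plain iteration.\<close>
 have "ALL z. EX u. fst z <= T --> snd z : S --> snd z : borel_measurable (F (fst z)) -->
   u : C & u : borel_measurable (F (fst z)) & (snd z, u) : Q (fst z)"
  using Q by (metis)
 from choice[OF this] obtain f' where f': "ALL z. fst z <= T --> snd z : S --> snd z : borel_measurable (F (fst z)) -->
   f' z : C & f' z : borel_measurable (F (fst z)) & (snd z, f' z) : Q (fst z)" by blast
 define f where "f t x = f' (t, x)" for t x
 have f: "f t x : C" "f t x : borel_measurable (F t)" "(x, f t x) : Q t" if "t <= T" "x : S" "x : borel_measurable (F t)" for t x
  using f'[rule_format, of "(t, x)"] that unfolding f_def by auto
 define X where "X = rec_nat x0 (%t x h. x h + A (Suc t) h *v x h + B (Suc t) h *v f t x h + W' (Suc t) h)"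
 define U where "U t = f t (X t)" for t
 have X0: "X 0 = x0" unfolding X_def by simp
 have XS: "X (Suc t) = (%h. X t h + A (Suc t) h *v X t h + B (Suc t) h *v U t h + W' (Suc t) h)" for t
  unfolding X_def U_def by simp
 have mem: "t <= T ==> X t : S & X t : borel_measurable (F t)" for t
 proof (induction t)
  case 0 thus ?case using x0 X0 by simp
 next
  case (Suc t)
  hence t: "t <= T" "Suc t : {1..T}" and IH: "X t : S" "X t : borel_measurable (F t)" by auto
  have u: "U t : C" "U t : borel_measurable (F t)" unfolding U_def using f[OF t(1) IH] by auto
  have w: "W' (Suc t) : S" "W' (Suc t) : borel_measurable (F (Suc t))"
   using W' t(2) unfolding adapted_sequences_in_def sequences_in_def by auto
  have up: "X t : borel_measurable (F (Suc t))" "U t : borel_measurable (F (Suc t))"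
   using toF[OF _ Suc.prems IH(2)] toF[OF _ Suc.prems u(2)] by auto
  have "X (Suc t) = X t + (%h. A (Suc t) h *v X t h) + (%h. B (Suc t) h *v U t h) + W' (Suc t)"
   unfolding XS by (simp add: fun_eq_iff)
  moreover have "\<dots> : S" by (intro S.S_add IH A_S B_C t u w)
  moreover have "X (Suc t) : borel_measurable (F (Suc t))" unfolding XS
   by (intro borel_measurable_add measurable_matrix_vector_mult up w A_meas B_meas t)
  ultimately show ?case by metis
 qed
 have "(X, U) : adapted_strategies T F S C" unfolding adapted_strategies_def adapted_processes_def
  using mem f unfolding U_def by auto
 moreover have "ALL t<=T. (X t, U t) : Q t" unfolding U_def using mem f by auto
 moreover have "X t h - X (t - 1) h = A t h *v X (t - 1) h + B t h *v U (t - 1) h + W' t h" if "t : {1..T}" for t h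
 proof -
  have "t = Suc (t - 1)" using that by auto
  thus ?thesis using XS[of "t - 1"] by simp
 qed
 ultimately show ?thesis using X0 by blast
qed

lemma oc_objective_Dom:
 assumes "!!t. t <= T ==> (X t, U t) : Dom t"
 shows "oc_objective M T L X U = ereal (SUM t<=T. V t (X t, U t))"
proof -
 let ?l = "%t. control_integrand.lz (L t) (X t, U t)"
 have i: "integrable M (?l t)" if "t <= T" for t
  by (rule control_integrand.D_integrable[OF integrand[OF that] assms[OF that]])
 have "AE w in M. ALL t:{0..T}. control_integrand.Lz (L t) (X t, U t) w = ereal (?l t w)"
  using control_integrand.D_finite[OF integrand assms] by (intro AE_finite_allI) auto
 hence "AE w in M. (SUM t=0..T. L t (X t w, U t w) w) = ereal (SUM t=0..T. ?l t w)"
 proof eventually_elim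
  case (elim w)
  have "L t (X t w, U t w) w = ereal (?l t w)" if "t : {0..T}" for t
   using elim that control_integrand.Lz_def[OF integrand, of t "(X t, U t)" w] by auto
  thus ?case by (simp add: sum_ereal)
 qed
 moreover have "integrable M (%w. SUM t=0..T. ?l t w)" using i by (intro Bochner_Integration.integrable_sum) auto
 ultimately have "oc_objective M T L X U = ereal (LINT w|M. (SUM t=0..T. ?l t w))"
  unfolding oc_objective_def by (intro ext_expectation_integrable)
 also have "(LINT w|M. (SUM t=0..T. ?l t w)) = (SUM t=0..T. (LINT w|M. ?l t w))"
  using i by (intro Bochner_Integration.integral_sum) auto
 also have "\<dots> = (SUM t<=T. V t (X t, U t))" unfolding atMost_atLeast0
  by (intro sum.cong refl) (simp add: control_integrand.val_def[OF integrand])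
 finally show ?thesis .
qed

end

text \<open>\<open>K_closed\<close> is strong closedness in sequential form, which matches the
  pseudo-metrics and is what limits of residuals are tested against.\<close>

locale control_qualified = control M S S' qS C C' qC T F A B L
 for M :: "'a measure" and S S' :: "('a => real^'n) set" and qS and C C' :: "('a => real^'m) set" and qC
  and T F A B and L :: "nat => (real^'n) \<times> (real^'m) => 'a => ereal" +
 fixes W :: "nat => 'a => real^'n" and Xb :: "nat => 'a => real^'n" and Ub :: "nat => 'a => real^'m"
  and K :: "nat => (('a => real^'n) \<times> ('a => real^'m)) set"
 assumes W: "W : adapted_sequences_in T F S"
  and bar_adapted: "(Xb, Ub) : adapted_strategies T F S C"
  and bar_system: "system_equations M T A B W Xb Ub"
  and K_eq: "t <= T ==> K t = pos_hull ((%z. z - (Xb t, Ub t)) ` dom_E M S C (L t))"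
  and K_linear: "t <= T ==> subspace (K t)"
  and K_closed: "t <= T ==> (!!n::nat. s n : K t) ==> z : S \<times> C ==> (%n. qS (fst (s n) - fst z)) \<longlonglongrightarrow> 0 ==>
   (%n. qC (snd (s n) - snd z)) \<longlonglongrightarrow> 0 ==> z : K t"
  and K_cond_exp: "t <= T ==> z : K t ==> map_prod (cond_exp M (F t)) (cond_exp M (F t)) z : K t"
  and K_recourse: "t <= T ==> x : S ==> EX u:C. (x, u) : K t"
  and dom_cond_exp: "t <= T ==> z : dom_E M S C (L t) ==>
   map_prod (cond_exp M (F t)) (cond_exp M (F t)) z : dom_E M S C (L t)"
  and dom_recourse: "t <= T ==> x : S ==> EX u:C. (x, u) : dom_E M S C (L t)"
begin

definition xb :: "nat => ('a => real^'n) \<times> ('a => real^'m)" where "xb t = (Xb t, Ub t)"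

lemma Dom_eq: "t <= T ==> dom_E M S C (L t) = Dom t"
 by (simp add: control_integrand.D_def[OF integrand])

lemma cexp_Dom: "t <= T ==> z : Dom t ==> cexp t z : Dom t"
 using dom_cond_exp[of t z] by (simp add: Dom_eq cexp_def map_prod_def case_prod_beta)

lemma cexp_K: "t <= T ==> z : K t ==> cexp t z : K t"
 using K_cond_exp[of t z] by (simp add: cexp_def map_prod_def case_prod_beta)

lemma xb_mem: "t <= T ==> xb t : S \<times> C"
 and xb_measurable: "t <= T ==> fst (xb t) : borel_measurable (F t)" "t <= T ==> snd (xb t) : borel_measurable (F t)"
 using bar_adapted unfolding adapted_strategies_def adapted_processes_def xb_def by auto

lemma K_iff: "t <= T ==> k : K t \<longleftrightarrow> (EX c>0. EX d:Dom t. k = c *\<^sub>R (d - xb t))"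
 unfolding K_eq Dom_eq pos_hull_def xb_def[symmetric] image_image
 by (simp only: UN_iff image_iff greaterThan_iff Bex_def)

lemma K_eqv: assumes t: "t <= T" and k: "k : K t" and y: "y : S \<times> C" "eqv y k" shows "y : K t"
proof -
 obtain c d where c: "c > 0" "d : Dom t" "k = c *\<^sub>R (d - xb t)" using k unfolding K_iff[OF t] by blast
 define d' where "d' = xb t + (1 / c) *\<^sub>R y"
 have "eqv d' (xb t + (1 / c) *\<^sub>R k)" unfolding d'_def by (intro eqv_add eqv_refl eqv_scale y)
 moreover have "xb t + (1 / c) *\<^sub>R k = d" using c by simp
 ultimately have "d' : Dom t"
  using Dom_eqv(1)[OF t c(2)] SC_add[OF xb_mem[OF t] SC_scale[OF y(1)]] unfolding d'_def by simp
 moreover have "y = c *\<^sub>R (d' - xb t)" using c(1) unfolding d'_def by simp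
 ultimately show ?thesis using c(1) unfolding K_iff[OF t] by blast
qed

lemma xb_Dom: assumes t: "t <= T" shows "xb t : Dom t"
proof -
 obtain c d where "c > 0" "d : Dom t" "0 = c *\<^sub>R (d - xb t)"
  using subspace_0[OF K_linear[OF t]] unfolding K_iff[OF t] by blast
 thus ?thesis by simp
qed

lemma Dom_K: "t <= T ==> d : Dom t ==> d - xb t : K t"
 unfolding K_iff by (intro exI[of _ 1]) auto

text \<open>By convexity a whole interval of step lengths is admissible; it is needed because
  \<open>process_duality\<close> uses a common step length for all times.\<close>

lemma K_segment:
 assumes t: "t <= T" and k: "k : K t"
 shows "EX e>0. ALL r. 0 < r --> r <= e --> xb t + r *\<^sub>R k : Dom t"
proof -
 obtain c d where c: "c > 0" "d : Dom t" "k = c *\<^sub>R (d - xb t)" using k unfolding K_iff[OF t] by blast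
 have "xb t + r *\<^sub>R k : Dom t" if r: "0 < r" "r <= 1 / c" for r
 proof -
  have "r * c <= 1" "0 <= r * c" using r c(1) by (auto simp: field_simps)
  hence "(1 - r * c) *\<^sub>R xb t + (r * c) *\<^sub>R d : Dom t"
   by (intro control_integrand.D_convex_comb(1)[OF integrand[OF t] xb_Dom[OF t] c(2)]) auto
  moreover have "(1 - r * c) *\<^sub>R xb t + (r * c) *\<^sub>R d = xb t + r *\<^sub>R k"
   unfolding c(3) by (simp add: algebra_simps)
  ultimately show ?thesis by simp
 qed
 thus ?thesis using c(1) by (intro exI[of _ "1 / c"]) auto
qed

text \<open>The recourse control is replaced by its conditional expectation. The state is already
  measurable, so conditioning the pair changes the state on a null set only, and the domain is
  stable under both operations.\<close>

lemma adapted_recourse_Dom: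
 assumes t: "t <= T" and x: "x : S" "x : borel_measurable (F t)"
 shows "EX u. u : C & u : borel_measurable (F t) & (x, u) : Dom t"
proof -
 obtain u where u: "u : C" "(x, u) : Dom t" using dom_recourse[OF t x(1)] unfolding Dom_eq[OF t] by blast
 have 1: "cexp t (x, u) : Dom t" by (rule cexp_Dom[OF t u(2)])
 have 2: "cond_exp M (F t) u : C" using EC[OF t] u(1) by blast
 have "AE w in M. x w = cond_exp M (F t) x w"
  using prob_subalgebra.cond_exp_ident[OF sub_alg[OF t] S.S_integrable[OF x(1)] x(2)] by eventually_elim simp
 hence "eqv (x, cond_exp M (F t) u) (cexp t (x, u))" unfolding eqv_def cexp_def by simp
 hence "(x, cond_exp M (F t) u) : Dom t" using Dom_eqv(1)[OF t 1] x(1) 2 by simp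
 thus ?thesis using 2 prob_subalgebra.cond_exp_measurable[OF sub_alg[OF t]] by blast
qed

lemma adapted_recourse_K:
 assumes t: "t <= T" and x: "x : S" "x : borel_measurable (F t)"
 shows "EX u. u : C & u : borel_measurable (F t) & (x, u) : K t"
proof -
 obtain u where u: "u : C" "(x, u) : K t" using K_recourse[OF t x(1)] by blast
 have 1: "cexp t (x, u) : K t" by (rule cexp_K[OF t u(2)])
 have 2: "cond_exp M (F t) u : C" using EC[OF t] u(1) by blast
 have "AE w in M. x w = cond_exp M (F t) x w"
  using prob_subalgebra.cond_exp_ident[OF sub_alg[OF t] S.S_integrable[OF x(1)] x(2)] by eventually_elim simp
 hence "eqv (x, cond_exp M (F t) u) (cexp t (x, u))" unfolding eqv_def cexp_def by simp
 hence "(x, cond_exp M (F t) u) : K t" using K_eqv[OF t 1] x(1) 2 by simp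
 thus ?thesis using 2 prob_subalgebra.cond_exp_measurable[OF sub_alg[OF t]] by blast
qed

lemma feasible_exists:
 assumes "W' : adapted_sequences_in T F S"
 shows "EX X U. oc_feasible M T F A B W' L X U"
proof -
 have z: "0 : borel_measurable (F 0)" by (simp add: zero_fun_def)
 have ex: "EX X U. (X, U) : adapted_strategies T F S C & (ALL t<=T. (X t, U t) : Dom t) & X 0 = 0 &
  (ALL t:{1..T}. ALL w. X t w - X (t - 1) w = A t w *v X (t - 1) w + B t w *v U (t - 1) w + W' t w)"
  by (rule recourse_strategy[OF _ S.S_zero z assms]) (rule adapted_recourse_Dom; assumption)
 obtain X U where XU: "(X, U) : adapted_strategies T F S C" "ALL t<=T. (X t, U t) : Dom t"
  "ALL t:{1..T}. ALL w. X t w - X (t - 1) w = A t w *v X (t - 1) w + B t w *v U (t - 1) w + W' t w"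
  using ex by blast
 have "\<bar>oc_objective M T L X U\<bar> ~= \<infinity>" using oc_objective_Dom[of X U] XU(2) by simp
 moreover have "(X, U) : oc_constraints M T F A B W'"
  using XU(1,3) unfolding oc_constraints_def adapted_strategies_def system_equations_def by auto
 ultimately show ?thesis unfolding oc_feasible_def by (intro exI[of _ X] exI[of _ U] conjI)
qed

text \<open>The reachable directions. Only the non-adapted part is constrained, since an adapted
  part can be corrected by a homogeneous solution.\<close>

definition residual_space :: "(nat => ('a => real^'n) \<times> ('a => real^'m)) set" where
 "residual_space = {z : procs. ALL t<=T. z t - cexp t (z t) : K t}"

lemma residual_subspace: "subspace residual_space"
proof (rule subspaceI)
 have P: "subspace procs" by (rule fspace_subspace[OF procs_fspace])
 show "0 : residual_space"
 proof -
  have "0 - cexp t 0 : K t" if t: "t <= T" for t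
  proof (rule K_eqv[OF t subspace_0[OF K_linear[OF t]] SC_diff[OF SC_zero cexp_mem[OF t SC_zero]]])
   have "eqv (cexp t 0) 0" using cexp_adapted[OF t SC_zero] by (simp add: zero_fun_def)
   thus "eqv (0 - cexp t 0) 0" using eqv_diff[OF eqv_refl, of "cexp t 0" 0 0] by simp
  qed
  thus ?thesis using subspace_0[OF P] unfolding residual_space_def by simp
 qed
 show "x + y : residual_space" if xy: "x : residual_space" "y : residual_space" for x y
 proof -
  have "(x + y) t - cexp t ((x + y) t) : K t" if t: "t <= T" for t
  proof -
   have k: "x t - cexp t (x t) : K t" "y t - cexp t (y t) : K t" and m: "x t : S \<times> C" "y t : S \<times> C"
    using xy t procsD unfolding residual_space_def by blast+
   have "eqv (x t + y t - cexp t (x t + y t)) (x t + y t - (cexp t (x t) + cexp t (y t)))"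
    by (intro eqv_diff eqv_refl cexp_add t m)
   moreover have "x t + y t - (cexp t (x t) + cexp t (y t)) = (x t - cexp t (x t)) + (y t - cexp t (y t))" by simp
   ultimately show ?thesis
    using K_eqv[OF t subspace_add[OF K_linear[OF t] k]] SC_diff[OF SC_add[OF m] cexp_mem[OF t SC_add[OF m]]] by simp
  qed
  thus ?thesis using xy subspace_add[OF P] unfolding residual_space_def by simp
 qed
 show "c *\<^sub>R x : residual_space" if x: "x : residual_space" for c x
 proof -
  have "(c *\<^sub>R x) t - cexp t ((c *\<^sub>R x) t) : K t" if t: "t <= T" for t
  proof -
   have k: "x t - cexp t (x t) : K t" and m: "x t : S \<times> C"
    using x t procsD unfolding residual_space_def by blast+
   have "eqv (c *\<^sub>R x t - cexp t (c *\<^sub>R x t)) (c *\<^sub>R x t - c *\<^sub>R cexp t (x t))"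
    by (intro eqv_diff eqv_refl cexp_scale t m)
   moreover have "c *\<^sub>R x t - c *\<^sub>R cexp t (x t) = c *\<^sub>R (x t - cexp t (x t))" by (simp add: scaleR_diff_right)
   ultimately show ?thesis
    using K_eqv[OF t subspace_scale[OF K_linear[OF t] k, of c]] SC_diff[OF SC_scale[OF m] cexp_mem[OF t SC_scale[OF m]]] by simp
  qed
  thus ?thesis using x subspace_scale[OF P] unfolding residual_space_def by simp
 qed
qed

lemma homogeneous_residual: "homogeneous <= residual_space"
proof
 fix g assume g: "g : homogeneous"
 have "g t - cexp t (g t) : K t" if t: "t <= T" for t
 proof -
  have m: "g t : S \<times> C" using g t procsD unfolding homogeneous_def by blast
  show ?thesis
  proof (rule K_eqv[OF t subspace_0[OF K_linear[OF t]] SC_diff[OF m cexp_mem[OF t m]]])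
   have "eqv (cexp t (g t)) (g t)" using g t unfolding homogeneous_def by blast
   from eqv_diff[OF eqv_refl this, of "g t"] show "eqv (g t - cexp t (g t)) 0" by simp
  qed
 qed
 thus "g : residual_space" using g unfolding homogeneous_def residual_space_def by blast
qed

lemma residual_closed: "seq_closed_in procs procs_norm residual_space"
 unfolding seq_closed_in_def
proof (intro allI impI, elim conjE)
 fix s :: "nat => _" and x assume s: "ALL n. s n : residual_space" and x: "x : procs" and lim: "(%n. procs_norm (s n - x)) \<longlonglongrightarrow> 0"
 have sp: "s n : procs" for n using s unfolding residual_space_def by blast
 have sd: "s n - x : procs" for n by (rule fspace_diff[OF procs_fspace sp x])
 have "x t - cexp t (x t) : K t" if t: "t <= T" for t
 proof -
  note st = procsD[OF sp t] and xt = procsD[OF x t]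
  have k: "s n t - cexp t (s n t) : K t" for n using s t unfolding residual_space_def by blast
  have l: "(%n. qS (fst (s n t) - fst (x t))) \<longlonglongrightarrow> 0" "(%n. qC (snd (s n t) - snd (x t))) \<longlonglongrightarrow> 0"
   using component_tendsto[OF sd lim t] by simp_all
  note lc = cexp_continuous[OF t st xt l]
  have m: "fst (s n t) : S" "snd (s n t) : C" "fst (x t) : S" "snd (x t) : C"
   "fst (cexp t (s n t)) : S" "snd (cexp t (s n t)) : C" "fst (cexp t (x t)) : S" "snd (cexp t (x t)) : C" for n
   using st[of n] xt cexp_mem[OF t st[of n]] cexp_mem[OF t xt] by (auto simp: mem_Times_iff)
  have "(%n. qS ((fst (s n t) - fst (x t)) + - 1 *\<^sub>R (fst (cexp t (s n t)) - fst (cexp t (x t))))) \<longlonglongrightarrow> 0"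
   by (intro q_add_tendsto[OF S.S_fspace] q_scale_tendsto[OF S.S_fspace] l lc S.S_scale S.S_diff m)
  moreover have "(fst (s n t) - fst (x t)) + - 1 *\<^sub>R (fst (cexp t (s n t)) - fst (cexp t (x t))) =
   fst (s n t - cexp t (s n t)) - fst (x t - cexp t (x t))" for n by simp
  ultimately have 1: "(%n. qS (fst (s n t - cexp t (s n t)) - fst (x t - cexp t (x t)))) \<longlonglongrightarrow> 0" by (simp only:)
  have "(%n. qC ((snd (s n t) - snd (x t)) + - 1 *\<^sub>R (snd (cexp t (s n t)) - snd (cexp t (x t))))) \<longlonglongrightarrow> 0"
   by (intro q_add_tendsto[OF C.S_fspace] q_scale_tendsto[OF C.S_fspace] l lc C.S_scale C.S_diff m)
  moreover have "(snd (s n t) - snd (x t)) + - 1 *\<^sub>R (snd (cexp t (s n t)) - snd (cexp t (x t))) =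
   snd (s n t - cexp t (s n t)) - snd (x t - cexp t (x t))" for n by simp
  ultimately have 2: "(%n. qC (snd (s n t - cexp t (s n t)) - snd (x t - cexp t (x t)))) \<longlonglongrightarrow> 0" by (simp only:)
  show ?thesis by (rule K_closed[OF t k SC_diff[OF xt cexp_mem[OF t xt]] 1 2])
 qed
 thus "x : residual_space" using x unfolding residual_space_def by blast
qed

lemma strategy_homogeneous:
 assumes XU: "(X, U) : adapted_strategies T F S C" and d: "!!t. t : {1..T} ==> AE w in M. defect (%t. (X t, U t)) t w = 0"
 shows "(%t. (X t, U t)) : homogeneous"
proof -
 have m: "(X t, U t) : S \<times> C" "X t : borel_measurable (F t)" "U t : borel_measurable (F t)" if "t <= T" for t
  using XU that unfolding adapted_strategies_def adapted_processes_def by auto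
 hence "eqv (cexp t (X t, U t)) (X t, U t)" if "t <= T" for t using cexp_adapted[OF that] that by auto
 thus ?thesis using m d unfolding homogeneous_def procs_def by auto
qed

text \<open>Splitting \<open>h\<close> into \<open>h - cexp h\<close>, which lies in \<open>K\<close>, and the adapted part \<open>cexp h\<close>, whose defect is
  reproduced by an adapted process with values in \<open>K\<close>.\<close>

lemma residual_split:
 assumes h: "h : residual_space"
 shows "EX g:homogeneous. ALL t<=T. h t + g t : K t"
proof -
 define a where "a = (%t. cexp t (h t))"
 have hp: "h : procs" and hK: "!!t. t <= T ==> h t - a t : K t" using h unfolding residual_space_def a_def by auto
 have ap: "a : procs" using cexp_mem procsD[OF hp] unfolding a_def procs_def by blast
 have am: "fst (a t) : borel_measurable (F t)" "snd (a t) : borel_measurable (F t)" if "t <= T" for t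
  unfolding a_def by (rule cexp_measurable[OF that])+
 have dm: "defect a t : borel_measurable (F t)" if t: "t : {1..T}" for t
 proof -
  have tT: "t <= T" "t - 1 <= t" "t - 1 <= T" using t by auto
  show ?thesis unfolding defect_def[abs_def]
   by (intro borel_measurable_diff measurable_matrix_vector_mult A_meas[OF t] B_meas[OF t]
     am[OF tT(1)] toF[OF tT(2,1) am(1)[OF tT(3)]] toF[OF tT(2,1) am(2)[OF tT(3)]])
 qed
 have W': "defect a : adapted_sequences_in T F S"
  unfolding adapted_sequences_in_def sequences_in_def using dm defect_mem[OF ap] by auto
 have a0: "fst (a 0) : S" using procsD[OF ap, of 0] by auto
 have ex: "EX X U. (X, U) : adapted_strategies T F S C & (ALL t<=T. (X t, U t) : K t) & X 0 = fst (a 0) &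
  (ALL t:{1..T}. ALL w. X t w - X (t - 1) w = A t w *v X (t - 1) w + B t w *v U (t - 1) w + defect a t w)"
  by (rule recourse_strategy[OF _ a0 am(1)[OF le0] W']) (rule adapted_recourse_K; assumption)
 obtain X U where XU: "(X, U) : adapted_strategies T F S C" "ALL t<=T. (X t, U t) : K t"
  "ALL t:{1..T}. ALL w. X t w - X (t - 1) w = A t w *v X (t - 1) w + B t w *v U (t - 1) w + defect a t w"
  using ex by blast
 define g where "g = (%t. (X t - fst (a t), U t - snd (a t)))"
 have g: "g : homogeneous" unfolding g_def
 proof (rule strategy_homogeneous)
  show "(%t. X t - fst (a t), %t. U t - snd (a t)) : adapted_strategies T F S C"
   using XU(1) am procsD[OF ap] S.S_diff C.S_diff unfolding adapted_strategies_def adapted_processes_def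
   by (auto simp: fun_diff_def mem_Times_iff)
  show "AE w in M. defect (%t. (X t - fst (a t), U t - snd (a t))) t w = 0" if t: "t : {1..T}" for t
  proof (rule AE_I2)
   fix w
   have "defect (%t. (X t - fst (a t), U t - snd (a t))) t w = defect ((%t. (X t, U t)) - a) t w"
    unfolding defect_def by simp
   also have "\<dots> = defect (%t. (X t, U t)) t w - defect a t w" by (rule defect_linear)
   also have "defect (%t. (X t, U t)) t w = defect a t w" using XU(3) t by (simp add: defect_def[of "%t. (X t, U t)"])
   finally show "defect (%t. (X t - fst (a t), U t - snd (a t))) t w = 0" by (simp only: diff_self)
  qed
 qed
 have "h t + g t : K t" if t: "t <= T" for t
 proof -
  have eq: "h t + g t = (h t - a t) + (X t, U t)" unfolding g_def by (simp add: prod_eq_iff)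
  have "(X t, U t) : K t" using XU(2) t by blast
  thus ?thesis unfolding eq by (rule subspace_add[OF K_linear[OF t] hK[OF t]])
 qed
 thus ?thesis using g by blast
qed

section \<open>Closedness of the total cost and the separating functional\<close>

definition dom_procs where "dom_procs = {x. ALL t<=T. x t : Dom t}"

definition cost where "cost x = (SUM t<=T. V t (x t))"

lemma dom_procs_sub: "dom_procs <= procs"
 unfolding dom_procs_def procs_def using Dom_sub by blast

text \<open>The limit could have infinite cost at some times, so the lower limits are not added
  directly. Instead real numbers strictly below them are summed: a huge one at a single time
  excludes an infinite value, and numbers just below the values give the inequality.\<close>

lemma cost_closed:
 assumes s: "!!n::nat. s n : dom_procs" and x: "x : procs" and lim: "(%n. procs_norm (s n - x)) \<longlonglongrightarrow> 0"
  and r: "!!n. cost (s n) <= r n" "r \<longlonglongrightarrow> c"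
 shows "x : dom_procs & cost x <= c"
proof -
 have sp: "s n : procs" for n using s dom_procs_sub by blast
 have sd: "s n - x : procs" for n by (rule fspace_diff[OF procs_fspace sp x])
 define e where "e t = ext_expectation M (control_integrand.Lz (L t) (x t))" for t
 have lsc: "e t <= liminf (%n. ereal (V t (s n t)))" if t: "t <= T" for t
 proof -
  have l: "(%n. qS (fst (s n t) - fst (x t))) \<longlonglongrightarrow> 0" "(%n. qC (snd (s n t) - snd (x t))) \<longlonglongrightarrow> 0"
   using component_tendsto[OF sd lim t] by simp_all
  have "ext_expectation M (control_integrand.Lz (L t) (s n t)) = ereal (V t (s n t))" for n
   using control_integrand.D_expectation[OF integrand[OF t]] s[of n] t unfolding dom_procs_def by blast
  thus ?thesis
   using control_integrand.val_lsc[OF integrand[OF t] procsD[OF sp t] procsD[OF x t] l] unfolding e_def by simp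
 qed
 have ninf: "e t > - \<infinity>" if t: "t <= T" for t
  unfolding e_def by (rule control_integrand.ext_expectation_Lz[OF integrand[OF t] procsD[OF x t]])
 have bound: "(SUM t<=T. b t) <= c" if b: "!!t. t <= T ==> ereal (b t) < e t" for b
 proof -
  have "\<forall>\<^sub>F n in sequentially. ALL t:{..T}. b t <= V t (s n t)"
  proof (rule eventually_ball_finite)
   show "ALL t:{..T}. \<forall>\<^sub>F n in sequentially. b t <= V t (s n t)"
   proof
    fix t assume "t : {..T}"
    hence "ereal (b t) < liminf (%n. ereal (V t (s n t)))" using b lsc by (metis atMost_iff less_le_trans)
    hence "\<forall>\<^sub>F n in sequentially. ereal (b t) < ereal (V t (s n t))" by (rule less_LiminfD)
    thus "\<forall>\<^sub>F n in sequentially. b t <= V t (s n t)" by eventually_elim simp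
   qed
  qed simp
  hence "\<forall>\<^sub>F n in sequentially. (SUM t<=T. b t) <= r n"
  proof eventually_elim
   case (elim n)
   have "(SUM t<=T. b t) <= cost (s n)" unfolding cost_def using elim by (intro sum_mono) auto
   thus ?case using r(1)[of n] by simp
  qed
  thus ?thesis using tendsto_lowerbound[OF r(2)] by simp
 qed
 have "ALL t. EX b. t <= T --> ereal b < e t"
 proof
  fix t show "EX b. t <= T --> ereal b < e t"
  proof (cases "t <= T")
   case True
   obtain b where "- \<infinity> < ereal b" "ereal b < e t" using ereal_dense2[OF ninf[OF True]] by blast
   thus ?thesis by blast
  qed simp
 qed
 from choice[OF this] obtain b0 where b0: "!!t. t <= T ==> ereal (b0 t) < e t" by blast
 have fin: "e t < \<infinity>" if t: "t <= T" for t
 proof (rule ccontr)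
  assume "~ e t < \<infinity>"
  hence top: "e t = \<infinity>" by (cases "e t") auto
  \<comment> \<open>The entry at \<open>t\<close> is adjusted so that the total is
    \<open>c + 1\<close>, contradicting \<open>bound\<close>.\<close>
  define b where "b = b0(t := c + 1 - (SUM s:{..T} - {t}. b0 s))"
  have "(SUM s<=T. b s) = b t + (SUM s:{..T} - {t}. b s)" by (rule sum.remove) (use t in auto)
  also have "(SUM s:{..T} - {t}. b s) = (SUM s:{..T} - {t}. b0 s)" unfolding b_def by (intro sum.cong) auto
  finally have "(SUM s<=T. b s) = c + 1" unfolding b_def by simp
  moreover have "(SUM s<=T. b s) <= c" by (rule bound) (use b0 top in \<open>auto simp: b_def\<close>)
  ultimately show False by simp
 qed
 have xD: "x t : Dom t" if t: "t <= T" for t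
  using fin[OF t] procsD[OF x t] unfolding e_def control_integrand.D_iff[OF integrand[OF t]] by blast
 have ev: "e t = ereal (V t (x t))" if t: "t <= T" for t
  unfolding e_def by (rule control_integrand.D_expectation[OF integrand[OF t] xD[OF t]])
 have "cost x <= c"
 proof (rule field_le_epsilon)
  fix \<epsilon> :: real assume \<epsilon>: "\<epsilon> > 0"
  have "(SUM t<=T. V t (x t) - \<epsilon> / real (Suc T)) <= c" by (rule bound) (use ev \<epsilon> in auto)
  moreover have "(SUM t<=T. V t (x t) - \<epsilon> / real (Suc T)) = cost x - \<epsilon>" unfolding cost_def sum_subtractf by simp
  ultimately show "cost x <= c + \<epsilon>" by simp
 qed
 thus ?thesis using xD unfolding dom_procs_def by blast
qed

text \<open>A process differing from \<open>xb\<close> by a homogeneous one is almost surely equal to a feasible one.\<close>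

lemma cost_ge_inf:
 assumes g: "g : homogeneous" and x: "xb + g : dom_procs"
 shows "oc_inf M T F A B W L <= ereal (cost (xb + g))"
proof -
 \<comment> \<open>Conditioning produces an adapted version; both \<open>xb\<close> and
   \<open>g\<close> are invariant under it up to null sets.\<close>
 define y where "y t = cexp t ((xb + g) t)" for t
 have gm: "g t : S \<times> C" if "t <= T" for t using g procsD[OF _ that] unfolding homogeneous_def by blast
 have yD: "y t : Dom t" and yV: "V t (y t) <= V t ((xb + g) t)" and yx: "eqv (y t) ((xb + g) t)" if t: "t <= T" for t
 proof -
  have xt: "(xb + g) t : Dom t" using x t unfolding dom_procs_def by blast
  have m: "(xb + g) t : S \<times> C" by (rule Dom_sub[OF t xt])
  have "eqv (cexp t (xb t + g t)) (cexp t (xb t) + cexp t (g t))" by (rule cexp_add[OF t xb_mem[OF t] gm[OF t]])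
  moreover have "eqv (cexp t (xb t) + cexp t (g t)) (xb t + g t)"
   using g t unfolding homogeneous_def by (intro eqv_add cexp_adapted[OF t xb_mem[OF t] xb_measurable[OF t]]) auto
  ultimately show e: "eqv (y t) ((xb + g) t)" unfolding y_def using eqv_trans by simp
  show "y t : Dom t" "V t (y t) <= V t ((xb + g) t)"
   using Dom_eqv[OF t xt _ e] cexp_mem[OF t m] unfolding y_def by auto
 qed
 have "oc_objective M T L (%t. fst (y t)) (%t. snd (y t)) = ereal (SUM t<=T. V t (fst (y t), snd (y t)))"
  by (rule oc_objective_Dom) (use yD in simp)
 also have "\<dots> <= ereal (cost (xb + g))" unfolding cost_def using yV by (auto intro!: sum_mono)
 finally have 1: "oc_objective M T L (%t. fst (y t)) (%t. snd (y t)) <= ereal (cost (xb + g))" .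
 have "AE w in M. fst (y t) w - fst (y (t - 1)) w =
   A t w *v fst (y (t - 1)) w + B t w *v snd (y (t - 1)) w + W t w" if t: "t : {1..T}" for t
 proof -
  have tT: "t <= T" "t - 1 <= T" using t by auto
  have "AE w in M. defect xb t w = W t w"
   using bar_system t unfolding system_equations_def defect_def xb_def by (auto elim!: AE_mp simp: algebra_simps)
  moreover have "AE w in M. defect g t w = 0" using g t unfolding homogeneous_def by blast
  moreover have "AE w in M. fst (y t) w = fst ((xb + g) t) w & snd (y t) w = snd ((xb + g) t) w"
   "AE w in M. fst (y (t - 1)) w = fst ((xb + g) (t - 1)) w & snd (y (t - 1)) w = snd ((xb + g) (t - 1)) w"
   using yx[OF tT(1)] yx[OF tT(2)] unfolding eqv_def .
  ultimately show ?thesis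
  proof eventually_elim
   case (elim w)
   have "defect y t w = defect (xb + g) t w" unfolding defect_def using elim(3,4) by simp
   also have "\<dots> = W t w" using elim(1,2) by (simp add: defect_linear)
   finally show ?case unfolding defect_def by (simp add: algebra_simps)
  qed
 qed
 hence "(%t. fst (y t), %t. snd (y t)) : oc_constraints M T F A B W"
  using cexp_measurable unfolding oc_constraints_def adapted_processes_def system_equations_def y_def by auto
 hence "oc_inf M T F A B W L <= oc_objective M T L (%t. fst (y t)) (%t. snd (y t))"
  unfolding oc_inf_def by (rule INF_lower2) simp
 thus ?thesis using 1 by (rule order_trans)
qed

lemma process_duality:
 assumes m: "ereal m <= oc_inf M T F A B W L"
 shows "EX v. continuous_functional procs procs_norm v & (ALL g:homogeneous. v g = 0) &
  (ALL x:dom_procs. m + v (x - xb) <= cost x)"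
proof (rule fspace_duality[OF procs_fspace homogeneous_subspace homogeneous_residual homogeneous_closed
   residual_subspace _ residual_closed dom_procs_sub _ _ _ _ cost_closed])
 show "residual_space <= procs" unfolding residual_space_def by blast
 show "u *\<^sub>R x + v *\<^sub>R y : dom_procs & cost (u *\<^sub>R x + v *\<^sub>R y) <= u * cost x + v * cost y"
  if xy: "x : dom_procs" "y : dom_procs" and uv: "0 <= u" "0 <= v" "u + v = 1" for x y u v
 proof -
  have c: "u *\<^sub>R x t + v *\<^sub>R y t : Dom t" "V t (u *\<^sub>R x t + v *\<^sub>R y t) <= u * V t (x t) + v * V t (y t)" if "t <= T" for t
   using control_integrand.D_convex_comb[OF integrand[OF that] _ _ uv] xy that unfolding dom_procs_def by blast+
  have "cost (u *\<^sub>R x + v *\<^sub>R y) <= (SUM t<=T. u * V t (x t) + v * V t (y t))"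
   unfolding cost_def using c(2) by (intro sum_mono) auto
  also have "\<dots> = u * cost x + v * cost y" unfolding cost_def by (simp add: sum.distrib sum_distrib_left)
  finally show ?thesis using c(1) unfolding dom_procs_def by simp
 qed
 show "xb : dom_procs" unfolding dom_procs_def using xb_Dom by blast
 show "x - xb : residual_space" if x: "x : dom_procs" for x
 proof -
  have "(x - xb) t - cexp t ((x - xb) t) : K t" if t: "t <= T" for t
   using Dom_K[OF t, of "x t"] cexp_K[OF t] subspace_diff[OF K_linear[OF t]] x t unfolding dom_procs_def by simp
  moreover have "x - xb : procs"
   using SC_diff[OF Dom_sub xb_mem] x unfolding dom_procs_def procs_def by auto
  ultimately show ?thesis unfolding residual_space_def by blast
 qed
 show "EX t>0. EX g:homogeneous. xb + t *\<^sub>R h + g : dom_procs" if h: "h : residual_space" for h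
 proof -
  obtain g where g: "g : homogeneous" "!!t. t <= T ==> h t + g t : K t" using residual_split[OF h] by blast
  have "ALL t. EX e>0. t <= T --> (ALL r. 0 < r --> r <= e --> xb t + r *\<^sub>R (h t + g t) : Dom t)"
   using K_segment[OF _ g(2)] zero_less_one by metis
  from choice[OF this] obtain e where e: "!!t. e t > 0"
   "!!t r. t <= T ==> 0 < r ==> r <= e t ==> xb t + r *\<^sub>R (h t + g t) : Dom t" by blast
  define r where "r = Min (e ` {..T})"
  have r: "r > 0" "!!t. t <= T ==> r <= e t" unfolding r_def using e(1) by (auto simp: Min_gr_iff)
  have "xb + r *\<^sub>R h + r *\<^sub>R g : dom_procs" unfolding dom_procs_def using e(2)[OF _ r(1) r(2)]
   by (auto simp: scaleR_add_right add.assoc)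
  thus ?thesis using r(1) subspace_scale[OF homogeneous_subspace g(1)] by blast
 qed
 show "m <= cost (xb + g)" if "g : homogeneous" "xb + g : dom_procs" for g
  using order_trans[OF m cost_ge_inf[OF that]] by simp
qed

end

section \<open>Multipliers\<close>

lemma linear_functional_on_sum:
 assumes l: "linear_functional_on V l" and V: "subspace V" and x: "finite I" "!!i. i : I ==> x i : V"
 shows "l (SUM i:I. x i) = (SUM i:I. l (x i))"
 using x
proof (induction I rule: finite_induct)
 case empty
 thus ?case using linear_functional_on_zero[OF l subspace_0[OF V]] by simp
next
 case (insert i I)
 thus ?case using linear_functional_onD(1)[OF l, of "x i" "SUM i:I. x i"] subspace_sum[OF V, of I x] by simp
qed

context control
begin

definition single :: "nat => ('a => real^'n) \<times> ('a => real^'m) => nat => ('a => real^'n) \<times> ('a => real^'m)" where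
 "single t z = (%s. if s = t then z else 0)"

lemma single_mem: "z : S \<times> C ==> single t z : procs"
 unfolding single_def procs_def using SC_zero by simp

lemma single_norm: assumes "t <= T" shows "procs_norm (single t z) = qS (fst z) + qC (snd z)"
proof -
 have "procs_norm (single t z) = (SUM s<=T. if s = t then qS (fst z) + qC (snd z) else 0)"
  unfolding procs_norm_def single_def using q_zero[OF S.S_fspace] q_zero[OF C.S_fspace] by (intro sum.cong) auto
 thus ?thesis using assms by simp
qed

text \<open>A functional on a finite product is the sum of its restrictions to the coordinates,
  which \<open>single\<close> embeds.\<close>

lemma functional_components:
 assumes v: "continuous_functional procs procs_norm v"
 obtains lS lC where "!!t. t <= T ==> continuous_functional S qS (lS t)" "!!t. t <= T ==> continuous_functional C qC (lC t)"
  "!!x. x : procs ==> v x = (SUM t<=T. lS t (fst (x t)) + lC t (snd (x t)))"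
proof
 let ?lS = "%t x. v (single t (x, 0))" and ?lC = "%t u. v (single t (0, u))"
 have lin: "linear_functional_on procs v" using v unfolding continuous_functional_def by blast
 have P: "subspace procs" by (rule fspace_subspace[OF procs_fspace])
 have m1: "single t (x, 0) : procs" if "x : S" for t x using single_mem that C.S_zero by simp
 have m2: "single t (0, u) : procs" if "u : C" for t u using single_mem that S.S_zero by simp
 show "continuous_functional S qS (?lS t)" if t: "t <= T" for t
 proof (rule continuous_functionalI[OF S.S_fspace])
  have "single t (x + y, 0) = single t (x, 0) + single t (y, 0)" "single t (c *\<^sub>R x, 0) = c *\<^sub>R single t (x, 0)" for x y c
   unfolding single_def by (auto simp: fun_eq_iff)
  thus "linear_functional_on S (?lS t)"
   unfolding linear_functional_on_def using linear_functional_onD[OF lin] m1 by simp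
  fix s :: "nat => _" assume s: "!!n. s n : S" "(%n. qS (s n)) \<longlonglongrightarrow> 0"
  show "(%n. v (single t (s n, 0))) \<longlonglongrightarrow> 0"
   by (rule continuous_functional_tendsto_0[OF procs_fspace v m1[OF s(1)]])
    (use s(2) single_norm[OF t] q_zero[OF C.S_fspace] in simp)
 qed
 show "continuous_functional C qC (?lC t)" if t: "t <= T" for t
 proof (rule continuous_functionalI[OF C.S_fspace])
  have "single t (0, x + y) = single t (0, x) + single t (0, y)" "single t (0, c *\<^sub>R x) = c *\<^sub>R single t (0, x)" for x y c
   unfolding single_def by (auto simp: fun_eq_iff)
  thus "linear_functional_on C (?lC t)"
   unfolding linear_functional_on_def using linear_functional_onD[OF lin] m2 by simp
  fix s :: "nat => _" assume s: "!!n. s n : C" "(%n. qC (s n)) \<longlonglongrightarrow> 0"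
  show "(%n. v (single t (0, s n))) \<longlonglongrightarrow> 0"
   by (rule continuous_functional_tendsto_0[OF procs_fspace v m2[OF s(1)]])
    (use s(2) single_norm[OF t] q_zero[OF S.S_fspace] in simp)
 qed
 show "v x = (SUM t<=T. ?lS t (fst (x t)) + ?lC t (snd (x t)))" if x: "x : procs" for x
 proof -
  have f: "fst (x t) : S" "snd (x t) : C" if "t <= T" for t using procsD[OF x that] by (auto simp: mem_Times_iff)
  have sm: "single t (x t) : procs" if "t <= T" for t by (rule single_mem[OF procsD[OF x that]])
  \<comment> \<open>\<open>y\<close> agrees with \<open>x\<close> up to time \<open>T\<close>, and
    the difference at later times has \<open>procs_norm\<close> equal to \<open>0\<close>.\<close>
  define y where "y = (SUM t<=T. single t (x t))"
  have yp: "y : procs" unfolding y_def by (rule subspace_sum[OF P]) (use sm in auto)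
  have sum_apply: "(SUM t:I. single t (x t)) s = (SUM t:I. single t (x t) s)" for s and I :: "nat set"
   by (induction I rule: infinite_finite_induct) auto
  have "y s = x s" if "s <= T" for s
  proof -
   have "y s = (SUM t<=T. if s = t then x t else 0)" unfolding y_def sum_apply by (simp add: single_def)
   thus ?thesis using that by simp
  qed
  hence "procs_norm (x - y) = 0"
   unfolding procs_norm_def using q_zero[OF S.S_fspace] q_zero[OF C.S_fspace] by simp
  hence "v (x - y) = 0" by (rule continuous_functional_null[OF procs_fspace v subspace_diff[OF P x yp]])
  hence "v x = v y" using linear_functional_on_diff[OF lin P x yp] by simp
  also have "\<dots> = (SUM t<=T. v (single t (x t)))"
   unfolding y_def by (rule linear_functional_on_sum[OF lin P]) (use sm in auto)
  also have "\<dots> = (SUM t<=T. ?lS t (fst (x t)) + ?lC t (snd (x t)))"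
  proof (rule sum.cong[OF refl])
   fix t assume "t : {..T}"
   hence m: "single t (fst (x t), 0) : procs" "single t (0, snd (x t)) : procs" using m1 m2 f by auto
   have "single t (x t) = single t (fst (x t), 0) + single t (0, snd (x t))"
    unfolding single_def by (auto simp: fun_eq_iff prod_eq_iff)
   thus "v (single t (x t)) = ?lS t (fst (x t)) + ?lC t (snd (x t))"
    using linear_functional_onD(1)[OF lin m] by simp
  qed
  finally show ?thesis .
 qed
qed

definition pairS :: "('a => real^'n) => ('a => real^'n) => real" where "pairS x v = (LINT w|M. x w \<bullet> v w)"
definition pairC :: "('a => real^'m) => ('a => real^'m) => real" where "pairC x v = (LINT w|M. x w \<bullet> v w)"

lemma pairS_add: "x : S ==> y : S ==> v : S' ==> pairS (x + y) v = pairS x v + pairS y v"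
 and pairS_diff: "x : S ==> y : S ==> v : S' ==> pairS (x - y) v = pairS x v - pairS y v"
 and pairS_add': "x : S ==> v : S' ==> w : S' ==> pairS x (v + w) = pairS x v + pairS x w"
 unfolding pairS_def using S.pairing_integrable by (simp_all add: inner_add_left inner_diff_left inner_add_right)

lemma pairC_diff: "x : C ==> y : C ==> v : C' ==> pairC (x - y) v = pairC x v - pairC y v"
 and pairC_diff': "x : C ==> v : C' ==> w : C' ==> pairC x (v - w) = pairC x v - pairC x w"
 unfolding pairC_def using C.pairing_integrable by (simp_all add: inner_diff_left inner_diff_right)

lemma pairS_adapted:
 assumes "t <= T" "x : S" "x : borel_measurable (F t)" "v : S'"
 shows "pairS x (cond_exp M (F t) v) = pairS x v"
 unfolding pairS_def by (rule S.cond_exp_pairing[OF sub[OF assms(1)] ES[OF assms(1)] assms(2-4)])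

lemma cond_exp_S': "t <= T ==> v : S' ==> cond_exp M (F t) v : S'"
 by (rule S.cond_exp_dual_mem[OF sub ES])

lemma cond_exp_C': "t <= T ==> v : C' ==> cond_exp M (F t) v : C'"
 by (rule C.cond_exp_dual_mem[OF sub EC])

definition step :: "nat => ('a => real^'n) => 'a => real^'n" where "step t x = x + (%w. A t w *v x w)"

lemma step_mem: "t : {1..T} ==> x : S ==> step t x : S"
 unfolding step_def by (intro S.S_add A_S)

text \<open>The multipliers solve a backward recursion that sums up the future marginal values \<open>\<alpha>\<close> along
  the uncontrolled dynamics.\<close>

lemma multipliers:
 assumes \<alpha>: "!!t. n <= t ==> t <= T ==> \<alpha> t : S'"
 obtains y where "!!t. n <= t ==> t <= T ==> y t : S'" "!!t. t <= T ==> y t : borel_measurable (F t)"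
  "!!t \<xi>. n <= t ==> t <= T ==> \<xi> : S ==> \<xi> : borel_measurable (F t) ==>
   pairS \<xi> (\<alpha> t) = pairS \<xi> (y t) - (if t < T then pairS (step (Suc t) \<xi>) (y (Suc t)) else 0)"
proof -
 \<comment> \<open>Runs backwards with \<open>k = T - t\<close>: \<open>y t\<close> is the
   conditional expectation of \<open>\<alpha> t\<close> plus \<open>y (Suc t)\<close> plus its image
   under \<open>transpose (A (Suc t))\<close>.\<close>
 define Y where "Y = rec_nat (cond_exp M (F T) (\<alpha> T)) (%k z. cond_exp M (F (T - Suc k))
  (\<alpha> (T - Suc k) + (z + (%w. transpose (A (Suc (T - Suc k)) w) *v z w))))"
 define y where "y t = Y (T - t)" for t
 have yT: "y T = cond_exp M (F T) (\<alpha> T)" unfolding y_def Y_def by simp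
 have yS: "y t = cond_exp M (F t) (\<alpha> t + (y (Suc t) + (%w. transpose (A (Suc t) w) *v y (Suc t) w)))" if "t < T" for t
 proof -
  have "T - t = Suc (T - Suc t)" "T - Suc (T - Suc t) = t" using that by auto
  thus ?thesis unfolding y_def Y_def by simp
 qed
 have mem: "n <= t ==> y t : S'" if "t <= T" for t using that
 proof (induction t rule: inc_induct)
  case base
  thus ?case unfolding yT by (intro cond_exp_S' \<alpha>) auto
 next
  case (step t)
  hence "y (Suc t) : S'" "Suc t : {1..T}" by auto
  thus ?case using step unfolding yS[OF step.hyps(2)] by (intro cond_exp_S' S.S'_add A_adjoint \<alpha>) auto
 qed
 show thesis
 proof
  show "y t : S'" if "n <= t" "t <= T" for t by (rule mem[OF that(2,1)])
  show "y t : borel_measurable (F t)" if t: "t <= T" for t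
  proof (cases "t = T")
   case True thus ?thesis using yT prob_subalgebra.cond_exp_measurable[OF sub_alg[OF t]] by simp
  next
   case False
   hence "t < T" using t by simp
   from yS[OF this] show ?thesis using prob_subalgebra.cond_exp_measurable[OF sub_alg[OF t]] by metis
  qed
  show "pairS \<xi> (\<alpha> t) = pairS \<xi> (y t) - (if t < T then pairS (step (Suc t) \<xi>) (y (Suc t)) else 0)"
   if t: "n <= t" "t <= T" and \<xi>: "\<xi> : S" "\<xi> : borel_measurable (F t)" for t \<xi>
  proof (cases "t = T")
   case True thus ?thesis using yT pairS_adapted[OF t(2) \<xi> \<alpha>[OF t]] by simp
  next
   case False
   hence lt: "t < T" and s: "Suc t : {1..T}" using t by auto
   have z: "y (Suc t) : S'" using mem s t by auto
   have zA: "(%w. transpose (A (Suc t) w) *v y (Suc t) w) : S'" by (rule A_adjoint[OF s z])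
   have "pairS \<xi> (y t) = pairS \<xi> (\<alpha> t + (y (Suc t) + (%w. transpose (A (Suc t) w) *v y (Suc t) w)))"
    unfolding yS[OF lt] by (rule pairS_adapted[OF t(2) \<xi>]) (intro S.S'_add \<alpha> t z zA)
   also have "\<dots> = pairS \<xi> (\<alpha> t) + (pairS \<xi> (y (Suc t)) + pairS \<xi> (%w. transpose (A (Suc t) w) *v y (Suc t) w))"
    using pairS_add'[OF \<xi>(1) \<alpha>[OF t] S.S'_add[OF z zA]] pairS_add'[OF \<xi>(1) z zA] by simp
   also have "pairS \<xi> (%w. transpose (A (Suc t) w) *v y (Suc t) w) = pairS (%w. A (Suc t) w *v \<xi> w) (y (Suc t))"
    unfolding pairS_def by (simp only: inner_transpose_mult)
   also have "pairS \<xi> (y (Suc t)) + pairS (%w. A (Suc t) w *v \<xi> w) (y (Suc t)) = pairS (step (Suc t) \<xi>) (y (Suc t))"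
    unfolding step_def by (rule pairS_add[OF \<xi>(1) A_S[OF s \<xi>(1)] z, symmetric])
   finally show ?thesis using lt by simp
  qed
 qed
qed

text \<open>Summation by parts along the backward recursion. What remains are the residuals of
  \<open>\<xi>\<close> against the uncontrolled dynamics, so for uncontrolled trajectories the sum
  collapses to its first term.\<close>

lemma multiplier_sum:
 assumes y: "!!t. n <= t ==> t <= T ==> y t : S'"
  and rec: "!!t \<xi>. n <= t ==> t <= T ==> \<xi> : S ==> \<xi> : borel_measurable (F t) ==>
   pairS \<xi> (\<alpha> t) = pairS \<xi> (y t) - (if t < T then pairS (step (Suc t) \<xi>) (y (Suc t)) else 0)"
  and \<xi>: "!!t. t <= T ==> \<xi> t : S" "!!t. t <= T ==> \<xi> t : borel_measurable (F t)" and n: "n <= T"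
 shows "(SUM t=n..T. pairS (\<xi> t) (\<alpha> t)) = pairS (\<xi> n) (y n) + (SUM s=Suc n..T. pairS (\<xi> s - step s (\<xi> (s - 1))) (y s))"
proof -
 have "k >= n ==> (SUM t=k..T. pairS (\<xi> t) (\<alpha> t)) = pairS (\<xi> k) (y k) + (SUM s=Suc k..T. pairS (\<xi> s - step s (\<xi> (s - 1))) (y s))"
  if "k <= T" for k using that
 proof (induction k rule: inc_induct)
  case base
  thus ?case using rec[of T "\<xi> T"] \<xi> by simp
 next
  case (step k)
  have k: "Suc k : {1..T}" "k <= T" using step.hyps by auto
  have m: "\<xi> (Suc k) : S" "step (Suc k) (\<xi> k) : S" "y (Suc k) : S'"
   using \<xi>(1)[OF k(2)] k step_mem[OF k(1)] y[of "Suc k"] \<xi>(1)[of "Suc k"] step.prems by auto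
  have "(SUM t=k..T. pairS (\<xi> t) (\<alpha> t)) = pairS (\<xi> k) (\<alpha> k) + (SUM t=Suc k..T. pairS (\<xi> t) (\<alpha> t))"
   using k by (simp add: sum.atLeast_Suc_atMost)
  also have "pairS (\<xi> k) (\<alpha> k) = pairS (\<xi> k) (y k) - pairS (step (Suc k) (\<xi> k)) (y (Suc k))"
   using rec[OF step.prems k(2) \<xi>(1)[OF k(2)] \<xi>(2)[OF k(2)]] k by simp
  also have "(SUM t=Suc k..T. pairS (\<xi> t) (\<alpha> t)) =
    pairS (\<xi> (Suc k)) (y (Suc k)) + (SUM s=Suc (Suc k)..T. pairS (\<xi> s - step s (\<xi> (s - 1))) (y s))"
   by (rule step.IH) (use step.prems in simp)
  also have "pairS (\<xi> k) (y k) - pairS (step (Suc k) (\<xi> k)) (y (Suc k)) + \<dots> =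
    pairS (\<xi> k) (y k) + (pairS (\<xi> (Suc k) - step (Suc k) (\<xi> k)) (y (Suc k)) +
     (SUM s=Suc (Suc k)..T. pairS (\<xi> s - step s (\<xi> (s - 1))) (y s)))"
   unfolding pairS_diff[OF m] by (simp only: algebra_simps)
  also have "pairS (\<xi> (Suc k) - step (Suc k) (\<xi> k)) (y (Suc k)) + (SUM s=Suc (Suc k)..T. pairS (\<xi> s - step s (\<xi> (s - 1))) (y s)) =
    (SUM s=Suc k..T. pairS (\<xi> s - step s (\<xi> (s - 1))) (y s))"
   using k by (subst sum.atLeast_Suc_atMost[of "Suc k" T]) auto
  finally show ?case .
 qed
 thus ?thesis using n by blast
qed

text \<open>The forward recursion with the controls prescribed in advance and no disturbance; the
  selection rule of \<open>recourse_strategy\<close> just returns the given control.\<close>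

lemma free_continuation:
 assumes U: "!!t. t <= T ==> U t : C" "!!t. t <= T ==> U t : borel_measurable (F t)"
  and x0: "x0 : S" "x0 : borel_measurable (F 0)"
 obtains X where "(X, U) : adapted_strategies T F S C" "X 0 = x0"
  "!!t. t : {1..T} ==> X t = step t (X (t - 1)) + (%h. B t h *v U (t - 1) h)"
proof -
 have w: "(%_. 0) : adapted_sequences_in T F S"
  unfolding adapted_sequences_in_def sequences_in_def using S.S_zero by (simp add: zero_fun_def)
 have "EX X U'. (X, U') : adapted_strategies T F S C & (ALL t<=T. (X t, U' t) : {z. snd z = U t}) & X 0 = x0 &
  (ALL t:{1..T}. ALL h. X t h - X (t - 1) h = A t h *v X (t - 1) h + B t h *v U' (t - 1) h + (%_. 0) t h)"
  by (rule recourse_strategy[OF _ x0 w]) (use U in auto)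
 then obtain X U' where X: "(X, U') : adapted_strategies T F S C" "ALL t<=T. U' t = U t" "X 0 = x0"
  "ALL t:{1..T}. ALL h. X t h - X (t - 1) h = A t h *v X (t - 1) h + B t h *v U' (t - 1) h" by auto
 show thesis
 proof
  show "(X, U) : adapted_strategies T F S C"
   using X(1) U unfolding adapted_strategies_def adapted_processes_def by auto
  show "X t = step t (X (t - 1)) + (%h. B t h *v U (t - 1) h)" if t: "t : {1..T}" for t
  proof
   fix h
   have "X t h - X (t - 1) h = A t h *v X (t - 1) h + B t h *v U (t - 1) h"
    using X(2,4) t prev_le[OF t] by simp
   thus "X t h = (step t (X (t - 1)) + (%h. B t h *v U (t - 1) h)) h"
    unfolding step_def by (simp add: algebra_simps)
  qed
 qed (rule X(3))
qed

lemma continuation_homogeneous: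
 assumes XU: "(X, U) : adapted_strategies T F S C"
  and X: "!!t. t : {1..T} ==> X t = step t (X (t - 1)) + (%w. B t w *v U (t - 1) w)"
 shows "(%t. (X t, U t)) : homogeneous"
proof -
 have m: "(X t, U t) : S \<times> C" "X t : borel_measurable (F t)" "U t : borel_measurable (F t)" if "t <= T" for t
  using XU that unfolding adapted_strategies_def adapted_processes_def by auto
 hence "eqv (cexp t (X t, U t)) (X t, U t)" if "t <= T" for t using cexp_adapted[OF that] that by auto
 moreover have "defect (%t. (X t, U t)) t w = 0" if t: "t : {1..T}" for t w
  unfolding defect_def fst_conv snd_conv X[OF t] step_def by simp
 ultimately show ?thesis using m unfolding homogeneous_def procs_def by auto
qed

text \<open>A single control at time \<open>t\<close>, started from state \<open>0\<close>, moves
  only states after \<open>t\<close>, where the functionals are already represented. Vanishing on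
  this homogeneous trajectory determines \<open>lC t\<close> on adapted controls.\<close>

lemma control_component:
 assumes t: "t <= T" and \<alpha>: "!!s. t < s ==> s <= T ==> \<alpha> s : S'"
  and lS: "!!s x. t < s ==> s <= T ==> x : S ==> lS s x = pairS x (\<alpha> s)"
  and zero: "!!s. s <= T ==> lS s 0 = 0" "!!s. s <= T ==> lC s 0 = 0"
  and hom: "!!g. g : homogeneous ==> (SUM s<=T. lS s (fst (g s)) + lC s (snd (g s))) = 0"
 shows "EX b:C'. ALL u:C. u : borel_measurable (F t) --> lC t u = - pairC u b"
proof -
 obtain y where y: "!!s. Suc t <= s ==> s <= T ==> y s : S'"
  "!!s \<xi>. Suc t <= s ==> s <= T ==> \<xi> : S ==> \<xi> : borel_measurable (F s) ==>
   pairS \<xi> (\<alpha> s) = pairS \<xi> (y s) - (if s < T then pairS (step (Suc s) \<xi>) (y (Suc s)) else 0)"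
  using multipliers[of "Suc t" \<alpha>] \<alpha> by (metis Suc_le_eq)
 \<comment> \<open>The control enters through \<open>B (Suc t)\<close>; the evolution after that is
   uncontrolled, so the sum collapses to the multiplier at \<open>Suc t\<close>. At
   \<open>t = T\<close> there is no later state.\<close>
 define b where "b = (if t < T then (%w. transpose (B (Suc t) w) *v y (Suc t) w) else 0)"
 have b: "b : C'" unfolding b_def using B_adjoint[of "Suc t" "y (Suc t)"] y(1) C.S'_zero by simp
 have "lC t u = - pairC u b" if u: "u : C" "u : borel_measurable (F t)" for u
 proof -
  define U where "U s = (if s = t then u else 0)" for s
  have U: "U s : C" "U s : borel_measurable (F s)" for s
   unfolding U_def using u C.S_zero by (auto simp: zero_fun_def)
  have z: "0 : borel_measurable (F 0)" by (simp add: zero_fun_def)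
  obtain X where X: "(X, U) : adapted_strategies T F S C" "X 0 = 0"
   "!!t. t : {1..T} ==> X t = step t (X (t - 1)) + (%w. B t w *v U (t - 1) w)"
   using free_continuation[OF U S.S_zero z] by blast
  have Xm: "X s : S" "X s : borel_measurable (F s)" if "s <= T" for s
   using X(1) that unfolding adapted_strategies_def adapted_processes_def by auto
  have X0: "s <= t ==> X s = 0" for s
  proof (induction s)
   case 0 thus ?case using X(2) by simp
  next
   case (Suc s)
   thus ?case using X(3)[of "Suc s"] t unfolding U_def step_def by (simp add: fun_eq_iff)
  qed
  have "(SUM s<=T. lS s (X s) + lC s (U s)) = 0" using hom[OF continuation_homogeneous[OF X(1,3)]] by simp
  moreover have "(SUM s<=T. lC s (U s)) = lC t u"
  proof -
   have "(SUM s<=T. lC s (U s)) = (SUM s<=T. if s = t then lC t u else 0)"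
    by (intro sum.cong) (auto simp: U_def zero)
   thus ?thesis using t by simp
  qed
  moreover have "(SUM s<=T. lS s (X s)) = pairC u b"
  proof -
   have "(SUM s<=T. lS s (X s)) = (SUM s:{Suc t..T}. lS s (X s))"
    by (rule sum.mono_neutral_right) (auto simp: X0 zero)
   also have "\<dots> = (SUM s=Suc t..T. pairS (X s) (\<alpha> s))" by (intro sum.cong refl lS) (auto simp: Xm)
   also have "\<dots> = pairC u b"
   proof (cases "t < T")
    case True
    hence s: "Suc t : {1..T}" by auto
    have "(SUM s=Suc t..T. pairS (X s) (\<alpha> s)) =
      pairS (X (Suc t)) (y (Suc t)) + (SUM s=Suc (Suc t)..T. pairS (X s - step s (X (s - 1))) (y s))"
     using True by (intro multiplier_sum y Xm) auto
    also have "(SUM s=Suc (Suc t)..T. pairS (X s - step s (X (s - 1))) (y s)) = 0"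
    proof (rule sum.neutral, rule ballI)
     fix s assume "s : {Suc (Suc t)..T}"
     hence "X s = step s (X (s - 1))" using X(3)[of s] by (auto simp: U_def fun_eq_iff)
     thus "pairS (X s - step s (X (s - 1))) (y s) = 0" unfolding pairS_def by simp
    qed
    also have "X (Suc t) = (%w. B (Suc t) w *v u w)"
     using X(3)[OF s] X0[of t] by (simp add: U_def step_def fun_eq_iff)
    also have "pairS (%w. B (Suc t) w *v u w) (y (Suc t)) = pairC u b"
     unfolding b_def using True unfolding pairS_def pairC_def by (simp only: inner_transpose_mult if_True)
    finally show ?thesis by simp
   next
    case False
    thus ?thesis by (simp add: b_def pairC_def)
   qed
   finally show ?thesis .
  qed
  ultimately show ?thesis by (simp add: sum.distrib)
 qed
 thus ?thesis using b by blast
qed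

end

section \<open>Removal of the singular parts\<close>

context control_qualified
begin

text \<open>The singular parts are removed twice: first at \<open>z\<close> with \<open>cexp t z\<close> in place of \<open>z\<close>, which makes the
  functionals agree with the old ones on adapted processes; then, after the control component has been
  represented by a function, the remaining singular functional of the state is bounded above on all of \<open>S\<close>.\<close>

lemma marginal_values:
 assumes m: "ereal m <= oc_inf M T F A B W L"
 shows "EX \<alpha> \<beta> \<mu>. (ALL t<=T. \<alpha> t : S' & \<beta> t : C') & m <= (SUM t<=T. \<mu> t) &
  (ALL t<=T. ALL z:Dom t. \<mu> t + pairS (fst z - Xb t) (\<alpha> t) + pairC (snd z - Ub t) (\<beta> t) <= V t z) &
  (ALL g:homogeneous. (SUM t<=T. pairS (fst (g t)) (\<alpha> t) + pairC (snd (g t)) (\<beta> t)) = 0)"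
proof -
 obtain v where v: "continuous_functional procs procs_norm v" "!!g. g : homogeneous ==> v g = 0"
  "!!x. x : dom_procs ==> m + v (x - xb) <= cost x" using process_duality[OF m] by blast
 obtain kS kC where kS: "!!t. t <= T ==> continuous_functional S qS (kS t)"
  and kC: "!!t. t <= T ==> continuous_functional C qC (kC t)"
  and vk: "!!x. x : procs ==> v x = (SUM t<=T. kS t (fst (x t)) + kC t (snd (x t)))"
  using functional_components[OF v(1)] by blast
 have xbp: "xb : procs" using xb_mem unfolding procs_def by blast
 have bar: "Xb t : S" "Ub t : C" if "t <= T" for t using xb_mem[OF that] unfolding xb_def by auto
 have bf: "Xb t : borel_measurable (F t)" "Ub t : borel_measurable (F t)" if "t <= T" for t
  using xb_measurable[OF that] unfolding xb_def by auto
 \<comment> \<open>The joint inequality for processes is separated into one inequality for each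
   time.\<close>
 have "EX \<mu>. m <= sum \<mu> {..T} & (ALL t:{..T}. ALL z:Dom t. \<mu> t <= V t z - (kS t (fst z - Xb t) + kC t (snd z - Ub t)))"
 proof (rule separable_lower_bound)
  show "Dom t ~= {}" if "t : {..T}" for t using xb_Dom[of t] that by auto
  show "m <= (SUM t<=T. V t (x t) - (kS t (fst (x t) - Xb t) + kC t (snd (x t) - Ub t)))"
   if x: "!!t. t : {..T} ==> x t : Dom t" for x
  proof -
   have xD: "x : dom_procs" using x unfolding dom_procs_def by auto
   have "v (x - xb) = (SUM t<=T. kS t (fst ((x - xb) t)) + kC t (snd ((x - xb) t)))"
    by (rule vk[OF fspace_diff[OF procs_fspace _ xbp]]) (use xD dom_procs_sub in blast)
   also have "\<dots> = (SUM t<=T. kS t (fst (x t) - Xb t) + kC t (snd (x t) - Ub t))"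
    by (simp only: minus_apply fst_diff snd_diff xb_def fst_conv snd_conv)
   finally show ?thesis using v(3)[OF xD] unfolding cost_def sum_subtractf by linarith
  qed
 qed simp
 then obtain \<mu> where \<mu>: "m <= (SUM t<=T. \<mu> t)"
  "!!t z. t <= T ==> z : Dom t ==> \<mu> t + kS t (fst z - Xb t) + kC t (snd z - Ub t) <= V t z"
  by (force simp: algebra_simps)
 have "ALL t. EX w. t <= T --> fst w : S' & continuous_functional S qS (snd w) & singular_on M S (snd w) &
   (ALL x:S. kS t x = pairS x (fst w) + snd w x)"
 proof
  fix t show "EX w. t <= T --> fst w : S' & continuous_functional S qS (snd w) & singular_on M S (snd w) &
   (ALL x:S. kS t x = pairS x (fst w) + snd w x)"
  proof (cases "t <= T")
   case True
   obtain a \<sigma> where "a : S'" "continuous_functional S qS \<sigma>" "singular_on M S \<sigma>" "ALL x:S. kS t x = (LINT h|M. x h \<bullet> a h) + \<sigma> x"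
    using S.dual_split[OF kS[OF True]] by blast
   thus ?thesis by (intro exI[of _ "(a, \<sigma>)"]) (simp add: pairS_def)
  qed simp
 qed
 from choice[OF this] obtain wS where wS: "!!t. t <= T ==> fst (wS t) : S' & continuous_functional S qS (snd (wS t)) &
   singular_on M S (snd (wS t)) & (ALL x:S. kS t x = pairS x (fst (wS t)) + snd (wS t) x)" by blast
 define a sS where "a t = fst (wS t)" and "sS t = snd (wS t)" for t
 have a: "a t : S'" and sS: "continuous_functional S qS (sS t)" "singular_on M S (sS t)"
  and kS_eq: "!!x. x : S ==> kS t x = pairS x (a t) + sS t x" if "t <= T" for t
  using wS[OF that] unfolding a_def sS_def by auto
 have "ALL t. EX w. t <= T --> fst w : C' & continuous_functional C qC (snd w) & singular_on M C (snd w) &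
   (ALL x:C. kC t x = pairC x (fst w) + snd w x)"
 proof
  fix t show "EX w. t <= T --> fst w : C' & continuous_functional C qC (snd w) & singular_on M C (snd w) &
   (ALL x:C. kC t x = pairC x (fst w) + snd w x)"
  proof (cases "t <= T")
   case True
   obtain b \<sigma> where "b : C'" "continuous_functional C qC \<sigma>" "singular_on M C \<sigma>" "ALL x:C. kC t x = (LINT h|M. x h \<bullet> b h) + \<sigma> x"
    using C.dual_split[OF kC[OF True]] by blast
   thus ?thesis by (intro exI[of _ "(b, \<sigma>)"]) (simp add: pairC_def)
  qed simp
 qed
 from choice[OF this] obtain wC where wC: "!!t. t <= T ==> fst (wC t) : C' & continuous_functional C qC (snd (wC t)) &
   singular_on M C (snd (wC t)) & (ALL x:C. kC t x = pairC x (fst (wC t)) + snd (wC t) x)" by blast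
 define b sC where "b t = fst (wC t)" and "sC t = snd (wC t)" for t
 have b: "b t : C'" and sC: "continuous_functional C qC (sC t)" "singular_on M C (sC t)"
  and kC_eq: "!!x. x : C ==> kC t x = pairC x (b t) + sC t x" if "t <= T" for t
  using wC[OF that] unfolding b_def sC_def by auto
 \<comment> \<open>Only the singular part is composed with the conditional expectation; on adapted
   arguments \<open>lS\<close> and \<open>lC\<close> still agree with \<open>kS\<close> and
   \<open>kC\<close>.\<close>
 define lS where "lS t x = pairS x (a t) + sS t (cond_exp M (F t) x)" for t x
 define lC where "lC t u = pairC u (b t) + sC t (cond_exp M (F t) u)" for t u
 have ce_S: "cond_exp M (F t) x : S" if "t <= T" "x : S" for t x using ES[OF that(1)] that(2) by blast
 have ce_C: "cond_exp M (F t) x : C" if "t <= T" "x : C" for t x using EC[OF that(1)] that(2) by blast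
 have pairing: "control_integrand.pairing M z w = pairS (fst z) (fst w) + pairC (snd z) (snd w)" for z w
  unfolding control_integrand.pairing_def[OF integrand[OF le0]] pairS_def pairC_def ..
 have lin: "linear_functional_on S (sS t)" "linear_functional_on C (sC t)" if "t <= T" for t
  using sS(1)[OF that] sC(1)[OF that] unfolding continuous_functional_def by auto
 have lS_lin: "linear_functional_on S (lS t)" and lC_lin: "linear_functional_on C (lC t)" if t: "t <= T" for t
 proof -
  have "continuous_functional S qS (%x. 1 * (LINT h|M. x h \<bullet> a t h) + 1 * sS t (cond_exp M (F t) x))"
   by (rule continuous_functional_linear_comb[OF S.S_fspace S.pairing_continuous[OF a[OF t]] S.functional_cond_exp[OF sub[OF t] ES[OF t] sS(1)[OF t]]])
  thus "linear_functional_on S (lS t)" unfolding continuous_functional_def lS_def[abs_def] pairS_def by simp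
  have "continuous_functional C qC (%x. 1 * (LINT h|M. x h \<bullet> b t h) + 1 * sC t (cond_exp M (F t) x))"
   by (rule continuous_functional_linear_comb[OF C.S_fspace C.pairing_continuous[OF b[OF t]] C.functional_cond_exp[OF sub[OF t] EC[OF t] sC(1)[OF t]]])
  thus "linear_functional_on C (lC t)" unfolding continuous_functional_def lC_def[abs_def] pairC_def by simp
 qed
 have zero: "lS t 0 = 0" "lC t 0 = 0" if "t <= T" for t
  using linear_functional_on_zero[OF lS_lin[OF that] S.S_zero] linear_functional_on_zero[OF lC_lin[OF that] C.S_zero] by auto
 have bound: "\<mu> t + lS t (fst z - Xb t) + lC t (snd z - Ub t) <= V t z" if t: "t <= T" and z: "z : Dom t" for t z
 proof -
  \<comment> \<open>Collects the constants produced by centring at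
    \<open>(Xb t, Ub t)\<close>.\<close>
  define c where "c = \<mu> t - pairS (Xb t) (a t) - pairC (Ub t) (b t) - sS t (Xb t) - sC t (Ub t)"
  have mz: "fst y : S" "snd y : C" if "y : Dom t" for y using Dom_sub[OF t that] by auto
  have low: "c + control_integrand.pairing M y (a t, b t) + sS t (fst y) + sC t (snd y) <= V t y" if y: "y : Dom t" for y
  proof -
   have "kS t (fst y - Xb t) = pairS (fst y) (a t) - pairS (Xb t) (a t) + (sS t (fst y) - sS t (Xb t))"
    using kS_eq[OF t S.S_diff[OF mz(1)[OF y] bar(1)[OF t]]] pairS_diff[OF mz(1)[OF y] bar(1)[OF t] a[OF t]]
     linear_functional_on_diff[OF lin(1)[OF t] S.subspace_S mz(1)[OF y] bar(1)[OF t]] by simp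
   moreover have "kC t (snd y - Ub t) = pairC (snd y) (b t) - pairC (Ub t) (b t) + (sC t (snd y) - sC t (Ub t))"
    using kC_eq[OF t C.S_diff[OF mz(2)[OF y] bar(2)[OF t]]] pairC_diff[OF mz(2)[OF y] bar(2)[OF t] b[OF t]]
     linear_functional_on_diff[OF lin(2)[OF t] C.subspace_S mz(2)[OF y] bar(2)[OF t]] by simp
   ultimately show ?thesis using \<mu>(2)[OF t y] unfolding c_def pairing by simp
  qed
  have ab: "(a t, b t) : S' \<times> C'" using a[OF t] b[OF t] by simp
  have main: "c + control_integrand.pairing M z (a t, b t) + sS t (fst (cexp t z)) + sC t (snd (cexp t z)) <= V t z"
   by (rule control_integrand.eliminate_singular[OF integrand[OF t] sS[OF t] sC[OF t] ab low z cexp_Dom[OF t z]])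
  have "eqv (cexp t (z - xb t)) (cexp t z - xb t)"
   by (rule eqv_trans[OF cexp_diff[OF t Dom_sub[OF t z] xb_mem[OF t]]
      eqv_diff[OF eqv_refl cexp_adapted[OF t xb_mem[OF t] xb_measurable[OF t]]]])
  hence e: "AE h in M. cond_exp M (F t) (fst z - Xb t) h = (cond_exp M (F t) (fst z) - Xb t) h"
   "AE h in M. cond_exp M (F t) (snd z - Ub t) h = (cond_exp M (F t) (snd z) - Ub t) h"
   unfolding eqv_def cexp_def xb_def by auto
  have "sS t (cond_exp M (F t) (fst z - Xb t)) = sS t (cond_exp M (F t) (fst z) - Xb t)"
   by (rule S.functional_AE_eq[OF sS(1)[OF t] ce_S[OF t S.S_diff] S.S_diff[OF ce_S[OF t]] e(1)]) (use mz[OF z] bar[OF t] in auto)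
  also have "\<dots> = sS t (cond_exp M (F t) (fst z)) - sS t (Xb t)"
   by (rule linear_functional_on_diff[OF lin(1)[OF t] S.subspace_S ce_S[OF t mz(1)[OF z]] bar(1)[OF t]])
  finally have 1: "lS t (fst z - Xb t) = pairS (fst z) (a t) - pairS (Xb t) (a t) + (sS t (cond_exp M (F t) (fst z)) - sS t (Xb t))"
   unfolding lS_def using pairS_diff[OF mz(1)[OF z] bar(1)[OF t] a[OF t]] by simp
  have "sC t (cond_exp M (F t) (snd z - Ub t)) = sC t (cond_exp M (F t) (snd z) - Ub t)"
   by (rule C.functional_AE_eq[OF sC(1)[OF t] ce_C[OF t C.S_diff] C.S_diff[OF ce_C[OF t]] e(2)]) (use mz[OF z] bar[OF t] in auto)
  also have "\<dots> = sC t (cond_exp M (F t) (snd z)) - sC t (Ub t)"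
   by (rule linear_functional_on_diff[OF lin(2)[OF t] C.subspace_S ce_C[OF t mz(2)[OF z]] bar(2)[OF t]])
  finally have 2: "lC t (snd z - Ub t) = pairC (snd z) (b t) - pairC (Ub t) (b t) + (sC t (cond_exp M (F t) (snd z)) - sC t (Ub t))"
   unfolding lC_def using pairC_diff[OF mz(2)[OF z] bar(2)[OF t] b[OF t]] by simp
  show ?thesis using main unfolding 1 2 pairing c_def cexp_def by simp
 qed
 have hom: "(SUM t<=T. lS t (fst (g t)) + lC t (snd (g t))) = 0" if g: "g : homogeneous" for g
 proof -
  have gp: "g : procs" using g unfolding homogeneous_def by blast
  have "lS t (fst (g t)) = kS t (fst (g t)) & lC t (snd (g t)) = kC t (snd (g t))" if t: "t <= T" for t
  proof -
   have mg: "fst (g t) : S" "snd (g t) : C" using procsD[OF gp t] by auto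
   have "eqv (cexp t (g t)) (g t)" using g t unfolding homogeneous_def by blast
   hence e: "AE h in M. cond_exp M (F t) (fst (g t)) h = fst (g t) h" "AE h in M. cond_exp M (F t) (snd (g t)) h = snd (g t) h"
    unfolding eqv_def cexp_def by auto
   have "sS t (cond_exp M (F t) (fst (g t))) = sS t (fst (g t))"
    by (rule S.functional_AE_eq[OF sS(1)[OF t] ce_S[OF t mg(1)] mg(1) e(1)])
   moreover have "sC t (cond_exp M (F t) (snd (g t))) = sC t (snd (g t))"
    by (rule C.functional_AE_eq[OF sC(1)[OF t] ce_C[OF t mg(2)] mg(2) e(2)])
   ultimately show ?thesis unfolding lS_def lC_def using kS_eq[OF t mg(1)] kC_eq[OF t mg(2)] by simp
  qed
  hence "(SUM t<=T. lS t (fst (g t)) + lC t (snd (g t))) = v g" unfolding vk[OF gp] by (intro sum.cong) auto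
  thus ?thesis using v(2)[OF g] by simp
 qed
 \<comment> \<open>Strong induction on \<open>T - t\<close>, because
   \<open>control_component\<close> uses the representations at all later times together.\<close>
 have rep: "EX \<alpha>:S'. EX \<beta>:C'. (ALL x:S. lS t x = pairS x \<alpha>) & (ALL u:C. lC t u = pairC u \<beta>)" if "t <= T" for t using that
 proof (induction "T - t" arbitrary: t rule: less_induct)
  case less
  note t = \<open>t <= T\<close>
  have "ALL s. EX \<alpha>. t < s --> s <= T --> \<alpha> : S' & (ALL x:S. lS s x = pairS x \<alpha>)"
  proof
   fix s show "EX \<alpha>. t < s --> s <= T --> \<alpha> : S' & (ALL x:S. lS s x = pairS x \<alpha>)"
   proof (cases "t < s & s <= T")
    case True
    hence "T - s < T - t" "s <= T" by auto
    from less.hyps[OF this] show ?thesis by blast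
   qed blast
  qed
  from choice[OF this] obtain \<alpha>' where \<alpha>': "!!s. t < s ==> s <= T ==> \<alpha>' s : S'"
   "!!s x. t < s ==> s <= T ==> x : S ==> lS s x = pairS x (\<alpha>' s)" by blast
  obtain b' where b': "b' : C'" "!!u. u : C ==> u : borel_measurable (F t) ==> lC t u = - pairC u b'"
   using control_component[of t \<alpha>' lS lC, OF t \<alpha>' zero hom] by blast
  \<comment> \<open>\<open>control_component\<close> gives \<open>lC t\<close> at the conditional
    expectation of \<open>u\<close>. Solving for the singular term there and moving the conditional
    expectation to the dual vectors by self-adjointness produces the two subtracted terms.\<close>
  define \<beta> where "\<beta> = b t - cond_exp M (F t) (b t) - cond_exp M (F t) b'"
  have cb: "cond_exp M (F t) (b t) : C'" "cond_exp M (F t) b' : C'" using cond_exp_C'[OF t] b[OF t] b'(1) by auto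
  have \<beta>: "\<beta> : C'" unfolding \<beta>_def by (intro C.S'_diff b[OF t] cb)
  have lC_rep: "lC t u = pairC u \<beta>" if u: "u : C" for u
  proof -
   let ?e = "cond_exp M (F t) u"
   have eC: "?e : C" by (rule ce_C[OF t u])
   have eF: "?e : borel_measurable (F t)" by (rule prob_subalgebra.cond_exp_measurable[OF sub_alg[OF t]])
   have "sC t (cond_exp M (F t) ?e) = sC t ?e"
    by (rule C.functional_AE_eq[OF sC(1)[OF t] ce_C[OF t eC] eC
       prob_subalgebra.cond_exp_ident[OF sub_alg[OF t] C.S_integrable[OF eC] eF]])
   hence "sC t ?e = - pairC ?e b' - pairC ?e (b t)" using b'(2)[OF eC eF] unfolding lC_def by simp
   also have "pairC ?e b' = pairC u (cond_exp M (F t) b')"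
    unfolding pairC_def by (rule C.cond_exp_selfadjoint[OF sub[OF t] EC[OF t] u b'(1)])
   also have "pairC ?e (b t) = pairC u (cond_exp M (F t) (b t))"
    unfolding pairC_def by (rule C.cond_exp_selfadjoint[OF sub[OF t] EC[OF t] u b[OF t]])
   finally show ?thesis unfolding lC_def \<beta>_def
    using pairC_diff'[OF u C.S'_diff[OF b[OF t] cb(1)] cb(2)] pairC_diff'[OF u b[OF t] cb(1)] by simp
  qed
  \<comment> \<open>The composed functional can have an integrable part, so it is split again;
    \<open>r\<close> is added to \<open>a t\<close>, and \<open>\<rho>\<close> is to be shown
    zero.\<close>
  obtain r \<rho> where r: "r : S'" and \<rho>: "continuous_functional S qS \<rho>" "singular_on M S \<rho>"
   and r_eq: "!!x. x : S ==> sS t (cond_exp M (F t) x) = pairS x r + \<rho> x"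
   using S.dual_split[OF S.functional_cond_exp[OF sub[OF t] ES[OF t] sS(1)[OF t]]] unfolding pairS_def by blast
  define \<alpha> where "\<alpha> = a t + r"
  have \<alpha>: "\<alpha> : S'" unfolding \<alpha>_def by (rule S.S'_add[OF a[OF t] r])
  have lS_rep: "lS t x = pairS x \<alpha> + \<rho> x" if "x : S" for x
   unfolding lS_def \<alpha>_def r_eq[OF that] pairS_add'[OF that a[OF t] r] by simp
  have \<rho>lin: "linear_functional_on S \<rho>" using \<rho>(1) unfolding continuous_functional_def by blast
  define c where "c = \<mu> t - pairS (Xb t) \<alpha> - pairC (Ub t) \<beta> - \<rho> (Xb t)"
  have low: "c + control_integrand.pairing M y (\<alpha>, \<beta>) + \<rho> (fst y) + 0 <= V t y" if y: "y : Dom t" for y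
  proof -
   have my: "fst y : S" "snd y : C" using Dom_sub[OF t y] by auto
   have "lS t (fst y - Xb t) = pairS (fst y) \<alpha> - pairS (Xb t) \<alpha> + (\<rho> (fst y) - \<rho> (Xb t))"
    using lS_rep[OF S.S_diff[OF my(1) bar(1)[OF t]]] pairS_diff[OF my(1) bar(1)[OF t] \<alpha>]
     linear_functional_on_diff[OF \<rho>lin S.subspace_S my(1) bar(1)[OF t]] by simp
   moreover have "lC t (snd y - Ub t) = pairC (snd y) \<beta> - pairC (Ub t) \<beta>"
    using lC_rep[OF C.S_diff[OF my(2) bar(2)[OF t]]] pairC_diff[OF my(2) bar(2)[OF t] \<beta>] by simp
   ultimately show ?thesis using bound[OF t y] unfolding c_def pairing by simp
  qed
  have z0: "continuous_functional C qC (%_. 0)" "singular_on M C (%_. 0)"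
  proof -
   show "continuous_functional C qC (%_. 0)"
    unfolding continuous_functional_def linear_functional_on_def by (auto intro: exI[of _ 1])
   have "range (%_::nat. {}) <= sets M" "decseq (%_::nat. {}::'a set)" by (auto simp: decseq_def)
   thus "singular_on M C (%_. 0)" unfolding singular_on_def by (intro ballI exI[of _ "%_. {}"]) simp
  qed
  have \<alpha>\<beta>: "(\<alpha>, \<beta>) : S' \<times> C'" using \<alpha> \<beta> by simp
  \<comment> \<open>The bound is free of \<open>x\<close>: the elimination is made at
    \<open>xb t\<close> with \<open>z' = (x, u)\<close>, so that \<open>x\<close> enters through
    \<open>\<rho>\<close> alone.\<close>
  define \<kappa> where "\<kappa> = V t (xb t) - c - control_integrand.pairing M (xb t) (\<alpha>, \<beta>)"
  have up: "\<rho> x <= \<kappa>" if x: "x : S" for x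
  proof -
   obtain u where u: "(x, u) : Dom t" using dom_recourse[OF t x] unfolding Dom_eq[OF t] by blast
   have "c + control_integrand.pairing M (xb t) (\<alpha>, \<beta>) + \<rho> (fst (x, u)) + 0 <= V t (xb t)"
    by (rule control_integrand.eliminate_singular[OF integrand[OF t] \<rho> z0 \<alpha>\<beta> low xb_Dom[OF t] u])
   thus ?thesis unfolding \<kappa>_def by simp
  qed
  have "\<rho> x = 0" if x: "x : S" for x
  proof (rule ccontr)
   assume n: "\<rho> x ~= 0"
   have "\<rho> (((\<kappa> + 1) / \<rho> x) *\<^sub>R x) = \<kappa> + 1" using linear_functional_onD(2)[OF \<rho>lin x] n by simp
   thus False using up[OF S.S_scale[OF x, of "(\<kappa> + 1) / \<rho> x"]] by simp
  qed
  hence "ALL x:S. lS t x = pairS x \<alpha>" using lS_rep by simp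
  thus ?case using lC_rep \<alpha> \<beta> by blast
 qed
 have "ALL t. EX w. t <= T --> fst w : S' & snd w : C' & (ALL x:S. lS t x = pairS x (fst w)) & (ALL u:C. lC t u = pairC u (snd w))"
 proof
  fix t show "EX w. t <= T --> fst w : S' & snd w : C' & (ALL x:S. lS t x = pairS x (fst w)) & (ALL u:C. lC t u = pairC u (snd w))"
  proof (cases "t <= T")
   case True
   obtain \<alpha> \<beta> where "\<alpha> : S'" "\<beta> : C'" "ALL x:S. lS t x = pairS x \<alpha>" "ALL u:C. lC t u = pairC u \<beta>" using rep[OF True] by blast
   thus ?thesis by (intro exI[of _ "(\<alpha>, \<beta>)"]) simp
  qed simp
 qed
 from choice[OF this] obtain w where w: "!!t. t <= T ==> fst (w t) : S' & snd (w t) : C' &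
  (ALL x:S. lS t x = pairS x (fst (w t))) & (ALL u:C. lC t u = pairC u (snd (w t)))" by blast
 show ?thesis
 proof (intro exI conjI allI impI ballI)
  show "m <= (SUM t<=T. \<mu> t)" by (rule \<mu>(1))
  show "fst (w t) : S'" "snd (w t) : C'" if "t <= T" for t using w[OF that] by auto
  show "\<mu> t + pairS (fst z - Xb t) (fst (w t)) + pairC (snd z - Ub t) (snd (w t)) <= V t z" if t: "t <= T" and z: "z : Dom t" for t z
  proof -
   have mz: "fst z - Xb t : S" "snd z - Ub t : C"
    using Dom_sub[OF t z] bar[OF t] S.S_diff C.S_diff by auto
   have "lS t (fst z - Xb t) = pairS (fst z - Xb t) (fst (w t))" "lC t (snd z - Ub t) = pairC (snd z - Ub t) (snd (w t))"
    using w[OF t] mz by blast+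
   thus ?thesis using bound[OF t z] by simp
  qed
  show "(SUM t<=T. pairS (fst (g t)) (fst (w t)) + pairC (snd (g t)) (snd (w t))) = 0" if g: "g : homogeneous" for g
  proof -
   have gp: "g : procs" using g unfolding homogeneous_def by blast
   have "(SUM t<=T. pairS (fst (g t)) (fst (w t)) + pairC (snd (g t)) (snd (w t))) = (SUM t<=T. lS t (fst (g t)) + lC t (snd (g t)))"
   proof (rule sum.cong[OF refl])
    fix t assume "t : {..T}"
    hence t: "t <= T" by simp
    have "fst (g t) : S" "snd (g t) : C" using procsD[OF gp t] by auto
    thus "pairS (fst (g t)) (fst (w t)) + pairC (snd (g t)) (snd (w t)) = lS t (fst (g t)) + lC t (snd (g t))"
     using w[OF t] by auto
   qed
   thus ?thesis using hom[OF g] by simp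
  qed
 qed
qed

end

section \<open>Strong duality\<close>

context control
begin

lemma adapted_strategy_procs: "(X, U) : adapted_strategies T F S C ==> (%t. (X t, U t)) : procs"
 unfolding adapted_strategies_def procs_def by auto

lemma inner_pair_integral:
 assumes "x : S" "u : C" "(%w. fst (f w)) : S'" "(%w. snd (f w)) : C'"
 shows "integrable M (%w. (x w, u w) \<bullet> f w)"
  "(LINT w|M. (x w, u w) \<bullet> f w) = pairS x (%w. fst (f w)) + pairC u (%w. snd (f w))"
 using S.pairing_integrable[OF assms(1,3)] C.pairing_integrable[OF assms(2,4)]
 unfolding pairS_def pairC_def inner_prod_def by simp_all

lemma adjoint_pairing:
 assumes x: "x : procs" and y: "y : sequences_in T S'"
 shows "(SUM t<=T. \<integral>w. (fst (x t) w, snd (x t) w) \<bullet> adjoint_term T A B y t w \<partial>M) = - (SUM s=1..T. pairS (defect x s) (y s))"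
proof -
 have xm: "fst (x t) : S" "snd (x t) : C" if "t <= T" for t using procsD[OF x that] by auto
 have ym: "y s : S'" if "s : {1..T}" for s using y that unfolding sequences_in_def by blast
 have "(SUM t<=T. \<integral>w. (fst (x t) w, snd (x t) w) \<bullet> adjoint_term T A B y t w \<partial>M) =
   (LINT w|M. (SUM t=0..T. (fst (x t) w, snd (x t) w) \<bullet> adjoint_term T A B y t w))"
  unfolding atMost_atLeast0
  by (rule Bochner_Integration.integral_sum[symmetric]) (use inner_pair_integral(1)[OF xm adjoint_mem[OF y]] in auto)
 also have "\<dots> = (LINT w|M. - (SUM s=1..T. defect x s w \<bullet> y s w))"
  unfolding adjoint_summation_by_parts_T defect_def by (simp only: inner_commute)
 also have "\<dots> = - (SUM s=1..T. pairS (defect x s) (y s))"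
  unfolding pairS_def using S.pairing_integrable[OF defect_mem[OF x] ym]
  by (subst Bochner_Integration.integral_minus, subst Bochner_Integration.integral_sum) auto
 finally show ?thesis .
qed

lemma annihilatorI:
 assumes p: "!!t. t <= T ==> (%w. fst (p t w)) : S'" "!!t. t <= T ==> (%w. snd (p t w)) : C'"
  and zero: "!!X U. (X, U) : adapted_strategies T F S C ==> (SUM t<=T. \<integral>w. (X t w, U t w) \<bullet> p t w \<partial>M) = 0"
 shows "p : annihilator M T F S S' C C'"
proof -
 have "(LINT w|M. (SUM t=0..T. (X t w, U t w) \<bullet> p t w)) = 0" if XU: "(X, U) : adapted_strategies T F S C" for X U
 proof -
  have x: "X t : S" "U t : C" if "t <= T" for t using XU that unfolding adapted_strategies_def by auto
  have "(LINT w|M. (SUM t=0..T. (X t w, U t w) \<bullet> p t w)) = (SUM t=0..T. \<integral>w. (X t w, U t w) \<bullet> p t w \<partial>M)"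
  proof (rule Bochner_Integration.integral_sum)
   fix t assume "t : {0..T}"
   hence t: "t <= T" by simp
   show "integrable M (%w. (X t w, U t w) \<bullet> p t w)" by (rule inner_pair_integral(1)[OF x(1)[OF t] x(2)[OF t] p(1)[OF t] p(2)[OF t]])
  qed
  thus ?thesis using zero[OF XU] by (simp add: atMost_atLeast0)
 qed
 thus ?thesis using p unfolding annihilator_def by auto
qed

lemma zero_annihilator: "(%_ _. 0) : annihilator M T F S S' C C'"
 using S.S'_zero C.S'_zero unfolding annihilator_def by (auto simp: zero_fun_def)

lemma annihilator_cond_exp:
 assumes p: "p : annihilator M T F S S' C C'" and t: "t <= T"
 shows "AE w in M. cond_exp M (F t) (p t) w = 0"
proof -
 have "AE w in M. (%_. 0) w = cond_exp M (F t) (p t) w"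
 proof (rule prob_subalgebra.cond_exp_charact[OF sub_alg[OF t]])
  show "integrable M (p t)" by (rule pair_integrable[OF annihilatorD[OF p t]])
  show "(LINT w|M. f w \<bullet> 0) = (LINT w|M. f w \<bullet> p t w)" if "f : borel_measurable (F t)" "!!w. norm (f w) <= 1" for f
   using annihilator_orthogonal[OF p t that] by simp
 qed auto
 thus ?thesis by eventually_elim simp
qed

lemma dual_value_eq:
 assumes w: "!!t. t : {1..T} ==> W t : S" "!!t. t : {1..T} ==> y t : S'"
  and c: "!!t. t <= T ==> integrable M (c t)"
   "!!t. t <= T ==> AE h in M. fenchel_conjugate (%z. L t z h) (v t h) = ereal (c t h)"
 shows "dual_value M T W L v y = ereal ((SUM t=1..T. pairS (W t) (y t)) - (SUM t<=T. \<integral>h. c t h \<partial>M))"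
proof -
 let ?g = "%h. - ((SUM t=1..T. W t h \<bullet> y t h) - (SUM t<=T. c t h))"
 have i1: "integrable M (%h. SUM t=1..T. W t h \<bullet> y t h)"
  by (rule Bochner_Integration.integrable_sum[OF S.pairing_integrable[OF w]])
 have i2: "integrable M (%h. SUM t<=T. c t h)" using c(1) by (intro Bochner_Integration.integrable_sum) auto
 have "AE h in M. ALL t:{0..T}. fenchel_conjugate (%z. L t z h) (v t h) = ereal (c t h)"
  using c(2) by (intro AE_finite_allI) auto
 hence "AE h in M. - (ereal (SUM t=1..T. W t h \<bullet> y t h) - (SUM t=0..T. fenchel_conjugate (%z. L t z h) (v t h))) = ereal (?g h)"
  by eventually_elim (simp add: sum_ereal atMost_atLeast0)
 hence "dual_value M T W L v y = - ereal (LINT h|M. ?g h)"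
  unfolding dual_value_def using i1 i2 by (subst ext_expectation_integrable[of M ?g]) auto
 also have "(LINT h|M. ?g h) = - ((LINT h|M. (SUM t=1..T. W t h \<bullet> y t h)) - (LINT h|M. (SUM t<=T. c t h)))"
  using i1 i2 by simp
 also have "(LINT h|M. (SUM t=1..T. W t h \<bullet> y t h)) = (SUM t=1..T. pairS (W t) (y t))"
  unfolding pairS_def by (rule Bochner_Integration.integral_sum[OF S.pairing_integrable[OF w]])
 also have "(LINT h|M. (SUM t<=T. c t h)) = (SUM t<=T. \<integral>h. c t h \<partial>M)"
  using c(1) by (intro Bochner_Integration.integral_sum) auto
 finally show ?thesis by simp
qed

text \<open>With this \<open>p\<close> the argument of the conjugate becomes minus the conditional
  expectation of the adjoint term. The reduced dual is thus the dual at a special \<open>p\<close>,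
  and weak duality carries over.\<close>

lemma reduced_annihilator:
 assumes y: "y : sequences_in T S'"
 shows "(%t w. adjoint_term T A B y t w - cond_exp M (F t) (adjoint_term T A B y t) w) : annihilator M T F S S' C C'"
  (is "?p : _")
proof -
 let ?a = "%t w. fst (adjoint_term T A B y t w)" and ?b = "%t w. snd (adjoint_term T A B y t w)"
 have pa: "(%w. fst (?p t w)) = ?a t - cond_exp M (F t) (?a t)" and pb: "(%w. snd (?p t w)) = ?b t - cond_exp M (F t) (?b t)" for t
  by (simp_all add: fun_eq_iff cond_exp_fst cond_exp_snd)
 have m: "?a t : S'" "?b t : C'" "cond_exp M (F t) (?a t) : S'" "cond_exp M (F t) (?b t) : C'" if "t <= T" for t
  using adjoint_mem[OF y that] cond_exp_S'[OF that] cond_exp_C'[OF that] by auto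
 have pm: "(%w. fst (?p t w)) : S'" "(%w. snd (?p t w)) : C'" if "t <= T" for t
  unfolding pa pb by (intro S.S'_diff C.S'_diff m that)+
 have "(LINT w|M. (X t w, U t w) \<bullet> ?p t w) = 0" if XU: "(X, U) : adapted_strategies T F S C" and t: "t <= T" for X U t
 proof -
  have x: "X t : S" "U t : C" "X t : borel_measurable (F t)" "U t : borel_measurable (F t)"
   using XU t unfolding adapted_strategies_def adapted_processes_def by auto
  have "(LINT w|M. (X t w, U t w) \<bullet> ?p t w) = pairS (X t) (%w. fst (?p t w)) + pairC (U t) (%w. snd (?p t w))"
   by (rule inner_pair_integral(2)[OF x(1,2) pm[OF t]])
  also have "\<dots> = pairS (X t) (?a t - cond_exp M (F t) (?a t)) + pairC (U t) (?b t - cond_exp M (F t) (?b t))"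
   unfolding pa pb ..
  also have "pairC (U t) (?b t - cond_exp M (F t) (?b t)) = 0"
  proof -
   have "pairC (U t) (cond_exp M (F t) (?b t)) = pairC (U t) (?b t)"
    unfolding pairC_def by (rule C.cond_exp_pairing[OF sub[OF t] EC[OF t] x(2,4) m(2)[OF t]])
   thus ?thesis using pairC_diff'[OF x(2) m(2)[OF t] m(4)[OF t]] by simp
  qed
  also have "pairS (X t) (?a t - cond_exp M (F t) (?a t)) = 0"
  proof -
   have "pairS (X t) ((?a t - cond_exp M (F t) (?a t)) + cond_exp M (F t) (?a t)) =
     pairS (X t) (?a t - cond_exp M (F t) (?a t)) + pairS (X t) (cond_exp M (F t) (?a t))"
    by (rule pairS_add'[OF x(1) S.S'_diff[OF m(1)[OF t] m(3)[OF t]] m(3)[OF t]])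
   thus ?thesis using pairS_adapted[OF t x(1,3) m(1)[OF t]] by simp
  qed
  finally show ?thesis by simp
 qed
 hence "(SUM t<=T. \<integral>w. (X t w, U t w) \<bullet> ?p t w \<partial>M) = 0" if "(X, U) : adapted_strategies T F S C" for X U
  using that by (intro sum.neutral ballI) auto
 thus ?thesis by (rule annihilatorI[rotated 2]) (assumption | erule pm(1) | erule pm(2))+
qed

lemma reduced_as_dual:
 "dual_objective M T A B W L (%t w. adjoint_term T A B y t w - cond_exp M (F t) (adjoint_term T A B y t) w) y =
  reduced_dual_objective M T F A B W L y"
 unfolding dual_objective_def reduced_dual_objective_def by simp

end

section \<open>Attainment and optimality conditions\<close>

context control_qualified
begin

lemma W_mem: "t : {1..T} ==> W t : S"
 using W unfolding adapted_sequences_in_def sequences_in_def by blast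

text \<open>\<open>p\<close> is the sum of \<open>(\<alpha>, \<beta>)\<close> and the adjoint term,
  so the conjugates are evaluated at \<open>(\<alpha>, \<beta>)\<close>. The marginal inequalities
  bound their integrals, and by \<open>WB\<close> the bounds add up to the pairing of
  \<open>W\<close> with \<open>y\<close> minus the sum of the \<open>\<mu> t\<close>. A lower bound
  \<open>m\<close> is used in place of the infimum itself, which could be
  \<open>- \<infinity>\<close>.\<close>

lemma dual_attained:
 assumes m: "ereal m <= oc_inf M T F A B W L"
 shows "EX p:annihilator M T F S S' C C'. EX y:adapted_sequences_in T F S'.
  ereal m <= dual_objective M T A B W L p y &
  ((ALL t<=T. convex_normal_integrand (F t) (L t)) --> ereal m <= reduced_dual_objective M T F A B W L y)"
proof -
 obtain \<alpha> \<beta> \<mu> where ab: "!!t. t <= T ==> \<alpha> t : S'" "!!t. t <= T ==> \<beta> t : C'" and \<mu>: "m <= (SUM t<=T. \<mu> t)"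
  and bound: "!!t z. t <= T ==> z : Dom t ==> \<mu> t + pairS (fst z - Xb t) (\<alpha> t) + pairC (snd z - Ub t) (\<beta> t) <= V t z"
  and hom: "!!g. g : homogeneous ==> (SUM t<=T. pairS (fst (g t)) (\<alpha> t) + pairC (snd (g t)) (\<beta> t)) = 0"
  using marginal_values[OF m] by blast
 obtain y where y: "!!t. 0 <= t ==> t <= T ==> y t : S'" "!!t. t <= T ==> y t : borel_measurable (F t)"
  and rec: "!!t \<xi>. 0 <= t ==> t <= T ==> \<xi> : S ==> \<xi> : borel_measurable (F t) ==>
   pairS \<xi> (\<alpha> t) = pairS \<xi> (y t) - (if t < T then pairS (step (Suc t) \<xi>) (y (Suc t)) else 0)"
  by (rule multipliers[of 0 \<alpha>, OF ab(1)]) blast+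
 have yA: "y : adapted_sequences_in T F S'" and yQ: "y : sequences_in T S'"
  unfolding adapted_sequences_in_def sequences_in_def using y by auto
 have bar: "Xb t : S" "Ub t : C" if "t <= T" for t using xb_mem[OF that] unfolding xb_def by auto
 \<comment> \<open>Subtracting the homogeneous trajectory with the same controls and initial state
   removes the controls from the sum, and the multiplier formula applies to the difference of the
   states.\<close>
 have balance: "(SUM t<=T. pairS (X t) (\<alpha> t) + pairC (U t) (\<beta> t)) = (SUM s=1..T. pairS (defect (%t. (X t, U t)) s) (y s))"
  if XU: "(X, U) : adapted_strategies T F S C" for X U
 proof -
  have x: "X t : S" "U t : C" "X t : borel_measurable (F t)" "U t : borel_measurable (F t)" if "t <= T" for t
   using XU that unfolding adapted_strategies_def adapted_processes_def by auto
  obtain Z where Z: "(Z, U) : adapted_strategies T F S C" "Z 0 = X 0"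
   "!!t. t : {1..T} ==> Z t = step t (Z (t - 1)) + (%h. B t h *v U (t - 1) h)"
   by (rule free_continuation[OF x(2,4) x(1)[OF le0] x(3)[OF le0]]) blast+
  have z: "Z t : S" "Z t : borel_measurable (F t)" if "t <= T" for t
   using Z(1) that unfolding adapted_strategies_def adapted_processes_def by auto
  define \<xi> where "\<xi> t = X t - Z t" for t
  have \<xi>: "\<xi> t : S" "\<xi> t : borel_measurable (F t)" if "t <= T" for t
   using S.S_diff[OF x(1) z(1)] x(3) z(2) that unfolding \<xi>_def by (auto simp: fun_diff_def)
  have "(SUM t<=T. pairS (X t) (\<alpha> t) + pairC (U t) (\<beta> t)) =
    (SUM t<=T. pairS (\<xi> t) (\<alpha> t)) + (SUM t<=T. pairS (Z t) (\<alpha> t) + pairC (U t) (\<beta> t))"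
   unfolding sum.distrib[symmetric]
  proof (rule sum.cong[OF refl])
   fix t assume "t : {..T}"
   hence t: "t <= T" by simp
   show "pairS (X t) (\<alpha> t) + pairC (U t) (\<beta> t) = pairS (\<xi> t) (\<alpha> t) + (pairS (Z t) (\<alpha> t) + pairC (U t) (\<beta> t))"
    unfolding \<xi>_def pairS_diff[OF x(1)[OF t] z(1)[OF t] ab(1)[OF t]] by simp
  qed
  also have "(SUM t<=T. pairS (Z t) (\<alpha> t) + pairC (U t) (\<beta> t)) = 0"
   using hom[OF continuation_homogeneous[OF Z(1,3)]] by simp
  also have "(SUM t<=T. pairS (\<xi> t) (\<alpha> t)) = pairS (\<xi> 0) (y 0) + (SUM s=Suc 0..T. pairS (\<xi> s - step s (\<xi> (s - 1))) (y s))"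
   unfolding atMost_atLeast0 by (rule multiplier_sum) (rule y(1) rec \<xi> le0; assumption)+
  also have "pairS (\<xi> 0) (y 0) = 0" unfolding \<xi>_def Z(2) pairS_def by simp
  also have "(SUM s=Suc 0..T. pairS (\<xi> s - step s (\<xi> (s - 1))) (y s)) = (SUM s=1..T. pairS (defect (%t. (X t, U t)) s) (y s))"
  proof (rule sum.cong)
   fix s assume s: "s : {1..T}"
   have "\<xi> s h - step s (\<xi> (s - 1)) h = defect (%t. (X t, U t)) s h" for h
    unfolding \<xi>_def Z(3)[OF s] step_def defect_def
    by (simp add: matrix_vector_mult_diff_distrib algebra_simps)
   hence "\<xi> s - step s (\<xi> (s - 1)) = defect (%t. (X t, U t)) s" by (simp add: fun_eq_iff)
   thus "pairS (\<xi> s - step s (\<xi> (s - 1))) (y s) = pairS (defect (%t. (X t, U t)) s) (y s)" by simp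
  qed simp
  finally show ?thesis by simp
 qed
 define p where "p t h = (\<alpha> t h, \<beta> t h) + adjoint_term T A B y t h" for t h
 have pm: "(%h. fst (p t h)) : S'" "(%h. snd (p t h)) : C'" if "t <= T" for t
  using S.S'_add[OF ab(1)[OF that] adjoint_mem(1)[OF yQ that]] C.S'_add[OF ab(2)[OF that] adjoint_mem(2)[OF yQ that]]
  unfolding p_def by (simp_all add: plus_fun_def)
 have pA: "p : annihilator M T F S S' C C'"
 proof (rule annihilatorI, erule pm(1), erule pm(2))
  fix X U assume XU: "(X, U) : adapted_strategies T F S C"
  have x: "X t : S" "U t : C" if "t <= T" for t using XU that unfolding adapted_strategies_def by auto
  have "(SUM t<=T. \<integral>h. (X t h, U t h) \<bullet> p t h \<partial>M) =
    (SUM t<=T. pairS (X t) (\<alpha> t) + pairC (U t) (\<beta> t)) + (SUM t<=T. \<integral>h. (X t h, U t h) \<bullet> adjoint_term T A B y t h \<partial>M)"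
   unfolding sum.distrib[symmetric]
  proof (rule sum.cong[OF refl])
   fix t assume "t : {..T}"
   hence t: "t <= T" by simp
   show "(LINT h|M. (X t h, U t h) \<bullet> p t h) =
     pairS (X t) (\<alpha> t) + pairC (U t) (\<beta> t) + (LINT h|M. (X t h, U t h) \<bullet> adjoint_term T A B y t h)"
    using inner_pair_integral[OF x(1)[OF t] x(2)[OF t] adjoint_mem[OF yQ t]] inner_pair_integral[OF x(1)[OF t] x(2)[OF t], of "%h. (\<alpha> t h, \<beta> t h)"] ab[OF t]
    unfolding p_def inner_add_right by simp
  qed
  also have "\<dots> = 0" using balance[OF XU] adjoint_pairing[OF adapted_strategy_procs[OF XU] yQ] by simp
  finally show "(SUM t<=T. \<integral>h. (X t h, U t h) \<bullet> p t h \<partial>M) = 0" .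
 qed
 have WB: "(SUM t<=T. pairS (Xb t) (\<alpha> t) + pairC (Ub t) (\<beta> t)) = (SUM t=1..T. pairS (W t) (y t))"
  unfolding balance[OF bar_adapted]
 proof (rule sum.cong[OF refl])
  fix t assume t: "t : {1..T}"
  have tT: "t <= T" "t - 1 <= T" using t by auto
  have "AE h in M. defect (%t. (Xb t, Ub t)) t h = W t h"
   using bar_system t unfolding system_equations_def defect_def by (auto elim!: AE_mp simp: algebra_simps)
  hence "AE h in M. defect (%t. (Xb t, Ub t)) t h \<bullet> y t h = W t h \<bullet> y t h" by eventually_elim simp
  moreover have "(%h. defect (%t. (Xb t, Ub t)) t h \<bullet> y t h) : borel_measurable M" "(%h. W t h \<bullet> y t h) : borel_measurable M"
   using S.pairing_integrable[OF defect_mem[OF adapted_strategy_procs[OF bar_adapted] t] y(1)[OF le0 tT(1)]]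
    S.pairing_integrable[OF W_mem[OF t] y(1)[OF le0 tT(1)]] by auto
  ultimately show "pairS (defect (%t. (Xb t, Ub t)) t) (y t) = pairS (W t) (y t)"
   unfolding pairS_def by (intro integral_cong_AE)
 qed
 have pairing: "control_integrand.pairing M z w = pairS (fst z) (fst w) + pairC (snd z) (snd w)" for z w
  unfolding control_integrand.pairing_def[OF integrand[OF le0]] pairS_def pairC_def ..
 \<comment> \<open>The marginal inequality rearranged into an upper bound for the pairing minus the
   cost, that is, for the conjugate of the integral functional.\<close>
 define \<kappa> where "\<kappa> t = pairS (Xb t) (\<alpha> t) + pairC (Ub t) (\<beta> t) - \<mu> t" for t
 have low: "pairS (fst z) (\<alpha> t) + pairC (snd z) (\<beta> t) - V t z <= \<kappa> t" if t: "t <= T" and z: "z : Dom t" for t z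
 proof -
  have mz: "fst z : S" "snd z : C" using Dom_sub[OF t z] by auto
  show ?thesis using bound[OF t z] unfolding \<kappa>_def pairS_diff[OF mz(1) bar(1)[OF t] ab(1)[OF t]] pairC_diff[OF mz(2) bar(2)[OF t] ab(2)[OF t]]
   by simp
 qed
 have attained: "ereal m <= dual_value M T W L v y"
  if c: "!!t. t <= T ==> integrable M (c t)" "!!t. t <= T ==> AE h in M. fenchel_conjugate (%z. L t z h) (v t h) = ereal (c t h)"
   "!!t. t <= T ==> (LINT h|M. c t h) <= \<kappa> t" for c v
 proof -
  have "(SUM t<=T. \<integral>h. c t h \<partial>M) <= (SUM t<=T. \<kappa> t)" using c(3) by (intro sum_mono) auto
  also have "\<dots> = (SUM t=1..T. pairS (W t) (y t)) - (SUM t<=T. \<mu> t)" unfolding \<kappa>_def sum_subtractf WB ..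
  finally have "m <= (SUM t=1..T. pairS (W t) (y t)) - (SUM t<=T. \<integral>h. c t h \<partial>M)" using \<mu> by linarith
  moreover have "dual_value M T W L v y = ereal ((SUM t=1..T. pairS (W t) (y t)) - (SUM t<=T. \<integral>h. c t h \<partial>M))"
   by (rule dual_value_eq) (use W_mem y(1) c in auto)
  ultimately show ?thesis by simp
 qed
 define c where "c t h = real_of_ereal (fenchel_conjugate (%x. L t x h) (\<alpha> t h, \<beta> t h))" for t h
 have vm: "(\<alpha> t, \<beta> t) : S' \<times> C'" "fst (\<alpha> t, \<beta> t) : borel_measurable M" "snd (\<alpha> t, \<beta> t) : borel_measurable M" if t: "t <= T" for t
  using ab[OF t] S.S'_measurable C.S'_measurable by auto
 have conj: "integrable M (c t)" "AE h in M. fenchel_conjugate (%x. L t x h) (\<alpha> t h, \<beta> t h) = ereal (c t h)"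
  "(LINT h|M. c t h) <= \<kappa> t" if t: "t <= T" for t
 proof -
  have sM: "subalgebra M M" unfolding subalgebra_def by simp
  have b: "control_integrand.pairing M z (\<alpha> t, \<beta> t) - V t z <= \<kappa> t" if "z : Dom t" for z
   using low[OF t that] unfolding pairing by simp
  note cl = control_integrand.conjugate_le[OF integrand[OF t] sM normal[OF t] xb_Dom[OF t]
    toM[OF t xb_measurable(1)[OF t]] toM[OF t xb_measurable(2)[OF t]] vm[OF t], unfolded fst_conv snd_conv]
  show "integrable M (c t)" unfolding c_def by (rule cl(1), rule b)
   show "AE h in M. fenchel_conjugate (%x. L t x h) (\<alpha> t h, \<beta> t h) = ereal (c t h)"
    unfolding c_def by (rule cl(2), rule b)
   show "(LINT h|M. c t h) <= \<kappa> t" unfolding c_def by (rule cl(3), rule b)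
 qed
 have "ereal m <= dual_objective M T A B W L p y"
  unfolding dual_objective_def by (rule attained[OF conj(1) _ conj(3)]) (use conj(2) in \<open>simp_all add: p_def\<close>)
 moreover have "ereal m <= reduced_dual_objective M T F A B W L y" if nF: "ALL t<=T. convex_normal_integrand (F t) (L t)"
 proof -
  \<comment> \<open>Against adapted vectors \<open>\<alpha>\<close> and \<open>\<beta>\<close> may
    be replaced by their conditional expectations, and adapted test vectors suffice when the
    integrand is \<open>F t\<close>-measurable.\<close>
  define a' b' where "a' t = cond_exp M (F t) (\<alpha> t)" and "b' t = cond_exp M (F t) (\<beta> t)" for t
  define c' where "c' t h = real_of_ereal (fenchel_conjugate (%x. L t x h) (a' t h, b' t h))" for t h
  have conj': "integrable M (c' t)" "AE h in M. fenchel_conjugate (%x. L t x h) (a' t h, b' t h) = ereal (c' t h)"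
   "(LINT h|M. c' t h) <= \<kappa> t" if t: "t <= T" for t
  proof -
   have m: "(a' t, b' t) : S' \<times> C'" "fst (a' t, b' t) : borel_measurable (F t)" "snd (a' t, b' t) : borel_measurable (F t)"
    unfolding a'_def b'_def using cond_exp_S'[OF t ab(1)[OF t]] cond_exp_C'[OF t ab(2)[OF t]]
     prob_subalgebra.cond_exp_measurable[OF sub_alg[OF t]] by auto
   have b: "control_integrand.pairing M z (a' t, b' t) - V t z <= \<kappa> t"
    if z: "z : Dom t" "fst z : borel_measurable (F t)" "snd z : borel_measurable (F t)" for z
   proof -
    have mz: "fst z : S" "snd z : C" using Dom_sub[OF t z(1)] by auto
    have "pairC (snd z) (b' t) = pairC (snd z) (\<beta> t)"
     unfolding pairC_def b'_def by (rule C.cond_exp_pairing[OF sub[OF t] EC[OF t] mz(2) z(3) ab(2)[OF t]])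
    thus ?thesis using low[OF t z(1)] pairS_adapted[OF t mz(1) z(2) ab(1)[OF t]] unfolding pairing a'_def by simp
   qed
   note cl = control_integrand.conjugate_le[OF integrand[OF t] sub[OF t] nF[rule_format, OF t] xb_Dom[OF t]
     xb_measurable(1)[OF t] xb_measurable(2)[OF t] m, unfolded fst_conv snd_conv]
   show "integrable M (c' t)" unfolding c'_def by (rule cl(1), rule b)
   show "AE h in M. fenchel_conjugate (%x. L t x h) (a' t h, b' t h) = ereal (c' t h)"
    unfolding c'_def by (rule cl(2), rule b)
   show "(LINT h|M. c' t h) <= \<kappa> t" unfolding c'_def by (rule cl(3), rule b)
  qed
  \<comment> \<open>\<open>p t\<close> has conditional expectation \<open>0\<close> and is the sum
    of \<open>(\<alpha> t, \<beta> t)\<close> and the adjoint term.\<close>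
  have eq: "AE h in M. - cond_exp M (F t) (adjoint_term T A B y t) h = (a' t h, b' t h)" if t: "t <= T" for t
  proof -
   have i1: "integrable M (%h. (\<alpha> t h, \<beta> t h))" by (rule pair_integrable) (use ab[OF t] in simp_all)
   have i2: "integrable M (adjoint_term T A B y t)" by (rule pair_integrable[OF adjoint_mem[OF yQ t]])
   have "p t = (%h. (\<alpha> t h, \<beta> t h)) + adjoint_term T A B y t" unfolding p_def by (simp add: fun_eq_iff)
   hence "AE h in M. cond_exp M (F t) (p t) h = cond_exp M (F t) (%h. (\<alpha> t h, \<beta> t h)) h + cond_exp M (F t) (adjoint_term T A B y t) h"
    using prob_subalgebra.cond_exp_add[OF sub_alg[OF t] i1 i2] by simp
   moreover have ce: "cond_exp M (F t) (%h. (\<alpha> t h, \<beta> t h)) h = (a' t h, b' t h)" for h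
    unfolding a'_def b'_def by (rule prod_eqI) (simp_all add: cond_exp_fst cond_exp_snd)
   ultimately have "AE h in M. cond_exp M (F t) (p t) h = (a' t h, b' t h) + cond_exp M (F t) (adjoint_term T A B y t) h"
    unfolding ce by simp
   with annihilator_cond_exp[OF pA t] show ?thesis
   proof eventually_elim
    case (elim h)
    hence "(a' t h, b' t h) + cond_exp M (F t) (adjoint_term T A B y t) h = 0" by simp
    hence "(a' t h, b' t h) = - cond_exp M (F t) (adjoint_term T A B y t) h" by (simp only: eq_neg_iff_add_eq_0)
    thus ?case by (rule sym)
   qed
  qed
  have "AE h in M. fenchel_conjugate (%x. L t x h) (- cond_exp M (F t) (adjoint_term T A B y t) h) = ereal (c' t h)" if t: "t <= T" for t
   using eq[OF t] conj'(2)[OF t] by eventually_elim simp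
  thus ?thesis unfolding reduced_dual_objective_def by (intro attained[OF conj'(1) _ conj'(3)]) auto
 qed
 ultimately show ?thesis using pA yA by blast
qed

lemma dual_le_inf:
 assumes "p : annihilator M T F S S' C C'" "y : sequences_in T S'"
 shows "dual_objective M T A B W L p y <= oc_inf M T F A B W L"
 unfolding oc_inf_def
proof (rule INF_greatest, clarify)
 fix X U assume XU: "(X, U) : oc_constraints M T F A B W"
 show "dual_objective M T A B W L p y <= oc_objective M T L X U"
 proof (cases "oc_objective M T L X U < \<infinity> & dual_objective M T A B W L p y > - \<infinity>")
  case True
  thus ?thesis using weak_duality[OF XU assms(2,1) W_mem] by (metis ereal_less_eq(3))
 next
  \<comment> \<open>One of the two sides is then infinite in the favourable direction.\<close>
  case False
  thus ?thesis by auto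
 qed
qed

lemma inf_less_top: "oc_inf M T F A B W L < \<infinity>"
proof -
 have "(Xb, Ub) : oc_constraints M T F A B W"
  using bar_adapted bar_system unfolding oc_constraints_def adapted_strategies_def by auto
 hence "oc_inf M T F A B W L <= oc_objective M T L Xb Ub" unfolding oc_inf_def by (rule INF_lower2) simp
 also have "\<dots> < \<infinity>" using oc_objective_Dom[of Xb Ub] xb_Dom unfolding xb_def by simp
 finally show ?thesis .
qed

lemma strong_duality:
 defines "\<Delta> \<equiv> (SUP (p, y)\<in> annihilator M T F S S' C C' \<times> sequences_in T S'. dual_objective M T A B W L p y)"
 shows "oc_inf M T F A B W L = \<Delta> &
  (EX p:annihilator M T F S S' C C'. EX y:sequences_in T S'. dual_objective M T A B W L p y = \<Delta>)"
proof -
 have le: "\<Delta> <= oc_inf M T F A B W L" unfolding \<Delta>_def by (rule SUP_least) (auto intro: dual_le_inf)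
 have ge: "dual_objective M T A B W L p y <= \<Delta>"
  if "p : annihilator M T F S S' C C'" "y : sequences_in T S'" for p y
  unfolding \<Delta>_def by (rule SUP_upper2[of "(p, y)"]) (use that in auto)
 have "EX p:annihilator M T F S S' C C'. EX y:sequences_in T S'. oc_inf M T F A B W L <= dual_objective M T A B W L p y"
 proof (cases "oc_inf M T F A B W L")
  case (real m)
  thus ?thesis using dual_attained[of m] unfolding adapted_sequences_in_def by auto
 next
  \<comment> \<open>Every dual value is at least \<open>- \<infinity>\<close>, so the zero pair
    attains the optimum.\<close>
  case MInf
  have "(%_. 0) : sequences_in T S'" unfolding sequences_in_def using S.S'_zero by simp
  thus ?thesis using zero_annihilator MInf by auto
 qed (use inf_less_top in simp)
 then obtain p y where py: "p : annihilator M T F S S' C C'" "y : sequences_in T S'"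
  "oc_inf M T F A B W L <= dual_objective M T A B W L p y" by blast
 have "dual_objective M T A B W L p y = \<Delta>" "oc_inf M T F A B W L = \<Delta>"
  using ge[OF py(1,2)] le py(3) by auto
 thus ?thesis using py(1,2) by blast
qed

lemma optimal_if_subdifferential:
 assumes f: "oc_feasible M T F A B W L X U"
  and py: "p : annihilator M T F S S' C C'" "y : sequences_in T S'" "dual_objective M T A B W L p y > - \<infinity>"
  and sd: "AE w in M. ALL t<=T. p t w - adjoint_term T A B y t w : subdifferential (%z. L t z w) (X t w, U t w)"
 shows "oc_optimal M T F A B W L X U"
proof -
 have XU: "(X, U) : oc_constraints M T F A B W" and fin: "oc_objective M T L X U < \<infinity>"
  using f unfolding oc_feasible_def by auto
 obtain a b where "oc_objective M T L X U = ereal a" "dual_objective M T A B W L p y = ereal b" "b <= a"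
  "a = b \<longleftrightarrow> (AE w in M. ALL t<=T. p t w - adjoint_term T A B y t w : subdifferential (%z. L t z w) (X t w, U t w))"
  by (rule weak_duality[OF XU py(2,1) W_mem fin py(3)])
 hence "oc_objective M T L X U = dual_objective M T A B W L p y" using sd by simp
 hence "oc_objective M T L X U <= oc_inf M T F A B W L" using dual_le_inf[OF py(1,2)] by simp
 moreover have "oc_inf M T F A B W L <= oc_objective M T L X U" unfolding oc_inf_def using XU by (rule INF_lower2) simp
 ultimately show ?thesis unfolding oc_optimal_def using XU by simp
qed

lemma subdifferential_if_attained:
 assumes f: "oc_feasible M T F A B W L X U"
  and py: "p : annihilator M T F S S' C C'" "y : sequences_in T S'" "oc_objective M T L X U <= dual_objective M T A B W L p y"
 shows "dual_objective M T A B W L p y > - \<infinity>"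
  "AE w in M. ALL t<=T. p t w - adjoint_term T A B y t w : subdifferential (%z. L t z w) (X t w, U t w)"
proof -
 have XU: "(X, U) : oc_constraints M T F A B W" and fin: "oc_objective M T L X U < \<infinity>" "oc_objective M T L X U > - \<infinity>"
  using f unfolding oc_feasible_def by (auto simp: less_le)
 show d: "dual_objective M T A B W L p y > - \<infinity>" using fin(2) py(3) by (rule less_le_trans)
 obtain a b where "oc_objective M T L X U = ereal a" "dual_objective M T A B W L p y = ereal b" "b <= a"
  "a = b \<longleftrightarrow> (AE w in M. ALL t<=T. p t w - adjoint_term T A B y t w : subdifferential (%z. L t z w) (X t w, U t w))"
  by (rule weak_duality[OF XU py(2,1) W_mem fin(1) d])
 thus "AE w in M. ALL t<=T. p t w - adjoint_term T A B y t w : subdifferential (%z. L t z w) (X t w, U t w)"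
  using py(3) by simp
qed

lemma optimal_dual:
 assumes f: "oc_feasible M T F A B W L X U" and opt: "oc_optimal M T F A B W L X U"
 obtains p y where "p : annihilator M T F S S' C C'" "y : adapted_sequences_in T F S'"
  "oc_objective M T L X U <= dual_objective M T A B W L p y"
  "ALL t<=T. convex_normal_integrand (F t) (L t) ==> oc_objective M T L X U <= reduced_dual_objective M T F A B W L y"
proof -
 obtain m where m: "oc_objective M T L X U = ereal m" using f unfolding oc_feasible_def by auto
 hence "ereal m <= oc_inf M T F A B W L" using opt unfolding oc_optimal_def by simp
 thus thesis using dual_attained[of m] that unfolding m by blast
qed

end

text \<open>A point outside \<open>K\<close> has an open rectangle avoiding \<open>K\<close>; each
  side contains a ball of the corresponding pseudo-metric, which the sequence must enter.\<close>

lemma closedin_prod_sequentially: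
 assumes K: "closedin (prod_topology X Y) K" "K <= S \<times> C" and top: "topspace X = S" "topspace Y = C"
  and X: "!!G x. openin X G ==> x : G ==> EX e>0. ALL y:S. qS (y - x :: 'v::real_vector) < e --> y : G"
  and Y: "!!G x. openin Y G ==> x : G ==> EX e>0. ALL y:C. qC (y - x :: 'w::real_vector) < (e::real) --> y : G"
  and s: "!!n::nat. s n : K" and z: "z : S \<times> C"
  and lim: "(%n. qS (fst (s n) - fst z)) \<longlonglongrightarrow> (0::real)" "(%n. qC (snd (s n) - snd z)) \<longlonglongrightarrow> 0"
 shows "z : K"
proof (rule ccontr)
 assume "z ~: K"
 hence "z : topspace (prod_topology X Y) - K" using z top by (auto simp: topspace_prod_topology)
 moreover have "openin (prod_topology X Y) (topspace (prod_topology X Y) - K)" using K(1) by (rule openin_diff[OF openin_topspace])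
 ultimately obtain G H where G: "openin X G" "openin Y H" "fst z : G" "snd z : H" "G \<times> H <= topspace (prod_topology X Y) - K"
  unfolding openin_prod_topology_alt by (metis prod.collapse)
 obtain e where e: "e > 0" "!!y. y : S ==> qS (y - fst z) < e ==> y : G" using X[OF G(1,3)] by blast
 obtain d where d: "d > 0" "!!y. y : C ==> qC (y - snd z) < d ==> y : H" using Y[OF G(2,4)] by blast
 have "\<forall>\<^sub>F n in sequentially. qS (fst (s n) - fst z) < e & qC (snd (s n) - snd z) < d"
  by (intro eventually_conj order_tendstoD(2)[OF lim(1) e(1)] order_tendstoD(2)[OF lim(2) d(1)])
 then obtain n where n: "qS (fst (s n) - fst z) < e" "qC (snd (s n) - snd z) < d"
  using eventually_happens'[OF sequentially_bot] by blast
 have "fst (s n) : S" "snd (s n) : C" using subsetD[OF K(2) s[of n]] by (auto simp: mem_Times_iff)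
 hence "s n : G \<times> H" using e(2) d(2) n by (simp add: mem_Times_iff)
 hence "s n : topspace (prod_topology X Y) - K" by (rule subsetD[OF G(5)])
 thus False using s[of n] by simp
qed

theorem theorem39:
  fixes M :: "'a measure" and T :: nat and F :: "nat \<Rightarrow> 'a measure"
    and S S' :: "('a \<Rightarrow> real^'n) set" and C C' :: "('a \<Rightarrow> real^'m) set"
    and \<tau>S :: "('a \<Rightarrow> real^'n) topology" and \<tau>C :: "('a \<Rightarrow> real^'m) topology"
    and A :: "nat \<Rightarrow> 'a \<Rightarrow> real^'n^'n" and B :: "nat \<Rightarrow> 'a \<Rightarrow> real^'m^'n"
    and W :: "nat \<Rightarrow> 'a \<Rightarrow> real^'n"
    and L :: "nat \<Rightarrow> (real^'n) \<times> (real^'m) \<Rightarrow> 'a \<Rightarrow> ereal"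
    and Xb :: "nat \<Rightarrow> 'a \<Rightarrow> real^'n" and Ub :: "nat \<Rightarrow> 'a \<Rightarrow> real^'m"
    and K :: "nat \<Rightarrow> (('a \<Rightarrow> real^'n) \<times> ('a \<Rightarrow> real^'m)) set"
  assumes prob: "prob_space M" and filt: "finite_filtration M T F"
    and spaces: "solid_decomposable_space M S" "solid_decomposable_space M S'"
      "solid_decomposable_space M C" "solid_decomposable_space M C'"
    and duality: "separating_duality M S S'" "separating_duality M C C'"
    and cond_exp_S: "\<forall>t\<le>T. cond_exp M (F t) ` S \<subseteq> S"
    and cond_exp_C: "\<forall>t\<le>T. cond_exp M (F t) ` C \<subseteq> C"
    and strong: "strong_topology M S S' \<tau>S" "strong_topology M C C' \<tau>C"
    and A_meas: "\<forall>t\<in>{1..T}. A t \<in> borel_measurable (F t)"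
    and B_meas: "\<forall>t\<in>{1..T}. B t \<in> borel_measurable (F t)"
    and W: "W \<in> adapted_sequences_in T F S"
    and normal: "\<forall>t\<le>T. convex_normal_integrand M (L t)"
    \<comment> \<open>(A)\<close>
    and A_S: "\<forall>t\<in>{1..T}. \<forall>x\<in>S. (\<lambda>\<omega>. A t \<omega> *v x \<omega>) \<in> S"
    and B_C: "\<forall>t\<in>{1..T}. \<forall>u\<in>C. (\<lambda>\<omega>. B t \<omega> *v u \<omega>) \<in> S"
    \<comment> \<open>(B)\<close>
    and proper: "\<forall>t\<le>T. proper_E_on M S C (L t)"
    and bar_adapted: "(Xb, Ub) \<in> adapted_strategies T F S C"
    and bar_feasible: "oc_feasible M T F A B W L Xb Ub"
    and K_eq: "\<forall>t\<le>T. K t = pos_hull ((\<lambda>z. z - (Xb t, Ub t)) ` dom_E M S C (L t))"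
    and K_linear: "\<forall>t\<le>T. subspace (K t)"
    and K_closed: "\<forall>t\<le>T. closedin (prod_topology \<tau>S \<tau>C) (K t)"
    \<comment> \<open>(C)\<close>
    and K_cond_exp: "\<forall>t\<le>T. \<forall>t'\<le>t.
      map_prod (cond_exp M (F t)) (cond_exp M (F t)) ` K t' \<subseteq> K t'"
    and K_recourse: "\<forall>t\<le>T. \<forall>x\<in>S. \<exists>u\<in>C. (x, u) \<in> K t"
    \<comment> \<open>(D)\<close>
    and dom_cond_exp: "\<forall>t\<le>T. \<forall>t'\<le>t.
      map_prod (cond_exp M (F t)) (cond_exp M (F t)) ` dom_E M S C (L t') \<subseteq> dom_E M S C (L t')"
    and dom_recourse: "\<forall>t\<le>T. \<forall>x\<in>S. \<exists>u\<in>C. (x, u) \<in> dom_E M S C (L t)"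
  shows
    "(\<forall>W'\<in>adapted_sequences_in T F S. \<exists>X U. oc_feasible M T F A B W' L X U) \<and>
     oc_inf M T F A B W L =
       (SUP (p, y) \<in> annihilator M T F S S' C C' \<times> sequences_in T S'.
          dual_objective M T A B W L p y) \<and>
     (\<exists>p\<in>annihilator M T F S S' C C'. \<exists>y\<in>sequences_in T S'.
        dual_objective M T A B W L p y =
          (SUP (p', y') \<in> annihilator M T F S S' C C' \<times> sequences_in T S'.
             dual_objective M T A B W L p' y')) \<and>
     (\<forall>X U. oc_feasible M T F A B W L X U \<longrightarrow>
        (oc_optimal M T F A B W L X U \<longleftrightarrow>
          (\<exists>p\<in>annihilator M T F S S' C C'. \<exists>y\<in>sequences_in T S'.
             dual_objective M T A B W L p y > - \<infinity> \<and>
             (AE \<omega> in M. \<forall>t\<le>T. p t \<omega> - adjoint_term T A B y t \<omega>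
                \<in> subdifferential (\<lambda>z. L t z \<omega>) (X t \<omega>, U t \<omega>))))) \<and>
     ((\<forall>t\<le>T. convex_normal_integrand (F t) (L t)) \<longrightarrow>
       (\<forall>X U. oc_feasible M T F A B W L X U \<longrightarrow>
         (oc_optimal M T F A B W L X U \<longleftrightarrow>
           (\<exists>y\<in>adapted_sequences_in T F S'.
              reduced_dual_objective M T F A B W L y > - \<infinity> \<and>
              (AE \<omega> in M. \<forall>t\<le>T. - cond_exp M (F t) (adjoint_term T A B y t) \<omega>
                 \<in> subdifferential (\<lambda>z. L t z \<omega>) (X t \<omega>, U t \<omega>))))))"
proof -
 obtain qS where qS: "rv_space M S S' qS" "!!G x. openin \<tau>S G ==> x : G ==> EX e>0. ALL y:S. qS (y - x) < e --> y : G"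
  by (rule strong_topology_rv_space[OF prob spaces(1,2) duality(1) strong(1)]) blast
 obtain qC where qC: "rv_space M C C' qC" "!!G x. openin \<tau>C G ==> x : G ==> EX e>0. ALL y:C. qC (y - x) < e --> y : G"
  by (rule strong_topology_rv_space[OF prob spaces(3,4) duality(2) strong(2)]) blast
 have top: "topspace \<tau>S = S" "topspace \<tau>C = C"
  using strong unfolding strong_topology_def frechet_ae_def locally_convex_tvs_def by blast+
 interpret control M S S' qS C C' qC T F A B L
 proof (intro control.intro control_axioms.intro qS(1) qC(1) filt)
  show "cond_exp M (F t) ` S <= S" "cond_exp M (F t) ` C <= C" "convex_normal_integrand M (L t)" "proper_E_on M S C (L t)"
   if "t <= T" for t using cond_exp_S cond_exp_C normal proper that by blast+
  show "A t : borel_measurable (F t)" "B t : borel_measurable (F t)" if "t : {1..T}" for t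
   using A_meas B_meas that by blast+
  show "(%w. A t w *v x w) : S" if "t : {1..T}" "x : S" for t x using A_S that by blast
  show "(%w. B t w *v u w) : S" if "t : {1..T}" "u : C" for t u using B_C that by blast
 qed
 interpret control_qualified M S S' qS C C' qC T F A B L W Xb Ub K
 proof
  show "W : adapted_sequences_in T F S" by (rule W)
  show "(Xb, Ub) : adapted_strategies T F S C" by (rule bar_adapted)
  show "system_equations M T A B W Xb Ub" using bar_feasible unfolding oc_feasible_def oc_constraints_def by blast
  show "K t = pos_hull ((%z. z - (Xb t, Ub t)) ` dom_E M S C (L t))" "subspace (K t)" if "t <= T" for t
   using K_eq K_linear that by blast+
  show "z : K t" if t: "t <= T" and s: "!!n::nat. s n : K t" and z: "z : S \<times> C"
   and lim: "(%n. qS (fst (s n) - fst z)) \<longlonglongrightarrow> 0" "(%n. qC (snd (s n) - snd z)) \<longlonglongrightarrow> 0" for t s z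
  proof -
   have cl: "closedin (prod_topology \<tau>S \<tau>C) (K t)" using K_closed t by blast
   have sub: "K t <= S \<times> C" using closedin_subset[OF cl] unfolding topspace_prod_topology top .
   show ?thesis
    by (rule closedin_prod_sequentially[where X=\<tau>S and Y=\<tau>C and S=S and C=C and qS=qS and qC=qC and s=s and z=z])
     (fact cl sub top qS(2) qC(2) s z lim)+
  qed
  show "map_prod (cond_exp M (F t)) (cond_exp M (F t)) z : K t" if "t <= T" "z : K t" for t z
   using K_cond_exp[rule_format, OF that(1) order_refl] that(2) by blast
  show "map_prod (cond_exp M (F t)) (cond_exp M (F t)) z : dom_E M S C (L t)" if "t <= T" "z : dom_E M S C (L t)" for t z
   using dom_cond_exp[rule_format, OF that(1) order_refl] that(2) by blast
  show "EX u:C. (x, u) : K t" if "t <= T" "x : S" for t x using K_recourse that by blast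
  show "EX u:C. (x, u) : dom_E M S C (L t)" if "t <= T" "x : S" for t x using dom_recourse that by blast
 qed
 have adapted_seq: "y : sequences_in T S'" if "y : adapted_sequences_in T F S'" for y
  using that unfolding adapted_sequences_in_def by blast
 show ?thesis
 proof (intro conjI)
  show "ALL W':adapted_sequences_in T F S. EX X U. oc_feasible M T F A B W' L X U"
   using feasible_exists by blast
  show "oc_inf M T F A B W L =
   (SUP (p, y)\<in> annihilator M T F S S' C C' \<times> sequences_in T S'.
     dual_objective M T A B W L p y)"
   by (rule conjunct1[OF strong_duality])
  show "EX p:annihilator M T F S S' C C'. EX y:sequences_in T S'.
    dual_objective M T A B W L p y =
     (SUP (p', y')\<in> annihilator M T F S S' C C' \<times> sequences_in T S'.
      dual_objective M T A B W L p' y')"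
   by (rule conjunct2[OF strong_duality])
  show "ALL X U. oc_feasible M T F A B W L X U -->
    (oc_optimal M T F A B W L X U \<longleftrightarrow>
     (EX p:annihilator M T F S S' C C'. EX y:sequences_in T S'.
      dual_objective M T A B W L p y > - \<infinity> &
      (AE w in M. ALL t<=T. p t w - adjoint_term T A B y t w
        : subdifferential (%z. L t z w) (X t w, U t w))))"
  proof (intro allI impI iffI)
   fix X U assume f: "oc_feasible M T F A B W L X U" and "oc_optimal M T F A B W L X U"
   then obtain p y where p: "p : annihilator M T F S S' C C'" and y: "y : adapted_sequences_in T F S'"
    and le: "oc_objective M T L X U <= dual_objective M T A B W L p y"
    by (rule optimal_dual) (rule that)
   show "EX p:annihilator M T F S S' C C'. EX y:sequences_in T S'. dual_objective M T A B W L p y > - \<infinity> &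
     (AE w in M. ALL t<=T. p t w - adjoint_term T A B y t w : subdifferential (%z. L t z w) (X t w, U t w))"
    by (intro bexI[OF _ p] bexI[OF _ adapted_seq[OF y]] conjI subdifferential_if_attained[OF f p adapted_seq[OF y] le])
  next
   fix X U assume f: "oc_feasible M T F A B W L X U"
    and "EX p:annihilator M T F S S' C C'. EX y:sequences_in T S'. dual_objective M T A B W L p y > - \<infinity> &
     (AE w in M. ALL t<=T. p t w - adjoint_term T A B y t w : subdifferential (%z. L t z w) (X t w, U t w))"
   thus "oc_optimal M T F A B W L X U" by (elim bexE conjE) (rule optimal_if_subdifferential[OF f])
  qed
  show "(ALL t<=T. convex_normal_integrand (F t) (L t)) -->
   (ALL X U. oc_feasible M T F A B W L X U -->
    (oc_optimal M T F A B W L X U \<longleftrightarrow>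
     (EX y:adapted_sequences_in T F S'.
       reduced_dual_objective M T F A B W L y > - \<infinity> &
       (AE w in M. ALL t<=T. - cond_exp M (F t) (adjoint_term T A B y t) w
        : subdifferential (%z. L t z w) (X t w, U t w)))))"
  proof (intro allI impI iffI)
   fix X U assume nF: "ALL t<=T. convex_normal_integrand (F t) (L t)" and f: "oc_feasible M T F A B W L X U"
    and opt: "oc_optimal M T F A B W L X U"
   obtain p y where y: "y : adapted_sequences_in T F S'" and le: "oc_objective M T L X U <= reduced_dual_objective M T F A B W L y"
    by (rule optimal_dual[OF f opt]) (use nF in \<open>auto intro: that\<close>)
   \<comment> \<open>Reduces to the unreduced condition by reading the reduced dual as the dual at
     the process of \<open>reduced_annihilator\<close>.\<close>
   note sd = subdifferential_if_attained[OF f reduced_annihilator[OF adapted_seq[OF y]] adapted_seq[OF y], unfolded reduced_as_dual, OF le]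
   show "EX y:adapted_sequences_in T F S'. reduced_dual_objective M T F A B W L y > - \<infinity> &
     (AE w in M. ALL t<=T. - cond_exp M (F t) (adjoint_term T A B y t) w : subdifferential (%z. L t z w) (X t w, U t w))"
    by (intro bexI[OF _ y] conjI sd(1)) (use sd(2) in simp)
  next
   fix X U assume f: "oc_feasible M T F A B W L X U"
    and "EX y:adapted_sequences_in T F S'. reduced_dual_objective M T F A B W L y > - \<infinity> &
     (AE w in M. ALL t<=T. - cond_exp M (F t) (adjoint_term T A B y t) w : subdifferential (%z. L t z w) (X t w, U t w))"
   then obtain y where y: "y : adapted_sequences_in T F S'" and d: "reduced_dual_objective M T F A B W L y > - \<infinity>"
    and sd: "AE w in M. ALL t<=T. - cond_exp M (F t) (adjoint_term T A B y t) w : subdifferential (%z. L t z w) (X t w, U t w)"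
    by (elim bexE conjE)
   show "oc_optimal M T F A B W L X U"
    by (rule optimal_if_subdifferential[OF f reduced_annihilator[OF adapted_seq[OF y]] adapted_seq[OF y], unfolded reduced_as_dual, OF d])
     (use sd in simp)
  qed
 qed
qed

end
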